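(* There exists an absolute constant $C\ge 1$ such that the following holds. Let $\delta>0$, let $N$ be a positive integer, and let $f_1,f_2,f_3:\mathbb{Z}\to\mathbb{C}$ be functions with $|f_i|\le 1$ everywhere and with support contained in $\{1,\dots,N\}$. Suppose that $$\Bigl|\sum_{x\in\mathbb{Z}}\sum_{y\in\mathbb{N}} f_1(x)\,f_2(x+y)\,f_3(x+y^2)\Bigr|\ge \delta N^{3/2},$$ where $\mathbb{N}=\{1,2,3,\dots\}$. Then either $N\le C\delta^{-C}$, or for each $i\in\{1,2,3\}$ there is a local function $\phi_i:\mathbb{Z}\to\mathbb{C}$ with $|\phi_i|\le 1$, of resolution at least $C^{-1}\delta^{C}N^{1/2}$ and modulus $q_i\le C\delta^{-C}$, such that $$\Bigl|\sum_{x\in\mathbb{Z}} f_i(x)\phi_i(x)\Bigr|\ge C^{-1}\delta^{C}N.$$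
   Context: A function $\phi:\mathbb{Z}\to\mathbb{C}$ is called a local function of resolution $M$ and modulus $q$ (where $q$ is a positive integer) if there exists a partition of $\mathbb{Z}$ into intervals of length $M$ such that $\phi$ is constant on the intersection of every such interval with every congruence class modulo $q$. *)

theory Defs
  imports "HOL-Analysis.Analysis" "HOL-Library.Disjoint_Sets" "HOL-Number_Theory.Cong"
begin

text \<open>
  An interval of length \<open>M\<close> is a block of \<open>M\<close> consecutive integers. The conditions \<open>M > 0\<close> and
  \<open>partition_on UNIV \<P>\<close> (disjoint nonempty blocks covering all integers) force the blocks to be the
  translates of a single one by the multiples of \<open>M\<close>.
\<close>

definition local_function :: "nat \<Rightarrow> nat \<Rightarrow> (int \<Rightarrow> complex) \<Rightarrow> bool" where
  "local_function M q \<phi> \<longleftrightarrow>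
     M > 0 \<and> q > 0 \<and>
     (\<exists>\<P>. partition_on UNIV \<P> \<and> (\<forall>I\<in>\<P>. \<exists>a. I = {a..<a + int M}) \<and>
          (\<forall>I\<in>\<P>. \<forall>r. \<phi> constant_on (I \<inter> {x. [x = r] (mod int q)})))"

end

(* Work on Z/L with L = 3N and y at most Y = N^(1/2). By Cauchy-Schwarz the third function may be replaced by a
   dual function D(z) = E_y g1(z - y^2) g2(z - y^2 + y). Van der Corput differencing bounds the counting
   operator by an average, over h, k, h1, k1 of size Y, of box averages of D in five explicit linear directions.
   No concatenation theorem is needed, because dual functions admit degree lowering: if the Fourier coefficients of
   the multiplicative derivatives of D at some frequencies gamma(s) are large on average, then interchanging D with
   its defining average shows that the alternating sums of gamma over boxes lie in major arcs. These contain boundedly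
   many frequencies, so by pigeonholing the alternating sums may be taken to vanish, and then the phases can be removed
   by Cauchy-Schwarz. Hence a direction can be dropped as soon as its exponential sums are large at few
   frequencies; dropping them one by one leaves a large Fourier coefficient of D.

   This says that the average of g1(x) g2(x+y) e(m (x+y^2) / L) is large. Weyl's inequality makes q m / L almost an
   integer for some small q, so the phase is nearly constant along progressions of step q and length about Y, and
   g1, g2 have large averages on such progressions. Applying this to the function F(x) dual to f1 shows that F has large
   averages on progressions; smoothing y along the same step turns this into large averages of f3 over quadratic
   progressions, and Fourier analysis with Weyl's inequality again gives large averages of f3 on linear ones. Grouping
   the starting points of the progressions into blocks produces the local functions. *)

theory Submission
  imports Defs
begin

section \<open>Averages over finite sets\<close>

text \<open>Since \<open>Y\<close> is of the order of the square root of \<open>L\<close>, Weyl's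
  inequality puts \<open>q m / L\<close> within about \<open>1 / Y\<^sup>2\<close> of an integer,
  and an interval of that length holds boundedly many fractions of denominator \<open>L\<close>:
  this is why major arcs are finite in effect. The five directions behave differently. Three combine
  two independent parameters, so a large exponential sum gives two simultaneous approximations;
  together with a bounded gcd these leave few frequencies for each nondegenerate choice of
  \<open>h\<close>, \<open>k\<close>, \<open>h1\<close>, \<open>k1\<close>. The other two have one
  parameter, and for fixed \<open>h\<close> or \<open>k\<close> their sums may be large at far too
  many frequencies. They become good only on average over \<open>h\<close> or \<open>k\<close>, so
  they are dropped last, when that average is still at hand. Every Cauchy-Schwarz step doubles the
  index set and replaces a direction by its differences. This never increases exponential sums, so
  equidistribution is proved only for the original directions. All losses are powers of \<delta>.
  Parameters are kept at most 1/2, so that numerical constants are absorbed into further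
  powers.\<close>

definition avg :: "'a set \<Rightarrow> ('a \<Rightarrow> 'b::real_normed_field) \<Rightarrow> 'b" where
  "avg A f = (\<Sum>a\<in>A. f a) / of_nat (card A)"

lemma avg_cong: "A = B \<Longrightarrow> (\<And>a. a \<in> B \<Longrightarrow> f a = g a) \<Longrightarrow> avg A f = avg B g"
  unfolding avg_def by (simp cong: sum.cong)

lemma avg_const: "finite A \<Longrightarrow> A \<noteq> {} \<Longrightarrow> avg A (\<lambda>_. c) = c"
  by (simp add: avg_def)

lemma avg_add: "avg A (\<lambda>a. f a + g a) = avg A f + avg A g"
  by (simp add: avg_def sum.distrib add_divide_distrib)

lemma avg_diff: "avg A (\<lambda>a. f a - g a) = avg A f - avg A g"
  by (simp add: avg_def sum_subtractf diff_divide_distrib)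

lemma avg_mult_left: "avg A (\<lambda>a. c * f a) = c * avg A f"
  by (simp add: avg_def sum_distrib_left)

lemma avg_mult_right: "avg A (\<lambda>a. f a * c) = avg A f * c"
  by (simp add: avg_def sum_distrib_right)

lemma avg_mult_avg: "avg A f * avg B g = avg A (\<lambda>a. avg B (\<lambda>b. f a * g b))"
  by (simp add: avg_mult_left avg_mult_right)

lemma avg_sum: "avg A (\<lambda>a. \<Sum>b\<in>B. f a b) = (\<Sum>b\<in>B. avg A (\<lambda>a. f a b))"
  unfolding avg_def by (subst sum.swap) (simp add: sum_divide_distrib)

lemma avg_swap: "avg A (\<lambda>a. avg B (\<lambda>b. f a b)) = avg B (\<lambda>b. avg A (\<lambda>a. f a b))"
  using sum.swap[of f B A] by (simp add: avg_def sum_divide_distrib[symmetric] mult.commute)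

lemma avg_Times: "avg (A \<times> B) (\<lambda>p. f (fst p) (snd p)) = avg A (\<lambda>a. avg B (\<lambda>b. f a b))"
  unfolding avg_def
  by (simp add: card_cartesian_product sum_divide_distrib[symmetric] sum.cartesian_product split_def mult.commute)

lemma avg_reindex: "bij_betw h A B \<Longrightarrow> avg B f = avg A (\<lambda>a. f (h a))"
  unfolding avg_def by (metis bij_betw_same_card sum.reindex_bij_betw)

lemma avg_cnj: "cnj (avg A f) = avg A (\<lambda>a. cnj (f a))"
  by (simp add: avg_def)

lemma avg_Re: "Re (avg A f) = avg A (\<lambda>a. Re (f a))"
  unfolding avg_def by (metis Re_divide_of_nat Re_sum of_real_eq_id id_apply of_real_of_nat_eq)

lemma avg_of_real: "avg A (\<lambda>a. complex_of_real (f a)) = complex_of_real (avg A f)"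
  by (simp add: avg_def)

lemma norm_avg_le: "norm (avg A f) \<le> avg A (\<lambda>a. norm (f a))"
  unfolding avg_def by (simp add: norm_divide divide_right_mono norm_sum)

lemma avg_mono:
  fixes f g :: "'a \<Rightarrow> real"
  shows "(\<And>a. a \<in> A \<Longrightarrow> f a \<le> g a) \<Longrightarrow> avg A f \<le> avg A g"
  unfolding avg_def by (simp add: divide_right_mono sum_mono)

lemma avg_nonneg:
  fixes f :: "'a \<Rightarrow> real"
  shows "(\<And>a. a \<in> A \<Longrightarrow> 0 \<le> f a) \<Longrightarrow> 0 \<le> avg A f"
  unfolding avg_def by (simp add: sum_nonneg)

lemma avg_le_const:
  fixes f :: "'a \<Rightarrow> real"
  assumes "\<And>a. a \<in> A \<Longrightarrow> f a \<le> c" "0 \<le> c"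
  shows "avg A f \<le> c"
proof (cases "finite A \<and> A \<noteq> {}")
  case True
  then show ?thesis using avg_mono[of A f "\<lambda>_. c"] assms avg_const[of A c] by auto
next
  case False
  then show ?thesis using assms(2) by (auto simp: avg_def)
qed

lemma norm_avg_le_const:
  assumes "\<And>a. a \<in> A \<Longrightarrow> norm (f a) \<le> c" "0 \<le> c"
  shows "norm (avg A f) \<le> c"
  using norm_avg_le[of A f] avg_le_const[of A "\<lambda>a. norm (f a)" c] assms by auto

lemma ex_ge_avg:
  fixes f :: "'a \<Rightarrow> real"
  assumes "finite A" "A \<noteq> {}"
  shows "\<exists>a\<in>A. avg A f \<le> f a"
proof (rule ccontr)
  assume "\<not> ?thesis"
  then have "\<And>a. a \<in> A \<Longrightarrow> f a < avg A f" by auto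
  then have "(\<Sum>a\<in>A. f a) < (\<Sum>a\<in>A. avg A f)" using assms by (intro sum_strict_mono) auto
  then show False using assms by (simp add: avg_def)
qed

lemma avg_square_le:
  fixes f :: "'a \<Rightarrow> real"
  shows "(avg A f)\<^sup>2 \<le> avg A (\<lambda>a. (f a)\<^sup>2)"
proof (cases "finite A \<and> A \<noteq> {}")
  case True
  have "0 \<le> avg A (\<lambda>a. (f a - avg A f)\<^sup>2)" by (rule avg_nonneg) simp
  also have "(\<lambda>a. (f a - avg A f)\<^sup>2) = (\<lambda>a. (f a)\<^sup>2 + (avg A f)\<^sup>2 - 2 * avg A f * f a)"
    by (simp add: power2_eq_square algebra_simps)
  finally show ?thesis using True
    by (simp add: avg_add avg_diff avg_const avg_mult_left power2_eq_square)
next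
  case False
  then show ?thesis by (auto simp: avg_def)
qed

lemma avg_power_le:
  fixes f :: "'a \<Rightarrow> real"
  assumes "\<And>a. a \<in> A \<Longrightarrow> 0 \<le> f a"
  shows "(avg A f) ^ (2 ^ d) \<le> avg A (\<lambda>a. f a ^ (2 ^ d))"
proof (induction d)
  case (Suc d)
  have "(avg A f) ^ (2 ^ Suc d) = ((avg A f) ^ (2 ^ d))\<^sup>2"
    by (simp add: power_mult[symmetric] mult.commute)
  also have "\<dots> \<le> (avg A (\<lambda>a. f a ^ (2 ^ d)))\<^sup>2"
    using Suc avg_nonneg[of A f] assms by (intro power_mono) auto
  also have "\<dots> \<le> avg A (\<lambda>a. (f a ^ (2 ^ d))\<^sup>2)" by (rule avg_square_le)
  finally show ?case by (simp add: power_mult[symmetric] mult.commute)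
qed simp

lemma norm_square_complex: "complex_of_real ((cmod z)\<^sup>2) = z * cnj z"
  by (rule complex_norm_square)

lemma norm_avg_square:
  "complex_of_real ((cmod (avg A f))\<^sup>2) = avg A (\<lambda>a. avg A (\<lambda>b. f a * cnj (f b)))"
  by (simp only: norm_square_complex avg_cnj avg_mult_avg)

lemma norm_avg_mult_square:
  assumes "\<And>x. x \<in> X \<Longrightarrow> cmod (u x) \<le> 1"
  shows "(cmod (avg X (\<lambda>x. u x * v x)))\<^sup>2 \<le> avg X (\<lambda>x. (cmod (v x))\<^sup>2)"
proof -
  have "cmod (avg X (\<lambda>x. u x * v x)) \<le> avg X (\<lambda>x. cmod (u x * v x))" by (rule norm_avg_le)
  also have "\<dots> \<le> avg X (\<lambda>x. cmod (v x))"
    by (rule avg_mono) (use assms in \<open>simp add: norm_mult mult_left_le_one_le\<close>)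
  finally have "(cmod (avg X (\<lambda>x. u x * v x)))\<^sup>2 \<le> (avg X (\<lambda>x. cmod (v x)))\<^sup>2"
    by (intro power_mono) auto
  also have "\<dots> \<le> avg X (\<lambda>x. (cmod (v x))\<^sup>2)" by (rule avg_square_le)
  finally show ?thesis .
qed

lemma dense_of_avg:
  fixes f :: "'a \<Rightarrow> real"
  assumes "finite A" "A \<noteq> {}" "\<And>a. a \<in> A \<Longrightarrow> f a \<le> 1" "\<eta> \<le> avg A f" "0 \<le> \<eta>"
  shows "\<eta> / 2 * card A \<le> card {a\<in>A. \<eta> / 2 \<le> f a}"
proof -
  let ?B = "{a\<in>A. \<eta> / 2 \<le> f a}"
  have "\<eta> * card A \<le> (\<Sum>a\<in>A. f a)"
    using assms by (simp add: avg_def field_simps card_gt_0_iff)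
  also have "\<dots> = (\<Sum>a\<in>?B. f a) + (\<Sum>a\<in>A - ?B. f a)"
    using assms(1) by (subst add.commute, intro sum.subset_diff) auto
  also have "(\<Sum>a\<in>?B. f a) \<le> (\<Sum>a\<in>?B. 1)" using assms by (intro sum_mono) auto
  also have "(\<Sum>a\<in>A - ?B. f a) \<le> (\<Sum>a\<in>A - ?B. \<eta> / 2)" by (intro sum_mono) auto
  also have "\<dots> \<le> card A * (\<eta> / 2)"
    using assms by (simp add: mult_right_mono card_mono)
  finally show ?thesis by (simp add: algebra_simps)
qed

lemma avg_ge_of_dense:
  fixes f :: "'a \<Rightarrow> real" and \<rho> :: real
  assumes "finite A" "A \<noteq> {}" "\<And>a. a \<in> A \<Longrightarrow> 0 \<le> f a" "B \<subseteq> A"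
    "\<rho> * card A \<le> card B" "\<And>a. a \<in> B \<Longrightarrow> c \<le> f a" "0 \<le> c"
  shows "\<rho> * c \<le> avg A f"
proof -
  have "\<rho> * card A * c \<le> card B * c" using assms by (intro mult_right_mono) auto
  also have "\<dots> = (\<Sum>a\<in>B. c)" by simp
  also have "\<dots> \<le> (\<Sum>a\<in>B. f a)" using assms by (intro sum_mono) auto
  also have "\<dots> \<le> (\<Sum>a\<in>A. f a)" using assms by (intro sum_mono2) auto
  finally show ?thesis using assms(1,2) by (simp add: avg_def field_simps card_gt_0_iff)
qed

lemma avg_bool_card:
  assumes "finite A"
  shows "avg A (\<lambda>a. if P a then 1 else 0 :: real) = card {a\<in>A. P a} / card A"
  using assms by (simp add: avg_def sum.If_cases Int_def)

section \<open>The exponential and the distance to the nearest integer\<close>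

definition ee :: "real \<Rightarrow> complex" where "ee t = cis (2 * pi * t)"

lemma ee_norm [simp]: "cmod (ee t) = 1" by (simp add: ee_def)
lemma ee_add: "ee (s + t) = ee s * ee t" by (simp add: ee_def cis_mult distrib_left)
lemma ee_zero [simp]: "ee 0 = 1" by (simp add: ee_def)
lemma ee_cnj: "cnj (ee t) = ee (- t)" by (simp add: ee_def cis_cnj)
lemma ee_of_int [simp]: "ee (of_int n) = 1"
  by (simp add: ee_def cis_multiple_2pi)
lemma ee_of_int_add: "ee (of_int n + t) = ee t" by (simp add: ee_add)
lemma ee_minus_one_le: "cmod (ee t - 1) \<le> 7 * \<bar>t\<bar>"
proof -
  have "cmod (ee t - 1) = 2 * \<bar>sin (pi * t)\<bar>"
    using dist_exp_i_1[of "2 * pi * t"] by (simp add: ee_def cis_conv_exp)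
  also have "\<dots> \<le> \<bar>2 * pi * t\<bar>"
    using abs_sin_x_le_abs_x[of "pi * t"] by (simp add: abs_mult)
  also have "\<dots> \<le> 7 * \<bar>t\<bar>" using pi_less_4 pi_approx by (simp add: abs_mult mult_right_mono)
  finally show ?thesis .
qed

definition nd :: "real \<Rightarrow> real" where "nd t = \<bar>t - of_int (round t)\<bar>"

lemma nd_nonneg [simp]: "0 \<le> nd t" by (simp add: nd_def)
lemma nd_le_half: "nd t \<le> 1 / 2" using of_int_round_abs_le[of t] by (simp only: nd_def abs_minus_commute)
lemma nd_le: "nd t \<le> \<bar>t - of_int n\<bar>"
  using round_diff_minimal[of t n] by (simp add: nd_def)
lemma nd_le_abs: "nd t \<le> \<bar>t\<bar>" using nd_le[of t 0] by simp
lemma nd_eqI: "\<bar>t\<bar> \<le> 1 / 2 \<Longrightarrow> nd t = \<bar>t\<bar>"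
proof -
  assume a: "\<bar>t\<bar> \<le> 1 / 2"
  have "\<bar>t\<bar> \<le> \<bar>t - of_int n\<bar>" for n :: int
  proof (cases "n = 0")
    case False
    then have "1 \<le> \<bar>of_int n :: real\<bar>" by linarith
    then show ?thesis using a by linarith
  qed simp
  then show ?thesis using nd_le_abs[of t] unfolding nd_def by (metis order_antisym)
qed
lemma nd_add_of_int: "nd (t + of_int n) = nd t"
proof -
  have "nd (t + of_int n) \<le> nd t" for t and n :: int
    using nd_le[of "t + of_int n" "round t + n"] by (simp add: nd_def)
  from this[of t n] this[of "t + of_int n" "- n"] show ?thesis by simp
qed
lemma nd_triangle: "nd (s + t) \<le> nd s + nd t"
  using nd_le[of "s + t" "round s + round t"] unfolding nd_def by linarith
lemma nd_minus: "nd (- t) = nd t"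
proof -
  have "nd (- t) \<le> nd t" for t using nd_le[of "- t" "- round t"] by (simp add: nd_def)
  from this[of t] this[of "- t"] show ?thesis by simp
qed
lemma nd_obtain: obtains r :: int and k where "t = of_int r + k" "\<bar>k\<bar> = nd t"
  by (rule that[of "round t" "t - of_int (round t)"]) (auto simp: nd_def)

text \<open>Removing the nearest integer leaves \<open>k\<close> of modulus at most 1/2, so
  \<open>pi * k\<close> stays below 1.6 in modulus, and there the cubic Taylor bound gives
  \<open>\<bar>sin x\<bar>\<close> at least half of \<open>\<bar>x\<bar>\<close>. The sharp constant
  would be 4; its value does not matter.\<close>

lemma nd_le_norm_ee: "nd t \<le> cmod (1 - ee t)"
proof -
  obtain r k where rk: "t = of_int r + k" "\<bar>k\<bar> = nd t" by (rule nd_obtain)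
  have "ee t = ee k" using rk by (simp add: ee_of_int_add)
  have "k \<le> 1/2" "- 1/2 \<le> k" using rk nd_le_half[of t] by auto
  have 1: "cmod (1 - ee k) = 2 * \<bar>sin (pi * k)\<bar>"
    using dist_exp_i_1[of "2 * pi * k"] by (simp add: ee_def cis_conv_exp norm_minus_commute)
  have p: "3.1 < pi" "pi < 3.2" using pi_approx by auto
  have "\<bar>sin (pi*k) - (\<Sum>m<3. sin_coeff m * (pi*k) ^ m)\<bar> \<le> inverse (fact 3) * \<bar>pi*k\<bar> ^ 3"
    by (rule Maclaurin_sin_bound)
  then have 2: "\<bar>sin (pi*k) - pi*k\<bar> \<le> \<bar>pi*k\<bar> ^ 3 / 6"
    by (simp add: eval_nat_numeral sin_coeff_def)
  have x: "\<bar>pi*k\<bar> \<le> 1.6" using mult_mono[of pi "3.2" "\<bar>k\<bar>" "1/2"] p rk nd_le_half[of t] by (simp add: abs_mult)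
  have "\<bar>pi*k\<bar> ^ 3 = \<bar>pi*k\<bar> ^ 2 * \<bar>pi*k\<bar>" by (simp add: eval_nat_numeral)
  also have "\<dots> \<le> 1.6 ^ 2 * \<bar>pi*k\<bar>" using x by (intro mult_right_mono power_mono) auto
  also have "\<dots> \<le> 3 * \<bar>pi*k\<bar>" by (intro mult_right_mono) (auto simp: power2_eq_square)
  finally have "\<bar>pi*k\<bar> ^ 3 \<le> 3 * \<bar>pi*k\<bar>" .
  then have "\<bar>sin (pi*k) - pi*k\<bar> \<le> \<bar>pi*k\<bar> / 2" using 2 by linarith
  then have "\<bar>pi*k\<bar> / 2 \<le> \<bar>sin (pi*k)\<bar>" by linarith
  moreover have "3 * \<bar>k\<bar> \<le> \<bar>pi*k\<bar>" using p by (simp add: abs_mult mult_right_mono)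
  ultimately have "\<bar>k\<bar> \<le> 2 * \<bar>sin (pi*k)\<bar>" by linarith
  then show ?thesis using 1 rk \<open>ee t = ee k\<close> by simp
qed

section \<open>Recurrence of multiples of a real number, and Weyl's inequality\<close>

lemma card_spread_le:
  fixes M :: "int set" and D :: real
  assumes "finite M" "\<And>m n. m \<in> M \<Longrightarrow> n \<in> M \<Longrightarrow> m \<le> n \<Longrightarrow> of_int (n - m) \<le> D" "0 \<le> D"
  shows "card M \<le> D + 1"
proof (cases "M = {}")
  case False
  have "M \<subseteq> {Min M..Max M}" using assms(1) by auto
  then have "card M \<le> card {Min M..Max M}" by (intro card_mono) auto
  also have "\<dots> = nat (Max M - Min M + 1)" by simp
  finally have "int (card M) \<le> Max M - Min M + 1"
    using assms(1) False Min_le[of M "Max M"] Max_in[of M] by linarith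
  then have "real (card M) \<le> of_int (Max M - Min M) + 1"
    by (metis of_int_1 of_int_add of_int_le_iff of_int_of_nat_eq)
  also have "\<dots> \<le> D + 1" using assms(2)[of "Min M" "Max M"] assms(1) False by auto
  finally show ?thesis .
qed (use assms in auto)

lemma sum_pairs_shift:
  fixes V :: "int set"
  assumes "finite V" "finite H" "\<And>y y'. y \<in> V \<Longrightarrow> y' \<in> V \<Longrightarrow> y' - y \<in> H"
  shows "(\<Sum>y\<in>V. \<Sum>y'\<in>V. \<Phi> y y') = (\<Sum>h\<in>H. \<Sum>y\<in>{y\<in>V. y + h \<in> V}. \<Phi> y (y + h))"
proof -
  have "(\<Sum>y\<in>V. \<Sum>y'\<in>V. \<Phi> y y') = (\<Sum>(y, y')\<in>V \<times> V. \<Phi> y y')"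
    by (rule sum.cartesian_product)
  also have "\<dots> = (\<Sum>(h, y)\<in>(SIGMA h:H. {y\<in>V. y + h \<in> V}). \<Phi> y (y + h))"
    by (rule sum.reindex_bij_witness[of _ "\<lambda>(h, y). (y, y + h)" "\<lambda>(y, y'). (y' - y, y)"])
      (use assms in auto)
  also have "\<dots> = (\<Sum>h\<in>H. \<Sum>y\<in>{y\<in>V. y + h \<in> V}. \<Phi> y (y + h))"
    by (rule sum.Sigma[symmetric]) (use assms in auto)
  finally show ?thesis .
qed

lemma interval_shift: "{y\<in>{a..<b::int}. y + h \<in> {a..<b}} = {max a (a - h)..<min b (b - h)}"
  by auto

text \<open>Multiplying by \<open>1 - ee t\<close> telescopes the sum. The product form needs no
  exception for integers \<open>t\<close>, where \<open>nd t\<close> vanishes.\<close>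

lemma geom_le:
  "cmod (\<Sum>z\<in>{a..<b::int}. ee (of_int z * t + c)) * nd t \<le> 2"
proof (cases "a \<le> b")
  case True
  define g where "g z = ee (of_int z * t + c)" for z :: int
  have "(\<Sum>z\<in>{a..<b}. g z - g (z + 1)) = g a - g b"
    using True
  proof (induction b rule: int_ge_induct)
    case (step i)
    then have "{a..<i + 1} = insert i {a..<i}" by auto
    then show ?case using step by simp
  qed simp
  moreover have "g z - g (z + 1) = g z * (1 - ee t)" for z
    by (simp add: g_def algebra_simps flip: ee_add)
  ultimately have "(\<Sum>z\<in>{a..<b}. g z) * (1 - ee t) = g a - g b"
    by (simp add: sum_distrib_right)
  then have "cmod (\<Sum>z\<in>{a..<b}. g z) * cmod (1 - ee t) \<le> 2"
    using norm_triangle_ineq4[of "g a" "g b"] by (simp add: norm_mult[symmetric] g_def)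
  moreover have "cmod (\<Sum>z\<in>{a..<b}. g z) * nd t \<le> cmod (\<Sum>z\<in>{a..<b}. g z) * cmod (1 - ee t)"
    by (intro mult_left_mono nd_le_norm_ee) auto
  ultimately show ?thesis by (simp add: g_def)
qed simp

text \<open>Two close elements of \<open>A\<close> give a small \<open>q\<close> with
  \<open>nd (q * \<theta>)\<close> at most \<open>2 * \<tau>\<close>. The further factor
  \<open>H\<close> comes from density: if \<open>q * \<theta>\<close> differs from an integer by
  \<open>k\<close>, the values drift by \<open>k\<close> per step along a progression of step
  \<open>q\<close>, and unless \<open>k\<close> is tiny they soon leave the neighbourhood of the
  integers.\<close>

lemma recurrence_denominator:
  fixes A :: "int set" and H :: nat and \<rho> \<tau> \<theta> :: real
  assumes A: "A \<subseteq> {1..int H}" "\<rho> * H \<le> card A" "\<And>a. a \<in> A \<Longrightarrow> nd (of_int a * \<theta>) \<le> \<tau>"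
    and r: "0 < \<rho>" "\<rho> \<le> 1" "0 \<le> \<tau>" "32 * \<tau> < \<rho>" "32 / \<rho>\<^sup>2 \<le> H"
  shows "\<exists>q::nat. (1::nat) \<le> q \<and> real q \<le> 4 / \<rho> \<and> nd (q * \<theta>) \<le> 64 * \<tau> / (\<rho>\<^sup>2 * H)"
proof -
  have finA: "finite A" using A(1) finite_subset by blast
  have rH: "32 \<le> \<rho> * H" "32 \<le> \<rho>\<^sup>2 * H" 
  proof -
    show *: "32 \<le> \<rho>\<^sup>2 * H" using r by (simp add: field_simps)
    have "\<rho>\<^sup>2 * H \<le> \<rho> * H" using r by (simp add: power2_eq_square mult_right_mono mult_left_le_one_le)
    then show "32 \<le> \<rho> * H" using * by linarith
  qed
  have Hpos: "0 < real H" using rH r(1) by (cases H) auto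
  \<comment> \<open>Windows of length about \<open>2 / \<rho>\<close> are too few for the elements
    of \<open>A\<close> to lie in different ones, so two of them are closer than
    \<open>w\<close>.\<close>
  define w where "w = \<lceil>2 / \<rho>\<rceil>"
  have w1: "2 / \<rho> \<le> of_int w" "of_int w \<le> 3 / \<rho>"
  proof -
    show "2 / \<rho> \<le> of_int w" by (simp add: w_def)
    have "of_int w \<le> 2 / \<rho> + 1" by (simp add: w_def)
    also have "\<dots> \<le> 3 / \<rho>" using r by (simp add: field_simps)
    finally show "of_int w \<le> 3 / \<rho>" .
  qed
  have wpos: "0 < w" using w1(1) r(1)
    by (metis divide_pos_pos of_int_0_less_iff order_less_le_trans zero_less_numeral)
  have "\<not> inj_on (\<lambda>a. (a - 1) div w) A"
  proof
    assume "inj_on (\<lambda>a. (a - 1) div w) A"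
    then have "card A = card ((\<lambda>a. (a - 1) div w) ` A)" by (simp add: card_image)
    also have "\<dots> \<le> card {0..(int H) div w}"
    proof (intro card_mono image_subsetI)
      fix x assume "x \<in> A"
      then have "1 \<le> x" "x \<le> int H" using A(1) by auto
      then show "(x - 1) div w \<in> {0..int H div w}"
        using wpos zdiv_mono1[of "x - 1" "int H" w] by (simp add: pos_imp_zdiv_nonneg_iff)
    qed simp
    also have "\<dots> = nat (int H div w + 1)" by simp
    finally have "card A \<le> nat (int H div w + 1)" .
    then have "real (card A) \<le> of_int (int H div w) + 1"
      using wpos by (simp add: le_nat_iff pos_imp_zdiv_nonneg_iff)
    also have "of_int (int H div w) \<le> H / of_int w"
      by (metis floor_divide_of_int_eq of_int_floor_le of_int_of_nat_eq)
    also have "\<dots> \<le> \<rho> * H / 2"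
    proof -
      have "2 \<le> \<rho> * of_int w" using w1(1) r(1) by (simp add: field_simps)
      from mult_left_mono[OF this, of "real H"] show ?thesis using wpos by (simp add: field_simps)
    qed
    finally show False using A(2) rH by linarith
  qed
  then obtain a a' where aa: "a \<in> A" "a' \<in> A" "a < a'" "(a - 1) div w = (a' - 1) div w"
    unfolding inj_on_def by (metis linorder_neqE)
  have "a' - a < w"
  proof -
    have "a - 1 = w * ((a - 1) div w) + (a - 1) mod w" "a' - 1 = w * ((a - 1) div w) + (a' - 1) mod w"
      by (metis mult_div_mod_eq aa(4))+
    moreover have "0 \<le> (a - 1) mod w" "(a' - 1) mod w < w" using wpos by auto
    ultimately show ?thesis by linarith
  qed
  define q where "q = nat (a' - a)"
  have q: "1 \<le> q" "int q = a' - a" using aa by (auto simp: q_def)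
  have "real q = of_int (int q)" by simp
  also have "\<dots> \<le> of_int w" using \<open>a' - a < w\<close> q(2) by (simp only: of_int_le_iff)
  finally have q3: "real q \<le> 3 / \<rho>" using w1(2) by linarith
  have "nd (q * \<theta>) \<le> 2 * \<tau>"
  proof -
    have "real q * \<theta> = of_int a' * \<theta> + - (of_int a * \<theta>)"
    proof -
      have "real q = of_int a' - of_int a" using arg_cong[OF q(2), of real_of_int] by simp
      then show ?thesis by (simp add: left_diff_distrib)
    qed
    then show ?thesis using nd_triangle[of "of_int a' * \<theta>" "- (of_int a * \<theta>)"] A(3)[OF aa(1)] A(3)[OF aa(2)]
      by (simp add: nd_minus)
  qed
  obtain p and k where pk: "q * \<theta> = of_int p + k" "\<bar>k\<bar> = nd (q * \<theta>)" by (rule nd_obtain)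
  have k2: "\<bar>k\<bar> \<le> 2 * \<tau>" using pk \<open>nd (q * \<theta>) \<le> 2 * \<tau>\<close> by simp
  have "nd (q * \<theta>) \<le> 64 * \<tau> / (\<rho>\<^sup>2 * H)"
  proof (cases "k = 0")
    case True
    then show ?thesis using pk r Hpos by simp
  next
    case False
    \<comment> \<open>The first bound keeps the total drift below 1/2, so that \<open>nd\<close>
      measures it without wrapping; the second keeps the number of possible starting points below
      \<open>2 * H\<close>.\<close>
    define n where "n = min \<lfloor>1 / (2 * \<bar>k\<bar>)\<rfloor> \<lfloor>H / q\<rfloor>"
    have qpos: "0 < real q" using q by simp
    have n1: "of_int n * \<bar>k\<bar> \<le> 1 / 2"
    proof -
      have "of_int n \<le> 1 / (2 * \<bar>k\<bar>)" unfolding n_def by (simp add: min.coboundedI1 of_int_floor_le le_floor_iff[symmetric])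
      then show ?thesis using False by (simp add: field_simps)
    qed
    have n2: "of_int n * real q \<le> H"
    proof -
      have "of_int n \<le> H / q" unfolding n_def by (simp add: le_floor_iff[symmetric])
      then show ?thesis using qpos by (simp add: field_simps)
    qed
    have "1 \<le> 1 / (2 * \<bar>k\<bar>)" using k2 r False by (simp add: field_simps)
    moreover have qH: "16 * q \<le> \<rho> * H * 2"
    proof -
      have "16 * q \<le> 48 / \<rho>" using q3 by simp
      also have "\<dots> \<le> \<rho> * H * 2" using rH(2) r(1) by (simp add: field_simps power2_eq_square)
      finally show ?thesis .
    qed
    moreover have "1 \<le> H / q"
    proof -
      have "\<rho> * H \<le> H" using r by (simp add: mult_left_le_one_le)
      then show ?thesis using qH qpos by (simp add: field_simps)
    qed
    ultimately have n0: "1 \<le> n" by (simp add: n_def le_floor_iff)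
    let ?D = "2 * \<tau> / \<bar>k\<bar>"
    have D0: "0 \<le> ?D" using r by simp
    let ?F = "\<lambda>h. {m\<in>{0..<n}. h + m * int q \<in> A}"
    have finF: "finite (?F h)" for h by (rule finite_subset[of _ "{0..<n}"]) auto
    have fib: "card (?F h) \<le> ?D + 1" for h
    proof (rule card_spread_le)
      fix m m' assume m: "m \<in> ?F h" "m' \<in> ?F h" "m \<le> m'"
      have "of_int (m' - m) * (q * \<theta>) = of_int (h + m' * int q) * \<theta> + - (of_int (h + m * int q) * \<theta>)"
        by (simp add: algebra_simps)
      then have "nd (of_int (m' - m) * (q * \<theta>)) \<le> nd (of_int (h + m' * int q) * \<theta>) + nd (of_int (h + m * int q) * \<theta>)"
        using nd_triangle nd_minus by metis
      also have "\<dots> \<le> 2 * \<tau>" using A(3)[of "h + m * int q"] A(3)[of "h + m' * int q"] m by simp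
      finally have "nd (of_int (m' - m) * (q * \<theta>)) \<le> 2 * \<tau>" .
      moreover have "of_int (m' - m) * (q * \<theta>) = of_int (m' - m) * k + of_int ((m' - m) * p)"
        by (simp add: pk(1) distrib_left)
      ultimately have "nd (of_int (m' - m) * k + of_int ((m' - m) * p)) \<le> 2 * \<tau>" by simp
      then have "nd (of_int (m' - m) * k) \<le> 2 * \<tau>" by (simp only: nd_add_of_int)
      moreover have "\<bar>of_int (m' - m) * k\<bar> \<le> of_int n * \<bar>k\<bar>"
        unfolding abs_mult using m by (intro mult_right_mono) auto
      ultimately have "\<bar>of_int (m' - m) * k\<bar> \<le> 2 * \<tau>" using n1 nd_eqI[of "of_int (m' - m) * k"] by linarith
      then have "of_int (m' - m) * \<bar>k\<bar> \<le> 2 * \<tau>" using m(3) by (simp add: abs_mult)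
      then show "of_int (m' - m) \<le> ?D" using False by (simp add: field_simps)
    next
      show "finite (?F h)" by (rule finF)
    qed (use D0 in auto)
    \<comment> \<open>Double counting: a pair \<open>(a, m)\<close> is sorted by the starting point
      \<open>a - m * int q\<close>, and the progression from each starting point meets
      \<open>A\<close> at most \<open>?D + 1\<close> times.\<close>
    have "card (A \<times> {0..<n}) \<le> card (SIGMA h:{1 - n * int q..int H}. ?F h)"
    proof (rule card_inj_on_le[of "\<lambda>(a, m). (a - m * int q, m)"])
      show "inj_on (\<lambda>(a, m). (a - m * int q, m)) (A \<times> {0..<n})" by (auto simp: inj_on_def)
      show "(\<lambda>(a, m). (a - m * int q, m)) ` (A \<times> {0..<n}) \<subseteq> (SIGMA h:{1 - n * int q..int H}. ?F h)"
      proof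
        fix z assume "z \<in> (\<lambda>(a, m). (a - m * int q, m)) ` (A \<times> {0..<n})"
        then obtain a m where am: "a \<in> A" "0 \<le> m" "m < n" "z = (a - m * int q, m)" by auto
        have "m * int q \<le> n * int q" "0 \<le> m * int q" using am by (auto simp: mult_right_mono)
        moreover have "1 \<le> a" "a \<le> int H" using A(1) am(1) by auto
        ultimately have "a - m * int q \<le> int H" "1 - n * int q \<le> a - m * int q" by linarith+
        then show "z \<in> (SIGMA h:{1 - n * int q..int H}. ?F h)" using am by auto
      qed
      show "finite (SIGMA h:{1 - n * int q..int H}. ?F h)" by (intro finite_SigmaI finF) simp
    qed
    then have "real (card A) * of_int n \<le> real (card (SIGMA h:{1 - n * int q..int H}. ?F h))"
      using n0 by (simp add: card_cartesian_product flip: of_nat_le_iff[where 'a = real])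
    also have "\<dots> = (\<Sum>h\<in>{1 - n * int q..int H}. real (card (?F h)))" by (subst card_SigmaI) (use finF in auto)
    also have "\<dots> \<le> (\<Sum>h\<in>{1 - n * int q..int H}. ?D + 1)" by (intro sum_mono fib)
    also have "\<dots> = (H + n * int q) * (?D + 1)" using n0 by (simp add: nat_add_distrib)
    also have "\<dots> \<le> (2 * H) * (?D + 1)" using n2 D0 by (intro mult_right_mono) auto
    finally have "real (card A) * of_int n \<le> (2 * H) * (?D + 1)" .
    moreover have "\<rho> * H * of_int n \<le> real (card A) * of_int n" using A(2) n0 by (intro mult_right_mono) auto
    ultimately have "H * (\<rho> * of_int n) \<le> H * (2 * (?D + 1))" by (simp add: algebra_simps)
    then have main: "\<rho> * of_int n \<le> 2 * (?D + 1)" using Hpos by (simp add: mult_le_cancel_left_pos)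
    \<comment> \<open>If the drift bound were the active one, the count would force
      \<open>\<rho>\<close> to be at most \<open>32 * \<tau>\<close>.\<close>
    have nk: "n \<noteq> \<lfloor>1 / (2 * \<bar>k\<bar>)\<rfloor>"
    proof
      assume "n = \<lfloor>1 / (2 * \<bar>k\<bar>)\<rfloor>"
      then have "1 / (2 * \<bar>k\<bar>) < of_int n + 1" by simp
      then have "1 / (2 * \<bar>k\<bar>) \<le> 2 * of_int n" using n0 by linarith
      then have "1 \<le> 4 * \<bar>k\<bar> * of_int n" using False by (simp add: field_simps)
      then have "\<rho> \<le> \<rho> * (4 * \<bar>k\<bar> * of_int n)" using r by simp
      also have "\<dots> = 4 * \<bar>k\<bar> * (\<rho> * of_int n)" by simp
      also have "\<dots> \<le> 4 * \<bar>k\<bar> * (2 * (?D + 1))" using main by (intro mult_left_mono) auto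
      also have "\<dots> = 16 * \<tau> + 8 * \<bar>k\<bar>" using False by (simp add: field_simps)
      also have "\<dots> \<le> 32 * \<tau>" using k2 by simp
      finally show False using r by simp
    qed
    then have "n = \<lfloor>H / q\<rfloor>" by (simp add: n_def min_def split: if_splits)
    then have "H / q < of_int n + 1" by simp
    then have "H / q \<le> 2 * of_int n" using n0 by linarith
    then have "\<rho> * (H / q) \<le> \<rho> * (2 * of_int n)" using r by (intro mult_left_mono) auto
    then have "\<rho> * (H / q) \<le> 4 * (?D + 1)" using main by linarith
    moreover have "8 \<le> \<rho> * (H / q)" using qH qpos by (simp add: field_simps)
    ultimately have "\<rho> * (H / q) \<le> 8 * ?D" by argo
    then have "\<rho> * H * \<bar>k\<bar> \<le> 16 * \<tau> * q" using qpos False by (simp add: field_simps)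
    also have "\<dots> \<le> 16 * \<tau> * (3 / \<rho>)" using q3 r by (intro mult_left_mono) auto
    finally have "\<rho>\<^sup>2 * H * \<bar>k\<bar> \<le> 48 * \<tau>" using r by (simp add: field_simps power2_eq_square)
    then show ?thesis using pk r Hpos by (simp add: field_simps)
  qed
  moreover have "real q \<le> 4 / \<rho>" using q3 r by (simp add: field_simps)
  ultimately show ?thesis using q(1) by blast
qed

text \<open>Van der Corput differencing turns the square of the sum into geometric sums of frequency
  \<open>2 * h * \<alpha>\<close>. If it is large, this frequency is close to an integer for a
  positive proportion of \<open>h\<close>, which is the situation of
  \<open>recurrence_denominator\<close>.\<close>

lemma weyl_quadratic:
  fixes \<alpha> \<beta> c \<eta> :: real and n :: nat and a :: int
  assumes e: "0 < \<eta>" "\<eta> \<le> 1 / 2" "(1 / \<eta>) ^ 18 \<le> n"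
    and S: "\<eta> \<le> cmod (avg {a..<a + int n} (\<lambda>y. ee (\<alpha> * (of_int y)\<^sup>2 + \<beta> * of_int y + c)))"
  shows "\<exists>q::nat. (1::nat) \<le> q \<and> real q \<le> (1 / \<eta>) ^ 9 \<and> nd (q * \<alpha>) \<le> (1 / \<eta>) ^ 23 / (real n)\<^sup>2"
proof -
  \<comment> \<open>As \<open>E\<close> is at least 2, a constant \<open>2 ^ k\<close> is absorbed
    as \<open>E ^ k\<close>; this accounts for much of the exponents 9, 18 and 23. The same device
    recurs in later proofs.\<close>
  define E where "E = 1 / \<eta>"
  have E2: "2 \<le> E" and Ee: "\<eta> = 1 / E" using e by (auto simp: E_def field_simps)
  have En: "E ^ 18 \<le> n" using e by (simp add: E_def)
  have Epow: "2 ^ k \<le> E ^ k" for k using E2 by (intro power_mono) auto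
  have E0: "0 < E" using E2 by simp
  have npos: "0 < real n" using En E0 by (metis less_le_trans zero_less_power)
  have nbig: "2 ^ k * E ^ j \<le> n" if "j + k = 18" for j k
  proof -
    have "2 ^ k * E ^ j \<le> E ^ k * E ^ j" using E0 Epow by (intro mult_right_mono) auto
    then show ?thesis using En that by (simp add: power_add[symmetric] add.commute)
  qed
  define V where "V = {a..<a + int n}"
  define G where "G y = ee (\<alpha> * (of_int y)\<^sup>2 + \<beta> * of_int y + c)" for y :: int
  define I where "I h = {y\<in>V. y + h \<in> V}" for h
  define C where "C h = cmod (\<Sum>y\<in>I h. cnj (G y) * G (y + h))" for h
  have finV: "finite V" "card V = n" by (auto simp: V_def)
  have S': "\<eta> * n \<le> cmod (\<Sum>y\<in>V. G y)"
    using S npos unfolding avg_def V_def[symmetric] G_def[symmetric] finV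
    by (simp add: norm_divide pos_le_divide_eq)
  have GG: "cnj (G y) * G (y + h) = ee (of_int y * (of_int h * (2 * \<alpha>)) + (\<alpha> * (of_int h)\<^sup>2 + \<beta> * of_int h))" for y h
    unfolding G_def ee_cnj ee_add[symmetric] by (rule arg_cong[of _ _ ee]) (simp add: power2_eq_square algebra_simps)
  have C1: "C h \<le> n" for h
  proof -
    have "C h \<le> (\<Sum>y\<in>I h. 1)" unfolding C_def by (rule order_trans[OF norm_sum]) (simp add: GG)
    also have "\<dots> \<le> n" using card_mono[of V "I h"] finV by (simp add: I_def)
    finally show ?thesis .
  qed
  have C2: "C h * nd (of_int h * (2 * \<alpha>)) \<le> 2" for h
    unfolding C_def GG I_def V_def interval_shift by (rule geom_le)
  have "complex_of_real ((cmod (\<Sum>y\<in>V. G y))\<^sup>2) = (\<Sum>y\<in>V. \<Sum>y'\<in>V. cnj (G y) * G y')"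
    unfolding norm_square_complex by (subst mult.commute) (simp only: cnj_sum sum_product)
  also have "\<dots> = (\<Sum>h\<in>{- int n..int n}. \<Sum>y\<in>I h. cnj (G y) * G (y + h))"
    unfolding I_def by (rule sum_pairs_shift) (use finV in \<open>auto simp: V_def\<close>)
  finally have "cmod (complex_of_real ((cmod (\<Sum>y\<in>V. G y))\<^sup>2)) \<le> (\<Sum>h\<in>{- int n..int n}. C h)"
    unfolding C_def by (metis norm_sum)
  then have "(cmod (\<Sum>y\<in>V. G y))\<^sup>2 \<le> (\<Sum>h\<in>{- int n..int n}. C h)" by (simp add: norm_power)
  moreover have "(\<eta> * n)\<^sup>2 \<le> (cmod (\<Sum>y\<in>V. G y))\<^sup>2" using S' e by (intro power_mono) auto
  ultimately have sq: "(\<eta> * n)\<^sup>2 \<le> (\<Sum>h\<in>{- int n..int n}. C h)" by linarith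
  \<comment> \<open>Chosen so that the geometric sums outside \<open>good\<close> are at most
    \<open>\<eta>\<^sup>2 * n / 4\<close>, which over all \<open>h\<close> makes at most three
    quarters of \<open>(\<eta> * n)\<^sup>2\<close>.\<close>
  define \<tau> where "\<tau> = 8 * E\<^sup>2 / n"
  define good where "good = {h\<in>{- int n..int n}. nd (of_int h * (2 * \<alpha>)) \<le> \<tau>}"
  have \<tau>0: "0 < \<tau>" using npos E0 by (simp add: \<tau>_def)
  have Cb: "C h \<le> \<eta>\<^sup>2 * n / 4" if "h \<in> {- int n..int n} - good" for h
  proof -
    have "C h * \<tau> \<le> C h * nd (of_int h * (2 * \<alpha>))"
      using that by (intro mult_left_mono) (auto simp: good_def C_def)
    then have "C h * \<tau> \<le> 2" using C2[of h] by linarith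
    then show ?thesis using npos E0 by (simp add: \<tau>_def Ee field_simps)
  qed
  have "(\<Sum>h\<in>{- int n..int n}. C h) = (\<Sum>h\<in>good. C h) + (\<Sum>h\<in>{- int n..int n} - good. C h)"
    by (subst add.commute, rule sum.subset_diff) (auto simp: good_def)
  also have "\<dots> \<le> (\<Sum>h\<in>good. real n) + (\<Sum>h\<in>{- int n..int n} - good. \<eta>\<^sup>2 * n / 4)"
    by (intro add_mono sum_mono Cb C1)
  also have "\<dots> \<le> card good * n + (2 * n + 1) * (\<eta>\<^sup>2 * n / 4)"
  proof -
    have "card ({- int n..int n} - good) \<le> card {- int n..int n}" by (intro card_mono) auto
    then have "card ({- int n..int n} - good) \<le> 2 * n + 1" by simp
    then have "real (card ({- int n..int n} - good)) \<le> 2 * n + 1"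
      by (metis of_nat_1 of_nat_add of_nat_le_iff of_nat_mult of_nat_numeral)
    then have "real (card ({- int n..int n} - good)) * (\<eta>\<^sup>2 * n / 4) \<le> (2 * n + 1) * (\<eta>\<^sup>2 * n / 4)"
      by (rule mult_right_mono) simp
    then show ?thesis by simp
  qed
  also have "\<dots> \<le> card good * n + (3 * n) * (\<eta>\<^sup>2 * n / 4)"
    using npos by (intro add_left_mono mult_right_mono) auto
  finally have "n * (\<eta>\<^sup>2 * n) \<le> n * (card good + 3 * (\<eta>\<^sup>2 * n / 4))"
    using sq by (simp add: power2_eq_square algebra_simps)
  then have "\<eta>\<^sup>2 * n \<le> card good + 3 * (\<eta>\<^sup>2 * n / 4)" using npos by (simp add: mult_le_cancel_left_pos)
  then have g1: "\<eta>\<^sup>2 * n / 4 \<le> card good" by linarith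
  define A where "A = {h\<in>{1..int n}. nd (of_int h * (2 * \<alpha>)) \<le> \<tau>}"
  have finA: "finite A" by (rule finite_subset[of _ "{1..int n}"]) (auto simp: A_def)
  have "good \<subseteq> A \<union> {0} \<union> uminus ` A"
  proof
    fix h assume h: "h \<in> good"
    have "h \<in> uminus ` A" if "h < 0"
      using h that nd_minus[of "of_int h * (2 * \<alpha>)"] by (intro image_eqI[of _ _ "- h"]) (auto simp: A_def good_def)
    moreover have "h \<in> A" if "h > 0" using h that by (auto simp: A_def good_def)
    ultimately show "h \<in> A \<union> {0} \<union> uminus ` A" by (cases "h = 0") (auto simp: neq_iff)
  qed
  then have "card good \<le> card (A \<union> {0} \<union> uminus ` A)" using finA by (intro card_mono) auto
  also have "\<dots> \<le> card (A \<union> {0}) + card (uminus ` A)" by (rule card_Un_le)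
  also have "\<dots> \<le> card A + 1 + card A"
    using card_Un_le[of A "{0}"] card_image_le[OF finA, of uminus] by simp
  finally have g2: "real (card good) \<le> 2 * card A + 1" by linarith
  have n2: "2 ^ 16 \<le> \<eta>\<^sup>2 * n" using nbig[of 2 16] E0 by (simp add: Ee field_simps)
  have n4: "2 ^ 14 \<le> \<eta> ^ 4 * n" using nbig[of 4 14] E0 by (simp add: Ee field_simps)
  have "\<exists>q::nat. (1::nat) \<le> q \<and> real q \<le> 4 / (\<eta>\<^sup>2 / 16) \<and> nd (q * (2 * \<alpha>)) \<le> 64 * \<tau> / ((\<eta>\<^sup>2 / 16)\<^sup>2 * n)"
  proof (rule recurrence_denominator)
    show "A \<subseteq> {1..int n}" by (auto simp: A_def)
    show "\<eta>\<^sup>2 / 16 * n \<le> card A" using g1 g2 n2 by simp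
    show "nd (of_int a * (2 * \<alpha>)) \<le> \<tau>" if "a \<in> A" for a using that by (simp add: A_def)
    show "0 < \<eta>\<^sup>2 / 16" "0 \<le> \<tau>" using e \<tau>0 by auto
    show "\<eta>\<^sup>2 / 16 \<le> 1" using power_le_one[of \<eta> 2] e by simp
    show "32 * \<tau> < \<eta>\<^sup>2 / 16" 
    proof -
      have "16384 * E ^ 4 \<le> n" using nbig[of 4 14] by simp
      moreover have "0 < E ^ 4" using E0 by simp
      ultimately have "4096 * E ^ 4 < n" by linarith
      then have "4096 * (E\<^sup>2 * E\<^sup>2) < n" by (simp add: eval_nat_numeral mult.assoc)
      then have "4096 * E\<^sup>2 * E\<^sup>2 / n < 1" using npos by (simp add: mult.assoc)
      then have "256 * E\<^sup>2 / n < 1 / (16 * E\<^sup>2)" using E0 by (simp add: field_simps)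
      then show ?thesis by (simp add: \<tau>_def Ee power_divide)
    qed
    show "32 / (\<eta>\<^sup>2 / 16)\<^sup>2 \<le> n"
    proof -
      have 1: "(\<eta>\<^sup>2 / 16)\<^sup>2 = 1 / (256 * E ^ 4)" by (simp add: Ee power_divide power_mult[symmetric])
      have "2 ^ 13 * E ^ 4 \<le> 2 ^ 14 * E ^ 4" using E0 by simp
      then have "2 ^ 13 * E ^ 4 \<le> n" using nbig[of 4 14] by linarith
      then show ?thesis unfolding 1 by simp
    qed
  qed
  then obtain q :: nat where q: "(1::nat) \<le> q" "real q \<le> 4 / (\<eta>\<^sup>2 / 16)" "nd (q * (2 * \<alpha>)) \<le> 64 * \<tau> / ((\<eta>\<^sup>2 / 16)\<^sup>2 * n)"
    by blast
  \<comment> \<open>The denominator found belongs to \<open>2 * \<alpha>\<close>, so the witness for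
    \<alpha> is \<open>2 * q\<close>.\<close>
  have "real (2 * q) \<le> 2 ^ 7 * E ^ 2" using q(2) E0 by (simp add: Ee field_simps)
  also have "\<dots> \<le> E ^ 7 * E ^ 2" using Epow[of 7] E0 by (intro mult_right_mono) auto
  finally have r1: "real (2 * q) \<le> E ^ 9" by (simp add: power_add[symmetric])
  have "nd (real (2 * q) * \<alpha>) \<le> 64 * \<tau> / ((\<eta>\<^sup>2 / 16)\<^sup>2 * n)" using q(3) by (simp add: mult_ac)
  also have "\<dots> = 2 ^ 17 * E ^ 6 / (real n)\<^sup>2"
  proof -
    have "(\<eta>\<^sup>2 / 16)\<^sup>2 = 1 / (256 * E ^ 4)" by (simp add: Ee power_divide power_mult[symmetric])
    moreover have "E ^ 6 = E\<^sup>2 * E ^ 4" by (simp add: power_add[symmetric])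
    ultimately show ?thesis using npos E0 by (simp add: \<tau>_def power2_eq_square[of "real n"])
  qed
  also have "\<dots> \<le> E ^ 17 * E ^ 6 / (real n)\<^sup>2" using Epow[of 17] E0 by (intro divide_right_mono mult_right_mono) auto
  finally have r2: "nd (real (2 * q) * \<alpha>) \<le> E ^ 23 / (real n)\<^sup>2" by (simp add: power_add[symmetric])
  show ?thesis using r1 r2 q(1) unfolding E_def by (intro exI[of _ "2 * q"]) auto
qed

section \<open>Fourier analysis modulo L\<close>

definition per :: "nat \<Rightarrow> (int \<Rightarrow> 'a) \<Rightarrow> bool" where
  "per L f \<longleftrightarrow> (\<forall>x. f (x + int L) = f x)"

definition bd :: "('a \<Rightarrow> complex) \<Rightarrow> bool" where "bd f \<longleftrightarrow> (\<forall>x. cmod (f x) \<le> 1)"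

abbreviation ZL :: "nat \<Rightarrow> int set" where "ZL L \<equiv> {0..<int L}"

lemma per_add_mult: assumes "per L f" shows "f (x + k * int L) = f x"
proof (induction k rule: int_induct[where k = 0])
  case (step1 i)
  then show ?case using assms unfolding per_def by (metis distrib_right mult_1 add.assoc)
next
  case (step2 i)
  have "f (x + (i - 1) * int L + int L) = f (x + (i - 1) * int L)" using assms by (simp add: per_def)
  then show ?case using step2 by (simp add: algebra_simps)
qed simp

lemma per_cong: "per L f \<Longrightarrow> int L dvd x - y \<Longrightarrow> f x = f y"
  by (metis add.commute diff_add_cancel dvdE mult.commute per_add_mult)

lemma per_mod: "per L f \<Longrightarrow> f (x mod int L) = f x"
  by (rule per_cong) (auto simp: mod_eq_dvd_iff[symmetric])

lemma per_shift: "per L f \<Longrightarrow> per L (\<lambda>x. f (x + c))"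
  unfolding per_def by (metis add.assoc add.commute)

lemma per_shift_diff: "per L f \<Longrightarrow> per L (\<lambda>x. f (x - c))"
  using per_shift[of L f "- c"] by simp

lemma per_map: "per L f \<Longrightarrow> per L (\<lambda>x. h (f x))" by (simp add: per_def)
lemma per_map2: "per L f \<Longrightarrow> per L g \<Longrightarrow> per L (\<lambda>x. h (f x) (g x))" by (simp add: per_def)
lemma per_avg: "(\<And>a. a \<in> A \<Longrightarrow> per L (f a)) \<Longrightarrow> per L (\<lambda>x. avg A (\<lambda>a. f a x))"
  by (simp add: per_def cong: avg_cong)

lemma bd_mult: "bd f \<Longrightarrow> bd g \<Longrightarrow> bd (\<lambda>x. f x * g x)"
  by (simp add: bd_def norm_mult mult_le_one)
lemma bd_cnj: "bd f \<Longrightarrow> bd (\<lambda>x. cnj (f x))" by (simp add: bd_def)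
lemma bd_avg: "(\<And>a. a \<in> A \<Longrightarrow> bd (f a)) \<Longrightarrow> bd (\<lambda>x. avg A (\<lambda>a. f a x))"
  by (auto simp: bd_def intro!: norm_avg_le_const)

text \<open>Because of the equivalence, \<open>h\<close> induces an injective and hence bijective
  map on residues modulo \<open>L\<close>.\<close>

lemma sum_per_bij:
  fixes F :: "int \<Rightarrow> 'b::comm_monoid_add"
  assumes L: "0 < L" and F: "per L F" and h: "\<And>x y. int L dvd h x - h y \<longleftrightarrow> int L dvd x - y"
  shows "(\<Sum>k\<in>ZL L. F (h k)) = (\<Sum>k\<in>ZL L. F k)"
proof -
  have inj: "inj_on (\<lambda>k. h k mod int L) (ZL L)"
  proof (rule inj_onI)
    fix x y assume "x \<in> ZL L" "y \<in> ZL L" "h x mod int L = h y mod int L"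
    then have "int L dvd x - y" by (metis h mod_eq_dvd_iff)
    then have "x mod int L = y mod int L" by (metis mod_eq_dvd_iff)
    then show "x = y" using \<open>x \<in> ZL L\<close> \<open>y \<in> ZL L\<close> by simp
  qed
  have "(\<lambda>k. h k mod int L) ` ZL L = ZL L"
    using inj L by (intro endo_inj_surj) auto
  then have "(\<Sum>k\<in>ZL L. F k) = (\<Sum>k\<in>ZL L. F (h k mod int L))"
    using inj by (metis (no_types, lifting) sum.reindex_cong)
  then show ?thesis using per_mod[OF F] by simp
qed

lemma sum_per_shift:
  fixes F :: "int \<Rightarrow> 'b::comm_monoid_add"
  shows "0 < L \<Longrightarrow> per L F \<Longrightarrow> (\<Sum>k\<in>ZL L. F (k + c)) = (\<Sum>k\<in>ZL L. F k)"
  by (rule sum_per_bij) (auto simp: algebra_simps)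

lemma sum_per_minus:
  fixes F :: "int \<Rightarrow> 'b::comm_monoid_add"
  shows "0 < L \<Longrightarrow> per L F \<Longrightarrow> (\<Sum>k\<in>ZL L. F (c - k)) = (\<Sum>k\<in>ZL L. F k)"
  by (rule sum_per_bij) (auto simp: dvd_diff_commute)

lemma avg_per_shift:
  "0 < L \<Longrightarrow> per L F \<Longrightarrow> avg (ZL L) (\<lambda>x. F (x + c)) = avg (ZL L) F"
  by (simp add: avg_def sum_per_shift)

lemma avg_per_shift_diff:
  "0 < L \<Longrightarrow> per L F \<Longrightarrow> avg (ZL L) (\<lambda>x. F (x - c)) = avg (ZL L) F"
  using avg_per_shift[of L F "- c"] by simp

definition ch :: "nat \<Rightarrow> int \<Rightarrow> int \<Rightarrow> complex" where "ch L k x = ee (of_int (k * x) / real L)"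

lemma ch_norm [simp]: "cmod (ch L k x) = 1" by (simp add: ch_def)
lemma ch_add: "ch L k (x + y) = ch L k x * ch L k y"
  by (simp add: ch_def distrib_left add_divide_distrib ee_add)
lemma ch_add_left: "ch L (k + l) x = ch L k x * ch L l x"
  by (simp add: ch_def distrib_right add_divide_distrib ee_add)
lemma ch_commute: "ch L k x = ch L x k" by (simp add: ch_def mult.commute)
lemma ch_zero [simp]: "ch L k 0 = 1" "ch L 0 x = 1" by (simp_all add: ch_def)
lemma ch_cnj: "cnj (ch L k x) = ch L (- k) x" by (simp add: ch_def ee_cnj)
lemma ch_diff: "ch L k (x - z) = ch L k x * ch L (- k) z"
  by (simp add: ch_def ee_add[symmetric] diff_divide_distrib right_diff_distrib)
lemma ch_diff_left: "ch L (k - l) x = ch L k x * ch L (- l) x"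
  by (simp add: ch_def ee_add[symmetric] diff_divide_distrib left_diff_distrib)
lemma ch_mult_minus [simp]: "ch L k x * ch L (- k) x = 1" "ch L (- k) x * ch L k x = 1"
  by (simp_all add: ch_add_left[symmetric])
lemma ch_per: "0 < L \<Longrightarrow> per L (ch L k)"
  unfolding per_def ch_add by (simp add: ch_def)
lemma ch_per_left: "0 < L \<Longrightarrow> per L (\<lambda>k. ch L k x)"
  using ch_per[of L x] by (subst ch_commute)
lemma avg_ch:
  assumes L: "0 < L"
  shows "avg (ZL L) (ch L k) = (if int L dvd k then 1 else 0)"
proof (cases "int L dvd k")
  case True
  then have "ch L k = (\<lambda>_. 1)"
    using per_cong[OF ch_per_left[OF L], of k 0] by auto
  then show ?thesis using L True by (simp add: avg_const)
next
  case False
  have "avg (ZL L) (ch L k) = avg (ZL L) (\<lambda>x. ch L k (x + 1))"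
    using avg_per_shift[OF L ch_per[OF L]] by metis
  also have "\<dots> = avg (ZL L) (ch L k) * ch L k 1" by (simp add: ch_add avg_mult_right)
  finally have "avg (ZL L) (ch L k) * (1 - ch L k 1) = 0" by (simp add: algebra_simps)
  moreover have "ch L k 1 \<noteq> 1"
  proof
    assume "ch L k 1 = 1"
    then have "nd (of_int k / real L) = 0"
      using nd_le_norm_ee[of "of_int k / real L"] nd_nonneg[of "of_int k / real L"] by (simp add: ch_def)
    then have "of_int k / real L = of_int (round (of_int k / real L))" by (simp add: nd_def)
    then have "of_int k = (of_int (round (of_int k / real L) * int L) :: real)" using L by (simp add: field_simps)
    then have "k = round (of_int k / real L) * int L" by (simp only: of_int_eq_iff)
    then show False using False by (metis dvd_triv_right)
  qed
  ultimately show ?thesis using False by simp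
qed

definition ft :: "nat \<Rightarrow> (int \<Rightarrow> complex) \<Rightarrow> int \<Rightarrow> complex" where
  "ft L g k = avg (ZL L) (\<lambda>x. g x * ch L (- k) x)"

lemma ft_per: "0 < L \<Longrightarrow> per L (ft L g)"
  unfolding ft_def per_def
proof (intro allI avg_cong refl)
  fix k x assume L: "0 < L"
  have "ch L (- (k + int L)) x = ch L (- k) x"
    by (rule per_cong[OF ch_per_left[OF L]]) simp
  then show "g x * ch L (- (k + int L)) x = g x * ch L (- k) x" by simp
qed

lemma ft_cong: "0 < L \<Longrightarrow> int L dvd k - l \<Longrightarrow> ft L g k = ft L g l"
  by (rule per_cong[OF ft_per])

lemma ft_le_one: "bd g \<Longrightarrow> cmod (ft L g k) \<le> 1"
  unfolding ft_def by (rule norm_avg_le_const) (auto simp: norm_mult bd_def)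

lemma fourier_inversion:
  assumes L: "0 < L" and g: "per L g"
  shows "g x = (\<Sum>k\<in>ZL L. ft L g k * ch L k x)"
proof -
  have "(\<Sum>k\<in>ZL L. ft L g k * ch L k x) = (\<Sum>k\<in>ZL L. avg (ZL L) (\<lambda>z. g z * ch L (x - z) k))"
    unfolding ft_def avg_mult_right[symmetric]
  proof (intro sum.cong avg_cong refl)
    fix k z
    have "ch L (x - z) k = ch L k x * ch L (- k) z" by (subst ch_commute) (rule ch_diff)
    then show "g z * ch L (- k) z * ch L k x = g z * ch L (x - z) k" by simp
  qed
  also have "\<dots> = avg (ZL L) (\<lambda>z. g z * (of_nat L * avg (ZL L) (ch L (x - z))))"
    unfolding avg_sum[symmetric] sum_distrib_left[symmetric] using L by (simp add: avg_def[of "ZL L" "ch L _"])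
  also have "\<dots> = avg (ZL L) (\<lambda>z. if z = x mod int L then of_nat L * g x else 0)"
  proof (intro avg_cong refl)
    fix z assume z: "z \<in> ZL L"
    have "int L dvd x - z \<longleftrightarrow> z = x mod int L"
      using z by (metis mod_eq_dvd_iff mod_pos_pos_trivial atLeastLessThan_iff)
    then show "g z * (of_nat L * avg (ZL L) (ch L (x - z))) = (if z = x mod int L then of_nat L * g x else 0)"
      using per_mod[OF g] by (simp add: avg_ch[OF L])
  qed
  also have "\<dots> = g x"
    using L by (simp add: avg_def)
  finally show ?thesis by simp
qed

lemma cnj_ft: "cnj (ft L h k) = avg (ZL L) (\<lambda>x. ch L k x * cnj (h x))"
  by (simp add: ft_def avg_cnj ch_cnj mult.commute)

lemma parseval_inner:
  assumes L: "0 < L" and g: "per L g"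
  shows "avg (ZL L) (\<lambda>x. g x * cnj (h x)) = (\<Sum>k\<in>ZL L. ft L g k * cnj (ft L h k))"
proof -
  have "avg (ZL L) (\<lambda>x. g x * cnj (h x)) = avg (ZL L) (\<lambda>x. \<Sum>k\<in>ZL L. ft L g k * (ch L k x * cnj (h x)))"
    by (subst fourier_inversion[OF L g]) (simp add: sum_distrib_right mult.assoc)
  also have "\<dots> = (\<Sum>k\<in>ZL L. ft L g k * cnj (ft L h k))"
    unfolding avg_sum by (simp only: avg_mult_left cnj_ft)
  finally show ?thesis .
qed

lemma parseval:
  assumes "0 < L" "per L g"
  shows "(\<Sum>k\<in>ZL L. (cmod (ft L g k))\<^sup>2) = avg (ZL L) (\<lambda>x. (cmod (g x))\<^sup>2)"
proof -
  have "complex_of_real (\<Sum>k\<in>ZL L. (cmod (ft L g k))\<^sup>2) = avg (ZL L) (\<lambda>x. g x * cnj (g x))"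
    unfolding of_real_sum norm_square_complex parseval_inner[OF assms] ..
  also have "\<dots> = complex_of_real (avg (ZL L) (\<lambda>x. (cmod (g x))\<^sup>2))"
    unfolding norm_square_complex[symmetric] avg_of_real ..
  finally show ?thesis by (simp only: of_real_eq_iff)
qed

lemma bessel:
  assumes "0 < L" "per L g" "bd g"
  shows "(\<Sum>k\<in>ZL L. (cmod (ft L g k))\<^sup>2) \<le> 1"
  unfolding parseval[OF assms(1,2)]
  by (rule avg_le_const) (use assms(3) in \<open>auto simp: bd_def power_le_one\<close>)

lemma ft_shift:
  assumes "0 < L" "per L g"
  shows "ft L (\<lambda>x. g (x + b)) k = ch L k b * ft L g k"
proof -
  have "ft L (\<lambda>x. g (x + b)) k = avg (ZL L) (\<lambda>x. ch L k b * (g (x + b) * ch L (- k) (x + b)))"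
    unfolding ft_def by (intro avg_cong refl) (simp add: ch_add mult_ac)
  also have "\<dots> = ch L k b * avg (ZL L) (\<lambda>x. g (x + b) * ch L (- k) (x + b))"
    by (rule avg_mult_left)
  also have "avg (ZL L) (\<lambda>x. g (x + b) * ch L (- k) (x + b)) = ft L g k"
    unfolding ft_def using assms
    by (intro avg_per_shift[where F = "\<lambda>x. g x * ch L (- k) x"] per_map2[where h = "(*)"] ch_per) auto
  finally show ?thesis .
qed

lemma autocorrelation:
  assumes "0 < L" "per L g"
  shows "avg (ZL L) (\<lambda>x. g x * cnj (g (x + b))) = (\<Sum>k\<in>ZL L. of_real ((cmod (ft L g k))\<^sup>2) * ch L (- k) b)"
  unfolding parseval_inner[OF assms] ft_shift[OF assms] norm_square_complex
  by (simp add: ch_cnj mult_ac)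

text \<open>The autocorrelation of \<open>g\<close> at a shift is the Fourier transform of the
  weights \<open>w k\<close>, whose total is at most 1. Squaring and averaging over \<open>j\<close>
  leaves the sum of \<open>w k * w l\<close> times the exponential sum at \<open>l - k\<close>. Sums
  below \<epsilon> contribute at most \<epsilon>; for each \<open>k\<close> at most \<open>K\<close>
  values of \<open>l\<close> remain, each of weight at most \<open>S\<close>.\<close>

lemma removal:
  fixes K :: real
  assumes L: "0 < L" and g: "per L g" "bd g" and S: "\<And>k. (cmod (ft L g k))\<^sup>2 \<le> S"
    and K: "real (card {m\<in>ZL L. \<epsilon> \<le> cmod (avg J (\<lambda>j. ch L m (b j)))}) \<le> K" and e: "0 \<le> \<epsilon>"
  shows "avg J (\<lambda>j. (cmod (avg (ZL L) (\<lambda>x. g x * cnj (g (x + b j)))))\<^sup>2) \<le> \<epsilon> + S * K"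
proof -
  define w where "w k = (cmod (ft L g k))\<^sup>2" for k
  define \<mu> where "\<mu> m = cmod (avg J (\<lambda>j. ch L m (b j)))" for m
  have w0: "0 \<le> w k" for k by (simp add: w_def)
  have wsum: "(\<Sum>k\<in>ZL L. w k) \<le> 1" unfolding w_def by (rule bessel[OF L g])
  have S0: "0 \<le> S" by (rule order_trans[OF zero_le_power2 S])
  have K0: "0 \<le> K" by (rule order_trans[OF of_nat_0_le_iff K])
  have \<mu>1: "\<mu> m \<le> 1" for m unfolding \<mu>_def by (rule norm_avg_le_const) auto
  have \<mu>per: "per L \<mu>"
    unfolding \<mu>_def using per_avg[of J L "\<lambda>j m. ch L m (b j)"] ch_per_left[OF L] per_map[where h = cmod] by blast
  have "complex_of_real (avg J (\<lambda>j. (cmod (avg (ZL L) (\<lambda>x. g x * cnj (g (x + b j)))))\<^sup>2))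
     = avg J (\<lambda>j. (\<Sum>k\<in>ZL L. of_real (w k) * ch L (- k) (b j)) * (\<Sum>l\<in>ZL L. of_real (w l) * ch L l (b j)))"
    unfolding avg_of_real[symmetric] norm_square_complex autocorrelation[OF L g(1)] w_def
    by (simp add: ch_cnj mult_ac)
  also have "\<dots> = (\<Sum>k\<in>ZL L. \<Sum>l\<in>ZL L. of_real (w k * w l) * avg J (\<lambda>j. ch L (l - k) (b j)))"
    unfolding sum_product avg_sum
  proof (intro sum.cong refl)
    fix k l
    show "avg J (\<lambda>j. of_real (w k) * ch L (- k) (b j) * (of_real (w l) * ch L l (b j)))
       = of_real (w k * w l) * avg J (\<lambda>j. ch L (l - k) (b j))"
      by (subst avg_mult_left[symmetric]) (simp add: ch_diff_left mult_ac)
  qed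
  finally have "cmod (complex_of_real (avg J (\<lambda>j. (cmod (avg (ZL L) (\<lambda>x. g x * cnj (g (x + b j)))))\<^sup>2)))
     = cmod (\<Sum>k\<in>ZL L. \<Sum>l\<in>ZL L. of_real (w k * w l) * avg J (\<lambda>j. ch L (l - k) (b j)))"
    by (rule arg_cong)
  then have "avg J (\<lambda>j. (cmod (avg (ZL L) (\<lambda>x. g x * cnj (g (x + b j)))))\<^sup>2)
     \<le> cmod (\<Sum>k\<in>ZL L. \<Sum>l\<in>ZL L. of_real (w k * w l) * avg J (\<lambda>j. ch L (l - k) (b j)))"
    unfolding norm_of_real by linarith
  also have "\<dots> \<le> (\<Sum>k\<in>ZL L. \<Sum>l\<in>ZL L. w k * w l * \<mu> (l - k))"
    by (intro order_trans[OF norm_sum] sum_mono) (simp add: norm_mult norm_power \<mu>_def w_def)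
  also have "\<dots> = (\<Sum>k\<in>ZL L. w k * (\<Sum>l\<in>ZL L. w l * \<mu> (l - k)))" by (simp add: sum_distrib_left mult.assoc)
  also have "\<dots> \<le> (\<Sum>k\<in>ZL L. w k * (\<epsilon> + S * K))"
  proof (intro sum_mono mult_left_mono w0)
    fix k
    have "(\<Sum>l\<in>ZL L. w l * \<mu> (l - k)) \<le> (\<Sum>l\<in>ZL L. w l * \<epsilon> + (if \<epsilon> \<le> \<mu> (l - k) then S else 0))"
    proof (intro sum_mono)
      fix l
      have "w l * \<mu> (l - k) \<le> w l" using \<mu>1[of "l - k"] w0[of l] by (simp add: mult_left_le)
      moreover have "w l \<le> S" using S[of l] by (simp add: w_def)
      moreover have "0 \<le> w l * \<epsilon>" using w0[of l] e by simp
      ultimately show "w l * \<mu> (l - k) \<le> w l * \<epsilon> + (if \<epsilon> \<le> \<mu> (l - k) then S else 0)"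
        using w0[of l] by (auto intro: mult_left_mono)
    qed
    also have "\<dots> = (\<Sum>l\<in>ZL L. w l) * \<epsilon> + (\<Sum>l\<in>ZL L. (if \<epsilon> \<le> \<mu> (l - k) then S else 0))"
      by (simp add: sum.distrib sum_distrib_right)
    also have "(\<Sum>l\<in>ZL L. (if \<epsilon> \<le> \<mu> (l - k) then S else 0)) = (\<Sum>l\<in>ZL L. (if \<epsilon> \<le> \<mu> l then S else 0))"
      using sum_per_shift[OF L per_map[OF \<mu>per, of "\<lambda>t. if \<epsilon> \<le> t then S else 0"], of "- k"] by simp
    also have "\<dots> = S * card {m\<in>ZL L. \<epsilon> \<le> \<mu> m}" by (simp add: sum.If_cases Int_def)
    also have "\<dots> \<le> S * K" using K S0 by (intro mult_left_mono) (auto simp: \<mu>_def)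
    also have "(\<Sum>l\<in>ZL L. w l) * \<epsilon> \<le> 1 * \<epsilon>" using wsum e by (intro mult_right_mono) auto
    finally show "(\<Sum>l\<in>ZL L. w l * \<mu> (l - k)) \<le> \<epsilon> + S * K" by simp
  qed
  also have "\<dots> = (\<Sum>k\<in>ZL L. w k) * (\<epsilon> + S * K)" by (simp add: sum_distrib_right)
  also have "\<dots> \<le> 1 * (\<epsilon> + S * K)" using wsum e S0 K0 by (intro mult_right_mono) auto
  finally show ?thesis by simp
qed

section \<open>Frequencies in major arcs\<close>

lemma card_abs_diff_le:
  fixes M :: "int set" and c r :: real
  assumes "finite M" "\<And>m. m \<in> M \<Longrightarrow> \<bar>of_int m - c\<bar> \<le> r" "0 \<le> r"
  shows "card M \<le> 2 * r + 1"
proof (rule card_spread_le[OF assms(1)])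
  fix m n assume "m \<in> M" "n \<in> M"
  then show "of_int (n - m) \<le> 2 * r" using assms(2)[of m] assms(2)[of n] by simp
qed (use assms(3) in auto)

text \<open>For each \<open>q\<close> the nearest integer \<open>a\<close> to \<open>q k / L\<close>
  lies between 0 and \<open>Q\<close>, and the \<open>k\<close> belonging to one pair
  \<open>q\<close>, \<open>a\<close> lie in an interval of length at most
  \<open>2 * \<sigma> * L\<close>. The bound is strong when \<sigma> is of order
  1/\<open>L\<close>.\<close>

lemma card_major_arcs:
  fixes \<sigma> :: real and L Q :: nat
  assumes L: "0 < L" and s: "0 \<le> \<sigma>"
  shows "card {k\<in>ZL L. \<exists>q::nat. 1 \<le> q \<and> q \<le> Q \<and> nd (real q * (of_int k / L)) \<le> \<sigma>} \<le> real Q * (real Q + 1) * (2 * \<sigma> * L + 1)"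
proof -
  define P where "P q a = {k\<in>ZL L. \<bar>real q * (of_int k / L) - of_int a\<bar> \<le> \<sigma>}" for q :: nat and a :: int
  have fin: "finite (P q a)" for q a by (rule finite_subset[of _ "ZL L"]) (auto simp: P_def)
  have P: "card (P q a) \<le> 2 * \<sigma> * L + 1" if "1 \<le> q" for q a
  proof -
    have "card (P q a) \<le> 2 * (\<sigma> * L) + 1"
    proof (rule card_abs_diff_le[OF fin, where c = "of_int a * L / q"])
      fix m assume "m \<in> P q a"
      then have "\<bar>real q * (of_int m / L) - of_int a\<bar> * (L / q) \<le> \<sigma> * (L / q)"
        by (intro mult_right_mono) (auto simp: P_def)
      moreover have "\<bar>real q * (of_int m / L) - of_int a\<bar> * (L / q) = \<bar>(real q * (of_int m / L) - of_int a) * (L / q)\<bar>"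
        by (simp add: abs_mult)
      moreover have "(real q * (of_int m / L) - of_int a) * (L / q) = of_int m - of_int a * L / q"
        using L that by (simp add: field_simps)
      moreover have "\<sigma> * (L / q) \<le> \<sigma> * L"
      proof (intro mult_left_mono s)
        have "real L * 1 \<le> real L * real q" using that by (intro mult_left_mono) auto
        then show "real L / q \<le> L" using that by (simp add: field_simps)
      qed
      ultimately show "\<bar>of_int m - of_int a * L / q\<bar> \<le> \<sigma> * L" by linarith
    qed (use s in auto)
    then show ?thesis by simp
  qed
  have "{k\<in>ZL L. \<exists>q::nat. 1 \<le> q \<and> q \<le> Q \<and> nd (real q * (of_int k / L)) \<le> \<sigma>} \<subseteq> (\<Union>q\<in>{1..Q}. \<Union>a\<in>{0..int Q}. P q a)"
  proof
    fix k assume "k \<in> {k\<in>ZL L. \<exists>q::nat. 1 \<le> q \<and> q \<le> Q \<and> nd (real q * (of_int k / L)) \<le> \<sigma>}"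
    then obtain q :: nat where k: "k \<in> ZL L" and q: "1 \<le> q" "q \<le> Q" "nd (real q * (of_int k / L)) \<le> \<sigma>" by blast
    define a where "a = round (real q * (of_int k / L))"
    have "of_int k / L \<le> 1" using k L by (simp add: field_simps)
    then have "real q * (of_int k / L) \<le> real q" using mult_left_mono[of "of_int k / L" 1 "real q"] by simp
    then have "a \<le> round (real_of_int (int q))" unfolding a_def by (intro round_mono) simp
    then have "a \<le> int q" by (simp only: round_of_int)
    moreover have "round (0 :: real) \<le> a" unfolding a_def using k by (intro round_mono) auto
    ultimately have "a \<in> {0..int Q}" using q by simp
    moreover have "k \<in> P q a" using k q by (simp add: P_def a_def nd_def)
    ultimately show "k \<in> (\<Union>q\<in>{1..Q}. \<Union>a\<in>{0..int Q}. P q a)" using q by fastforce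
  qed
  then have "card {k\<in>ZL L. \<exists>q::nat. 1 \<le> q \<and> q \<le> Q \<and> nd (real q * (of_int k / L)) \<le> \<sigma>}
     \<le> card (\<Union>q\<in>{1..Q}. \<Union>a\<in>{0..int Q}. P q a)"
    using fin by (intro card_mono) auto
  also have "\<dots> \<le> (\<Sum>q\<in>{1..Q}. \<Sum>a\<in>{0..int Q}. card (P q a))"
    by (intro order_trans[OF card_UN_le] sum_mono) auto
  finally have "real (card {k\<in>ZL L. \<exists>q::nat. 1 \<le> q \<and> q \<le> Q \<and> nd (real q * (of_int k / L)) \<le> \<sigma>})
     \<le> (\<Sum>q\<in>{1..Q}. \<Sum>a\<in>{0..int Q}. real (card (P q a)))"
    by (simp only: of_nat_le_iff flip: of_nat_sum)
  also have "\<dots> \<le> (\<Sum>q\<in>{1..Q}. \<Sum>a\<in>{0..int Q}. 2 * \<sigma> * L + 1)" by (intro sum_mono P) auto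
  also have "\<dots> = real Q * (real Q + 1) * (2 * \<sigma> * L + 1)" by (simp add: nat_add_distrib algebra_simps)
  finally show ?thesis .
qed

text \<open>The maximum of \<open>S\<close> comes out of the sum, and \<open>A k * B k\<close> is at
  most half the sum of the squares.\<close>

lemma ex_ge_of_bilinear:
  fixes A B S :: "int \<Rightarrow> real"
  assumes "finite Z" "Z \<noteq> {}" "(\<Sum>k\<in>Z. (A k)\<^sup>2) \<le> 1" "(\<Sum>k\<in>Z. (B k)\<^sup>2) \<le> 1"
    "\<rho> \<le> (\<Sum>k\<in>Z. A k * B k * S k)" "\<And>k. 0 \<le> A k" "\<And>k. 0 \<le> B k" "\<And>k. 0 \<le> S k" 
  shows "\<exists>k\<in>Z. \<rho> \<le> S k"
proof -
  have "Max (S ` Z) \<in> S ` Z" using assms by simp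
  then obtain k where k: "k \<in> Z" "S k = Max (S ` Z)" by auto
  have "(\<Sum>k\<in>Z. A k * B k * S k) \<le> (\<Sum>l\<in>Z. ((A l)\<^sup>2 + (B l)\<^sup>2) / 2 * S k)"
  proof (intro sum_mono mult_mono)
    fix l assume "l \<in> Z"
    then show "S l \<le> S k" using k assms(1) by simp
    show "A l * B l \<le> ((A l)\<^sup>2 + (B l)\<^sup>2) / 2" using sum_squares_bound[of "A l" "B l"] by simp
  qed (use assms in auto)
  also have "\<dots> = ((\<Sum>l\<in>Z. (A l)\<^sup>2) + (\<Sum>l\<in>Z. (B l)\<^sup>2)) / 2 * S k"
    by (simp only: sum.distrib[symmetric] sum_distrib_right sum_divide_distrib)
  also have "\<dots> \<le> 1 * S k" using assms by (intro mult_right_mono) auto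
  finally show ?thesis using k assms(5) by force
qed

text \<open>Expanding \<open>g2\<close> in characters decouples \<open>x\<close> from
  \<open>y\<close>. What remains is a bilinear form in the Fourier coefficients of \<open>g1\<close>
  and \<open>g2\<close>, weighted by quadratic exponential sums in \<open>y\<close> with leading
  coefficient \<open>m / L\<close>; by Bessel one of these is at least \<rho>.\<close>

lemma major_of_correlation:
  fixes g1 g2 :: "int \<Rightarrow> complex" and m :: int
  assumes L: "0 < L" and g: "per L g1" "per L g2" "bd g1" "bd g2"
    and r: "0 < \<rho>" "\<rho> \<le> 1 / 2" "(1 / \<rho>) ^ 18 \<le> Y"
    and big: "\<rho> \<le> cmod (avg (ZL L) (\<lambda>x. avg {1..int Y} (\<lambda>y. g1 x * g2 (x + y) * ch L m (x + y\<^sup>2))))"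
  shows "\<exists>q::nat. 1 \<le> q \<and> q \<le> (1 / \<rho>) ^ 9 \<and> nd (real q * (of_int m / L)) \<le> (1 / \<rho>) ^ 23 / (real Y)\<^sup>2"
proof -
  define S where "S l = avg {1..int Y} (\<lambda>y. ch L l y * ch L m (y\<^sup>2))" for l
  have "avg (ZL L) (\<lambda>x. avg {1..int Y} (\<lambda>y. g1 x * g2 (x + y) * ch L m (x + y\<^sup>2)))
     = avg (ZL L) (\<lambda>x. avg {1..int Y} (\<lambda>y. \<Sum>l\<in>ZL L. ft L g2 l * ((g1 x * ch L (l + m) x) * (ch L l y * ch L m (y\<^sup>2)))))"
  proof (intro avg_cong refl)
    fix x y
    have "g1 x * g2 (x + y) * ch L m (x + y\<^sup>2) = (\<Sum>l\<in>ZL L. g1 x * (ft L g2 l * ch L l (x + y)) * ch L m (x + y\<^sup>2))"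
      by (subst fourier_inversion[OF L g(2)]) (simp only: sum_distrib_left sum_distrib_right)
    also have "\<dots> = (\<Sum>l\<in>ZL L. ft L g2 l * ((g1 x * ch L (l + m) x) * (ch L l y * ch L m (y\<^sup>2))))"
      unfolding ch_add ch_add_left by (intro sum.cong refl) (simp only: mult_ac)
    finally show "g1 x * g2 (x + y) * ch L m (x + y\<^sup>2) = \<dots>" .
  qed
  also have "\<dots> = (\<Sum>l\<in>ZL L. ft L g2 l * (avg (ZL L) (\<lambda>x. g1 x * ch L (l + m) x) * S l))"
    unfolding avg_sum S_def by (simp only: avg_mult_left avg_mult_right)
  also have "\<dots> = (\<Sum>l\<in>ZL L. ft L g2 l * (ft L g1 (- m - l) * S l))" by (simp add: ft_def)
  finally have "\<rho> \<le> cmod (\<Sum>l\<in>ZL L. ft L g2 l * (ft L g1 (- m - l) * S l))" using big by simp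
  also have "\<dots> \<le> (\<Sum>l\<in>ZL L. cmod (ft L g2 l) * cmod (ft L g1 (- m - l)) * cmod (S l))"
    by (rule order_trans[OF norm_sum]) (simp add: norm_mult mult.assoc)
  finally have "\<exists>l\<in>ZL L. \<rho> \<le> cmod (S l)"
  proof (rule ex_ge_of_bilinear[rotated 4])
    show "(\<Sum>k\<in>ZL L. (cmod (ft L g2 k))\<^sup>2) \<le> 1" using bessel L g by blast
    show "(\<Sum>k\<in>ZL L. (cmod (ft L g1 (- m - k)))\<^sup>2) \<le> 1"
      using sum_per_minus[OF L per_map[OF ft_per[OF L]], of "\<lambda>z. (cmod z)\<^sup>2" g1 "- m"] bessel[OF L g(1,3)] by simp
  qed (use L in auto)
  then obtain l where "\<rho> \<le> cmod (S l)" by blast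
  moreover have "S l = avg {1..<1 + int Y} (\<lambda>y. ee (of_int m / L * (of_int y)\<^sup>2 + of_int l / L * of_int y + 0))"
    unfolding S_def by (intro avg_cong) (auto simp: ch_def ee_add mult_ac)
  ultimately have "\<rho> \<le> cmod (avg {1..<1 + int Y} (\<lambda>y. ee (of_int m / L * (of_int y)\<^sup>2 + of_int l / L * of_int y + 0)))"
    by simp
  then show ?thesis by (rule weyl_quadratic[OF r])
qed

section \<open>Tuples of indices and box averages\<close>

definition tup :: "nat \<Rightarrow> 'i set \<Rightarrow> 'i list set" where
  "tup d I = {s. length s = d \<and> set s \<subseteq> I}"

lemma tup_0: "tup 0 I = {[]}" by (auto simp: tup_def)
lemma bij_tup_Suc: "bij_betw (\<lambda>p. fst p # snd p) (I \<times> tup d I) (tup (Suc d) I)"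
proof (rule bij_betw_byWitness[where f' = "\<lambda>s. (hd s, tl s)"])
  show "(\<lambda>s. (hd s, tl s)) ` tup (Suc d) I \<subseteq> I \<times> tup d I"
  proof (rule image_subsetI)
    fix s assume "s \<in> tup (Suc d) I"
    then show "(hd s, tl s) \<in> I \<times> tup d I" by (cases s) (simp_all add: tup_def)
  qed
  show "\<forall>s\<in>tup (Suc d) I. fst (hd s, tl s) # snd (hd s, tl s) = s"
  proof
    fix s assume "s \<in> tup (Suc d) I"
    then show "fst (hd s, tl s) # snd (hd s, tl s) = s" by (cases s) (simp_all add: tup_def)
  qed
  show "(\<lambda>p. fst p # snd p) ` (I \<times> tup d I) \<subseteq> tup (Suc d) I"
    by (rule image_subsetI) (simp add: tup_def mem_Times_iff)
qed simp
lemma finite_tup: "finite I \<Longrightarrow> finite (tup d I)"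
  by (rule finite_subset[OF _ finite_lists_length_eq[of I d]]) (auto simp: tup_def)
lemma tup_nonempty: "I \<noteq> {} \<Longrightarrow> tup d I \<noteq> {}"
proof -
  assume "I \<noteq> {}"
  then obtain i where "i \<in> I" by auto
  then have "replicate d i \<in> tup d I" by (auto simp: tup_def)
  then show ?thesis by auto
qed
lemma avg_tup_0: "avg (tup 0 I) F = F []" by (simp add: tup_0 avg_def)
lemma avg_tup_Suc: "avg (tup (Suc d) I) F = avg I (\<lambda>i. avg (tup d I) (\<lambda>s. F (i # s)))"
  unfolding avg_reindex[OF bij_tup_Suc] by (rule avg_Times[of _ _ "\<lambda>i s. F (i # s)"])

lemma avg_tup_Times:
  "avg (tup d (I \<times> I)) F = avg (tup d I) (\<lambda>s. avg (tup d I) (\<lambda>s'. F (zip s s')))"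
proof (induction d arbitrary: F)
  case (Suc d)
  have "avg (tup (Suc d) (I \<times> I)) F = avg I (\<lambda>i. avg I (\<lambda>i'. avg (tup d (I \<times> I)) (\<lambda>s. F ((i, i') # s))))"
    unfolding avg_tup_Suc using avg_Times[of I I "\<lambda>i i'. avg (tup d (I \<times> I)) (\<lambda>s. F ((i, i') # s))"] by simp
  also have "\<dots> = avg I (\<lambda>i. avg I (\<lambda>i'. avg (tup d I) (\<lambda>s. avg (tup d I) (\<lambda>s'. F ((i, i') # zip s s')))))"
    by (simp only: Suc)
  also have "\<dots> = avg I (\<lambda>i. avg (tup d I) (\<lambda>s. avg I (\<lambda>i'. avg (tup d I) (\<lambda>s'. F ((i, i') # zip s s')))))"
    by (subst avg_swap[of I "tup d I"]) (rule refl)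
  finally show ?case by (simp add: avg_tup_Suc)
qed (simp add: avg_tup_0)

text \<open>Product of \<open>T\<close> over all vertices of the box with opposite corners
  \<open>s\<close> and \<open>s'\<close>, conjugated where an odd number of coordinates comes from
  \<open>s'\<close>. It is the integrand of a Gowers box norm.\<close>

fun box_diff :: "'i list \<Rightarrow> 'i list \<Rightarrow> ('i list \<Rightarrow> complex) \<Rightarrow> complex" where
  "box_diff (i # s) (i' # s') T = box_diff s s' (\<lambda>u. T (i # u) * cnj (T (i' # u)))"
| "box_diff _ _ T = T []"

text \<open>\<open>\<kappa>\<close> is a product of bounded functions each of which ignores one coordinate: the factor \<open>u\<close> ignores
  the first one, the others ignore a later one and may depend on the first.\<close>

primrec splits :: "nat \<Rightarrow> ('i list \<Rightarrow> 'x \<Rightarrow> complex) \<Rightarrow> bool" where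
  "splits 0 \<kappa> = (\<forall>x. \<kappa> [] x = 1)"
| "splits (Suc d) \<kappa> = (\<exists>u \<kappa>'. (\<forall>s x. cmod (u s x) \<le> 1) \<and> (\<forall>i s x. \<kappa> (i # s) x = u s x * \<kappa>' i s x)
     \<and> (\<forall>i. splits d (\<kappa>' i)))"

lemma splits_mult: "splits d \<kappa> \<Longrightarrow> splits d \<kappa>' \<Longrightarrow> splits d (\<lambda>s x. \<kappa> s x * \<kappa>' s x)"
proof (induction d arbitrary: \<kappa> \<kappa>')
  case (Suc d)
  obtain u k where 1: "\<forall>s x. cmod (u s x) \<le> 1" "\<forall>i s x. \<kappa> (i # s) x = u s x * k i s x" "\<forall>i. splits d (k i)"
    using Suc.prems(1) by auto
  obtain u' k' where 2: "\<forall>s x. cmod (u' s x) \<le> 1" "\<forall>i s x. \<kappa>' (i # s) x = u' s x * k' i s x" "\<forall>i. splits d (k' i)"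
    using Suc.prems(2) by auto
  show ?case
    unfolding splits.simps
    by (rule exI[of _ "\<lambda>s x. u s x * u' s x"], rule exI[of _ "\<lambda>i s x. k i s x * k' i s x"])
      (use 1 2 Suc.IH in \<open>auto simp: norm_mult mult_le_one\<close>)
qed simp

lemma splits_cnj_comp: "splits d \<kappa> \<Longrightarrow> splits d (\<lambda>s x. cnj (\<kappa> s (h x)))"
proof (induction d arbitrary: \<kappa>)
  case (Suc d)
  obtain u k where 1: "\<forall>s x. cmod (u s x) \<le> 1" "\<forall>i s x. \<kappa> (i # s) x = u s x * k i s x" "\<forall>i. splits d (k i)"
    using Suc.prems by auto
  show ?case
    unfolding splits.simps
    by (rule exI[of _ "\<lambda>s x. cnj (u s (h x))"], rule exI[of _ "\<lambda>i s x. cnj (k i s (h x))"])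
      (use 1 Suc.IH in auto)
qed simp

lemma splits_one: "splits d (\<lambda>s x. 1)"
proof (induction d)
  case (Suc d)
  then show ?case unfolding splits.simps
    by (intro exI[of _ "\<lambda>s x. 1"] exI[of _ "\<lambda>i s x. 1"]) auto
qed simp

lemma splits_missing:
  assumes "r < d" "\<And>s x. cmod (\<kappa> s x) \<le> 1" "\<And>s i x. \<kappa> (s[r := i]) x = \<kappa> s x"
  shows "splits d \<kappa>"
  using assms
proof (induction d arbitrary: r \<kappa>)
  case (Suc d)
  show ?case
  proof (cases r)
    case 0
    have "\<kappa> (i # s) x = \<kappa> (j # s) x" for i j s x
      using Suc.prems(3)[of "i # s" j x] 0 by simp
    then show ?thesis unfolding splits.simps
      by (intro exI[of _ "\<lambda>s x. \<kappa> (undefined # s) x"] exI[of _ "\<lambda>i s x. 1"])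
        (auto simp: Suc.prems splits_one)
  next
    case (Suc r')
    have "splits d (\<lambda>s. \<kappa> (i # s))" for i
    proof (rule Suc.IH[of r'])
      show "\<kappa> (i # s[r' := j]) x = \<kappa> (i # s) x" for s j x
        using Suc.prems(3)[of "i # s" j x] \<open>r = Suc r'\<close> by simp
    qed (use Suc.prems \<open>r = Suc r'\<close> in auto)
    then show ?thesis unfolding splits.simps
      by (intro exI[of _ "\<lambda>s x. 1"] exI[of _ "\<lambda>i s. \<kappa> (i # s)"]) auto
  qed
qed simp

text \<open>Iterated Cauchy-Schwarz: each coordinate of the index tuple eliminates the factors of
  \<open>\<kappa>\<close> that do not depend on it.\<close>

lemma box_cauchy_schwarz:
  fixes \<Theta> :: "'i list \<Rightarrow> 'x \<Rightarrow> complex"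
  assumes "splits (Suc d) \<kappa>"
  shows "(cmod (avg (tup (Suc d) I) (\<lambda>s. avg X (\<lambda>x. \<Theta> s x * \<kappa> s x)))) ^ (2 ^ Suc d)
     \<le> Re (avg (tup (Suc d) I) (\<lambda>s. avg (tup (Suc d) I) (\<lambda>s'. avg X (\<lambda>x. box_diff s s' (\<lambda>u. \<Theta> u x)))))"
  using assms
proof (induction d arbitrary: \<Theta> \<kappa>)
  case (0 \<Theta> \<kappa>)
  then obtain u k where u: "\<And>s x. cmod (u s x) \<le> 1" "\<And>i s x. \<kappa> (i # s) x = u s x * k i s x" "\<And>i x. k i [] x = 1"
    by (auto simp only: splits.simps)
  have "avg (tup (Suc 0) I) (\<lambda>s. avg X (\<lambda>x. \<Theta> s x * \<kappa> s x)) = avg I (\<lambda>i. avg X (\<lambda>x. u [] x * \<Theta> [i] x))"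
    by (simp add: avg_tup_Suc avg_tup_0 u mult.commute)
  also have "\<dots> = avg X (\<lambda>x. u [] x * avg I (\<lambda>i. \<Theta> [i] x))"
    by (subst avg_swap) (simp only: avg_mult_left)
  finally have "(cmod (avg (tup (Suc 0) I) (\<lambda>s. avg X (\<lambda>x. \<Theta> s x * \<kappa> s x))))\<^sup>2 \<le> avg X (\<lambda>x. (cmod (avg I (\<lambda>i. \<Theta> [i] x)))\<^sup>2)"
    using norm_avg_mult_square[of X "u []"] u(1) by simp
  also have "\<dots> = Re (avg X (\<lambda>x. avg I (\<lambda>i. avg I (\<lambda>i'. \<Theta> [i] x * cnj (\<Theta> [i'] x)))))"
    unfolding norm_avg_square[symmetric] avg_of_real by simp
  also have "avg X (\<lambda>x. avg I (\<lambda>i. avg I (\<lambda>i'. \<Theta> [i] x * cnj (\<Theta> [i'] x)))) = avg I (\<lambda>i. avg I (\<lambda>i'. avg X (\<lambda>x. \<Theta> [i] x * cnj (\<Theta> [i'] x))))"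
    by (subst avg_swap[of X]) (subst avg_swap[of X], rule refl)
  finally show ?case by (simp add: avg_tup_Suc avg_tup_0)
next
  case (Suc d \<Theta> \<kappa>)
  let ?T = "tup (Suc d) I"
  obtain u k where u: "\<And>s x. cmod (u s x) \<le> 1" "\<And>i s x. \<kappa> (i # s) x = u s x * k i s x" "\<And>i. splits (Suc d) (k i)"
    using Suc.prems unfolding splits.simps(2)[of "Suc d"] by blast
  define B where "B i i' = avg ?T (\<lambda>s. avg X (\<lambda>x. (\<Theta> (i # s) x * cnj (\<Theta> (i' # s) x)) * (k i s x * cnj (k i' s x))))" for i i'
  have "avg (tup (Suc (Suc d)) I) (\<lambda>s. avg X (\<lambda>x. \<Theta> s x * \<kappa> s x))
     = avg I (\<lambda>i. avg ?T (\<lambda>s. avg X (\<lambda>x. u s x * (\<Theta> (i # s) x * k i s x))))"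
    unfolding avg_tup_Suc[of "Suc d"] by (simp only: u(2) mult_ac)
  also have "\<dots> = avg ?T (\<lambda>s. avg X (\<lambda>x. u s x * avg I (\<lambda>i. \<Theta> (i # s) x * k i s x)))"
    by (subst avg_swap[of I]) (subst avg_swap[of I], simp only: avg_mult_left)
  also have "\<dots> = avg (?T \<times> X) (\<lambda>p. u (fst p) (snd p) * avg I (\<lambda>i. \<Theta> (i # fst p) (snd p) * k i (fst p) (snd p)))"
    by (rule avg_Times[symmetric])
  finally have "(cmod (avg (tup (Suc (Suc d)) I) (\<lambda>s. avg X (\<lambda>x. \<Theta> s x * \<kappa> s x))))\<^sup>2
     \<le> avg (?T \<times> X) (\<lambda>p. (cmod (avg I (\<lambda>i. \<Theta> (i # fst p) (snd p) * k i (fst p) (snd p))))\<^sup>2)"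
    using norm_avg_mult_square[of "?T \<times> X" "\<lambda>p. u (fst p) (snd p)"] u(1) by simp
  also have "\<dots> = avg ?T (\<lambda>s. avg X (\<lambda>x. (cmod (avg I (\<lambda>i. \<Theta> (i # s) x * k i s x)))\<^sup>2))"
    by (rule avg_Times)
  also have "\<dots> = Re (avg ?T (\<lambda>s. avg X (\<lambda>x. avg I (\<lambda>i. avg I (\<lambda>i'. (\<Theta> (i # s) x * k i s x) * cnj (\<Theta> (i' # s) x * k i' s x))))))"
    unfolding norm_avg_square[symmetric] avg_of_real by simp
  also have "avg ?T (\<lambda>s. avg X (\<lambda>x. avg I (\<lambda>i. avg I (\<lambda>i'. (\<Theta> (i # s) x * k i s x) * cnj (\<Theta> (i' # s) x * k i' s x)))))
      = avg I (\<lambda>i. avg I (\<lambda>i'. B i i'))"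
  proof -
    have "avg ?T (\<lambda>s. avg X (\<lambda>x. avg I (\<lambda>i. avg I (\<lambda>i'. (\<Theta> (i # s) x * k i s x) * cnj (\<Theta> (i' # s) x * k i' s x)))))
      = avg ?T (\<lambda>s. avg I (\<lambda>i. avg I (\<lambda>i'. avg X (\<lambda>x. (\<Theta> (i # s) x * k i s x) * cnj (\<Theta> (i' # s) x * k i' s x)))))"
      by (subst avg_swap[of X]) (subst avg_swap[of X], rule refl)
    also have "\<dots> = avg I (\<lambda>i. avg I (\<lambda>i'. avg ?T (\<lambda>s. avg X (\<lambda>x. (\<Theta> (i # s) x * k i s x) * cnj (\<Theta> (i' # s) x * k i' s x)))))"
      by (subst avg_swap[of ?T]) (subst avg_swap[of ?T], rule refl)
    finally show ?thesis by (simp only: B_def complex_cnj_mult mult_ac)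
  qed
  finally have "(cmod (avg (tup (Suc (Suc d)) I) (\<lambda>s. avg X (\<lambda>x. \<Theta> s x * \<kappa> s x))))\<^sup>2 \<le> Re (avg I (\<lambda>i. avg I (\<lambda>i'. B i i')))" .
  also have "\<dots> \<le> avg (I \<times> I) (\<lambda>p. cmod (B (fst p) (snd p)))"
    unfolding avg_Times[of I I B, symmetric] avg_Re by (intro avg_mono complex_Re_le_cmod)
  finally have 1: "(cmod (avg (tup (Suc (Suc d)) I) (\<lambda>s. avg X (\<lambda>x. \<Theta> s x * \<kappa> s x))))\<^sup>2 \<le> avg (I \<times> I) (\<lambda>p. cmod (B (fst p) (snd p)))" .
  have "(cmod (avg (tup (Suc (Suc d)) I) (\<lambda>s. avg X (\<lambda>x. \<Theta> s x * \<kappa> s x)))) ^ (2 ^ Suc (Suc d))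
     = ((cmod (avg (tup (Suc (Suc d)) I) (\<lambda>s. avg X (\<lambda>x. \<Theta> s x * \<kappa> s x))))\<^sup>2) ^ (2 ^ Suc d)"
    by (simp only: power_mult[symmetric] power_Suc)
  also have "\<dots> \<le> (avg (I \<times> I) (\<lambda>p. cmod (B (fst p) (snd p)))) ^ (2 ^ Suc d)"
    by (intro power_mono 1) auto
  also have "\<dots> \<le> avg (I \<times> I) (\<lambda>p. cmod (B (fst p) (snd p)) ^ (2 ^ Suc d))"
    by (intro avg_power_le) auto
  also have "\<dots> \<le> avg (I \<times> I) (\<lambda>p. Re (avg ?T (\<lambda>s. avg ?T (\<lambda>s'. avg X (\<lambda>x. box_diff s s' (\<lambda>v. \<Theta> (fst p # v) x * cnj (\<Theta> (snd p # v) x)))))))"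
  proof (rule avg_mono)
    fix p :: "'i \<times> 'i"
    \<comment> \<open>The leftover factors at \<open>fst p\<close> and at \<open>snd p\<close> still
      split in the remaining coordinates, and so does their product; hence induction applies to the
      differenced \<Theta>.\<close>
    have "splits (Suc d) (\<lambda>s x. k (fst p) s x * cnj (k (snd p) s x))"
      using splits_mult[OF u(3) splits_cnj_comp[OF u(3), where h = "\<lambda>x. x"]] by simp
    from Suc.IH[OF this, of "\<lambda>s x. \<Theta> (fst p # s) x * cnj (\<Theta> (snd p # s) x)"]
    show "cmod (B (fst p) (snd p)) ^ (2 ^ Suc d) \<le> Re (avg ?T (\<lambda>s. avg ?T (\<lambda>s'. avg X (\<lambda>x. box_diff s s' (\<lambda>v. \<Theta> (fst p # v) x * cnj (\<Theta> (snd p # v) x))))))"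
      unfolding B_def .
  qed
  also have "\<dots> = Re (avg I (\<lambda>i. avg I (\<lambda>i'. avg ?T (\<lambda>s. avg ?T (\<lambda>s'. avg X (\<lambda>x. box_diff (i # s) (i' # s') (\<lambda>v. \<Theta> v x)))))))"
    unfolding avg_Re[symmetric] box_diff.simps
    using avg_Times[of I I "\<lambda>i i'. avg ?T (\<lambda>s. avg ?T (\<lambda>s'. avg X (\<lambda>x. box_diff s s' (\<lambda>v. \<Theta> (i # v) x * cnj (\<Theta> (i' # v) x)))))"] by simp
  also have "\<dots> = Re (avg I (\<lambda>i. avg ?T (\<lambda>s. avg I (\<lambda>i'. avg ?T (\<lambda>s'. avg X (\<lambda>x. box_diff (i # s) (i' # s') (\<lambda>v. \<Theta> v x)))))))"
    by (subst avg_swap[of I ?T]) (rule refl)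
  finally show ?case unfolding avg_tup_Suc[of "Suc d"] .
qed

lemma box_diff_mult: "box_diff s s' (\<lambda>u. A u * B u) = box_diff s s' A * box_diff s s' B"
proof (induction s arbitrary: s' A B)
  case (Cons i s)
  show ?case
  proof (cases s')
    case (Cons j t)
    have "box_diff (i # s) s' (\<lambda>u. A u * B u) = box_diff s t (\<lambda>u. (A (i # u) * cnj (A (j # u))) * (B (i # u) * cnj (B (j # u))))"
      by (simp add: Cons mult_ac)
    then show ?thesis by (simp add: Cons Cons.IH)
  qed simp
qed simp

lemma box_diff_cnj: "box_diff s s' (\<lambda>u. cnj (A u)) = cnj (box_diff s s' A)"
proof (induction s s' A rule: box_diff.induct)
  case (1 i s i' s' T)
  then show ?case by (simp add: mult.commute)
qed simp_all

text \<open>All vertices other than \<open>s\<close> are bounded by 1. Keeping the one at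
  \<open>s\<close> carries the support of \<open>c\<close> through Cauchy-Schwarz.\<close>

lemma norm_box_diff_le:
  assumes "length s = length s'" "\<And>u. cmod (c u) \<le> 1"
  shows "cmod (box_diff s s' c) \<le> cmod (c s)"
  using assms
proof (induction s s' arbitrary: c rule: list_induct2)
  case (Cons i s i' s')
  have "cmod (box_diff (i # s) (i' # s') c) \<le> cmod (c (i # s) * cnj (c (i' # s)))"
    unfolding box_diff.simps by (rule Cons.IH) (simp add: norm_mult mult_le_one Cons.prems)
  also have "\<dots> \<le> cmod (c (i # s))" using Cons.prems by (simp add: norm_mult mult_left_le)
  finally show ?case .
qed simp

text \<open>Additive counterpart of \<open>box_diff\<close>: the mixed difference of \<gamma> over
  the box, that is, the frequency that remains when characters are multiplied over its
  vertices.\<close>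

fun alt_sum :: "'i list \<Rightarrow> 'i list \<Rightarrow> ('i list \<Rightarrow> int) \<Rightarrow> int" where
  "alt_sum (i # s) (i' # s') \<gamma> = alt_sum s s' (\<lambda>u. \<gamma> (i # u) - \<gamma> (i' # u))"
| "alt_sum _ _ \<gamma> = \<gamma> []"

lemma box_diff_ch: "box_diff s s' (\<lambda>u. ch L (\<gamma> u) t) = ch L (alt_sum s s' \<gamma>) t"
  by (induction s s' \<gamma> rule: alt_sum.induct) (simp_all add: ch_cnj ch_diff_left[symmetric])

lemma alt_sum_diff: "alt_sum s s' (\<lambda>u. \<gamma> u - \<gamma>' u) = alt_sum s s' \<gamma> - alt_sum s s' \<gamma>'"
proof (induction s arbitrary: s' \<gamma> \<gamma>')
  case (Cons i s)
  show ?case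
  proof (cases s')
    case (Cons j t)
    have "alt_sum (i # s) s' (\<lambda>u. \<gamma> u - \<gamma>' u) = alt_sum s t (\<lambda>u. (\<gamma> (i # u) - \<gamma> (j # u)) - (\<gamma>' (i # u) - \<gamma>' (j # u)))"
      by (simp add: Cons algebra_simps)
    then show ?thesis by (simp add: Cons Cons.IH)
  qed simp
qed simp

lemma alt_sum_zero: "alt_sum s s' (\<lambda>_. 0) = 0"
  using alt_sum_diff[of s s' "\<lambda>_. 0" "\<lambda>_. 0"] by simp

lemma alt_sum_const: "s \<noteq> [] \<Longrightarrow> length s = length s' \<Longrightarrow> alt_sum s s' (\<lambda>_. c) = 0"
  by (cases s; cases s') (auto simp: alt_sum_zero)

text \<open>Expanding \<open>alt_sum u t \<gamma>\<close> gives \<gamma> at \<open>u\<close> plus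
  terms that each ignore a coordinate of \<open>u\<close>, and a mixed difference annihilates such
  terms.\<close>

lemma alt_sum_alt_sum:
  "length s = length s' \<Longrightarrow> length s = length t \<Longrightarrow> alt_sum s s' (\<lambda>u. alt_sum u t \<gamma>) = alt_sum s s' \<gamma>"
proof (induction s arbitrary: s' t \<gamma>)
  case (Cons i s)
  obtain i' s1 j t1 where st: "s' = i' # s1" "t = j # t1" using Cons.prems by (cases s'; cases t) auto
  have "alt_sum (i # s) s' (\<lambda>u. alt_sum u t \<gamma>) = alt_sum s s1 (\<lambda>u. alt_sum u t1 (\<lambda>v. (\<gamma> (i # v) - \<gamma> (j # v)) - (\<gamma> (i' # v) - \<gamma> (j # v))))"
    by (simp add: st alt_sum_diff)
  also have "\<dots> = alt_sum s s1 (\<lambda>v. \<gamma> (i # v) - \<gamma> (i' # v))"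
    using Cons.IH[of s1 t1 "\<lambda>v. \<gamma> (i # v) - \<gamma> (i' # v)"] Cons.prems st by simp
  finally show ?case by (simp add: st)
qed simp

section \<open>Multiplicative derivatives\<close>

fun mult_diff :: "('i \<Rightarrow> int) list \<Rightarrow> 'i list \<Rightarrow> (int \<Rightarrow> complex) \<Rightarrow> int \<Rightarrow> complex" where
  "mult_diff (a # as) (i # s) F x = mult_diff as s (\<lambda>z. F z * cnj (F (z + a i))) x"
| "mult_diff _ _ F x = F x"

fun sum_dirs :: "('i \<Rightarrow> int) list \<Rightarrow> 'i list \<Rightarrow> int" where
  "sum_dirs (a # as) (i # s) = a i + sum_dirs as s"
| "sum_dirs _ _ = 0"

text \<open>The conjugation that a \<open>d\<close>-fold multiplicative derivative puts on the
  vertex where all shifts are added.\<close>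

primrec iter_cnj :: "nat \<Rightarrow> complex \<Rightarrow> complex" where
  "iter_cnj 0 z = z"
| "iter_cnj (Suc d) z = cnj (iter_cnj d z)"

lemma iter_cnj_norm [simp]: "cmod (iter_cnj d z) = cmod z" by (induction d) auto
lemma iter_cnj_mult: "iter_cnj d (z * w) = iter_cnj d z * iter_cnj d w" by (induction d) auto
lemma iter_cnj_avg: "iter_cnj d (avg A f) = avg A (\<lambda>a. iter_cnj d (f a))" by (induction d) (auto simp: avg_cnj)
lemma iter_cnj_of_real: "iter_cnj d (of_real r) = of_real r" by (induction d) auto
lemma box_diff_iter_cnj: "box_diff s s' (\<lambda>u. iter_cnj d (A u)) = iter_cnj d (box_diff s s' A)" by (induction d) (auto simp: box_diff_cnj)
lemma mult_diff_mult: "mult_diff as s (\<lambda>z. F z * G z) x = mult_diff as s F x * mult_diff as s G x"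
proof (induction as arbitrary: s F G)
  case (Cons a as)
  show ?case
  proof (cases s)
    case (Cons i t)
    have "mult_diff (a # as) s (\<lambda>z. F z * G z) x = mult_diff as t (\<lambda>z. (F z * cnj (F (z + a i))) * (G z * cnj (G (z + a i)))) x"
      by (simp add: Cons mult_ac)
    then show ?thesis by (simp add: Cons Cons.IH)
  qed simp
qed simp

lemma mult_diff_cnj: "mult_diff as s (\<lambda>z. cnj (F z)) x = cnj (mult_diff as s F x)"
proof (induction as s F x rule: mult_diff.induct)
  case (1 a as i s F x)
  then show ?case by (simp add: mult.commute)
qed simp_all

lemma mult_diff_shift: "mult_diff as s (\<lambda>z. F (z + c)) x = mult_diff as s F (x + c)"
proof (induction as arbitrary: s F)
  case (Cons a as)
  show ?case
  proof (cases s)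
    case (Cons i t)
    have "mult_diff (a # as) s (\<lambda>z. F (z + c)) x = mult_diff as t (\<lambda>z. (\<lambda>z. F z * cnj (F (z + a i))) (z + c)) x"
      by (simp add: Cons add.assoc add.commute[of c])
    then show ?thesis using Cons.IH[of t "\<lambda>z. F z * cnj (F (z + a i))"] by (simp add: Cons)
  qed simp
qed simp

lemma mult_diff_Cons: "mult_diff (a # as) (i # s) F x = mult_diff as s F x * cnj (mult_diff as s F (x + a i))"
  by (simp add: mult_diff_mult mult_diff_cnj mult_diff_shift)

lemma per_mult_diff: "per L F \<Longrightarrow> per L (mult_diff as s F)"
  unfolding per_def mult_diff_shift[symmetric] by simp

lemma bd_mult_diff: "bd F \<Longrightarrow> bd (mult_diff as s F)"
proof (induction as arbitrary: s F)
  case Nil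
  then show ?case by (simp add: bd_def)
next
  case (Cons a as)
  show ?case
  proof (cases s)
    case Nil
    then show ?thesis using Cons.prems by (simp add: bd_def)
  next
    case (Cons i t)
    have "bd (\<lambda>z. F z * cnj (F (z + a i)))"
      using Cons.prems by (simp add: bd_def norm_mult mult_le_one)
    from Cons.IH[OF this, of t] show ?thesis using Cons by (simp add: bd_def)
  qed
qed

text \<open>Only the vertex with all shifts added depends on every coordinate of \<open>s\<close>.
  Each other vertex omits a shift, so together they form a factor that Cauchy-Schwarz can eliminate.
  The parameter \<open>p\<close> lets one \<kappa> serve a whole family of functions.\<close>

lemma mult_diff_top:
  fixes F :: "'p \<Rightarrow> int \<Rightarrow> complex" and as :: "('i \<Rightarrow> int) list"
  assumes "\<And>p. bd (F p)"
  shows "\<exists>\<kappa>. splits (length as) \<kappa> \<and>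
    (\<forall>s p x. length s = length as \<longrightarrow> mult_diff as s (F p) x = iter_cnj (length as) (F p (x + sum_dirs as s)) * \<kappa> s (p, x))"
proof (induction as)
  case Nil
  show ?case by (rule exI[of _ "\<lambda>s q. 1"]) simp
next
  case (Cons a as)
  then obtain \<kappa> where k: "splits (length as) \<kappa>"
    "\<And>s p x. length s = length as \<Longrightarrow> mult_diff as s (F p) x = iter_cnj (length as) (F p (x + sum_dirs as s)) * \<kappa> s (p, x)" by blast
  define \<kappa>' where "\<kappa>' s q = (case s of [] \<Rightarrow> 1 | i # t \<Rightarrow>
     mult_diff as t (F (fst q)) (snd q) * cnj (\<kappa> t (fst q, snd q + a i)))" for s and q :: "'p \<times> int"
  show ?case
  proof (intro exI[of _ \<kappa>'] conjI allI impI)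
    show "splits (length (a # as)) \<kappa>'"
      unfolding splits.simps list.size add_Suc_right add_0_right
    proof (rule exI[of _ "\<lambda>t q. mult_diff as t (F (fst q)) (snd q)"],
        rule exI[of _ "\<lambda>i t q. cnj (\<kappa> t (fst q, snd q + a i))"], intro conjI allI)
      show "cmod (mult_diff as t (F (fst q)) (snd q)) \<le> 1" for t q
        using bd_mult_diff[OF assms, of as t "fst q"] by (simp add: bd_def)
      show "\<kappa>' (i # t) q = mult_diff as t (F (fst q)) (snd q) * cnj (\<kappa> t (fst q, snd q + a i))" for i t q
        by (simp add: \<kappa>'_def)
      show "splits (length as) (\<lambda>t q. cnj (\<kappa> t (fst q, snd q + a i)))" for i
        by (rule splits_cnj_comp[OF k(1)])
    qed
  next
    fix s :: "'i list" and p x assume "length s = length (a # as)"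
    then obtain i t where s: "s = i # t" "length t = length as" by (cases s) auto
    show "mult_diff (a # as) s (F p) x = iter_cnj (length (a # as)) (F p (x + sum_dirs (a # as) s)) * \<kappa>' s (p, x)"
      unfolding s(1) mult_diff_Cons using k(2)[OF s(2), of p "x + a i"] by (simp add: \<kappa>'_def add.assoc mult_ac)
  qed
qed

definition diff_dir :: "('i \<Rightarrow> int) \<Rightarrow> 'i \<times> 'i \<Rightarrow> int" where "diff_dir a p = a (snd p) - a (fst p)"

lemma box_diff_sum_dirs:
  "length s = length as \<Longrightarrow> length s' = length as \<Longrightarrow>
   box_diff s s' (\<lambda>u. G (x + sum_dirs as u)) = mult_diff (map diff_dir as) (zip s s') G (x + sum_dirs as s)"
proof (induction as arbitrary: s s' G x)
  case (Cons a as)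
  obtain i t i' t' where st: "s = i # t" "s' = i' # t'" using Cons.prems by (cases s; cases s') auto
  have "box_diff s s' (\<lambda>u. G (x + sum_dirs (a # as) u))
     = box_diff t t' (\<lambda>u. (\<lambda>z. G z * cnj (G (z + diff_dir a (i, i')))) ((x + a i) + sum_dirs as u))"
    by (simp add: st diff_dir_def add_ac)
  also have "\<dots> = mult_diff (map diff_dir as) (zip t t') (\<lambda>z. G z * cnj (G (z + diff_dir a (i, i')))) ((x + a i) + sum_dirs as t)"
    by (rule Cons.IH) (use Cons.prems st in auto)
  finally show ?case by (simp add: st add.assoc)
qed simp

section \<open>Degree lowering\<close>

lemma splits_comp: "splits d \<kappa> \<Longrightarrow> splits d (\<lambda>s x. \<kappa> s (h x))"
  using splits_cnj_comp[OF splits_cnj_comp[of d \<kappa> h], of "\<lambda>x. x"] by simp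

lemma alt_sum_minus: "alt_sum s s' (\<lambda>u. - \<gamma> u) = - alt_sum s s' \<gamma>"
  using alt_sum_diff[of s s' "\<lambda>_. 0" \<gamma>] by (simp add: alt_sum_zero)

text \<open>Substituting \<open>z = x + t\<close> makes the frequency act on \<open>t\<close> alone,
  apart from the values of \<open>g\<close>.\<close>

lemma norm_ft_square:
  assumes L: "0 < L" and g: "per L g"
  shows "complex_of_real ((cmod (ft L g k))\<^sup>2)
    = avg (ZL L) (\<lambda>x. avg (ZL L) (\<lambda>t. g x * cnj (g (x + t)) * ch L k t))"
proof -
  have "complex_of_real ((cmod (ft L g k))\<^sup>2)
     = avg (ZL L) (\<lambda>x. avg (ZL L) (\<lambda>z. (g x * ch L (- k) x) * cnj (g z * ch L (- k) z)))"
    unfolding ft_def by (rule norm_avg_square)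
  also have "\<dots> = avg (ZL L) (\<lambda>x. avg (ZL L) (\<lambda>t. g x * cnj (g (x + t)) * ch L k t))"
  proof (rule avg_cong[OF refl])
    fix x
    let ?F = "\<lambda>z. (g x * ch L (- k) x) * cnj (g z * ch L (- k) z)"
    have "per L ?F"
      using per_map2[OF g ch_per[OF L, of "- k"], of "\<lambda>a b. (g x * ch L (- k) x) * cnj (a * b)"] .
    then have "avg (ZL L) ?F = avg (ZL L) (\<lambda>t. ?F (t + x))" by (rule avg_per_shift[OF L, symmetric])
    also have "\<dots> = avg (ZL L) (\<lambda>t. g x * cnj (g (x + t)) * ch L k t)"
    proof (intro avg_cong refl)
      fix t
      have e: "ch L (- k) x * cnj (ch L (- k) (t + x)) = ch L k t"
        unfolding ch_add complex_cnj_mult ch_cnj minus_minus by (simp add: mult.left_commute[of _ "ch L k t"])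
      have "?F (t + x) = g x * cnj (g (x + t)) * (ch L (- k) x * cnj (ch L (- k) (t + x)))"
        unfolding add.commute[of x t] by (simp add: mult_ac)
      then show "?F (t + x) = g x * cnj (g (x + t)) * ch L k t" unfolding e .
    qed
    finally show "avg (ZL L) ?F = avg (ZL L) (\<lambda>t. g x * cnj (g (x + t)) * ch L k t)" .
  qed
  finally show ?thesis .
qed

lemma norm_avg_square_shift:
  assumes "0 < L" "per L g"
  shows "complex_of_real ((cmod (avg (ZL L) g))\<^sup>2) = avg (ZL L) (\<lambda>t. avg (ZL L) (\<lambda>x. g x * cnj (g (x + t))))"
proof -
  have "ft L g 0 = avg (ZL L) g" by (simp add: ft_def)
  then show ?thesis using norm_ft_square[OF assms, of 0] by (subst avg_swap) simp
qed

text \<open>The substitution \<open>z = x + y\<^sup>2\<close> in the counting form collects the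
  first two functions into this factor; see \<open>Lam_eq_dual\<close>.\<close>

definition dual :: "nat \<Rightarrow> (int \<Rightarrow> complex) \<Rightarrow> (int \<Rightarrow> complex) \<Rightarrow> int \<Rightarrow> complex" where
  "dual Y g1 g2 z = avg {1..int Y} (\<lambda>y. g1 (z + - y\<^sup>2) * g2 (z + (y - y\<^sup>2)))"

lemma bd_add: "bd f \<Longrightarrow> bd (\<lambda>x. f (x + c))" by (simp add: bd_def)

lemma per_dual: "per L g1 \<Longrightarrow> per L g2 \<Longrightarrow> per L (dual Y g1 g2)"
  unfolding dual_def by (intro per_avg per_map2[where h = "(*)"] per_shift)

lemma bd_dual: "bd g1 \<Longrightarrow> bd g2 \<Longrightarrow> bd (dual Y g1 g2)"
  unfolding dual_def by (intro bd_avg bd_mult bd_add)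

definition corr :: "nat \<Rightarrow> nat \<Rightarrow> (int \<Rightarrow> complex) \<Rightarrow> (int \<Rightarrow> complex) \<Rightarrow> int \<Rightarrow> complex" where
  "corr L Y g1 g2 m = avg (ZL L) (\<lambda>x. avg {1..int Y} (\<lambda>y. g1 x * g2 (x + y) * ch L m (x + y\<^sup>2)))"

lemma norm_corr_le: "bd g1 \<Longrightarrow> bd g2 \<Longrightarrow> cmod (corr L Y g1 g2 m) \<le> 1"
  unfolding corr_def by (intro norm_avg_le_const) (auto simp: norm_mult bd_def intro!: mult_le_one)

text \<open>\<open>mult_diff_top\<close> isolates one vertex of the derivative, and there
  \<open>dual\<close> is replaced by its average over \<open>y\<close>. Cauchy-Schwarz removes the
  other vertices with \<open>x\<close> and \<open>y\<close> held fixed, so what survives is a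
  derivative of the summand for a single \<open>y\<close>, hence a product of derivatives of
  \<open>g1\<close> and \<open>g2\<close>. The characters at the vertices multiply to one
  character.\<close>

lemma dual_difference_interchange:
  fixes as :: "('i \<Rightarrow> int) list" and \<gamma> :: "'i list \<Rightarrow> int" and c :: "'i list \<Rightarrow> complex"
  assumes L: "0 < L" and g: "per L g1" "per L g2" "bd g1" "bd g2"
    and as: "length as = d" "1 \<le> d" and c: "\<And>u. cmod (c u) \<le> 1"
  defines "h \<equiv> \<lambda>g s s' x. iter_cnj d (mult_diff (map diff_dir as) (zip s s') g x)"
  shows "(cmod (avg (tup d I) (\<lambda>s. c s * ft L (mult_diff as s (dual Y g1 g2)) (\<gamma> s)))) ^ (2 ^ d)
    \<le> avg (tup d I) (\<lambda>s'. avg (tup d I) (\<lambda>s. cmod (c s) * cmod (corr L Y (h g1 s s') (h g2 s s') (- alt_sum s s' \<gamma>))))"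
proof -
  let ?D = "dual Y g1 g2" and ?T = "tup d I"
  obtain d' where d': "d = Suc d'" using as(2) by (cases d) auto
  have "\<And>p::unit. bd ((\<lambda>_. ?D) p)" using bd_dual[OF g(3,4)] by simp
  from mult_diff_top[OF this, of as] obtain \<kappa> where k: "splits d \<kappa>"
    "\<And>s x. length s = d \<Longrightarrow> mult_diff as s ?D x = iter_cnj d (?D (x + sum_dirs as s)) * \<kappa> s ((), x)"
    using as(1) by blast
  define f where "f y z = g1 (z + - y\<^sup>2) * g2 (z + (y - y\<^sup>2))" for y z
  define \<Theta> where "\<Theta> s p = c s * (iter_cnj d (f (snd p) (fst p + sum_dirs as s)) * ch L (- \<gamma> s) (fst p))" for s and p :: "int \<times> int"
  define \<kappa>' where "\<kappa>' s p = \<kappa> s ((), fst p)" for s and p :: "int \<times> int"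
  define X where "X = ZL L \<times> {1..int Y}"
  have k': "splits (Suc d') \<kappa>'" unfolding \<kappa>'_def d'[symmetric] by (rule splits_comp[OF k(1)])
  have "avg ?T (\<lambda>s. c s * ft L (mult_diff as s ?D) (\<gamma> s)) = avg ?T (\<lambda>s. avg X (\<lambda>p. \<Theta> s p * \<kappa>' s p))"
  proof (intro avg_cong refl)
    fix s assume "s \<in> ?T"
    then have s: "length s = d" by (simp add: tup_def)
    have "c s * ft L (mult_diff as s ?D) (\<gamma> s) = avg (ZL L) (\<lambda>x. avg {1..int Y} (\<lambda>y. \<Theta> s (x, y) * \<kappa>' s (x, y)))"
      unfolding ft_def avg_mult_left[symmetric]
    proof (intro avg_cong refl)
      fix x
      have "iter_cnj d (?D (x + sum_dirs as s)) = avg {1..int Y} (\<lambda>y. iter_cnj d (f y (x + sum_dirs as s)))"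
        unfolding dual_def iter_cnj_avg f_def ..
      then show "c s * (mult_diff as s ?D x * ch L (- \<gamma> s) x) = avg {1..int Y} (\<lambda>y. \<Theta> s (x, y) * \<kappa>' s (x, y))"
        unfolding k(2)[OF s] \<Theta>_def \<kappa>'_def by (simp add: avg_mult_left avg_mult_right mult_ac)
    qed
    also have "\<dots> = avg X (\<lambda>p. \<Theta> s p * \<kappa>' s p)"
      unfolding X_def using avg_Times[of "ZL L" "{1..int Y}" "\<lambda>x y. \<Theta> s (x, y) * \<kappa>' s (x, y)"] by simp
    finally show "c s * ft L (mult_diff as s ?D) (\<gamma> s) = avg X (\<lambda>p. \<Theta> s p * \<kappa>' s p)" .
  qed
  then have "(cmod (avg ?T (\<lambda>s. c s * ft L (mult_diff as s ?D) (\<gamma> s)))) ^ (2 ^ d)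
     \<le> Re (avg ?T (\<lambda>s. avg ?T (\<lambda>s'. avg X (\<lambda>p. box_diff s s' (\<lambda>u. \<Theta> u p)))))"
    using box_cauchy_schwarz[OF k', of I X \<Theta>] by (simp add: d')
  also have "\<dots> \<le> cmod (avg ?T (\<lambda>s. avg ?T (\<lambda>s'. avg X (\<lambda>p. box_diff s s' (\<lambda>u. \<Theta> u p)))))"
    by (rule complex_Re_le_cmod)
  also have "\<dots> \<le> avg ?T (\<lambda>s. avg ?T (\<lambda>s'. cmod (avg X (\<lambda>p. box_diff s s' (\<lambda>u. \<Theta> u p)))))"
    by (intro order_trans[OF norm_avg_le] avg_mono norm_avg_le)
  also have "\<dots> \<le> avg ?T (\<lambda>s. avg ?T (\<lambda>s'. cmod (c s) * cmod (corr L Y (h g1 s s') (h g2 s s') (- alt_sum s s' \<gamma>))))"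
  proof (intro avg_mono)
    fix s s' assume "s \<in> ?T" "s' \<in> ?T"
    then have s: "length s = d" "length s' = d" by (auto simp: tup_def)
    define m where "m = - alt_sum s s' \<gamma>"
    define l where "l = sum_dirs as s"
    have bxT: "box_diff s s' (\<lambda>u. \<Theta> u (x, y)) = box_diff s s' c *
       (h g1 s s' (x + (l - y\<^sup>2)) * h g2 s s' (x + (l - y\<^sup>2) + y) * ch L m x)" for x y
    proof -
      have "box_diff s s' (\<lambda>u. \<Theta> u (x, y)) = box_diff s s' c * (iter_cnj d (mult_diff (map diff_dir as) (zip s s') (f y) (x + l)) * ch L m x)"
        unfolding \<Theta>_def box_diff_mult fst_conv snd_conv box_diff_iter_cnj l_def m_def box_diff_ch alt_sum_minus
        using box_diff_sum_dirs[of s as s' "f y" x] s as(1) by simp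
      also have "mult_diff (map diff_dir as) (zip s s') (f y) (x + l)
         = mult_diff (map diff_dir as) (zip s s') g1 (x + l + - y\<^sup>2) * mult_diff (map diff_dir as) (zip s s') g2 (x + l + (y - y\<^sup>2))"
        unfolding f_def mult_diff_mult mult_diff_shift ..
      finally show ?thesis by (simp add: h_def iter_cnj_mult algebra_simps)
    qed
    have hper: "per L (h g s s')" if "per L g" for g
      unfolding h_def by (rule per_map[OF per_mult_diff[OF that]])
    define F where "F y x = h g1 s s' x * h g2 s s' (x + y) * ch L m (x + y\<^sup>2)" for y x
    have Fper: "per L (F y)" for y
      unfolding F_def by (intro per_map2[where h = "(*)"] per_shift ch_per hper g L)
    have "avg X (\<lambda>p. box_diff s s' (\<lambda>u. \<Theta> u p)) = avg (ZL L) (\<lambda>x. avg {1..int Y} (\<lambda>y. box_diff s s' (\<lambda>u. \<Theta> u (x, y))))"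
      unfolding X_def using avg_Times[of "ZL L" "{1..int Y}" "\<lambda>x y. box_diff s s' (\<lambda>u. \<Theta> u (x, y))"] by simp
    \<comment> \<open>Translating by \<open>l - y\<^sup>2\<close> turns the shifts
      \<open>- y\<^sup>2\<close> and \<open>y - y\<^sup>2\<close> back into 0 and \<open>y\<close>,
      and puts \<open>y\<^sup>2\<close> into the character as in \<open>corr\<close>.\<close>
    also have "\<dots> = avg (ZL L) (\<lambda>x. avg {1..int Y} (\<lambda>y. box_diff s s' c * ch L m (- l) * F y (x + (l - y\<^sup>2))))"
    proof (intro avg_cong refl)
      fix x y
      have e: "ch L m x = ch L m (- l) * ch L m (x + (l - y\<^sup>2) + y\<^sup>2)"
        unfolding ch_add[symmetric] by simp
      show "box_diff s s' (\<lambda>u. \<Theta> u (x, y)) = box_diff s s' c * ch L m (- l) * F y (x + (l - y\<^sup>2))"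
        unfolding bxT F_def by (subst e) (simp only: mult_ac)
    qed
    also have "\<dots> = box_diff s s' c * ch L m (- l) * avg {1..int Y} (\<lambda>y. avg (ZL L) (\<lambda>x. F y (x + (l - y\<^sup>2))))"
      by (subst avg_swap) (simp only: avg_mult_left)
    also have "\<dots> = box_diff s s' c * ch L m (- l) * corr L Y (h g1 s s') (h g2 s s') m"
      unfolding avg_per_shift[OF L Fper] unfolding corr_def F_def by (subst avg_swap) (rule refl)
    finally have "cmod (avg X (\<lambda>p. box_diff s s' (\<lambda>u. \<Theta> u p))) = cmod (box_diff s s' c) * cmod (corr L Y (h g1 s s') (h g2 s s') m)"
      by (simp add: norm_mult)
    also have "\<dots> \<le> cmod (c s) * cmod (corr L Y (h g1 s s') (h g2 s s') m)"
      by (intro mult_right_mono norm_box_diff_le c) (simp_all add: s)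
    finally show "cmod (avg X (\<lambda>p. box_diff s s' (\<lambda>u. \<Theta> u p))) \<le> cmod (c s) * cmod (corr L Y (h g1 s s') (h g2 s s') (- alt_sum s s' \<gamma>))"
      by (simp add: m_def)
  qed
  finally show ?thesis by (subst avg_swap)
qed

text \<open>Frequencies without alternating sums over boxes are sums of functions each missing a coordinate,
  so that the Cauchy-Schwarz steps remove them.\<close>

lemma low_exp_rank_phase_removal:
  fixes as :: "('i \<Rightarrow> int) list" and \<gamma> :: "'i list \<Rightarrow> int"
  assumes L: "0 < L" and D: "per L D" "bd D" and as: "length as = d" "1 \<le> d"
    and alt_sum: "\<And>s s'. s \<in> tup d I \<Longrightarrow> s' \<in> tup d I \<Longrightarrow> alt_sum s s' \<gamma> = 0"
  shows "(avg (tup d I) (\<lambda>s. (cmod (ft L (mult_diff as s D) (\<gamma> s)))\<^sup>2)) ^ (2 ^ d)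
    \<le> avg (tup d (I \<times> I)) (\<lambda>p. (cmod (avg (ZL L) (mult_diff (map diff_dir as) p D)))\<^sup>2)"
proof -
  let ?T = "tup d I"
  obtain d' where d': "d = Suc d'" using as(2) by (cases d) auto
  \<comment> \<open>A further shift \<open>t\<close> is introduced by \<open>norm_ft_square\<close>,
    and \<gamma> occurs only in a character of \<open>t\<close>. The product of these characters
    over a box is the character at \<open>alt_sum\<close>, which is 1 by assumption.\<close>
  define F where "F t z = D z * cnj (D (z + t))" for t z
  have "bd (F t)" for t unfolding F_def by (intro bd_mult bd_cnj bd_add D)
  from mult_diff_top[of F, OF this, of as] obtain \<kappa> where k: "splits d \<kappa>"
    "\<And>s t x. length s = d \<Longrightarrow> mult_diff as s (F t) x = iter_cnj d (F t (x + sum_dirs as s)) * \<kappa> s (t, x)"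
    using as(1) by blast
  define \<Theta> where "\<Theta> s p = iter_cnj d (F (fst p) (snd p + sum_dirs as s)) * ch L (\<gamma> s) (fst p)" for s and p :: "int \<times> int"
  define X where "X = ZL L \<times> ZL L"
  have dlF: "mult_diff as s (F t) x = mult_diff as s D x * cnj (mult_diff as s D (x + t))" for as :: "('j \<Rightarrow> int) list" and s t x
    unfolding F_def by (simp add: mult_diff_mult mult_diff_cnj mult_diff_shift)
  have "complex_of_real (avg ?T (\<lambda>s. (cmod (ft L (mult_diff as s D) (\<gamma> s)))\<^sup>2)) = avg ?T (\<lambda>s. avg X (\<lambda>p. \<Theta> s p * \<kappa> s p))"
    unfolding avg_of_real[symmetric]
  proof (intro avg_cong refl)
    fix s assume "s \<in> ?T"
    then have s: "length s = d" by (simp add: tup_def)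
    have "complex_of_real ((cmod (ft L (mult_diff as s D) (\<gamma> s)))\<^sup>2)
       = avg (ZL L) (\<lambda>x. avg (ZL L) (\<lambda>t. mult_diff as s (F t) x * ch L (\<gamma> s) t))"
      unfolding norm_ft_square[OF L per_mult_diff[OF D(1)]] dlF ..
    also have "\<dots> = avg (ZL L) (\<lambda>t. avg (ZL L) (\<lambda>x. \<Theta> s (t, x) * \<kappa> s (t, x)))"
      unfolding k(2)[OF s] \<Theta>_def by (subst avg_swap) (simp add: mult_ac)
    also have "\<dots> = avg X (\<lambda>p. \<Theta> s p * \<kappa> s p)"
      unfolding X_def using avg_Times[of "ZL L" "ZL L" "\<lambda>t x. \<Theta> s (t, x) * \<kappa> s (t, x)"] by simp
    finally show "complex_of_real ((cmod (ft L (mult_diff as s D) (\<gamma> s)))\<^sup>2) = avg X (\<lambda>p. \<Theta> s p * \<kappa> s p)" .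
  qed
  then have "avg ?T (\<lambda>s. (cmod (ft L (mult_diff as s D) (\<gamma> s)))\<^sup>2) = cmod (avg ?T (\<lambda>s. avg X (\<lambda>p. \<Theta> s p * \<kappa> s p)))"
    using norm_of_real[of "avg ?T (\<lambda>s. (cmod (ft L (mult_diff as s D) (\<gamma> s)))\<^sup>2)", where 'a = complex]
      avg_nonneg[of ?T "\<lambda>s. (cmod (ft L (mult_diff as s D) (\<gamma> s)))\<^sup>2"] by simp
  then have "(avg ?T (\<lambda>s. (cmod (ft L (mult_diff as s D) (\<gamma> s)))\<^sup>2)) ^ (2 ^ d)
     \<le> Re (avg ?T (\<lambda>s. avg ?T (\<lambda>s'. avg X (\<lambda>p. box_diff s s' (\<lambda>u. \<Theta> u p)))))"
    using box_cauchy_schwarz[of d' \<kappa> I X \<Theta>] k(1) by (simp add: d')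
  also have "avg ?T (\<lambda>s. avg ?T (\<lambda>s'. avg X (\<lambda>p. box_diff s s' (\<lambda>u. \<Theta> u p))))
     = avg ?T (\<lambda>s. avg ?T (\<lambda>s'. complex_of_real ((cmod (avg (ZL L) (mult_diff (map diff_dir as) (zip s s') D)))\<^sup>2)))"
  proof (intro avg_cong refl)
    fix s s' assume ss: "s \<in> ?T" "s' \<in> ?T"
    then have s: "length s = d" "length s' = d" by (auto simp: tup_def)
    let ?P = "mult_diff (map diff_dir as) (zip s s') D"
    have perP: "per L ?P" by (rule per_mult_diff[OF D(1)])
    have "box_diff s s' (\<lambda>u. \<Theta> u (t, x)) = iter_cnj d (?P (x + sum_dirs as s) * cnj (?P (x + sum_dirs as s + t)))" for t x
      unfolding \<Theta>_def box_diff_mult fst_conv snd_conv box_diff_iter_cnj box_diff_ch alt_sum[OF ss] dlF[symmetric]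
      using box_diff_sum_dirs[of s as s' "F t" x] s as(1) by simp
    then have "avg X (\<lambda>p. box_diff s s' (\<lambda>u. \<Theta> u p))
       = avg (ZL L) (\<lambda>t. iter_cnj d (avg (ZL L) (\<lambda>x. ?P (x + sum_dirs as s) * cnj (?P (x + sum_dirs as s + t)))))"
      unfolding X_def iter_cnj_avg using avg_Times[of "ZL L" "ZL L" "\<lambda>t x. box_diff s s' (\<lambda>u. \<Theta> u (t, x))"] by simp
    also have "\<dots> = avg (ZL L) (\<lambda>t. iter_cnj d (avg (ZL L) (\<lambda>x. ?P x * cnj (?P (x + t)))))"
    proof (rule avg_cong[OF refl], rule arg_cong[where f = "iter_cnj d"])
      fix t
      have "per L (\<lambda>x. ?P x * cnj (?P (x + t)))"
        by (rule per_map2[OF perP per_shift[OF perP], where h = "\<lambda>a b. a * cnj b"])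
      from avg_per_shift[OF L this, of "sum_dirs as s"]
      show "avg (ZL L) (\<lambda>x. ?P (x + sum_dirs as s) * cnj (?P (x + sum_dirs as s + t))) = avg (ZL L) (\<lambda>x. ?P x * cnj (?P (x + t)))" .
    qed
    also have "\<dots> = complex_of_real ((cmod (avg (ZL L) ?P))\<^sup>2)"
      unfolding iter_cnj_avg[symmetric] norm_avg_square_shift[OF L perP, symmetric] by (rule iter_cnj_of_real)
    finally show "avg X (\<lambda>p. box_diff s s' (\<lambda>u. \<Theta> u p)) = complex_of_real ((cmod (avg (ZL L) ?P))\<^sup>2)" .
  qed
  also have "Re \<dots> = avg (tup d (I \<times> I)) (\<lambda>p. (cmod (avg (ZL L) (mult_diff (map diff_dir as) p D)))\<^sup>2)"
    unfolding avg_of_real avg_tup_Times by simp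
  finally show ?thesis .
qed

lemma pigeonhole_fiber:
  assumes "finite T" "finite M" "M \<noteq> {}" "h ` T \<subseteq> M"
  shows "\<exists>k\<in>M. real (card T) \<le> real (card M) * card {s\<in>T. h s = k}"
proof -
  have "(\<Sum>k\<in>M. \<Sum>s\<in>{s. s \<in> T \<and> h s = k}. 1::real) = (\<Sum>s\<in>T. 1)" using assms by (intro sum.group) auto
  then have "avg M (\<lambda>k. real (card {s\<in>T. h s = k})) = card T / card M" by (simp add: avg_def)
  moreover obtain k where k: "k \<in> M" "avg M (\<lambda>k. real (card {s\<in>T. h s = k})) \<le> card {s\<in>T. h s = k}"
    using ex_ge_avg[OF assms(2,3), of "\<lambda>k. real (card {s\<in>T. h s = k})"] by blast
  moreover have "0 < real (card M)" using assms(2,3) by (simp add: card_gt_0_iff)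
  ultimately have "card T \<le> real (card M) * card {s\<in>T. h s = k}"
    using mult_left_mono[OF k(2), of "real (card M)"] by simp
  then show ?thesis using k(1) by blast
qed

lemma cnj_sgn_mult: "cnj (sgn z) * z = of_real (cmod z)"
proof -
  have "cnj (sgn z) * z = of_real ((cmod z)\<^sup>2) / of_real (cmod z)"
    unfolding norm_square_complex sgn_eq by simp
  then show ?thesis by (simp add: power2_eq_square)
qed

text \<open>The values of the exponents \<open>low_exp\<close>, \<open>step_exp\<close>, \<open>box_exp\<close> and \<open>dual_exp\<close> are immaterial: they are
  what the arguments happen to lose, and only their independence of the data matters.\<close>

definition low_exp :: "nat \<Rightarrow> nat" where "low_exp d = (4 * 2 ^ d + 1) * (50 * 2 ^ d)"

text \<open>It is essential that \<open>Y\<^sup>2\<close> is comparable with \<open>L\<close>: the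
  arcs have length of order \<open>1 / Y\<^sup>2\<close> up to powers of \<open>1 / r\<close>, so
  each contains few fractions of denominator \<open>L\<close>.\<close>

lemma card_major_le:
  fixes r :: real
  assumes L: "0 < L" "real L \<le> 12 * (real Y)\<^sup>2" and r: "0 < r" "r \<le> 1 / 2" and Y: "0 < Y"
  shows "card {k\<in>ZL L. \<exists>q::nat. 1 \<le> q \<and> q \<le> nat \<lfloor>(1 / r) ^ 9\<rfloor> \<and> nd (real q * (of_int k / L)) \<le> (1 / r) ^ 23 / (real Y)\<^sup>2}
    \<le> (1 / r) ^ 47"
proof -
  define E where "E = 1 / r"
  have E2: "2 \<le> E" using r by (simp add: E_def field_simps)
  have E1: "1 \<le> E ^ k" for k using E2 by (intro one_le_power) auto
  define Q where "Q = nat \<lfloor>E ^ 9\<rfloor>"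
  have "0 \<le> E ^ 9" using E1[of 9] by linarith
  then have Q: "real Q \<le> E ^ 9" by (simp add: Q_def)
  have "real (card {k\<in>ZL L. \<exists>q::nat. 1 \<le> q \<and> q \<le> Q \<and> nd (real q * (of_int k / L)) \<le> E ^ 23 / (real Y)\<^sup>2})
    \<le> real Q * (real Q + 1) * (2 * (E ^ 23 / (real Y)\<^sup>2) * L + 1)"
    using E2 by (intro card_major_arcs L) auto
  also have "\<dots> \<le> E ^ 9 * (2 * E ^ 9) * (25 * E ^ 23)"
  proof (intro mult_mono)
    show "real Q + 1 \<le> 2 * E ^ 9" using Q E1[of 9] by linarith
    have "2 * (E ^ 23 / (real Y)\<^sup>2) * L \<le> 2 * (E ^ 23 / (real Y)\<^sup>2) * (12 * (real Y)\<^sup>2)"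
      using L E2 by (intro mult_left_mono) auto
    also have "\<dots> = 24 * E ^ 23" using Y by simp
    finally show "2 * (E ^ 23 / (real Y)\<^sup>2) * L + 1 \<le> 25 * E ^ 23" using E1[of 23] by linarith
  qed (use Q E2 in auto)
  also have "\<dots> = 50 * E ^ 41" by (simp add: power_add[symmetric])
  also have "\<dots> \<le> 2 ^ 6 * E ^ 41" using E2 by simp
  also have "\<dots> \<le> E ^ 6 * E ^ 41" using E2 by (intro mult_right_mono power_mono) auto
  also have "\<dots> = E ^ 47" by (simp add: power_add[symmetric])
  finally show ?thesis by (simp add: E_def Q_def)
qed

text \<open>Fixing one corner \<open>s0\<close> makes the alternating sum a function of
  \<open>s\<close> alone. On a dense set of \<open>s\<close> it lies in few residue classes modulo
  \<open>L\<close>, hence on a smaller dense set in a single one; subtracting it from \<gamma>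
  leaves frequencies to which \<open>low_exp_rank_phase_removal\<close> applies.\<close>

lemma degree_lowering:
  fixes as :: "('i \<Rightarrow> int) list" and \<gamma> :: "'i list \<Rightarrow> int"
  assumes L: "0 < L" "real L \<le> 12 * (real Y)\<^sup>2" and g: "per L g1" "per L g2" "bd g1" "bd g2"
    and as: "length as = d" "1 \<le> d" and I: "finite I" "I \<noteq> {}"
    and e: "0 < \<eta>" "\<eta> \<le> 1 / 2" "(1 / \<eta>) ^ low_exp d \<le> Y"
    and big: "\<eta> \<le> avg (tup d I) (\<lambda>s. (cmod (ft L (mult_diff as s (dual Y g1 g2)) (\<gamma> s)))\<^sup>2)"
  shows "\<eta> ^ low_exp d \<le> avg (tup d (I \<times> I)) (\<lambda>p. (cmod (avg (ZL L) (mult_diff (map diff_dir as) p (dual Y g1 g2))))\<^sup>2)"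
proof -
  let ?D = "dual Y g1 g2" and ?T = "tup d I"
  have D: "per L ?D" "bd ?D" using per_dual bd_dual g by auto
  have fT: "finite ?T" "?T \<noteq> {}" by (simp_all add: finite_tup tup_nonempty I)
  define N where "N = card ?T"
  have N0: "0 < real N" using fT by (simp add: N_def card_gt_0_iff)
  have Y0: "0 < Y" using e(1,3) by (metis gr0I less_le_not_le of_nat_0 zero_less_divide_1_iff zero_less_power)
  define A where "A s = ft L (mult_diff as s ?D) (\<gamma> s)" for s
  have A1: "cmod (A s) \<le> 1" for s unfolding A_def by (rule ft_le_one[OF bd_mult_diff[OF D(2)]])
  have A2: "(cmod (A s))\<^sup>2 \<le> cmod (A s)" for s
    using A1[of s] by (simp add: power2_eq_square mult_left_le)
  define G where "G = {s\<in>?T. \<eta> / 2 \<le> (cmod (A s))\<^sup>2}"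
  have dir2: "\<eta> / 2 * N \<le> card G"
    unfolding G_def N_def by (rule dense_of_avg) (use fT A1 big e in \<open>auto simp: A_def power_le_one\<close>)
  \<comment> \<open>Phases that make the coefficients positive, cut off to \<open>G\<close> so that
    every \<open>s\<close> surviving Cauchy-Schwarz still has a large coefficient.\<close>
  define c where "c s = (if s \<in> G then cnj (sgn (A s)) else 0)" for s
  have c1: "cmod (c s) \<le> 1" for s by (simp add: c_def norm_sgn)
  have cA: "c s * A s = of_real (if s \<in> G then cmod (A s) else 0)" for s
    by (simp add: c_def cnj_sgn_mult)
  have "\<eta> / 2 * (\<eta> / 2) \<le> avg ?T (\<lambda>s. if s \<in> G then cmod (A s) else 0)"
  proof (rule avg_ge_of_dense[OF fT, where B = G])
    show "\<eta> / 2 * card ?T \<le> card G" using dir2 by (simp add: N_def)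
    show "\<eta> / 2 \<le> (if s \<in> G then cmod (A s) else 0)" if "s \<in> G" for s
      using that A2[of s] by (auto simp: G_def)
  qed (use e in \<open>auto simp: G_def\<close>)
  then have cA2: "\<eta>\<^sup>2 / 4 \<le> cmod (avg ?T (\<lambda>s. c s * A s))"
    unfolding cA avg_of_real norm_of_real by (simp add: power2_eq_square)
  define h where "h = (\<lambda>g s s' x. iter_cnj d (mult_diff (map diff_dir as) (zip s s') g x))"
  define W where "W s s' = cmod (corr L Y (h g1 s s') (h g2 s s') (- alt_sum s s' \<gamma>))" for s s'
  have hb: "bd (h g s s')" "per L (h g s s')" if "bd g" "per L g" for g s s'
    using bd_mult_diff[OF that(1)] per_map[OF per_mult_diff[OF that(2)]] by (auto simp: h_def bd_def)
  have W1: "W s s' \<le> 1" for s s' unfolding W_def by (intro norm_corr_le hb g)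
  define \<rho> where "\<rho> = \<eta> ^ (4 * 2 ^ d)"
  have "\<rho> = (\<eta>\<^sup>2 * \<eta>\<^sup>2) ^ (2 ^ d)" by (simp add: \<rho>_def power_mult power_add[symmetric])
  also have "\<dots> \<le> (\<eta>\<^sup>2 / 4) ^ (2 ^ d)"
    using power_mono[of \<eta> "1/2" 2] e by (intro power_mono) (auto simp: power2_eq_square mult_left_le)
  also have "\<dots> \<le> (cmod (avg ?T (\<lambda>s. c s * A s))) ^ (2 ^ d)" by (intro power_mono cA2) auto
  also have "\<dots> \<le> avg ?T (\<lambda>s'. avg ?T (\<lambda>s. cmod (c s) * W s s'))"
    unfolding W_def h_def A_def by (rule dual_difference_interchange[OF L(1) g as c1])
  finally have "\<rho> \<le> avg ?T (\<lambda>s'. avg ?T (\<lambda>s. cmod (c s) * W s s'))" .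
  moreover obtain s0 where s0: "s0 \<in> ?T" "avg ?T (\<lambda>s'. avg ?T (\<lambda>s. cmod (c s) * W s s')) \<le> avg ?T (\<lambda>s. cmod (c s) * W s s0)"
    using ex_ge_avg[OF fT, of "\<lambda>s'. avg ?T (\<lambda>s. cmod (c s) * W s s')"] by blast
  ultimately have \<rho>W: "\<rho> \<le> avg ?T (\<lambda>s. cmod (c s) * W s s0)" by linarith
  define T2 where "T2 = {s\<in>?T. \<rho> / 2 \<le> cmod (c s) * W s s0}"
  have \<rho>0: "0 < \<rho>" using e by (simp add: \<rho>_def)
  define r where "r = \<eta> ^ (4 * 2 ^ d + 1)"
  have r: "0 < r" "r \<le> 1 / 2" "r \<le> \<rho> / 2" "r \<le> \<eta> / 2"
  proof -
    show "0 < r" using e by (simp add: r_def)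
    have "r = \<rho> * \<eta>" by (simp add: r_def \<rho>_def)
    also have "\<dots> \<le> \<rho> * (1 / 2)" using e \<rho>0 by (intro mult_left_mono) auto
    finally show "r \<le> \<rho> / 2" by simp
    have "\<rho> \<le> \<eta> ^ 1" unfolding \<rho>_def using e by (intro power_decreasing) auto
    then show "r \<le> \<eta> / 2" using \<open>r \<le> \<rho> / 2\<close> by simp
    then show "r \<le> 1 / 2" using e by linarith
  qed
  define M where "M = {k\<in>ZL L. \<exists>q::nat. 1 \<le> q \<and> q \<le> nat \<lfloor>(1 / r) ^ 9\<rfloor> \<and> nd (real q * (of_int k / L)) \<le> (1 / r) ^ 23 / (real Y)\<^sup>2}"
  have rY: "(1 / r) ^ 18 \<le> Y"
  proof -
    have "1 \<le> (2::nat) ^ d" by simp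
    then have "18 \<le> 50 * (2::nat) ^ d" by linarith
    then have "(4 * 2 ^ d + 1) * 18 \<le> low_exp d" unfolding low_exp_def by (intro mult_le_mono2)
    moreover have "1 \<le> 1 / \<eta>" using e by simp
    ultimately have 1: "(1 / \<eta>) ^ ((4 * 2 ^ d + 1) * 18) \<le> (1 / \<eta>) ^ low_exp d" by (intro power_increasing)
    have "(1 / \<eta>) ^ ((4 * 2 ^ d + 1) * 18) = (1 / r) ^ 18"
      unfolding r_def power_one_over[symmetric] power_mult[symmetric] ..
    then show ?thesis using e(3) 1 by linarith
  qed
  define k where "k s = (- alt_sum s s0 \<gamma>) mod int L" for s
  have T2: "s \<in> G" "k s \<in> M" if "s \<in> T2" for s
  proof -
    have fs: "\<rho> / 2 \<le> cmod (c s) * W s s0" using that by (simp add: T2_def)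
    then have "c s \<noteq> 0" using \<rho>0 by auto
    then show "s \<in> G" by (auto simp: c_def split: if_splits)
    have "cmod (c s) * W s s0 \<le> W s s0" using c1[of s] by (simp add: W_def mult_left_le_one_le)
    then have "r \<le> cmod (corr L Y (h g1 s s0) (h g2 s s0) (- alt_sum s s0 \<gamma>))" using fs r by (simp add: W_def)
    then have "\<exists>q::nat. 1 \<le> q \<and> real q \<le> (1 / r) ^ 9 \<and> nd (real q * (of_int (- alt_sum s s0 \<gamma>) / L)) \<le> (1 / r) ^ 23 / (real Y)\<^sup>2"
      unfolding corr_def
      by (rule major_of_correlation[OF L(1) hb(2)[OF g(3,1)] hb(2)[OF g(4,2)] hb(1)[OF g(3,1)] hb(1)[OF g(4,2)] r(1,2) rY])
    then obtain q :: nat where q: "1 \<le> q" "real q \<le> (1 / r) ^ 9" "nd (real q * (of_int (- alt_sum s s0 \<gamma>) / L)) \<le> (1 / r) ^ 23 / (real Y)\<^sup>2"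
      by blast
    have "- alt_sum s s0 \<gamma> = k s + int L * ((- alt_sum s s0 \<gamma>) div int L)" unfolding k_def by (simp only: mod_mult_div_eq)
    from arg_cong[OF this, of real_of_int]
    have "real_of_int (- alt_sum s s0 \<gamma>) = real_of_int (k s) + real L * real_of_int ((- alt_sum s s0 \<gamma>) div int L)"
      by (simp only: of_int_add of_int_mult of_int_of_nat_eq)
    then have "real q * (of_int (- alt_sum s s0 \<gamma>) / L) = real q * (of_int (k s) / L) + of_int (int q * ((- alt_sum s s0 \<gamma>) div int L))"
      using L(1) by (simp add: field_simps)
    then have "nd (real q * (of_int (k s) / L)) \<le> (1 / r) ^ 23 / (real Y)\<^sup>2"
      using q(3) by (simp only: nd_add_of_int)
    moreover have "q \<le> nat \<lfloor>(1 / r) ^ 9\<rfloor>" using q(2) by (simp add: le_nat_floor)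
    ultimately show "k s \<in> M" using q(1) L(1) by (auto simp: M_def k_def)
  qed
  have T2d: "r * N \<le> card T2"
  proof -
    have "\<rho> / 2 * N \<le> card T2"
      unfolding T2_def N_def
      by (rule dense_of_avg[OF fT _ \<rho>W]) (use \<rho>0 c1 W1 in \<open>auto simp: W_def intro!: mult_le_one\<close>)
    moreover have "r * N \<le> \<rho> / 2 * N" using r by (intro mult_right_mono) auto
    ultimately show ?thesis by linarith
  qed
  have fT2: "finite T2" using fT by (simp add: T2_def)
  have "T2 \<noteq> {}" using T2d r N0 by (auto simp: mult_le_0_iff)
  then have M: "finite M" "M \<noteq> {}" "k ` T2 \<subseteq> M"
    using T2(2) by (auto simp: M_def intro: finite_subset[of _ "ZL L"])
  obtain k0 where k0: "k0 \<in> M" "real (card T2) \<le> real (card M) * card {s\<in>T2. k s = k0}"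
    using pigeonhole_fiber[OF fT2 M] by blast
  define T3 where "T3 = {s\<in>T2. k s = k0}"
  have "card M \<le> (1 / r) ^ 47" unfolding M_def by (rule card_major_le[OF L r(1,2) Y0])
  then have "real (card M) * card T3 \<le> (1 / r) ^ 47 * card T3" by (intro mult_right_mono) auto
  then have "r * N \<le> (1 / r) ^ 47 * card T3" using k0(2) T2d by (simp add: T3_def)
  then have "r ^ 47 * (r * N) \<le> r ^ 47 * ((1 / r) ^ 47 * card T3)" using r by (intro mult_left_mono) auto
  then have T3d: "r ^ 48 * N \<le> card T3" using r(1) by (simp add: power_one_over power_Suc2[of r 47, symmetric] mult.assoc[symmetric])
  \<comment> \<open>On \<open>T3\<close> the subtracted quantity is a multiple of \<open>L\<close>,
    so the Fourier coefficient is unchanged there. Over any box,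
    \<open>alt_sum s s0 \<gamma>\<close> has the same alternating sum as \<gamma>, and the constant
    has none.\<close>
  define \<gamma>' where "\<gamma>' s = \<gamma> s - (alt_sum s s0 \<gamma> - (- k0))" for s
  have ftT3: "\<eta> / 2 \<le> (cmod (ft L (mult_diff as s ?D) (\<gamma>' s)))\<^sup>2" if "s \<in> T3" for s
  proof -
    have "k s = k0" "s \<in> G" using that T2(1) by (auto simp: T3_def)
    then have "int L dvd (- alt_sum s s0 \<gamma>) - k0" by (metis k_def dvd_minus_mod)
    moreover have "\<gamma>' s - \<gamma> s = (- alt_sum s s0 \<gamma>) - k0" by (simp add: \<gamma>'_def)
    ultimately have "ft L (mult_diff as s ?D) (\<gamma>' s) = A s" unfolding A_def by (intro ft_cong L) simp
    then show ?thesis using \<open>s \<in> G\<close> by (simp add: G_def)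
  qed
  have "r ^ 48 * (\<eta> / 2) \<le> avg ?T (\<lambda>s. (cmod (ft L (mult_diff as s ?D) (\<gamma>' s)))\<^sup>2)"
  proof (rule avg_ge_of_dense[OF fT, where B = T3])
    show "r ^ 48 * card ?T \<le> card T3" using T3d by (simp add: N_def)
  qed (use ftT3 e in \<open>auto simp: T3_def T2_def\<close>)
  moreover have "r ^ 50 \<le> r ^ 48 * (\<eta> / 2)"
  proof -
    have "r ^ 50 \<le> r ^ 49" using r by (intro power_decreasing) auto
    also have "\<dots> = r ^ 48 * r" by (simp add: power_Suc2[symmetric])
    also have "\<dots> \<le> r ^ 48 * (\<eta> / 2)" using r by (intro mult_left_mono) auto
    finally show ?thesis .
  qed
  ultimately have 1: "r ^ 50 \<le> avg ?T (\<lambda>s. (cmod (ft L (mult_diff as s ?D) (\<gamma>' s)))\<^sup>2)" by linarith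
  have "\<eta> ^ low_exp d = (r ^ 50) ^ (2 ^ d)" unfolding low_exp_def r_def by (simp only: power_mult)
  also have "\<dots> \<le> (avg ?T (\<lambda>s. (cmod (ft L (mult_diff as s ?D) (\<gamma>' s)))\<^sup>2)) ^ (2 ^ d)"
    using r by (intro power_mono 1) auto
  also have "\<dots> \<le> avg (tup d (I \<times> I)) (\<lambda>p. (cmod (avg (ZL L) (mult_diff (map diff_dir as) p ?D)))\<^sup>2)"
  proof (rule low_exp_rank_phase_removal[OF L(1) D as])
    fix s s' assume "s \<in> ?T" "s' \<in> ?T"
    then have l: "length s = d" "length s' = d" "length s0 = d" "s \<noteq> []" using s0(1) as(2) by (auto simp: tup_def)
    show "alt_sum s s' \<gamma>' = 0"
      unfolding \<gamma>'_def alt_sum_diff using alt_sum_alt_sum[of s s' s0 \<gamma>] alt_sum_const[of s s' "- k0"] l by simp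
  qed
  finally show ?thesis .
qed

text \<open>For each \<open>s\<close> the frequency \<open>\<gamma> s\<close> is taken at the
  largest Fourier coefficient of the derivative along \<open>as\<close>; \<open>removal\<close>,
  with the square of that coefficient as \<open>S\<close>, then averages out the direction
  \<open>a\<close>.\<close>

lemma direction_removal:
  fixes a :: "'j \<Rightarrow> int" and K :: real
  assumes L: "0 < L" and D: "per L D" "bd D" and e: "0 < \<eta>" "0 < K"
    and K: "card {m\<in>ZL L. \<eta> / 2 \<le> cmod (avg J (\<lambda>j. ch L m (a j)))} \<le> K"
    and J: "finite J" "J \<noteq> {}"
    and big: "\<eta> \<le> avg (tup (Suc d) J) (\<lambda>s. (cmod (avg (ZL L) (mult_diff (a # as) s D)))\<^sup>2)"
  shows "\<exists>\<gamma>. \<eta> / (2 * K) \<le> avg (tup d J) (\<lambda>s. (cmod (ft L (mult_diff as s D) (\<gamma> s)))\<^sup>2)"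
proof -
  have "\<exists>k. \<forall>l. (cmod (ft L (mult_diff as s D) l))\<^sup>2 \<le> (cmod (ft L (mult_diff as s D) k))\<^sup>2" for s
  proof -
    let ?f = "\<lambda>l. (cmod (ft L (mult_diff as s D) l))\<^sup>2"
    have "Max (?f ` ZL L) \<in> ?f ` ZL L" using L by (intro Max_in) auto
    then obtain k where k: "?f k = Max (?f ` ZL L)" by auto
    have "?f l \<le> ?f k" for l
    proof -
      have "?f l = ?f (l mod int L)" using per_mod[OF ft_per[OF L]] by metis
      also have "\<dots> \<le> ?f k" unfolding k using L by (intro Max_ge) auto
      finally show ?thesis .
    qed
    then show ?thesis by blast
  qed
  then obtain \<gamma> where \<gamma>: "\<And>s l. (cmod (ft L (mult_diff as s D) l))\<^sup>2 \<le> (cmod (ft L (mult_diff as s D) (\<gamma> s)))\<^sup>2" by metis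
  have "\<eta> \<le> avg J (\<lambda>j. avg (tup d J) (\<lambda>s. (cmod (avg (ZL L) (\<lambda>x. mult_diff as s D x * cnj (mult_diff as s D (x + a j)))))\<^sup>2))"
    using big unfolding avg_tup_Suc by (simp add: mult_diff_Cons[abs_def] mult_diff_mult mult_diff_cnj mult_diff_shift)
  also have "\<dots> = avg (tup d J) (\<lambda>s. avg J (\<lambda>j. (cmod (avg (ZL L) (\<lambda>x. mult_diff as s D x * cnj (mult_diff as s D (x + a j)))))\<^sup>2))"
    by (rule avg_swap)
  also have "\<dots> \<le> avg (tup d J) (\<lambda>s. \<eta> / 2 + (cmod (ft L (mult_diff as s D) (\<gamma> s)))\<^sup>2 * K)"
    by (intro avg_mono removal[OF L per_mult_diff[OF D(1)] bd_mult_diff[OF D(2)] \<gamma> K]) (use e in auto)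
  also have "\<dots> = \<eta> / 2 + avg (tup d J) (\<lambda>s. (cmod (ft L (mult_diff as s D) (\<gamma> s)))\<^sup>2) * K"
    using finite_tup[OF J(1), of d] tup_nonempty[OF J(2), of d] by (simp add: avg_add avg_const avg_mult_right)
  finally show ?thesis using e by (intro exI[of _ \<gamma>]) (simp add: field_simps)
qed

section \<open>From averages of polynomial type to box averages\<close>

definition Lam :: "nat \<Rightarrow> nat \<Rightarrow> (int \<Rightarrow> complex) \<Rightarrow> (int \<Rightarrow> complex) \<Rightarrow> (int \<Rightarrow> complex) \<Rightarrow> complex" where
  "Lam L Y f1 f2 f3 = avg (ZL L) (\<lambda>x. avg {1..int Y} (\<lambda>y. f1 x * f2 (x + y) * f3 (x + y\<^sup>2)))"

definition sm :: "('i \<Rightarrow> int) \<Rightarrow> 'i list \<Rightarrow> int" where "sm c s = (\<Sum>j<length s. c (s ! j))"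

lemma sum_dirs_eq_sum: "length s = length as \<Longrightarrow> sum_dirs as s = (\<Sum>j<length s. (as ! j) (s ! j))"
proof (induction as arbitrary: s)
  case (Cons a as)
  then obtain i t where "s = i # t" by (cases s) auto
  then show ?case using Cons by (simp add: sum.lessThan_Suc_shift del: sum.lessThan_Suc)
qed simp

lemma splits_prod:
  "finite R \<Longrightarrow> (\<And>r. r \<in> R \<Longrightarrow> splits d (\<kappa> r)) \<Longrightarrow> splits d (\<lambda>s x. \<Prod>r\<in>R. \<kappa> r s x)"
proof (induction R rule: finite_induct)
  case empty
  then show ?case by (simp add: splits_one)
next
  case (insert r R)
  then show ?case using splits_mult[of d "\<kappa> r" "\<lambda>s x. \<Prod>r\<in>R. \<kappa> r s x"] by simp
qed

text \<open>After the change of variables \<open>x \<mapsto> x - \<Sum>r. c\<^sub>r (s\<^sub>r)\<close> the function \<open>g r\<close> no longer depends on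
  the coordinate \<open>s\<^sub>r\<close>.\<close>

lemma linear_box_cauchy_schwarz:
  fixes cs :: "('i \<Rightarrow> int) list" and c0 :: "'i \<Rightarrow> int"
  assumes L: "0 < L" and g0: "per L g0" and g: "\<And>r. per L (g r)" "\<And>r. bd (g r)"
    and d: "length cs = d" "1 \<le> d"
  defines "as \<equiv> map (\<lambda>c i. c0 i - c i) cs"
  shows "(cmod (avg (tup d I) (\<lambda>s. avg (ZL L) (\<lambda>x. g0 (x + sm c0 s) * (\<Prod>r<d. g r (x + sm (cs ! r) s)))))) ^ (2 ^ d)
     \<le> Re (avg (tup d (I \<times> I)) (\<lambda>p. avg (ZL L) (mult_diff (map diff_dir as) p g0)))"
proof -
  let ?T = "tup d I"
  obtain d' where d': "d = Suc d'" using d(2) by (cases d) auto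
  have las: "length as = d" using d by (simp add: as_def)
  \<comment> \<open>The value 1 on lists of the wrong length makes the independence of coordinate
    \<open>r\<close> hold for all lists, as \<open>splits_missing\<close> requires.\<close>
  define \<kappa> where "\<kappa> r s x = (if length s = d then g r (x + (sm (cs ! r) s - sum_dirs cs s)) else 1)" for r s x
  define K where "K s x = (\<Prod>r<d. \<kappa> r s x)" for s x
  have "splits d (\<kappa> r)" if r: "r < d" for r
  proof (rule splits_missing[OF r])
    show "cmod (\<kappa> r s x) \<le> 1" for s x using g(2)[of r] by (simp add: \<kappa>_def bd_def)
    show "\<kappa> r (s[r := i]) x = \<kappa> r s x" for s i x
    proof (cases "length s = d")
      case True
      have "(\<Sum>j<d. (cs ! r) (s[r := i] ! j) - (cs ! j) (s[r := i] ! j)) = (\<Sum>j<d. (cs ! r) (s ! j) - (cs ! j) (s ! j))"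
      proof (intro sum.cong refl)
        fix j assume "j \<in> {..<d}"
        then show "(cs ! r) (s[r := i] ! j) - (cs ! j) (s[r := i] ! j) = (cs ! r) (s ! j) - (cs ! j) (s ! j)"
          by (cases "j = r") auto
      qed
      then show ?thesis using True d(1) by (simp add: \<kappa>_def sm_def sum_dirs_eq_sum sum_subtractf)
    qed (simp add: \<kappa>_def)
  qed
  then have K: "splits (Suc d') K" unfolding K_def d'[symmetric] by (intro splits_prod) auto
  define \<Theta> where "\<Theta> s x = g0 (x + sum_dirs as s)" for s x
  have as_sum_dirs: "sum_dirs as s = sm c0 s - sum_dirs cs s" if "length s = d" for s
    using that d(1) las by (simp add: sum_dirs_eq_sum sm_def as_def sum_subtractf[symmetric])
  have "avg ?T (\<lambda>s. avg (ZL L) (\<lambda>x. g0 (x + sm c0 s) * (\<Prod>r<d. g r (x + sm (cs ! r) s))))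
     = avg ?T (\<lambda>s. avg (ZL L) (\<lambda>x. \<Theta> s x * K s x))"
  proof (rule avg_cong[OF refl])
    fix s assume "s \<in> ?T"
    then have s: "length s = d" by (simp add: tup_def)
    let ?F = "\<lambda>x. g0 (x + sm c0 s) * (\<Prod>r<d. g r (x + sm (cs ! r) s))"
    have "per L ?F"
      unfolding per_def
    proof
      fix x
      have "g0 (x + int L + sm c0 s) = g0 (x + sm c0 s)" using g0 by (metis per_def add.assoc add.commute)
      moreover have "g r (x + int L + sm (cs ! r) s) = g r (x + sm (cs ! r) s)" for r
        using g(1)[of r] by (metis per_def add.assoc add.commute)
      ultimately show "?F (x + int L) = ?F x" by simp
    qed
    then have "avg (ZL L) ?F = avg (ZL L) (\<lambda>x. ?F (x - sum_dirs cs s))" by (rule avg_per_shift_diff[OF L, symmetric])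
    also have "\<dots> = avg (ZL L) (\<lambda>x. \<Theta> s x * K s x)"
      using s by (intro avg_cong refl) (simp add: \<Theta>_def K_def \<kappa>_def as_sum_dirs algebra_simps)
    finally show "avg (ZL L) ?F = avg (ZL L) (\<lambda>x. \<Theta> s x * K s x)" .
  qed
  then have "(cmod (avg ?T (\<lambda>s. avg (ZL L) (\<lambda>x. g0 (x + sm c0 s) * (\<Prod>r<d. g r (x + sm (cs ! r) s)))))) ^ (2 ^ d)
     \<le> Re (avg ?T (\<lambda>s. avg ?T (\<lambda>s'. avg (ZL L) (\<lambda>x. box_diff s s' (\<lambda>u. \<Theta> u x)))))"
    using box_cauchy_schwarz[OF K, of I "ZL L" \<Theta>] by (simp add: d')
  also have "avg ?T (\<lambda>s. avg ?T (\<lambda>s'. avg (ZL L) (\<lambda>x. box_diff s s' (\<lambda>u. \<Theta> u x))))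
     = avg ?T (\<lambda>s. avg ?T (\<lambda>s'. avg (ZL L) (mult_diff (map diff_dir as) (zip s s') g0)))"
  proof (rule avg_cong[OF refl], rule avg_cong[OF refl])
    fix s s' assume "s \<in> ?T" "s' \<in> ?T"
    then have s: "length s = d" "length s' = d" by (auto simp: tup_def)
    have "avg (ZL L) (\<lambda>x. box_diff s s' (\<lambda>u. \<Theta> u x)) = avg (ZL L) (\<lambda>x. mult_diff (map diff_dir as) (zip s s') g0 (x + sum_dirs as s))"
      unfolding \<Theta>_def using box_diff_sum_dirs[of s as s' g0] s las by simp
    also have "\<dots> = avg (ZL L) (mult_diff (map diff_dir as) (zip s s') g0)"
      by (rule avg_per_shift[OF L per_mult_diff[OF g0]])
    finally show "avg (ZL L) (\<lambda>x. box_diff s s' (\<lambda>u. \<Theta> u x)) = avg (ZL L) (mult_diff (map diff_dir as) (zip s s') g0)" .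
  qed
  finally show ?thesis unfolding avg_tup_Times .
qed

lemma interval_shift_sum:
  fixes G :: "int \<Rightarrow> complex"
  assumes "\<And>y. cmod (G y) \<le> 1" "0 \<le> p"
  shows "cmod ((\<Sum>y\<in>{a..<b}. G y) - (\<Sum>y\<in>{a..<b}. G (y + p))) \<le> 2 * of_int p"
proof -
  have "(\<Sum>y\<in>{a..<b}. G (y + p)) = (\<Sum>y\<in>{a + p..<b + p}. G y)"
    by (rule sum.reindex_bij_witness[of _ "\<lambda>y. y - p" "\<lambda>y. y + p"]) auto
  then have "(\<Sum>y\<in>{a..<b}. G y) - (\<Sum>y\<in>{a..<b}. G (y + p))
     = (\<Sum>y\<in>{a..<b} - {a + p..<b + p}. G y) - (\<Sum>y\<in>{a + p..<b + p} - {a..<b}. G y)"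
    using sum.Int_Diff[of "{a..<b}" G "{a + p..<b + p}"] sum.Int_Diff[of "{a + p..<b + p}" G "{a..<b}"]
    by (simp add: Int_commute)
  also have "cmod \<dots> \<le> cmod (\<Sum>y\<in>{a..<b} - {a + p..<b + p}. G y) + cmod (\<Sum>y\<in>{a + p..<b + p} - {a..<b}. G y)"
    by (rule norm_triangle_ineq4)
  also have "\<dots> \<le> of_int p + of_int p"
  proof (rule add_mono)
    have *: "cmod (\<Sum>y\<in>A. G y) \<le> of_int p" if "A \<subseteq> {c..<c + p}" for A c
    proof -
      have "cmod (\<Sum>y\<in>A. G y) \<le> (\<Sum>y\<in>A. 1)" by (rule order_trans[OF norm_sum sum_mono]) (rule assms)
      also have "\<dots> = real (card A)" by simp
      also have "card A \<le> card {c..<c + p}" using that by (intro card_mono) auto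
      finally show ?thesis using assms(2) by simp
    qed
    show "cmod (\<Sum>y\<in>{a..<b} - {a + p..<b + p}. G y) \<le> of_int p" by (rule *[of _ a]) (use assms(2) in auto)
    show "cmod (\<Sum>y\<in>{a + p..<b + p} - {a..<b}. G y) \<le> of_int p" by (rule *[of _ b]) (use assms(2) in auto)
  qed
  finally show ?thesis by simp
qed

text \<open>Differencing in \<open>y\<close> by \<open>h\<close> and then by \<open>k\<close> eliminates the first two functions and leaves the average of
  \<open>PP f h k y\<close>. A third Cauchy-Schwarz step doubles \<open>(h, k, y)\<close> to \<open>(h1, k1, y1)\<close>; replacing \<open>y\<close> and \<open>y1\<close> by
  \<open>y + \<Sum>l\<close> and \<open>y1 + \<Sum>l'\<close> for five pairs \<open>(l, l')\<close> and aligning with the factor \<open>2 (h + k) y\<close> gives the five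
  directions \<open>dirs\<close>.\<close>

definition dirs :: "int \<Rightarrow> int \<Rightarrow> int \<Rightarrow> int \<Rightarrow> (int \<times> int \<Rightarrow> int) list" where
  "dirs h k h1 k1 = map (\<lambda>c i. 2 * (h + k) * fst i - c i)
    [\<lambda>i. 2 * h1 * snd i, \<lambda>i. 2 * k1 * snd i, \<lambda>i. 2 * (h1 + k1) * snd i, \<lambda>i. 2 * k * fst i, \<lambda>i. 2 * h * fst i]"

definition Box :: "nat \<Rightarrow> nat \<Rightarrow> (int \<Rightarrow> complex) \<Rightarrow> int \<Rightarrow> int \<Rightarrow> int \<Rightarrow> int \<Rightarrow> real" where
  "Box L B f h k h1 k1 =
    Re (avg (tup 5 (({1..int B} \<times> {1..int B}) \<times> ({1..int B} \<times> {1..int B})))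
      (\<lambda>p. avg (ZL L) (mult_diff (map diff_dir (dirs h k h1 k1)) p f)))"

text \<open>These are the factors of \<open>Q h y\<close> times the conjugate of
  \<open>Q h (y + k)\<close> in \<open>linearization\<close>, translated so that the fourth factor
  becomes \<open>f x\<close>. The terms \<open>y\<^sup>2\<close> cancel and every shift is linear in
  \<open>y\<close>.\<close>

definition PP :: "(int \<Rightarrow> complex) \<Rightarrow> int \<Rightarrow> int \<Rightarrow> int \<Rightarrow> int \<Rightarrow> complex" where
  "PP f h k y x = cnj (f (x + (2 * h * y + h\<^sup>2))) * cnj (f (x + (2 * k * y + k\<^sup>2 - k)))
     * f (x + (2 * (h + k) * y + (h + k)\<^sup>2 - k))"

text \<open>Of the six values of \<open>f\<close>, the one shifted by \<open>2 * (h + k) * y\<close>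
  is kept. Each of the other five is eliminated by one coordinate of the tuple, whence tuples of
  length 5 and the power \<open>2 ^ 5\<close>.\<close>

lemma PP_box:
  assumes L: "0 < L" and f: "per L f" "bd f" and B: "0 < B"
  defines "BB \<equiv> {1..int B} \<times> {1..int B}"
  shows "(cmod (avg (tup 5 BB) (\<lambda>s. avg (ZL L) (\<lambda>x. PP f h k (y + sm fst s) x * cnj (PP f h1 k1 (y1 + sm snd s) x))))) ^ 32
    \<le> Box L B f h k h1 k1"
proof -
  define e where "e = 2 * (h + k) * y + (h + k)\<^sup>2 - k"
  define g0 where "g0 z = f (z + e)" for z
  define cs :: "(int \<times> int \<Rightarrow> int) list" where
    "cs = [\<lambda>i. 2 * h1 * snd i, \<lambda>i. 2 * k1 * snd i, \<lambda>i. 2 * (h1 + k1) * snd i, \<lambda>i. 2 * k * fst i, \<lambda>i. 2 * h * fst i]"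
  define gs :: "(int \<Rightarrow> complex) list" where
    "gs = [\<lambda>z. f (z + (2 * h1 * y1 + h1\<^sup>2)), \<lambda>z. f (z + (2 * k1 * y1 + k1\<^sup>2 - k1)),
       \<lambda>z. cnj (f (z + (2 * (h1 + k1) * y1 + (h1 + k1)\<^sup>2 - k1))),
       \<lambda>z. cnj (f (z + (2 * k * y + k\<^sup>2 - k))), \<lambda>z. cnj (f (z + (2 * h * y + h\<^sup>2)))]"
  define g where "g r = (if r < 5 then gs ! r else (\<lambda>_. 1))" for r
  have pf: "per L (\<lambda>z. f (z + a))" "per L (\<lambda>z. cnj (f (z + a)))" for a
    using per_shift[OF f(1)] per_map[OF per_shift[OF f(1)], of cnj] by auto
  have bf: "bd (\<lambda>z. f (z + a))" "bd (\<lambda>z. cnj (f (z + a)))" for a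
    using f(2) by (auto simp: bd_def)
  have gper: "per L (g r)" and gbd: "bd (g r)" for r
  proof -
    have "r < 5 \<Longrightarrow> r \<in> {0, 1, 2, 3, 4}" by auto
    then show "per L (g r)" unfolding g_def gs_def by (auto simp: pf per_def[of L "\<lambda>_. 1"])
    have "r < 5 \<Longrightarrow> r \<in> {0, 1, 2, 3, 4}" by auto
    then show "bd (g r)" unfolding g_def gs_def by (auto simp: bf bd_def[of "\<lambda>_. 1"])
  qed
  have smult: "sm (\<lambda>i. a * w i) s = a * sm w s" for a w and s :: "(int \<times> int) list"
    by (simp add: sm_def sum_distrib_left)
  have five: "(\<Prod>r<(5::nat). F r) = F 0 * F 1 * F 2 * F 3 * F 4" for F :: "nat \<Rightarrow> complex"
    by (simp add: eval_nat_numeral mult_ac)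
  have "PP f h k (y + sm fst s) x * cnj (PP f h1 k1 (y1 + sm snd s) x)
     = g0 (x + sm (\<lambda>i. 2 * (h + k) * fst i) s) * (\<Prod>r<5. g r (x + sm (cs ! r) s))" for s x
  proof -
    have E: "sm (cs ! 0) s = 2 * h1 * sm snd s" "sm (cs ! 1) s = 2 * k1 * sm snd s" "sm (cs ! 2) s = 2 * (h1 + k1) * sm snd s"
      "sm (cs ! 3) s = 2 * k * sm fst s" "sm (cs ! 4) s = 2 * h * sm fst s"
      by (simp_all only: cs_def nth_Cons_0 nth_Cons_numeral nth_Cons' One_nat_def smult)
        (simp_all add: smult)
    show ?thesis
      unfolding five E smult PP_def g0_def e_def by (simp add: g_def gs_def algebra_simps)
  qed
  then have "(cmod (avg (tup 5 BB) (\<lambda>s. avg (ZL L) (\<lambda>x. PP f h k (y + sm fst s) x * cnj (PP f h1 k1 (y1 + sm snd s) x))))) ^ 32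
    = (cmod (avg (tup 5 BB) (\<lambda>s. avg (ZL L) (\<lambda>x. g0 (x + sm (\<lambda>i. 2 * (h + k) * fst i) s) * (\<Prod>r<5. g r (x + sm (cs ! r) s)))))) ^ (2 ^ 5)"
    by simp
  also have "\<dots> \<le> Re (avg (tup 5 (BB \<times> BB)) (\<lambda>p. avg (ZL L) (mult_diff (map diff_dir (map (\<lambda>c i. 2 * (h + k) * fst i - c i) cs)) p g0)))"
    by (rule linear_box_cauchy_schwarz[OF L _ gper gbd]) (auto simp: cs_def g0_def pf)
  also have "(\<lambda>p. avg (ZL L) (mult_diff (map diff_dir (map (\<lambda>c i. 2 * (h + k) * fst i - c i) cs)) p g0))
     = (\<lambda>p. avg (ZL L) (mult_diff (map diff_dir (dirs h k h1 k1)) p f))"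
    unfolding g0_def mult_diff_shift dirs_def cs_def
    by (rule ext, rule avg_per_shift[OF L per_mult_diff[OF f(1)]])
  finally show ?thesis unfolding Box_def BB_def .
qed

lemma sm_bounds:
  assumes "s \<in> tup d I" "\<And>i. i \<in> I \<Longrightarrow> 0 \<le> c i" "\<And>i. i \<in> I \<Longrightarrow> c i \<le> b"
  shows "0 \<le> sm c s" "sm c s \<le> int d * b"
proof -
  have s: "length s = d" "\<And>j. j < d \<Longrightarrow> s ! j \<in> I" using assms(1) by (auto simp: tup_def)
  show "0 \<le> sm c s" unfolding sm_def using assms(2) s by (intro sum_nonneg) auto
  have "sm c s \<le> (\<Sum>j<length s. b)" unfolding sm_def using assms(3) s by (intro sum_mono) auto
  then show "sm c s \<le> int d * b" using s by simp
qed

lemma norm_PP: "bd f \<Longrightarrow> cmod (PP f h k y x) \<le> 1"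
  by (auto simp: PP_def bd_def norm_mult intro!: mult_le_one)

text \<open>\<open>sm fst s\<close> and \<open>sm snd s\<close> are at most \<open>5 * B\<close>.
  Moving either variable by them changes an inner sum by at most \<open>10 * B\<close>, hence the
  double sum by at most \<open>20 * B * Y\<close>; averaging over \<open>s\<close> then brings in
  \<open>PP_box\<close>.\<close>

lemma PP_pair_sum:
  fixes a b a1 b1 :: int
  assumes L: "0 < L" and f: "per L f" "bd f" and B: "0 < B" and V: "b - a \<le> int Y" "b1 - a1 \<le> int Y" and Y: "0 < Y"
  shows "cmod (\<Sum>y\<in>{a..<b}. \<Sum>y1\<in>{a1..<b1}. avg (ZL L) (\<lambda>x. PP f h k y x * cnj (PP f h1 k1 y1 x)))
    \<le> 20 * B * Y + (real Y)\<^sup>2 * root 32 (Box L B f h k h1 k1)"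
proof -
  define I where "I = {1..int B} \<times> {1..int B}"
  define T where "T y y1 = avg (ZL L) (\<lambda>x. PP f h k y x * cnj (PP f h1 k1 y1 x))" for y y1
  have T1: "cmod (T y y1) \<le> 1" for y y1
    unfolding T_def by (rule norm_avg_le_const) (auto simp: norm_mult norm_PP[OF f(2)] mult_le_one)
  let ?V = "{a..<b}" and ?V1 = "{a1..<b1}"
  have cV: "real (card ?V) \<le> Y" "real (card ?V1) \<le> Y" using V by auto
  have fI: "finite (tup 5 I)" "tup 5 I \<noteq> {}" using B by (auto simp: I_def intro!: finite_tup tup_nonempty)
  have sh: "cmod ((\<Sum>y\<in>?V. \<Sum>y1\<in>?V1. T y y1) - (\<Sum>y\<in>?V. \<Sum>y1\<in>?V1. T (y + sm fst s) (y1 + sm snd s))) \<le> 20 * B * Y"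
    if s: "s \<in> tup 5 I" for s
  proof -
    define p where "p = sm fst s"
    define p1 where "p1 = sm snd s"
    have p: "0 \<le> p" "of_int p \<le> 5 * real B" "0 \<le> p1" "of_int p1 \<le> 5 * real B"
    proof -
      have "0 \<le> p" "p \<le> 5 * int B" unfolding p_def using sm_bounds[OF s, of fst "int B"] by (auto simp: I_def)
      then show "0 \<le> p" "of_int p \<le> 5 * real B" by linarith+
      have "0 \<le> p1" "p1 \<le> 5 * int B" unfolding p1_def using sm_bounds[OF s, of snd "int B"] by (auto simp: I_def)
      then show "0 \<le> p1" "of_int p1 \<le> 5 * real B" by linarith+
    qed
    have dec: "(\<Sum>y\<in>?V. \<Sum>y1\<in>?V1. T y y1) - (\<Sum>y\<in>?V. \<Sum>y1\<in>?V1. T (y + p) (y1 + p1))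
       = (\<Sum>y\<in>?V. (\<Sum>y1\<in>?V1. T y y1) - (\<Sum>y1\<in>?V1. T y (y1 + p1)))
       + (\<Sum>y1\<in>?V1. (\<Sum>y\<in>?V. T y (y1 + p1)) - (\<Sum>y\<in>?V. T (y + p) (y1 + p1)))"
      unfolding sum_subtractf
      using sum.swap[of "\<lambda>y y1. T y (y1 + p1)" ?V1 ?V] sum.swap[of "\<lambda>y y1. T (y + p) (y1 + p1)" ?V1 ?V] by simp
    have "cmod ((\<Sum>y\<in>?V. \<Sum>y1\<in>?V1. T y y1) - (\<Sum>y\<in>?V. \<Sum>y1\<in>?V1. T (y + p) (y1 + p1)))
        \<le> (\<Sum>y\<in>?V. 2 * of_int p1) + (\<Sum>y1\<in>?V1. 2 * of_int p)"
      unfolding dec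
    proof (rule order_trans[OF norm_triangle_ineq], rule add_mono; rule order_trans[OF norm_sum sum_mono])
      show "cmod ((\<Sum>y1\<in>?V1. T y y1) - (\<Sum>y1\<in>?V1. T y (y1 + p1))) \<le> 2 * of_int p1" for y
        by (rule interval_shift_sum[OF T1 p(3)])
      show "cmod ((\<Sum>y\<in>?V. T y (y1 + p1)) - (\<Sum>y\<in>?V. T (y + p) (y1 + p1))) \<le> 2 * of_int p" for y1
        by (rule interval_shift_sum[where G = "\<lambda>y. T y (y1 + p1)", OF T1 p(1)])
    qed
    also have "\<dots> = real (card ?V) * (2 * of_int p1) + real (card ?V1) * (2 * of_int p)"
      by (simp only: sum_constant)
    also have "\<dots> \<le> Y * (2 * (5 * real B)) + Y * (2 * (5 * real B))"
      using p cV by (intro add_mono mult_mono) auto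
    finally show ?thesis by (simp add: p_def p1_def algebra_simps)
  qed
  define Z where "Z = root 32 (Box L B f h k h1 k1)"
  have avT: "cmod (avg (tup 5 I) (\<lambda>s. T (y + sm fst s) (y1 + sm snd s))) \<le> Z" for y y1
  proof -
    have "(cmod (avg (tup 5 I) (\<lambda>s. T (y + sm fst s) (y1 + sm snd s)))) ^ 32 \<le> Box L B f h k h1 k1"
      unfolding T_def I_def by (rule PP_box[OF L f B])
    then have "root 32 ((cmod (avg (tup 5 I) (\<lambda>s. T (y + sm fst s) (y1 + sm snd s)))) ^ 32) \<le> Z"
      unfolding Z_def by (intro real_root_le_mono) auto
    then show ?thesis by (simp add: real_root_power_cancel)
  qed
  have Z0: "0 \<le> Z" by (rule order_trans[OF norm_ge_zero avT[of 0 0]])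
  have "(\<Sum>y\<in>?V. \<Sum>y1\<in>?V1. T y y1) = avg (tup 5 I) (\<lambda>s. \<Sum>y\<in>?V. \<Sum>y1\<in>?V1. T y y1)"
    by (rule avg_const[OF fI, symmetric])
  also have "\<dots> = avg (tup 5 I) (\<lambda>s. (\<Sum>y\<in>?V. \<Sum>y1\<in>?V1. T y y1) - (\<Sum>y\<in>?V. \<Sum>y1\<in>?V1. T (y + sm fst s) (y1 + sm snd s)))
     + (\<Sum>y\<in>?V. \<Sum>y1\<in>?V1. avg (tup 5 I) (\<lambda>s. T (y + sm fst s) (y1 + sm snd s)))"
    unfolding avg_diff avg_sum by simp
  finally have dec: "(\<Sum>y\<in>?V. \<Sum>y1\<in>?V1. T y y1)
     = avg (tup 5 I) (\<lambda>s. (\<Sum>y\<in>?V. \<Sum>y1\<in>?V1. T y y1) - (\<Sum>y\<in>?V. \<Sum>y1\<in>?V1. T (y + sm fst s) (y1 + sm snd s)))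
     + (\<Sum>y\<in>?V. \<Sum>y1\<in>?V1. avg (tup 5 I) (\<lambda>s. T (y + sm fst s) (y1 + sm snd s)))" .
  have "cmod (\<Sum>y\<in>?V. \<Sum>y1\<in>?V1. T y y1) \<le> 20 * B * Y + (\<Sum>y\<in>?V. \<Sum>y1\<in>?V1. Z)"
  proof (subst dec, rule order_trans[OF norm_triangle_ineq], rule add_mono)
    show "cmod (avg (tup 5 I) (\<lambda>s. (\<Sum>y\<in>?V. \<Sum>y1\<in>?V1. T y y1) - (\<Sum>y\<in>?V. \<Sum>y1\<in>?V1. T (y + sm fst s) (y1 + sm snd s))))
      \<le> 20 * B * Y"
      by (rule norm_avg_le_const[OF sh]) auto
    show "cmod (\<Sum>y\<in>?V. \<Sum>y1\<in>?V1. avg (tup 5 I) (\<lambda>s. T (y + sm fst s) (y1 + sm snd s))) \<le> (\<Sum>y\<in>?V. \<Sum>y1\<in>?V1. Z)"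
      by (rule order_trans[OF norm_sum sum_mono], rule order_trans[OF norm_sum sum_mono], rule avT)
  qed
  also have "(\<Sum>y\<in>?V. \<Sum>y1\<in>?V1. Z) = real (card ?V) * (real (card ?V1) * Z)" by (simp only: sum_constant)
  also have "\<dots> \<le> real Y * (real Y * Z)" using cV Z0 by (intro mult_mono) auto
  finally show ?thesis by (simp add: T_def Z_def power2_eq_square mult.assoc)
qed

lemma Box_nonneg:
  assumes "0 < L" "per L f" "bd f" "0 < B"
  shows "0 \<le> Box L B f h k h1 k1"
  by (rule order_trans[OF _ PP_box[OF assms, of h k 0 h1 k1 0]]) simp

definition sym_int :: "nat \<Rightarrow> int set" where "sym_int Y = {- int Y..int Y}"

lemma sym_int_simps: "finite (sym_int Y)" "sym_int Y \<noteq> {}" "real (card (sym_int Y)) = 2 * real Y + 1"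
  by (auto simp: sym_int_def)

lemma sum_sym_int: "(\<Sum>h\<in>sym_int Y. F h) = of_nat (card (sym_int Y)) * avg (sym_int Y) F"
  using sym_int_simps[of Y] by (simp add: avg_def)

text \<open>Origin of the constants: \<open>sym_int Y\<close> has at most \<open>3 * Y\<close>
  elements, so successive squarings give \<open>\<delta>\<^sup>2 * Y / 3\<close>,
  \<open>\<delta> ^ 4 * Y / 27\<close> and, after division by \<open>Y\<^sup>2\<close>,
  \<open>\<delta> ^ 8 / 729\<close>. Half of this is left for the error term of
  \<open>PP_pair_sum\<close>.\<close>

lemma linearization:
  assumes L: "0 < L" and f: "per L f2" "per L f" "bd f1" "bd f2" "bd f" and Y: "0 < Y" and B: "0 < B"
    and d: "0 < \<delta>" "\<delta> \<le> cmod (Lam L Y f1 f2 f)" and BY: "20 * B / Y \<le> \<delta> ^ 8 / 1458"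
  shows "(\<delta> ^ 8 / 1458) ^ 32
    \<le> avg ((sym_int Y \<times> sym_int Y) \<times> (sym_int Y \<times> sym_int Y)) (\<lambda>w. Box L B f (fst (fst w)) (snd (fst w)) (fst (snd w)) (snd (snd w)))"
proof -
  define V where "V = {1..<int Y + 1}"
  have V': "{1..int Y} = V" by (auto simp: V_def)
  have finV: "finite V" "card V = Y" "V \<noteq> {}" using Y by (auto simp: V_def)
  let ?H = "sym_int Y"
  define VH where "VH h = {y\<in>V. y + h \<in> V}" for h
  define VK where "VK h k = {y\<in>VH h. y + k \<in> VH h}" for h k
  have VHi: "VH h = {max 1 (1 - h)..<min (int Y + 1) (int Y + 1 - h)}" for h
    unfolding VH_def V_def interval_shift ..
  have VKi: "\<exists>a b. VK h k = {a..<b} \<and> b - a \<le> int Y" for h k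
  proof (intro exI conjI)
    show "VK h k = {max (max 1 (1 - h)) (max 1 (1 - h) - k)..<min (min (int Y + 1) (int Y + 1 - h)) (min (int Y + 1) (int Y + 1 - h) - k)}"
      unfolding VK_def VHi interval_shift ..
  qed auto
  have finVH: "finite (VH h)" "finite (VK h k)" for h k using finV by (auto simp: VH_def VK_def)
  define b where "b h x = f2 x * cnj (f2 (x + h))" for h x
  define Q where "Q h y x = f (x + (y\<^sup>2 - y)) * cnj (f (x + ((y + h)\<^sup>2 - y)))" for h y x
  define S where "S h x = (\<Sum>y\<in>VH h. Q h y x)" for h x
  define R where "R y y' = avg (ZL L) (\<lambda>x. (f2 (x + y) * f (x + y\<^sup>2)) * cnj (f2 (x + y') * f (x + y'\<^sup>2)))" for y y'
  have bb: "cmod (b h x) \<le> 1" for h x using f(4) by (simp add: b_def bd_def norm_mult mult_le_one)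
  have "(cmod (Lam L Y f1 f2 f))\<^sup>2 = (cmod (avg (ZL L) (\<lambda>x. f1 x * avg V (\<lambda>y. f2 (x + y) * f (x + y\<^sup>2)))))\<^sup>2"
    unfolding Lam_def V' by (simp add: avg_mult_left mult.assoc)
  also have "\<dots> \<le> avg (ZL L) (\<lambda>x. (cmod (avg V (\<lambda>y. f2 (x + y) * f (x + y\<^sup>2))))\<^sup>2)"
    by (rule norm_avg_mult_square) (use f(3) in \<open>simp add: bd_def\<close>)
  also have "\<dots> = Re (avg (ZL L) (\<lambda>x. avg V (\<lambda>y. avg V (\<lambda>y'. (f2 (x + y) * f (x + y\<^sup>2)) * cnj (f2 (x + y') * f (x + y'\<^sup>2))))))"
    unfolding norm_avg_square[symmetric] avg_of_real by simp
  also have "avg (ZL L) (\<lambda>x. avg V (\<lambda>y. avg V (\<lambda>y'. (f2 (x + y) * f (x + y\<^sup>2)) * cnj (f2 (x + y') * f (x + y'\<^sup>2))))) = avg V (\<lambda>y. avg V (\<lambda>y'. R y y'))"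
    unfolding R_def by (subst avg_swap[of "ZL L"]) (subst avg_swap[of "ZL L"], rule refl)
  also have "avg V (\<lambda>y. avg V (\<lambda>y'. R y y')) = (\<Sum>y\<in>V. \<Sum>y'\<in>V. R y y') / (of_nat Y)\<^sup>2"
    by (simp add: avg_def finV sum_divide_distrib[symmetric] power2_eq_square)
  also have "(\<Sum>y\<in>V. \<Sum>y'\<in>V. R y y') = (\<Sum>h\<in>?H. \<Sum>y\<in>VH h. R y (y + h))"
    unfolding VH_def by (rule sum_pairs_shift) (auto simp: finV sym_int_simps V_def sym_int_def)
  also have "\<dots> = (\<Sum>h\<in>?H. avg (ZL L) (\<lambda>x. b h x * S h x))"
  proof (rule sum.cong[OF refl])
    fix h
    have "R y (y + h) = avg (ZL L) (\<lambda>x. b h x * Q h y x)" for y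
    proof -
      have pq: "per L (\<lambda>x. f2 (x + y) * f (x + y\<^sup>2))" for y
        by (rule per_map2[OF per_shift[OF f(1)] per_shift[OF f(2)], where h = "(*)"])
      let ?F = "\<lambda>x. (f2 (x + y) * f (x + y\<^sup>2)) * cnj (f2 (x + (y + h)) * f (x + (y + h)\<^sup>2))"
      have "per L ?F"
        by (rule per_map2[OF pq pq, where h = "\<lambda>u v. u * cnj v"])
      \<comment> \<open>After this translation the two values of \<open>f2\<close> are independent
        of \<open>y\<close> and form the bounded weight \<open>b h x\<close>.\<close>
      then have "avg (ZL L) ?F = avg (ZL L) (\<lambda>x. ?F (x - y))" by (rule avg_per_shift_diff[OF L, symmetric])
      also have "\<dots> = avg (ZL L) (\<lambda>x. b h x * Q h y x)"
        by (intro avg_cong refl) (simp add: b_def Q_def algebra_simps)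
      finally show ?thesis by (simp add: R_def)
    qed
    then show "(\<Sum>y\<in>VH h. R y (y + h)) = avg (ZL L) (\<lambda>x. b h x * S h x)"
      by (simp add: S_def sum_distrib_left avg_sum)
  qed
  also have "\<dots> = of_nat (card ?H) * avg ?H (\<lambda>h. avg (ZL L) (\<lambda>x. b h x * S h x))" by (rule sum_sym_int)
  also have "avg ?H (\<lambda>h. avg (ZL L) (\<lambda>x. b h x * S h x)) = avg (?H \<times> ZL L) (\<lambda>p. b (fst p) (snd p) * S (fst p) (snd p))"
    by (rule avg_Times[symmetric])
  also have "Re (of_nat (card ?H) * avg (?H \<times> ZL L) (\<lambda>p. b (fst p) (snd p) * S (fst p) (snd p)) / (of_nat Y)\<^sup>2)
     \<le> cmod (of_nat (card ?H) * avg (?H \<times> ZL L) (\<lambda>p. b (fst p) (snd p) * S (fst p) (snd p)) / (of_nat Y)\<^sup>2)"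
    by (rule complex_Re_le_cmod)
  also have "\<dots> = (2 * real Y + 1) * cmod (avg (?H \<times> ZL L) (\<lambda>p. b (fst p) (snd p) * S (fst p) (snd p))) / (real Y)\<^sup>2"
    by (simp only: norm_mult norm_divide norm_power norm_of_nat sym_int_simps)
  also have "\<dots> \<le> (3 * real Y) * cmod (avg (?H \<times> ZL L) (\<lambda>p. b (fst p) (snd p) * S (fst p) (snd p))) / (real Y)\<^sup>2"
    using Y by (intro divide_right_mono mult_right_mono) auto
  also have "\<dots> = 3 / real Y * cmod (avg (?H \<times> ZL L) (\<lambda>p. b (fst p) (snd p) * S (fst p) (snd p)))"
    using Y by (simp add: power2_eq_square)
  finally have 1: "(cmod (Lam L Y f1 f2 f))\<^sup>2 \<le> 3 / real Y * cmod (avg (?H \<times> ZL L) (\<lambda>p. b (fst p) (snd p) * S (fst p) (snd p)))" .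
  have "\<delta>\<^sup>2 \<le> (cmod (Lam L Y f1 f2 f))\<^sup>2" using d by (intro power_mono) auto
  then have "\<delta>\<^sup>2 \<le> 3 / real Y * cmod (avg (?H \<times> ZL L) (\<lambda>p. b (fst p) (snd p) * S (fst p) (snd p)))"
    using 1 by linarith
  then have "\<delta>\<^sup>2 * Y / 3 \<le> cmod (avg (?H \<times> ZL L) (\<lambda>p. b (fst p) (snd p) * S (fst p) (snd p)))"
    using Y by (simp add: field_simps)
  then have "(\<delta>\<^sup>2 * Y / 3)\<^sup>2 \<le> (cmod (avg (?H \<times> ZL L) (\<lambda>p. b (fst p) (snd p) * S (fst p) (snd p))))\<^sup>2"
    by (intro power_mono) auto
  also have "\<dots> \<le> avg (?H \<times> ZL L) (\<lambda>p. (cmod (S (fst p) (snd p)))\<^sup>2)"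
    by (rule norm_avg_mult_square) (rule bb)
  also have "\<dots> = avg ?H (\<lambda>h. avg (ZL L) (\<lambda>x. (cmod (S h x))\<^sup>2))" by (rule avg_Times)
  finally have 2: "(\<delta>\<^sup>2 * Y / 3)\<^sup>2 \<le> avg ?H (\<lambda>h. avg (ZL L) (\<lambda>x. (cmod (S h x))\<^sup>2))" .
  define U where "U h k x = (\<Sum>y\<in>VK h k. PP f h k y x)" for h k x
  define W where "W x = avg (?H \<times> ?H) (\<lambda>q. U (fst q) (snd q) x)" for x
  have "complex_of_real (avg ?H (\<lambda>h. avg (ZL L) (\<lambda>x. (cmod (S h x))\<^sup>2)))
     = avg ?H (\<lambda>h. \<Sum>k\<in>?H. avg (ZL L) (\<lambda>x. f x * U h k x))"
    unfolding avg_of_real[symmetric]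
  proof (rule avg_cong[OF refl])
    fix h
    have "complex_of_real ((cmod (S h x))\<^sup>2) = (\<Sum>k\<in>?H. \<Sum>y\<in>VK h k. Q h y x * cnj (Q h (y + k) x))" for x
    proof -
      have "complex_of_real ((cmod (S h x))\<^sup>2) = (\<Sum>y\<in>VH h. \<Sum>y'\<in>VH h. Q h y x * cnj (Q h y' x))"
        unfolding norm_square_complex S_def by (simp only: cnj_sum sum_product)
      also have "\<dots> = (\<Sum>k\<in>?H. \<Sum>y\<in>VK h k. Q h y x * cnj (Q h (y + k) x))"
        unfolding VK_def by (rule sum_pairs_shift[OF finVH(1) sym_int_simps(1)]) (auto simp: VH_def V_def sym_int_def)
      finally show ?thesis .
    qed
    then have "avg (ZL L) (\<lambda>x. complex_of_real ((cmod (S h x))\<^sup>2))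
       = (\<Sum>k\<in>?H. \<Sum>y\<in>VK h k. avg (ZL L) (\<lambda>x. Q h y x * cnj (Q h (y + k) x)))"
      by (simp only: avg_sum)
    also have "\<dots> = (\<Sum>k\<in>?H. \<Sum>y\<in>VK h k. avg (ZL L) (\<lambda>x. f x * PP f h k y x))"
    proof (rule sum.cong[OF refl], rule sum.cong[OF refl])
      fix k y
      let ?F = "\<lambda>x. Q h y x * cnj (Q h (y + k) x)"
      have Qper: "per L (Q h y)" for y
        unfolding Q_def by (rule per_map2[OF per_shift[OF f(2)] per_shift[OF f(2)], where h = "\<lambda>u v. u * cnj v"])
      have "per L ?F" by (rule per_map2[OF Qper Qper, where h = "\<lambda>u v. u * cnj v"])
      \<comment> \<open>After this one the factor \<open>f x\<close> is independent of
        \<open>h\<close>, \<open>k\<close> and \<open>y\<close>, so that the third Cauchy-Schwarz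
        step can discard it.\<close>
      then have "avg (ZL L) ?F = avg (ZL L) (\<lambda>x. ?F (x - (y\<^sup>2 - y)))" by (rule avg_per_shift_diff[OF L, symmetric])
      also have "\<dots> = avg (ZL L) (\<lambda>x. f x * PP f h k y x)"
        by (intro avg_cong refl) (simp add: PP_def Q_def power2_eq_square algebra_simps)
      finally show "avg (ZL L) ?F = avg (ZL L) (\<lambda>x. f x * PP f h k y x)" .
    qed
    also have "\<dots> = (\<Sum>k\<in>?H. avg (ZL L) (\<lambda>x. f x * U h k x))"
      by (simp add: U_def sum_distrib_left avg_sum)
    finally show "avg (ZL L) (\<lambda>x. complex_of_real ((cmod (S h x))\<^sup>2)) = (\<Sum>k\<in>?H. avg (ZL L) (\<lambda>x. f x * U h k x))" .
  qed
  also have "\<dots> = of_nat (card ?H) * avg (ZL L) (\<lambda>x. f x * W x)"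
  proof -
    have "avg (ZL L) (\<lambda>x. f x * W x) = avg (ZL L) (\<lambda>x. avg ?H (\<lambda>h. avg ?H (\<lambda>k. f x * U h k x)))"
      unfolding W_def using avg_Times[of ?H ?H "\<lambda>h k. U h k x" for x] by (simp add: avg_mult_left)
    also have "\<dots> = avg ?H (\<lambda>h. avg ?H (\<lambda>k. avg (ZL L) (\<lambda>x. f x * U h k x)))"
      by (subst avg_swap[of "ZL L"]) (subst avg_swap[of "ZL L"], rule refl)
    finally show ?thesis unfolding sum_sym_int avg_mult_left by simp
  qed
  finally have "cmod (complex_of_real (avg ?H (\<lambda>h. avg (ZL L) (\<lambda>x. (cmod (S h x))\<^sup>2))))
     = cmod (of_nat (card ?H) * avg (ZL L) (\<lambda>x. f x * W x))" by (rule arg_cong)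
  then have "avg ?H (\<lambda>h. avg (ZL L) (\<lambda>x. (cmod (S h x))\<^sup>2)) \<le> real (card ?H) * cmod (avg (ZL L) (\<lambda>x. f x * W x))"
    unfolding norm_of_real norm_mult norm_of_nat by linarith
  also have "\<dots> \<le> 3 * real Y * cmod (avg (ZL L) (\<lambda>x. f x * W x))"
    unfolding sym_int_simps using Y by (intro mult_right_mono) auto
  finally have "(\<delta>\<^sup>2 * Y / 3)\<^sup>2 \<le> 3 * real Y * cmod (avg (ZL L) (\<lambda>x. f x * W x))" using 2 by linarith
  then have "\<delta> ^ 4 * Y / 27 \<le> cmod (avg (ZL L) (\<lambda>x. f x * W x))"
    using Y by (simp add: power2_eq_square power4_eq_xxxx field_simps)
  then have "(\<delta> ^ 4 * Y / 27)\<^sup>2 \<le> (cmod (avg (ZL L) (\<lambda>x. f x * W x)))\<^sup>2"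
    using d by (intro power_mono) auto
  also have "\<dots> \<le> avg (ZL L) (\<lambda>x. (cmod (W x))\<^sup>2)"
    by (rule norm_avg_mult_square) (use f(5) in \<open>simp add: bd_def\<close>)
  also have "\<dots> = Re (avg (ZL L) (\<lambda>x. avg (?H \<times> ?H) (\<lambda>q. avg (?H \<times> ?H) (\<lambda>q'. U (fst q) (snd q) x * cnj (U (fst q') (snd q') x)))))"
    unfolding W_def norm_avg_square[symmetric] avg_of_real by simp
  also have "avg (ZL L) (\<lambda>x. avg (?H \<times> ?H) (\<lambda>q. avg (?H \<times> ?H) (\<lambda>q'. U (fst q) (snd q) x * cnj (U (fst q') (snd q') x))))
     = avg (?H \<times> ?H) (\<lambda>q. avg (?H \<times> ?H) (\<lambda>q'. avg (ZL L) (\<lambda>x. U (fst q) (snd q) x * cnj (U (fst q') (snd q') x))))"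
    by (subst avg_swap[of "ZL L"]) (subst avg_swap[of "ZL L"], rule refl)
  also have "Re \<dots> \<le> cmod \<dots>" by (rule complex_Re_le_cmod)
  also have "\<dots> \<le> avg (?H \<times> ?H) (\<lambda>q. avg (?H \<times> ?H) (\<lambda>q'. cmod (avg (ZL L) (\<lambda>x. U (fst q) (snd q) x * cnj (U (fst q') (snd q') x)))))"
    by (rule order_trans[OF norm_avg_le], rule avg_mono, rule norm_avg_le)
  also have "\<dots> \<le> avg (?H \<times> ?H) (\<lambda>q. avg (?H \<times> ?H) (\<lambda>q'.
      20 * B * Y + (real Y)\<^sup>2 * root 32 (Box L B f (fst q) (snd q) (fst q') (snd q'))))"
  proof (rule avg_mono, rule avg_mono)
    fix q q' :: "int \<times> int"
    obtain a b where ab: "VK (fst q) (snd q) = {a..<b}" "b - a \<le> int Y" using VKi by blast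
    obtain a1 b1 where ab1: "VK (fst q') (snd q') = {a1..<b1}" "b1 - a1 \<le> int Y" using VKi by blast
    have "avg (ZL L) (\<lambda>x. U (fst q) (snd q) x * cnj (U (fst q') (snd q') x))
       = (\<Sum>y\<in>{a..<b}. \<Sum>y1\<in>{a1..<b1}. avg (ZL L) (\<lambda>x. PP f (fst q) (snd q) y x * cnj (PP f (fst q') (snd q') y1 x)))"
      unfolding U_def ab ab1 cnj_sum sum_product avg_sum ..
    then show "cmod (avg (ZL L) (\<lambda>x. U (fst q) (snd q) x * cnj (U (fst q') (snd q') x)))
       \<le> 20 * B * Y + (real Y)\<^sup>2 * root 32 (Box L B f (fst q) (snd q) (fst q') (snd q'))"
      using PP_pair_sum[OF L f(2) f(5) B ab(2) ab1(2) Y] by simp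
  qed
  also have "\<dots> = avg ((?H \<times> ?H) \<times> (?H \<times> ?H)) (\<lambda>w. 20 * B * Y + (real Y)\<^sup>2 * root 32 (Box L B f (fst (fst w)) (snd (fst w)) (fst (snd w)) (snd (snd w))))"
    by (rule avg_Times[symmetric])
  also have "\<dots> = 20 * B * Y + (real Y)\<^sup>2 * avg ((?H \<times> ?H) \<times> (?H \<times> ?H)) (\<lambda>w. root 32 (Box L B f (fst (fst w)) (snd (fst w)) (fst (snd w)) (snd (snd w))))"
    unfolding avg_add avg_mult_left by (subst avg_const) (use sym_int_simps in auto)
  finally have "(\<delta> ^ 4 * Y / 27)\<^sup>2 \<le> 20 * B * Y + (real Y)\<^sup>2 * avg ((?H \<times> ?H) \<times> (?H \<times> ?H)) (\<lambda>w. root 32 (Box L B f (fst (fst w)) (snd (fst w)) (fst (snd w)) (snd (snd w))))" (is "_ \<le> _ + _ * ?A") .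
  then have "(\<delta> ^ 4 * Y / 27)\<^sup>2 / (real Y)\<^sup>2 \<le> (20 * B * Y + (real Y)\<^sup>2 * ?A) / (real Y)\<^sup>2" by (intro divide_right_mono) auto
  moreover have "(\<delta> ^ 4 * Y / 27)\<^sup>2 / (real Y)\<^sup>2 = \<delta> ^ 8 / 729"
    using Y by (simp add: power_mult_distrib power_divide power_mult[symmetric])
  moreover have "(20 * B * Y + (real Y)\<^sup>2 * ?A) / (real Y)\<^sup>2 = 20 * B / Y + ?A"
    using Y by (simp add: add_divide_distrib power2_eq_square)
  ultimately have "\<delta> ^ 8 / 1458 \<le> ?A" using BY by linarith
  then have "(\<delta> ^ 8 / 1458) ^ 32 \<le> ?A ^ (2 ^ 5)" using d by (simp add: power_mono)
  also have "\<dots> \<le> avg ((?H \<times> ?H) \<times> (?H \<times> ?H)) (\<lambda>w. (root 32 (Box L B f (fst (fst w)) (snd (fst w)) (fst (snd w)) (snd (snd w)))) ^ (2 ^ 5))"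
    by (rule avg_power_le) (simp add: Box_nonneg[OF L f(2) f(5) B])
  also have "\<dots> = avg ((?H \<times> ?H) \<times> (?H \<times> ?H)) (\<lambda>w. Box L B f (fst (fst w)) (snd (fst w)) (fst (snd w)) (snd (snd w)))"
    by (rule avg_cong[OF refl]) (simp add: Box_nonneg[OF L f(2) f(5) B])
  finally show ?thesis .
qed

section \<open>Equidistribution of the directions\<close>

definition bias :: "nat \<Rightarrow> 'j set \<Rightarrow> ('j \<Rightarrow> int) \<Rightarrow> int \<Rightarrow> real" where
  "bias L J a m = cmod (avg J (\<lambda>j. ch L m (a j)))"

lemma finite_ZL_Collect: "finite {m\<in>ZL L. P m}" by (rule finite_subset[of _ "ZL L"]) auto

lemma bias_le_one: "bias L J a m \<le> 1" unfolding bias_def by (rule norm_avg_le_const) auto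
lemma bias_nonneg: "0 \<le> bias L J a m" by (simp add: bias_def)

text \<open>The doubled average is the product of the averages at \<open>m\<close> and at
  \<open>- m\<close>, both at most 1 in modulus. Doubling an index set therefore creates no new
  frequencies with large exponential sums.\<close>

lemma bias_diff_dir: "bias L (J \<times> J) (diff_dir a) m \<le> bias L J a m"
proof -
  have "avg (J \<times> J) (\<lambda>j. ch L m (diff_dir a j)) = avg J (\<lambda>j. avg J (\<lambda>j'. ch L m (a j' - a j)))"
    unfolding diff_dir_def by (rule avg_Times)
  also have "\<dots> = avg J (\<lambda>j. ch L (- m) (a j)) * avg J (\<lambda>j'. ch L m (a j'))"
    unfolding avg_mult_avg by (intro avg_cong refl) (simp add: ch_diff mult.commute)
  finally have "bias L (J \<times> J) (diff_dir a) m = bias L J a (- m) * bias L J a m" by (simp add: bias_def norm_mult)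
  also have "\<dots> \<le> bias L J a m" using bias_le_one[of L J a "- m"] by (simp add: mult_left_le_one_le bias_nonneg)
  finally show ?thesis .
qed

lemma nd_of_large_phase:
  assumes e: "0 < \<epsilon>" "0 < B" "\<epsilon> \<le> cmod (avg {1..int B} (\<lambda>l. ch L m (u * l)))"
  shows "nd (of_int (m * u) / real L) \<le> 2 / (\<epsilon> * B)"
proof -
  let ?t = "of_int (m * u) / real L"
  let ?S = "\<Sum>z\<in>{1..<int B + 1}. ee (of_int z * ?t + 0)"
  have "(\<Sum>l\<in>{1..int B}. ch L m (u * l)) = ?S"
    by (rule sum.cong) (auto simp: ch_def mult_ac)
  then have "\<epsilon> * B \<le> cmod ?S" using e by (simp add: avg_def norm_divide field_simps)
  then have "\<epsilon> * B * nd ?t \<le> cmod ?S * nd ?t" by (intro mult_right_mono) auto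
  also have "\<dots> \<le> 2" by (rule geom_le)
  finally show ?thesis using e by (simp add: field_simps)
qed

definition dir2 :: "int \<Rightarrow> int \<Rightarrow> int \<times> int \<Rightarrow> int" where "dir2 u v i = u * fst i - v * snd i"
text \<open>The second coordinate is ignored so that all five directions share the index set
  \<open>BB B\<close>.\<close>

definition dir1 :: "int \<Rightarrow> int \<times> int \<Rightarrow> int" where "dir1 u i = u * fst i"
abbreviation BB :: "nat \<Rightarrow> (int \<times> int) set" where "BB B \<equiv> {1..int B} \<times> {1..int B}"

lemma dirs_eq: "dirs h k h1 k1 =
  [dir2 (2 * (h + k)) (2 * h1), dir2 (2 * (h + k)) (2 * k1), dir2 (2 * (h + k)) (2 * (h1 + k1)), dir1 (2 * h), dir1 (2 * k)]"
  by (simp add: dirs_def dir2_def dir1_def fun_eq_iff algebra_simps)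

lemma bias_dir1: "0 < B \<Longrightarrow> bias L (BB B) (dir1 u) m = cmod (avg {1..int B} (\<lambda>l. ch L m (u * l)))"
  unfolding bias_def dir1_def
  using avg_Times[of "{1..int B}" "{1..int B}" "\<lambda>l l'. ch L m (u * l)"] by (simp add: avg_const)

lemma bias_dir2:
  assumes "0 < \<epsilon>" "0 < B" "\<epsilon> \<le> bias L (BB B) (dir2 u v) m"
  shows "nd (of_int (m * u) / real L) \<le> 2 / (\<epsilon> * B)" "nd (of_int (m * v) / real L) \<le> 2 / (\<epsilon> * B)"
proof -
  let ?I = "{1..int B}"
  have "avg (BB B) (\<lambda>i. ch L m (dir2 u v i)) = avg ?I (\<lambda>l. avg ?I (\<lambda>l'. ch L m (u * l - v * l')))"
    unfolding dir2_def by (rule avg_Times)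
  also have "\<dots> = avg ?I (\<lambda>l. ch L m (u * l)) * avg ?I (\<lambda>l'. ch L m ((- v) * l'))"
    unfolding avg_mult_avg ch_add[symmetric] by simp
  finally have bias: "bias L (BB B) (dir2 u v) m = cmod (avg ?I (\<lambda>l. ch L m (u * l))) * cmod (avg ?I (\<lambda>l'. ch L m ((- v) * l')))"
    by (simp add: bias_def norm_mult)
  have le1: "cmod (avg ?I (\<lambda>l. ch L m (c * l))) \<le> 1" for c by (rule norm_avg_le_const) auto
  have "\<epsilon> \<le> cmod (avg ?I (\<lambda>l. ch L m (u * l)))"
    using assms(3) mult_left_le[OF le1[of "- v"] norm_ge_zero, of "avg ?I (\<lambda>l. ch L m (u * l))"] unfolding bias by linarith
  then show "nd (of_int (m * u) / real L) \<le> 2 / (\<epsilon> * B)" by (rule nd_of_large_phase[OF assms(1,2)])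
  have "\<epsilon> \<le> cmod (avg ?I (\<lambda>l. ch L m ((- v) * l)))"
    using assms(3) mult_left_le_one_le[OF norm_ge_zero norm_ge_zero le1[of u], of "avg ?I (\<lambda>l. ch L m ((- v) * l))"] unfolding bias by linarith
  then have "nd (of_int (m * (- v)) / real L) \<le> 2 / (\<epsilon> * B)" by (rule nd_of_large_phase[OF assms(1,2)])
  then show "nd (of_int (m * v) / real L) \<le> 2 / (\<epsilon> * B)"
    using nd_minus[of "of_int (m * v) / real L"] by simp
qed

text \<open>Let \<open>a\<close> and \<open>b\<close> be the integers nearest to
  \<open>m u / L\<close> and \<open>m v / L\<close>. Then \<open>u b - v a\<close> is small, which
  gives the first factor; a given value of it admits at most \<open>gcd u v + 1\<close> choices of
  \<open>a\<close> between 0 and \<open>u\<close>; and \<open>a\<close> confines \<open>m\<close> to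
  an interval of length \<open>2 * \<tau> * L / u\<close>.\<close>

lemma card_two_phases:
  fixes u v g :: int and \<tau> :: real and L :: nat
  assumes L: "0 < L" and u: "0 < u" and g: "gcd u v \<le> g" and t: "0 \<le> \<tau>"
  shows "card {m\<in>ZL L. nd (of_int (m * u) / real L) \<le> \<tau> \<and> nd (of_int (m * v) / real L) \<le> \<tau>}
    \<le> (2 * (\<tau> * (of_int u + \<bar>of_int v\<bar>)) + 1) * (of_int g + 1) * (2 * (\<tau> * L / of_int u) + 1)"
proof -
  define R where "R = \<tau> * (of_int u + \<bar>of_int v\<bar>)"
  have R0: "0 \<le> R" using t u by (simp add: R_def)
  define C where "C = {c :: int. \<bar>of_int c\<bar> \<le> R}"
  have finC: "finite C" by (rule finite_subset[of _ "{- \<lfloor>R\<rfloor>..\<lfloor>R\<rfloor>}"]) (auto simp: C_def le_floor_iff abs_le_iff minus_le_iff)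
  have cardC: "card C \<le> 2 * R + 1" by (rule card_abs_diff_le[OF finC, of 0]) (auto simp: C_def R0)
  define A where "A c = {a\<in>{0..u}. \<exists>b. u * b - v * a = c}" for c
  have finA: "finite (A c)" for c by (rule finite_subset[of _ "{0..u}"]) (auto simp: A_def)
  define d where "d = gcd u v"
  have d0: "0 < d" using u by (simp add: d_def)
  define w where "w = u div d"
  have uw: "u = d * w" by (simp add: w_def d_def)
  have w0: "0 < w" using u d0 uw by (metis zero_less_mult_pos)
  have cardA: "real (card (A c)) \<le> of_int g + 1" for c
  proof -
    \<comment> \<open>Two solutions with the same \<open>c\<close> differ by a multiple of
      \<open>w\<close>, so their quotients by \<open>w\<close> tell them apart.\<close>
    have "inj_on (\<lambda>a. a div w) (A c)"
    proof (rule inj_onI)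
      fix a a' assume a: "a \<in> A c" "a' \<in> A c" "a div w = a' div w"
      obtain b b' where "u * b - v * a = c" "u * b' - v * a' = c" using a by (auto simp: A_def)
      then have "v * (a - a') = u * (b - b')" by (simp add: algebra_simps)
      moreover have "v = d * (v div d)" by (simp add: d_def)
      ultimately have "d * ((v div d) * (a - a')) = d * (w * (b - b'))" using uw by (metis mult.assoc)
      then have "(v div d) * (a - a') = w * (b - b')" using d0 by simp
      moreover have "coprime w (v div d)" unfolding w_def d_def by (rule div_gcd_coprime) (use u in auto)
      ultimately have "w dvd a - a'" by (metis coprime_dvd_mult_right_iff dvd_triv_left)
      then have "a mod w = a' mod w" by (simp add: mod_eq_dvd_iff)
      then show "a = a'" using a(3) by (metis mult_div_mod_eq)
    qed
    then have "card (A c) = card ((\<lambda>a. a div w) ` A c)" by (simp add: card_image)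
    also have "\<dots> \<le> card {0..d}"
    proof (intro card_mono image_subsetI)
      fix a assume "a \<in> A c"
      then have "0 \<le> a" "a \<le> d * w" using uw by (auto simp: A_def)
      then show "a div w \<in> {0..d}" using w0 zdiv_mono1[of a "d * w" w] by (simp add: pos_imp_zdiv_nonneg_iff)
    qed simp
    finally have "int (card (A c)) \<le> d + 1" using d0 by simp
    then have "int (card (A c)) \<le> g + 1" using g by (simp add: d_def)
    then show ?thesis by linarith
  qed
  define P where "P a = {m\<in>ZL L. \<bar>of_int (m * u) / real L - of_int a\<bar> \<le> \<tau>}" for a :: int
  have finP: "finite (P a)" for a by (rule finite_subset[of _ "ZL L"]) (auto simp: P_def)
  have cardP: "card (P a) \<le> 2 * (\<tau> * L / of_int u) + 1" for a
  proof (rule card_abs_diff_le[OF finP, where c = "of_int a * L / of_int u"])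
    fix m assume "m \<in> P a"
    then have "\<bar>of_int (m * u) / real L - of_int a\<bar> * (L / of_int u) \<le> \<tau> * (L / of_int u)"
      using u by (intro mult_right_mono) (auto simp: P_def)
    moreover have "\<bar>of_int (m * u) / real L - of_int a\<bar> * (L / of_int u) = \<bar>(of_int (m * u) / real L - of_int a) * (L / of_int u)\<bar>"
      using u by (simp add: abs_mult)
    moreover have "(of_int (m * u) / real L - of_int a) * (L / of_int u) = of_int m - of_int a * L / of_int u"
      using L u by (simp add: field_simps)
    ultimately show "\<bar>of_int m - of_int a * L / of_int u\<bar> \<le> \<tau> * L / of_int u"
      by (simp only: times_divide_eq_right)
  qed (use t u in auto)
  let ?S = "{m\<in>ZL L. nd (of_int (m * u) / real L) \<le> \<tau> \<and> nd (of_int (m * v) / real L) \<le> \<tau>}"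
  have "?S \<subseteq> (\<Union>c\<in>C. \<Union>a\<in>A c. P a)"
  proof
    fix m assume m: "m \<in> ?S"
    define x where "x = of_int (m * u) / real L"
    define y where "y = of_int (m * v) / real L"
    define a where "a = round x"
    define b where "b = round y"
    have xa: "\<bar>x - of_int a\<bar> \<le> \<tau>" and yb: "\<bar>y - of_int b\<bar> \<le> \<tau>" using m by (auto simp: nd_def a_def b_def x_def y_def)
    have "0 \<le> x" "x \<le> of_int u"
    proof -
      have "m * u \<le> int L * u" using m u by (intro mult_right_mono) auto
      then have "of_int (m * u) \<le> real L * of_int u" by (metis of_int_le_iff of_int_mult of_int_of_nat_eq)
      then show "x \<le> of_int u" using L by (simp add: x_def field_simps)
      show "0 \<le> x" using m u by (simp add: x_def)
    qed
    then have "round (0 :: real) \<le> a" "a \<le> round (real_of_int u)" unfolding a_def by (intro round_mono; simp)+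
    then have a: "a \<in> {0..u}" by (simp add: round_of_int)
    have "u * y = v * x" by (simp add: x_def y_def)
    then have "of_int (u * b - v * a) = of_int v * (x - of_int a) - of_int u * (y - of_int b)" by (simp add: algebra_simps)
    also have "\<bar>\<dots>\<bar> \<le> \<bar>of_int v * (x - of_int a)\<bar> + \<bar>of_int u * (y - of_int b)\<bar>" by (rule abs_triangle_ineq4)
    also have "\<dots> \<le> \<bar>of_int v\<bar> * \<tau> + of_int u * \<tau>"
      unfolding abs_mult using u xa yb by (intro add_mono mult_mono) auto
    finally have "u * b - v * a \<in> C" by (simp add: C_def R_def algebra_simps)
    moreover have "a \<in> A (u * b - v * a)" using a by (auto simp: A_def)
    moreover have "m \<in> P a" using m xa by (auto simp: P_def x_def)
    ultimately show "m \<in> (\<Union>c\<in>C. \<Union>a\<in>A c. P a)" by blast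
  qed
  then have "card ?S \<le> card (\<Union>c\<in>C. \<Union>a\<in>A c. P a)"
    using finC finA finP by (intro card_mono) auto
  also have "\<dots> \<le> (\<Sum>c\<in>C. \<Sum>a\<in>A c. card (P a))"
    by (intro order_trans[OF card_UN_le] sum_mono finC finA) auto
  finally have "real (card ?S) \<le> (\<Sum>c\<in>C. \<Sum>a\<in>A c. real (card (P a)))"
    by (simp only: of_nat_le_iff flip: of_nat_sum)
  also have "\<dots> \<le> (\<Sum>c\<in>C. \<Sum>a\<in>A c. 2 * (\<tau> * L / of_int u) + 1)" by (intro sum_mono cardP)
  also have "\<dots> = (\<Sum>c\<in>C. real (card (A c)) * (2 * (\<tau> * L / of_int u) + 1))" by (simp only: sum_constant)
  also have "\<dots> \<le> (\<Sum>c\<in>C. (of_int g + 1) * (2 * (\<tau> * L / of_int u) + 1))"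
    using t u by (intro sum_mono mult_right_mono cardA) auto
  also have "\<dots> = real (card C) * ((of_int g + 1) * (2 * (\<tau> * L / of_int u) + 1))" by (simp only: sum_constant)
  also have "\<dots> \<le> (2 * R + 1) * ((of_int g + 1) * (2 * (\<tau> * L / of_int u) + 1))"
  proof (intro mult_right_mono cardC)
    have "0 \<le> real_of_int g" using g gcd_ge_0_int[of u v] by linarith
    then show "0 \<le> (of_int g + 1) * (2 * (\<tau> * L / of_int u) + 1)" using t u by (intro mult_nonneg_nonneg) auto
  qed
  finally show ?thesis by (simp add: R_def mult.assoc)
qed

text \<open>A large sum makes \<tau> of order 1/\<open>Y\<close> while \<open>p\<close> has order
  \<open>Y\<close>, so that all three factors in \<open>card_two_phases\<close> are bounded in terms
  of \<open>r\<close> and \<open>t\<close>.\<close>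

lemma card_dir2_large:
  fixes p w :: int and r t :: real
  assumes L: "0 < L" "real L \<le> 12 * (real Y)\<^sup>2" and Y: "0 < Y" and B: "t * Y \<le> B" "0 < B"
    and p: "t * Y \<le> \<bar>of_int p\<bar>" "\<bar>of_int p\<bar> \<le> 2 * real Y" and w: "\<bar>of_int w\<bar> \<le> 2 * real Y"
    and g: "of_int (gcd p w) \<le> 1 / t" and r: "0 < r" "r \<le> 1" and t: "0 < t" "t \<le> 1 / 2"
  shows "card {m\<in>ZL L. r \<le> bias L (BB B) (dir2 (2 * p) (2 * w)) m} \<le> 2 ^ 12 / (r\<^sup>2 * t ^ 4)"
proof -
  define \<tau> where "\<tau> = 2 / (r * B)"
  \<comment> \<open>The modulus is used because \<open>card_two_phases\<close> needs a positive
    coefficient; \<open>nd\<close> is even, so the sign of \<open>p\<close> is immaterial.\<close>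
  define u where "u = 2 * \<bar>p\<bar>"
  have Y0: "0 < real Y" using Y by simp
  have p0: "p \<noteq> 0" using p(1) t Y0 by (auto simp: mult_le_0_iff)
  have \<tau>0: "0 \<le> \<tau>" using r by (simp add: \<tau>_def)
  have \<tau>le: "\<tau> \<le> 2 / (r * (t * Y))"
    unfolding \<tau>_def using r t Y0 B by (intro divide_left_mono mult_left_mono mult_pos_pos) auto
  have u0: "0 < u" using p0 by (simp add: u_def)
  have ur: "of_int u = 2 * \<bar>real_of_int p\<bar>" by (simp add: u_def)
  have gcd2: "gcd u (2 * w) = 2 * gcd p w"
    using gcd_mult_distrib_int[of 2 "\<bar>p\<bar>" w] by (simp add: u_def)
  have "{m\<in>ZL L. r \<le> bias L (BB B) (dir2 (2 * p) (2 * w)) m}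
     \<subseteq> {m\<in>ZL L. nd (of_int (m * u) / real L) \<le> \<tau> \<and> nd (of_int (m * (2 * w)) / real L) \<le> \<tau>}"
  proof
    fix m assume m: "m \<in> {m\<in>ZL L. r \<le> bias L (BB B) (dir2 (2 * p) (2 * w)) m}"
    then have 1: "nd (of_int (m * (2 * p)) / real L) \<le> \<tau>" "nd (of_int (m * (2 * w)) / real L) \<le> \<tau>"
      using bias_dir2[of r B L "2 * p" "2 * w" m] r B by (auto simp: \<tau>_def)
    have "nd (of_int (m * u) / real L) \<le> \<tau>"
      using 1(1) nd_minus[of "of_int (m * (2 * p)) / real L"] by (cases "0 \<le> p") (auto simp: u_def)
    then show "m \<in> {m\<in>ZL L. nd (of_int (m * u) / real L) \<le> \<tau> \<and> nd (of_int (m * (2 * w)) / real L) \<le> \<tau>}"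
      using m 1 by simp
  qed
  then have "card {m\<in>ZL L. r \<le> bias L (BB B) (dir2 (2 * p) (2 * w)) m}
     \<le> card {m\<in>ZL L. nd (of_int (m * u) / real L) \<le> \<tau> \<and> nd (of_int (m * (2 * w)) / real L) \<le> \<tau>}"
    by (rule card_mono[OF finite_ZL_Collect])
  then have "real (card {m\<in>ZL L. r \<le> bias L (BB B) (dir2 (2 * p) (2 * w)) m})
     \<le> (2 * (\<tau> * (of_int u + \<bar>of_int (2 * w)\<bar>)) + 1) * (of_int (2 * gcd p w) + 1) * (2 * (\<tau> * L / of_int u) + 1)"
    using card_two_phases[OF L(1) u0 eq_refl[OF gcd2] \<tau>0] by linarith
  also have "\<dots> \<le> (33 / (r * t)) * (3 / t) * (25 / (r * t\<^sup>2))"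
  proof (intro mult_mono)
    have rt: "1 \<le> 1 / (r * t)" using r t by (simp add: mult_le_one)
    have "\<tau> * (of_int u + \<bar>of_int (2 * w)\<bar>) \<le> 2 / (r * (t * Y)) * (8 * real Y)"
      using \<tau>le \<tau>0 p w ur r t Y0 by (intro mult_mono) auto
    also have "\<dots> = 16 * (1 / (r * t))" using Y0 by simp
    finally have "2 * (\<tau> * (of_int u + \<bar>of_int (2 * w)\<bar>)) + 1 \<le> 33 * (1 / (r * t))" using rt by linarith
    then show "2 * (\<tau> * (of_int u + \<bar>of_int (2 * w)\<bar>)) + 1 \<le> 33 / (r * t)" by simp
    have "1 \<le> 1 / t" using t by simp
    then have "of_int (2 * gcd p w) + 1 \<le> 3 * (1 / t)" using g by simp
    then show "of_int (2 * gcd p w) + 1 \<le> 3 / t" by simp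
    have "r * t * t \<le> 1 * 1" using r t by (intro mult_mono) (auto simp: mult_le_one)
    then have rt2: "1 \<le> 1 / (r * t\<^sup>2)" using r t by (simp add: power2_eq_square)
    have "\<tau> * L / of_int u \<le> (2 / (r * (t * Y))) * (12 * (real Y)\<^sup>2) / (2 * (t * Y))"
      using \<tau>le \<tau>0 L p ur u0 t r Y0 by (intro frac_le mult_mono) auto
    also have "\<dots> = 12 * (1 / (r * t\<^sup>2))" using Y0 t r by (simp add: power2_eq_square field_simps)
    finally have "2 * (\<tau> * L / of_int u) + 1 \<le> 25 * (1 / (r * t\<^sup>2))" using rt2 by argo
    then show "2 * (\<tau> * L / of_int u) + 1 \<le> 25 / (r * t\<^sup>2)" by simp
  qed (use r t \<tau>0 u0 in auto)
  also have "\<dots> = 2475 / (r\<^sup>2 * t ^ 4)" by (simp add: power2_eq_square power4_eq_xxxx)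
  also have "\<dots> \<le> 2 ^ 12 / (r\<^sup>2 * t ^ 4)" using r t by (intro divide_right_mono) auto
  finally show ?thesis .
qed

section \<open>The chain of degree lowering steps\<close>

definition energy :: "nat \<Rightarrow> 'j set \<Rightarrow> ('j \<Rightarrow> int) list \<Rightarrow> (int \<Rightarrow> complex) \<Rightarrow> real" where
  "energy L J as D = avg (tup (length as) J) (\<lambda>s. (cmod (avg (ZL L) (mult_diff as s D)))\<^sup>2)"

definition step_exp :: "nat \<Rightarrow> nat" where "step_exp d = 42 * low_exp d"

text \<open>\<open>direction_removal\<close> trades the direction \<open>a\<close> for frequencies,
  and \<open>degree_lowering\<close> trades the frequencies for a doubled index set. The exponent 42
  arises because \<open>\<eta> / (2 * (1 / \<eta>) ^ 40)\<close> is at least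
  \<open>\<eta> ^ 42\<close>.\<close>

lemma lowering_step:
  assumes L: "0 < L" "real L \<le> 12 * (real Y)\<^sup>2" and g: "per L g1" "per L g2" "bd g1" "bd g2"
    and as: "length as = d" "1 \<le> d" and J: "finite J" "J \<noteq> {}"
    and e: "0 < \<eta>" "\<eta> \<le> 1 / 2" "(1 / \<eta>) ^ step_exp d \<le> Y"
    and K: "card {m\<in>ZL L. \<eta> / 2 \<le> bias L J a m} \<le> (1 / \<eta>) ^ 40"
    and big: "\<eta> \<le> energy L J (a # as) (dual Y g1 g2)"
  shows "\<eta> ^ step_exp d \<le> energy L (J \<times> J) (map diff_dir as) (dual Y g1 g2)"
proof -
  have D: "per L (dual Y g1 g2)" "bd (dual Y g1 g2)" using per_dual bd_dual g by auto
  have K0: "0 < (1 / \<eta>) ^ 40" using e by simp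
  obtain \<gamma> where \<gamma>: "\<eta> / (2 * (1 / \<eta>) ^ 40) \<le> avg (tup d J) (\<lambda>s. (cmod (ft L (mult_diff as s (dual Y g1 g2)) (\<gamma> s)))\<^sup>2)"
    using direction_removal[OF L(1) D e(1) K0 K[unfolded bias_def] J, of d as] big as(1) by (auto simp: energy_def)
  have "\<eta> ^ 42 = \<eta> ^ 40 * \<eta> * \<eta>" by (simp add: power_Suc2[symmetric])
  also have "\<dots> \<le> \<eta> ^ 40 * \<eta> * (1 / 2)" using e by (intro mult_left_mono) auto
  also have "\<dots> = \<eta> / (2 * (1 / \<eta>) ^ 40)" using e by (simp add: power_one_over)
  finally have 1: "\<eta> ^ 42 \<le> avg (tup d J) (\<lambda>s. (cmod (ft L (mult_diff as s (dual Y g1 g2)) (\<gamma> s)))\<^sup>2)" using \<gamma> by linarith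
  have "\<eta> ^ 42 \<le> \<eta> ^ 1" using e by (intro power_decreasing) auto
  then have 2: "\<eta> ^ 42 \<le> 1 / 2" using e by simp
  have 3: "(1 / \<eta> ^ 42) ^ low_exp d \<le> Y" using e(3) by (simp only: step_exp_def power_mult power_one_over)
  have "(\<eta> ^ 42) ^ low_exp d \<le> avg (tup d (J \<times> J)) (\<lambda>p. (cmod (avg (ZL L) (mult_diff (map diff_dir as) p (dual Y g1 g2))))\<^sup>2)"
    using e by (intro degree_lowering[OF L g as J _ 2 3 1]) auto
  then show ?thesis using as by (simp add: energy_def step_exp_def power_mult)
qed

lemma card_symmetric_le:
  assumes "\<And>h. P (- h) = P (h :: int)"
  shows "card {h\<in>{- int n..int n}. P h} \<le> 2 * card {h\<in>{1..int n}. P h} + 1"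
proof -
  let ?A = "{h\<in>{1..int n}. P h}"
  have fin: "finite ?A" by (rule finite_subset[of _ "{1..int n}"]) auto
  have "{h\<in>{- int n..int n}. P h} \<subseteq> ?A \<union> {0} \<union> uminus ` ?A"
  proof
    fix h assume h: "h \<in> {h\<in>{- int n..int n}. P h}"
    have "h \<in> uminus ` ?A" if "h < 0"
      using h that assms[of h] by (intro image_eqI[of _ _ "- h"]) auto
    moreover have "h \<in> ?A" if "h > 0" using h that by auto
    ultimately show "h \<in> ?A \<union> {0} \<union> uminus ` ?A" by (cases "h = 0") (auto simp: neq_iff)
  qed
  then have "card {h\<in>{- int n..int n}. P h} \<le> card (?A \<union> {0} \<union> uminus ` ?A)"
    using fin by (intro card_mono) auto
  also have "\<dots> \<le> card (?A \<union> {0}) + card (uminus ` ?A)" by (rule card_Un_le)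
  also have "\<dots> \<le> 2 * card ?A + 1"
    using card_Un_le[of ?A "{0}"] card_image_le[OF fin, of uminus] by simp
  finally show ?thesis .
qed

text \<open>If the average over \<open>h\<close> is large at \<open>m\<close>, then
  \<open>2 * h * m / L\<close> is near an integer for a positive proportion of \<open>h\<close>, and
  \<open>recurrence_denominator\<close> places \<open>m\<close> in a major arc. A single
  \<open>h\<close> would give only one such approximation, which is too weak.\<close>

lemma card_dir1_average:
  fixes t \<eta> :: real
  assumes L: "0 < L" "real L \<le> 12 * (real Y)\<^sup>2" and B: "t * Y \<le> B" "0 < B"
    and t: "\<eta> \<le> t" and e: "0 < \<eta>" "\<eta> \<le> 1 / 2" "(1 / \<eta>) ^ 20 \<le> Y"
    and w: "\<And>m. wt m \<le> avg (sym_int Y) (\<lambda>h. bias L (BB B) (dir1 (2 * h)) m)"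
  shows "card {m\<in>ZL L. \<eta> / 2 \<le> wt m} \<le> (1 / \<eta>) ^ 40"
proof -
  define E where "E = 1 / \<eta>"
  have E2: "2 \<le> E" and Ee: "\<eta> = 1 / E" using e by (auto simp: E_def field_simps)
  have E0: "0 < E" using E2 by simp
  have Epow: "2 ^ k \<le> E ^ k" for k using E2 by (intro power_mono) auto
  have En: "E ^ 20 \<le> Y" using e by (simp add: E_def)
  have Y0: "0 < real Y" using En E0 by (metis less_le_trans zero_less_power)
  have big: "2 ^ k * E ^ j \<le> Y" if "j + k = 20" for j k
  proof -
    have "2 ^ k * E ^ j \<le> E ^ k * E ^ j" using E0 Epow by (intro mult_right_mono) auto
    then show ?thesis using En that by (simp add: power_add[symmetric] add.commute)
  qed
  have EB: "Y \<le> E * B"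
  proof -
    have "\<eta> * Y \<le> t * Y" using t Y0 by (intro mult_right_mono) auto
    then have "\<eta> * Y \<le> B" using B(1) by linarith
    then show ?thesis using E0 by (simp add: Ee field_simps)
  qed
  define \<tau> where "\<tau> = 8 * E\<^sup>2 / Y"
  \<comment> \<open>The bound that \<open>recurrence_denominator\<close> gives for density
    \<open>\<eta> / 8\<close> and distance \<tau>.\<close>
  define \<sigma> where "\<sigma> = 2 ^ 15 * E ^ 4 / (real Y)\<^sup>2"
  have \<tau>0: "0 < \<tau>" using E0 Y0 by (simp add: \<tau>_def)
  have "{m\<in>ZL L. \<eta> / 2 \<le> wt m} \<subseteq> {m\<in>ZL L. \<exists>q::nat. 1 \<le> q \<and> q \<le> nat \<lfloor>64 * E\<rfloor> \<and> nd (real q * (of_int m / L)) \<le> \<sigma>}"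
  proof
    fix m assume m: "m \<in> {m\<in>ZL L. \<eta> / 2 \<le> wt m}"
    let ?f = "\<lambda>h. bias L (BB B) (dir1 (2 * h)) m"
    have "\<eta> / 2 \<le> avg (sym_int Y) ?f" using m w[of m] by simp
    then have "\<eta> / 2 / 2 * card (sym_int Y) \<le> card {h\<in>sym_int Y. \<eta> / 2 / 2 \<le> ?f h}"
      using sym_int_simps[of Y] e by (intro dense_of_avg) (auto simp: bias_le_one)
    then have 1: "\<eta> / 4 * (2 * real Y + 1) \<le> card {h\<in>sym_int Y. \<eta> / 4 \<le> ?f h}" by (simp add: sym_int_simps)
    define P where "P h \<longleftrightarrow> nd (of_int h * (2 * (of_int m / real L))) \<le> \<tau>" for h :: int
    have "{h\<in>sym_int Y. \<eta> / 4 \<le> ?f h} \<subseteq> {h\<in>{- int Y..int Y}. P h}"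
    proof
      fix h assume h: "h \<in> {h\<in>sym_int Y. \<eta> / 4 \<le> ?f h}"
      then have "nd (of_int (m * (2 * h)) / real L) \<le> 2 / (\<eta> / 4 * B)"
        using nd_of_large_phase[of "\<eta> / 4" B L m "2 * h"] e B by (simp add: bias_dir1)
      also have "\<dots> = 8 * E / B" using E0 by (simp add: Ee)
      also have "\<dots> \<le> \<tau>"
        unfolding \<tau>_def using EB E0 Y0 B by (simp add: field_simps power2_eq_square)
      finally show "h \<in> {h\<in>{- int Y..int Y}. P h}" using h by (simp add: P_def sym_int_def mult_ac)
    qed
    then have "card {h\<in>sym_int Y. \<eta> / 4 \<le> ?f h} \<le> card {h\<in>{- int Y..int Y}. P h}"
      by (intro card_mono) (auto intro: finite_subset[of _ "{- int Y..int Y}"])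
    also have "\<dots> \<le> 2 * card {h\<in>{1..int Y}. P h} + 1"
      by (rule card_symmetric_le) (simp add: P_def nd_minus)
    finally have "real (card {h\<in>sym_int Y. \<eta> / 4 \<le> ?f h}) \<le> 2 * real (card {h\<in>{1..int Y}. P h}) + 1" by linarith
    moreover have "4 \<le> \<eta> * Y"
    proof -
      have "2 ^ 19 * E \<le> Y" using big[of 1 19] by simp
      then show ?thesis using E0 by (simp add: Ee field_simps)
    qed
    moreover have "\<eta> / 4 * (2 * real Y + 1) = \<eta> * Y / 2 + \<eta> / 4" by (simp add: field_simps)
    ultimately have c: "\<eta> / 8 * Y \<le> card {h\<in>{1..int Y}. P h}" using 1 e by linarith
    have "\<exists>q::nat. 1 \<le> q \<and> real q \<le> 4 / (\<eta> / 8) \<and> nd (real q * (2 * (of_int m / real L))) \<le> 64 * \<tau> / ((\<eta> / 8)\<^sup>2 * Y)"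
    proof (rule recurrence_denominator)
      show "{h\<in>{1..int Y}. P h} \<subseteq> {1..int Y}" by auto
      show "nd (of_int a * (2 * (of_int m / real L))) \<le> \<tau>" if "a \<in> {h\<in>{1..int Y}. P h}" for a
        using that by (simp add: P_def)
      show "32 * \<tau> < \<eta> / 8"
      proof -
        have "131072 * E ^ 3 \<le> Y" using big[of 3 17] by simp
        moreover have "0 < E ^ 3" using E0 by simp
        ultimately have "2048 * E ^ 3 < Y" by linarith
        then have "2048 * E\<^sup>2 * E < Y" by (simp add: eval_nat_numeral mult.assoc)
        then show ?thesis using E0 Y0 by (simp add: \<tau>_def Ee field_simps)
      qed
      show "32 / (\<eta> / 8)\<^sup>2 \<le> Y"
      proof -
        have "262144 * E\<^sup>2 \<le> Y" using big[of 2 18] by simp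
        moreover have "0 < E\<^sup>2" using E0 by simp
        ultimately have "2048 * E\<^sup>2 \<le> Y" by linarith
        then show ?thesis by (simp add: Ee power_divide)
      qed
    qed (use c e \<tau>0 in auto)
    then obtain q :: nat where q: "1 \<le> q" "real q \<le> 4 / (\<eta> / 8)" "nd (real q * (2 * (of_int m / real L))) \<le> 64 * \<tau> / ((\<eta> / 8)\<^sup>2 * Y)"
      by blast
    have "real (2 * q) \<le> 64 * E" using q(2) by (simp add: Ee)
    then have "2 * q \<le> nat \<lfloor>64 * E\<rfloor>" by (rule le_nat_floor)
    moreover have "nd (real (2 * q) * (of_int m / L)) \<le> \<sigma>"
    proof -
      have "64 * \<tau> / ((\<eta> / 8)\<^sup>2 * Y) = \<sigma>"
        using E0 Y0 by (simp add: \<tau>_def \<sigma>_def Ee power_divide power2_eq_square power4_eq_xxxx)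
      then show ?thesis using q(3) by (simp add: mult_ac)
    qed
    ultimately show "m \<in> {m\<in>ZL L. \<exists>q::nat. 1 \<le> q \<and> q \<le> nat \<lfloor>64 * E\<rfloor> \<and> nd (real q * (of_int m / L)) \<le> \<sigma>}"
      using m q(1) by (intro CollectI conjI exI[of _ "2 * q"]) auto
  qed
  then have "card {m\<in>ZL L. \<eta> / 2 \<le> wt m} \<le> card {m\<in>ZL L. \<exists>q::nat. 1 \<le> q \<and> q \<le> nat \<lfloor>64 * E\<rfloor> \<and> nd (real q * (of_int m / L)) \<le> \<sigma>}"
    by (rule card_mono[OF finite_ZL_Collect])
  then have "real (card {m\<in>ZL L. \<eta> / 2 \<le> wt m}) \<le> real (nat \<lfloor>64 * E\<rfloor>) * (real (nat \<lfloor>64 * E\<rfloor>) + 1) * (2 * \<sigma> * L + 1)"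
    using card_major_arcs[OF L(1), of \<sigma> "nat \<lfloor>64 * E\<rfloor>"] E0 by (simp add: \<sigma>_def)
  also have "\<dots> \<le> (64 * E) * (65 * E) * (2 ^ 20 * E ^ 4)"
  proof (intro mult_mono)
    have Q: "real (nat \<lfloor>64 * E\<rfloor>) \<le> 64 * E" using E0 by simp
    then show "real (nat \<lfloor>64 * E\<rfloor>) \<le> 64 * E" "real (nat \<lfloor>64 * E\<rfloor>) + 1 \<le> 65 * E" using E2 by linarith+
    have "\<sigma> * L \<le> \<sigma> * (12 * (real Y)\<^sup>2)" using L E0 by (intro mult_left_mono) (auto simp: \<sigma>_def)
    also have "\<dots> = 393216 * E ^ 4" using Y0 by (simp add: \<sigma>_def)
    finally show "2 * \<sigma> * L + 1 \<le> 2 ^ 20 * E ^ 4" using Epow[of 4] by simp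
  qed (use E0 in \<open>auto simp: \<sigma>_def\<close>)
  also have "\<dots> = 4160 * 2 ^ 20 * E ^ 6" by (simp add: power_Suc2[symmetric] mult_ac flip: power_Suc)
  also have "\<dots> \<le> 2 ^ 34 * E ^ 6" using E0 by (intro mult_right_mono) auto
  also have "\<dots> \<le> E ^ 34 * E ^ 6" using E0 Epow[of 34] by (intro mult_right_mono) auto
  also have "\<dots> = (1 / \<eta>) ^ 40" by (simp add: E_def power_add[symmetric])
  finally show ?thesis .
qed

section \<open>Most parameter quadruples are nondegenerate\<close>

lemma avg_dvd_le:
  assumes g: "0 < g" "g \<le> 2 * int Y" 
  shows "avg (sym_int Y) (\<lambda>a. if g dvd a + c then 1 else 0 :: real) \<le> 2 / of_int g"
proof -
  let ?M = "{a\<in>sym_int Y. g dvd a + c}"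
  have fin: "finite ?M" using sym_int_simps(1) by (rule finite_subset[rotated]) auto
  have "inj_on (\<lambda>a. (a + c) div g) ?M"
    by (rule inj_onI) (metis (mono_tags, lifting) add_right_cancel dvd_div_eq_iff mem_Collect_eq)
  then have "card ?M = card ((\<lambda>a. (a + c) div g) ` ?M)" by (simp add: card_image)
  also have "real \<dots> \<le> 2 * real Y / of_int g + 1"
  proof (rule card_spread_le)
    fix m n assume "m \<in> (\<lambda>a. (a + c) div g) ` ?M" "n \<in> (\<lambda>a. (a + c) div g) ` ?M"
    then obtain a a' where a: "a \<in> ?M" "m = (a + c) div g" "a' \<in> ?M" "n = (a' + c) div g" by blast
    then have "g * n - g * m \<le> 2 * int Y" by (simp add: sym_int_def)
    then have "of_int (g * (n - m)) \<le> 2 * real Y" by (simp only: right_diff_distrib)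
    then show "of_int (n - m) \<le> 2 * real Y / of_int g" using g by (simp add: field_simps)
  qed (use fin g in auto)
  also have "\<dots> \<le> 2 / of_int g * (2 * real Y + 1)"
  proof -
    have "real_of_int g \<le> 2 * real Y" using g(2) by linarith
    then have "1 \<le> 2 * real Y / of_int g" using g(1) by (simp add: field_simps)
    moreover have "2 / of_int g * (2 * real Y + 1) = 2 * (2 * real Y / of_int g) + 2 / real_of_int g" by (simp add: distrib_left)
    moreover have "0 \<le> 2 / real_of_int g" using g(1) by simp
    ultimately show ?thesis by linarith
  qed
  finally have "real (card ?M) \<le> 2 / of_int g * (2 * real Y + 1)" .
  then show ?thesis by (simp add: avg_bool_card[OF sym_int_simps(1)] sym_int_simps(3) field_simps)
qed

lemma sum_inverse_squares_le:
  "0 < G \<Longrightarrow> (\<Sum>g\<in>{G<..n}. 4 / (real g)\<^sup>2) \<le> 4 / real G"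
proof -
  assume G: "0 < G"
  have "(\<Sum>g\<in>{G<..n}. 4 / (real g)\<^sup>2) \<le> 4 / real G - 4 / real n" if "G \<le> n"
    using that
  proof (induction n rule: dec_induct)
    case (step n)
    have "{G<..Suc n} = insert (Suc n) {G<..n}" using step by auto
    then have "(\<Sum>g\<in>{G<..Suc n}. 4 / (real g)\<^sup>2) = 4 / (real (Suc n))\<^sup>2 + (\<Sum>g\<in>{G<..n}. 4 / (real g)\<^sup>2)" by simp
    also have "\<dots> \<le> 4 / (real (Suc n))\<^sup>2 + (4 / real G - 4 / real n)" using step by simp
    also have "\<dots> \<le> 4 / real G - 4 / real (Suc n)"
    proof -
      have n: "0 < real n" using G step by simp
      have "4 / (real (Suc n))\<^sup>2 \<le> 4 / (real n * real (Suc n))"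
        using n by (intro divide_left_mono) (auto simp: power2_eq_square intro!: mult_right_mono)
      also have "\<dots> = 4 / real n - 4 / real (Suc n)" using n by (simp add: field_simps)
      finally show ?thesis by simp
    qed
    finally show ?case .
  qed simp
  moreover have "(\<Sum>g\<in>{G<..n}. 4 / (real g)\<^sup>2) = 0" if "n < G" using that by simp
  ultimately show ?thesis by (cases "G \<le> n") (auto intro: order_trans)
qed

text \<open>Union bound over common divisors \<open>g\<close> above \<open>1 / t\<close>: both
  numbers are multiples of \<open>g\<close> with density at most \<open>4 / g\<^sup>2\<close>, and
  the tail of that series is of order \<open>t\<close>. Excluding \<open>a + c = 0\<close> keeps
  \<open>g\<close> at most \<open>2 * Y\<close>, the range of \<open>avg_dvd_le\<close>.\<close>

lemma avg_large_gcd_le: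
  fixes t :: real
  assumes t: "0 < t" "t \<le> 1 / 2" and c: "\<bar>c\<bar> \<le> int Y"
  shows "avg (sym_int Y) (\<lambda>a. avg (sym_int Y) (\<lambda>b. if a + c \<noteq> 0 \<and> 1 / t < of_int (gcd (a + c) (b + c')) then 1 else 0 :: real)) \<le> 8 * t"
proof -
  define G where "G = nat \<lfloor>1 / t\<rfloor>"
  have G: "1 / (2 * t) \<le> real G" "0 < G"
  proof -
    have t2: "2 \<le> 1 / t" using t by (simp add: field_simps)
    have "1 / t - 1 < real G" using t by (simp add: G_def)
    moreover have "1 / (2 * t) = 1 / t / 2" by simp
    ultimately show "1 / (2 * t) \<le> real G" using t2 by linarith
    then show "0 < G" using t by (cases "G = 0") auto
  qed
  let ?i = "\<lambda>P. if P then 1 else 0 :: real"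
  let ?K = "{G<..2 * Y}"
  have pt: "?i (a + c \<noteq> 0 \<and> 1 / t < of_int (gcd (a + c) (b + c'))) \<le> (\<Sum>g\<in>?K. ?i (int g dvd a + c) * ?i (int g dvd b + c'))"
    if a: "a \<in> sym_int Y" for a b
  proof (cases "a + c \<noteq> 0 \<and> 1 / t < of_int (gcd (a + c) (b + c'))")
    case True
    define g where "g = nat (gcd (a + c) (b + c'))"
    have ig: "int g = gcd (a + c) (b + c')" by (simp add: g_def)
    have "gcd (a + c) (b + c') \<le> \<bar>a + c\<bar>" using True dvd_imp_le_int[of "a + c" "gcd (a + c) (b + c')"] by simp
    moreover have "- int Y \<le> a" "a \<le> int Y" using a by (auto simp: sym_int_def)
    ultimately have "g \<le> 2 * Y" using c ig by linarith
    moreover have "G < g"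
    proof -
      have "real G \<le> 1 / t" using t by (simp add: G_def)
      then have "real G < real g" using True ig by (metis of_int_of_nat_eq order_le_less_trans)
      then show ?thesis by simp
    qed
    ultimately have g: "g \<in> ?K" by simp
    have "1 = ?i (int g dvd a + c) * ?i (int g dvd b + c')" by (simp add: ig)
    also have "\<dots> \<le> (\<Sum>g\<in>?K. ?i (int g dvd a + c) * ?i (int g dvd b + c'))"
      using g by (intro member_le_sum) auto
    finally show ?thesis using True by simp
  next
    case False
    then show ?thesis by (auto intro!: sum_nonneg)
  qed
  have "avg (sym_int Y) (\<lambda>a. avg (sym_int Y) (\<lambda>b. ?i (a + c \<noteq> 0 \<and> 1 / t < of_int (gcd (a + c) (b + c')))))
     \<le> avg (sym_int Y) (\<lambda>a. avg (sym_int Y) (\<lambda>b. \<Sum>g\<in>?K. ?i (int g dvd a + c) * ?i (int g dvd b + c')))"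
    by (intro avg_mono pt)
  also have "\<dots> = (\<Sum>g\<in>?K. avg (sym_int Y) (\<lambda>a. ?i (int g dvd a + c)) * avg (sym_int Y) (\<lambda>b. ?i (int g dvd b + c')))"
    unfolding avg_sum avg_mult_avg ..
  also have "\<dots> \<le> (\<Sum>g\<in>?K. 2 / real g * (2 / real g))"
  proof (intro sum_mono mult_mono)
    fix g assume "g \<in> ?K"
    then have g: "0 < int g" "int g \<le> 2 * int Y" by auto
    show "avg (sym_int Y) (\<lambda>a. ?i (int g dvd a + c)) \<le> 2 / real g" using avg_dvd_le[OF g, of c] by simp
    show "avg (sym_int Y) (\<lambda>b. ?i (int g dvd b + c')) \<le> 2 / real g" using avg_dvd_le[OF g, of c'] by simp
  qed (auto intro!: avg_nonneg)
  also have "\<dots> = (\<Sum>g\<in>?K. 4 / (real g)\<^sup>2)" by (simp add: power2_eq_square)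
  also have "\<dots> \<le> 4 / real G" by (rule sum_inverse_squares_le[OF G(2)])
  also have "\<dots> \<le> 4 / (1 / (2 * t))" using G t by (intro divide_left_mono) auto
  also have "\<dots> = 8 * t" by simp
  finally show ?thesis .
qed

lemma avg_short_interval_le:
  fixes t :: real
  assumes t: "1 \<le> 2 * t * Y" "0 < t"
  shows "avg (sym_int Y) (\<lambda>b. if \<bar>of_int (a + b)\<bar> < t * Y then 1 else 0 :: real) \<le> 2 * t"
proof -
  let ?M = "{b\<in>sym_int Y. \<bar>of_int (a + b)\<bar> < t * real Y}"
  have fin: "finite ?M" using sym_int_simps(1) by (rule finite_subset[rotated]) auto
  have "real (card ?M) \<le> 2 * (t * Y) + 1"
    by (rule card_abs_diff_le[OF fin, where c = "- of_int a"]) (use t in auto)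
  also have "\<dots> \<le> 2 * t * (2 * real Y + 1)" using t by (simp add: algebra_simps)
  finally show ?thesis by (simp add: avg_bool_card[OF sym_int_simps(1)] sym_int_simps(3) field_simps)
qed

lemma card_dir2_weight:
  fixes p w :: int and t \<eta> :: real
  assumes L: "0 < L" "real L \<le> 12 * (real Y)\<^sup>2" and Y: "0 < Y" and B: "t * Y \<le> B" "0 < B"
    and p: "t * Y \<le> \<bar>of_int p\<bar>" "\<bar>of_int p\<bar> \<le> 2 * real Y" and w: "\<bar>of_int w\<bar> \<le> 2 * real Y"
    and g: "of_int (gcd p w) \<le> 1 / t" and t: "0 < t" "t \<le> 1 / 2" and e: "0 < \<eta>" "\<eta> \<le> t"
    and wt: "\<And>m. wt m \<le> bias L (BB B) (dir2 (2 * p) (2 * w)) m"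
  shows "card {m\<in>ZL L. \<eta> / 2 \<le> wt m} \<le> (1 / \<eta>) ^ 40"
proof -
  define E where "E = 1 / \<eta>"
  have E2: "2 \<le> E" using e t by (simp add: E_def field_simps)
  have "card {m\<in>ZL L. \<eta> / 2 \<le> wt m} \<le> card {m\<in>ZL L. \<eta> / 2 \<le> bias L (BB B) (dir2 (2 * p) (2 * w)) m}"
    by (rule card_mono[OF finite_ZL_Collect]) (use wt order_trans in blast)
  also have "real \<dots> \<le> 2 ^ 12 / ((\<eta> / 2)\<^sup>2 * t ^ 4)"
    using e t by (intro card_dir2_large[OF L Y B p w g _ _ t]) auto
  also have "\<dots> \<le> 2 ^ 12 / ((\<eta> / 2)\<^sup>2 * \<eta> ^ 4)"
    using e t by (intro divide_left_mono mult_left_mono power_mono mult_pos_pos) auto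
  also have "\<dots> = 2 ^ 14 * E ^ 6" by (simp add: E_def power_divide power_one_over power_add[symmetric])
  also have "\<dots> \<le> E ^ 14 * E ^ 6" using E2 by (intro mult_right_mono power_mono) auto
  also have "\<dots> = E ^ 20" by (simp add: power_add[symmetric])
  also have "\<dots> \<le> E ^ 40" using E2 by (intro power_increasing) auto
  finally show ?thesis by (simp add: E_def)
qed

text \<open>Nondegeneracy bounds the number of frequencies at which the exponential sums along the first three
  directions are large; the last two directions only have this property on average over \<open>h\<close> and \<open>k\<close>.\<close>

definition nondeg :: "nat \<Rightarrow> real \<Rightarrow> int \<Rightarrow> int \<Rightarrow> int \<Rightarrow> int \<Rightarrow> bool" where
  "nondeg Y t h k h1 k1 \<longleftrightarrow> t * Y \<le> \<bar>of_int (h + k)\<bar> \<and> of_int (gcd (h + k) h1) \<le> 1 / t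
    \<and> of_int (gcd (h + k) k1) \<le> 1 / t \<and> of_int (gcd (h + k) (h1 + k1)) \<le> 1 / t"

abbreviation H4 :: "nat \<Rightarrow> ((int \<times> int) \<times> (int \<times> int)) set" where
  "H4 Y \<equiv> (sym_int Y \<times> sym_int Y) \<times> (sym_int Y \<times> sym_int Y)"

lemma avg_H4:
  "avg (H4 Y) (\<lambda>w. F (fst (fst w)) (snd (fst w)) (fst (snd w)) (snd (snd w)))
   = avg (sym_int Y) (\<lambda>h. avg (sym_int Y) (\<lambda>k. avg (sym_int Y) (\<lambda>h1. avg (sym_int Y) (\<lambda>k1. F h k h1 k1))))"
  using avg_Times[of "sym_int Y \<times> sym_int Y" "sym_int Y \<times> sym_int Y" "\<lambda>p q. F (fst p) (snd p) (fst q) (snd q)"]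
    avg_Times[of "sym_int Y" "sym_int Y" "\<lambda>h k. avg (sym_int Y \<times> sym_int Y) (\<lambda>q. F h k (fst q) (snd q))"]
    avg_Times[of "sym_int Y" "sym_int Y" "\<lambda>h1 k1. F h k h1 k1" for h k]
  by simp

text \<open>Union bound over one short interval and three gcd conditions. Freezing \<open>k\<close>,
  and also \<open>k1\<close> in the last condition, makes \<open>h + k\<close> and
  \<open>h1 + k1\<close> translates of the averaging variables, as \<open>avg_large_gcd_le\<close>
  requires.\<close>

lemma avg_degenerate_le:
  fixes t :: real
  assumes t: "0 < t" "t \<le> 1 / 2" "1 \<le> 2 * t * Y"
  shows "avg (H4 Y) (\<lambda>w. if nondeg Y t (fst (fst w)) (snd (fst w)) (fst (snd w)) (snd (snd w)) then 0 else 1 :: real) \<le> 32 * t"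
proof -
  let ?H = "sym_int Y"
  let ?i = "\<lambda>P. if P then 1 else 0 :: real"
  define S where "S h k = ?i (\<bar>of_int (h + k)\<bar> < t * Y)" for h k :: int
  define T where "T a b = ?i (a \<noteq> 0 \<and> 1 / t < of_int (gcd a b))" for a b :: int
  note sym_int = sym_int_simps(1,2)[of Y]
  have tY: "0 < t * Y" using t by (cases Y) auto
  have "avg (H4 Y) (\<lambda>w. if nondeg Y t (fst (fst w)) (snd (fst w)) (fst (snd w)) (snd (snd w)) then 0 else 1 :: real)
    \<le> avg (H4 Y) (\<lambda>w. S (fst (fst w)) (snd (fst w)) + (T (fst (fst w) + snd (fst w)) (fst (snd w))
       + (T (fst (fst w) + snd (fst w)) (snd (snd w)) + T (fst (fst w) + snd (fst w)) (fst (snd w) + snd (snd w)))))"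
  proof (rule avg_mono)
    fix w :: "(int \<times> int) \<times> (int \<times> int)"
    have "0 \<le> S h k" "0 \<le> T a b" for h k a b by (auto simp: S_def T_def)
    moreover have "h + k \<noteq> 0" if "\<not> \<bar>of_int (h + k)\<bar> < t * Y" for h k :: int using that tY by auto
    ultimately show "(if nondeg Y t (fst (fst w)) (snd (fst w)) (fst (snd w)) (snd (snd w)) then 0 else 1 :: real)
      \<le> S (fst (fst w)) (snd (fst w)) + (T (fst (fst w) + snd (fst w)) (fst (snd w))
       + (T (fst (fst w) + snd (fst w)) (snd (snd w)) + T (fst (fst w) + snd (fst w)) (fst (snd w) + snd (snd w))))"
      unfolding nondeg_def S_def T_def by (auto simp: not_le not_less)
  qed
  also have "\<dots> = avg ?H (\<lambda>h. avg ?H (\<lambda>k. avg ?H (\<lambda>h1. avg ?H (\<lambda>k1. S h k))))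
      + (avg ?H (\<lambda>h. avg ?H (\<lambda>k. avg ?H (\<lambda>h1. avg ?H (\<lambda>k1. T (h + k) h1))))
      + (avg ?H (\<lambda>h. avg ?H (\<lambda>k. avg ?H (\<lambda>h1. avg ?H (\<lambda>k1. T (h + k) k1))))
      + avg ?H (\<lambda>h. avg ?H (\<lambda>k. avg ?H (\<lambda>h1. avg ?H (\<lambda>k1. T (h + k) (h1 + k1)))))))"
    unfolding avg_H4[of Y "\<lambda>h k h1 k1. S h k + (T (h + k) h1 + (T (h + k) k1 + T (h + k) (h1 + k1)))"]
    unfolding avg_add ..
  also have "\<dots> \<le> 2 * t + (8 * t + (8 * t + 8 * t))"
  proof (intro add_mono)
    have T: "avg ?H (\<lambda>h. avg ?H (\<lambda>b. T (h + k) (b + c))) \<le> 8 * t" if "k \<in> ?H" for k c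
      unfolding T_def using that by (intro avg_large_gcd_le t) (auto simp: sym_int_def)
    show "avg ?H (\<lambda>h. avg ?H (\<lambda>k. avg ?H (\<lambda>h1. avg ?H (\<lambda>k1. S h k)))) \<le> 2 * t"
      unfolding avg_const[OF sym_int] S_def
      by (rule avg_le_const, rule avg_short_interval_le) (use t in auto)
    show "avg ?H (\<lambda>h. avg ?H (\<lambda>k. avg ?H (\<lambda>h1. avg ?H (\<lambda>k1. T (h + k) h1)))) \<le> 8 * t"
      unfolding avg_const[OF sym_int]
    proof (subst avg_swap, rule avg_le_const)
      show "avg ?H (\<lambda>h. avg ?H (\<lambda>b. T (h + k) b)) \<le> 8 * t" if "k \<in> ?H" for k
        using T[OF that, of 0] by simp
    qed (use t in auto)
    show "avg ?H (\<lambda>h. avg ?H (\<lambda>k. avg ?H (\<lambda>h1. avg ?H (\<lambda>k1. T (h + k) k1)))) \<le> 8 * t"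
      unfolding avg_const[OF sym_int]
    proof (subst avg_swap, rule avg_le_const)
      show "avg ?H (\<lambda>h. avg ?H (\<lambda>b. T (h + k) b)) \<le> 8 * t" if "k \<in> ?H" for k
        using T[OF that, of 0] by simp
    qed (use t in auto)
    have "avg ?H (\<lambda>h. avg ?H (\<lambda>k. avg ?H (\<lambda>h1. avg ?H (\<lambda>k1. T (h + k) (h1 + k1)))))
       = avg ?H (\<lambda>k. avg ?H (\<lambda>h. avg ?H (\<lambda>k1. avg ?H (\<lambda>h1. T (h + k) (h1 + k1)))))"
      by (subst avg_swap) (intro avg_cong refl avg_swap)
    also have "\<dots> = avg ?H (\<lambda>k. avg ?H (\<lambda>k1. avg ?H (\<lambda>h. avg ?H (\<lambda>h1. T (h + k) (h1 + k1)))))"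
      by (rule avg_cong[OF refl], rule avg_swap)
    also have "\<dots> \<le> 8 * t"
      by (rule avg_le_const, rule avg_le_const, rule T) (use t in auto)
    finally show "avg ?H (\<lambda>h. avg ?H (\<lambda>k. avg ?H (\<lambda>h1. avg ?H (\<lambda>k1. T (h + k) (h1 + k1))))) \<le> 8 * t" .
  qed
  also have "\<dots> \<le> 32 * t" using t by simp
  finally show ?thesis .
qed

text \<open>The directions with two coefficients go first, since for them
  \<open>card_dir2_weight\<close> works one quadruple at a time. By \<open>bias_diff_dir\<close> the
  bound for the original direction remains valid on every doubled index set.\<close>

lemma lowering_chain:
  fixes t \<eta> :: real
  assumes L: "0 < L" "real L \<le> 12 * (real Y)\<^sup>2" and Y: "0 < Y" and g: "per L g1" "per L g2" "bd g1" "bd g2"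
    and B: "t * Y \<le> B" "0 < B" and t: "0 < t" "t \<le> 1 / 2" and e: "0 < \<eta>" "\<eta> \<le> t"
    and eY: "(1 / \<eta>) ^ (step_exp 4 * step_exp 3 * step_exp 2) \<le> Y"
    and nd: "nondeg Y t h k h1 k1" and hk: "h \<in> sym_int Y" "k \<in> sym_int Y" "h1 \<in> sym_int Y" "k1 \<in> sym_int Y"
    and big: "\<eta> \<le> energy L (BB B \<times> BB B) (map diff_dir (dirs h k h1 k1)) (dual Y g1 g2)"
  defines "J1 \<equiv> BB B \<times> BB B"
  defines "J2 \<equiv> J1 \<times> J1"
  defines "J3 \<equiv> J2 \<times> J2"
  defines "J4 \<equiv> J3 \<times> J3"
  shows "\<eta> ^ (step_exp 4 * step_exp 3 * step_exp 2) \<le> energy L J4 [diff_dir (diff_dir (diff_dir (diff_dir (dir1 (2 * h))))), diff_dir (diff_dir (diff_dir (diff_dir (dir1 (2 * k)))))] (dual Y g1 g2)"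
proof -
  let ?D = "dual Y g1 g2"
  let ?G1 = "dir2 (2 * (h + k)) (2 * h1)" and ?G2 = "dir2 (2 * (h + k)) (2 * k1)" and ?G3 = "dir2 (2 * (h + k)) (2 * (h1 + k1))"
  let ?A = "dir1 (2 * h)" and ?A' = "dir1 (2 * k)"
  have J: "finite J1" "J1 \<noteq> {}" "finite J2" "J2 \<noteq> {}" "finite J3" "J3 \<noteq> {}"
    using B by (auto simp: J1_def J2_def J3_def)
  have s1: "1 \<le> step_exp d" for d by (simp add: step_exp_def low_exp_def Suc_le_eq)
  have absY: "\<bar>of_int (a + b)\<bar> \<le> 2 * real Y" if "a \<in> sym_int Y" "b \<in> sym_int Y" for a b :: int
    using that by (auto simp: sym_int_def abs_le_iff)
  have abs1: "\<bar>of_int a\<bar> \<le> 2 * real Y" if "a \<in> sym_int Y" for a :: int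
    using that by (auto simp: sym_int_def abs_le_iff)
  have p: "t * Y \<le> \<bar>of_int (h + k)\<bar>" "\<bar>of_int (h + k)\<bar> \<le> 2 * real Y" using nd absY[OF hk(1,2)] by (auto simp: nondeg_def)
  note K = card_dir2_weight[OF L Y B p _ _ t]
  have pow: "\<eta> ^ a \<le> \<eta>" "\<eta> ^ a \<le> t" "\<eta> ^ a \<le> 1 / 2" "0 < \<eta> ^ a" if "1 \<le> a" for a
  proof -
    have "\<eta> ^ a \<le> \<eta> ^ 1" using that e t by (intro power_decreasing) auto
    then show "\<eta> ^ a \<le> \<eta>" "\<eta> ^ a \<le> t" "\<eta> ^ a \<le> 1 / 2" using e t by auto
    show "0 < \<eta> ^ a" using e by simp
  qed
  have inv1: "1 \<le> 1 / \<eta>" using e t by simp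
  have Yb: "(1 / \<eta> ^ a) ^ step_exp d \<le> Y" if "a * step_exp d \<le> step_exp 4 * step_exp 3 * step_exp 2" for a d
  proof -
    have "(1 / \<eta> ^ a) ^ step_exp d = (1 / \<eta>) ^ (a * step_exp d)" by (simp only: power_mult power_one_over)
    also have "\<dots> \<le> (1 / \<eta>) ^ (step_exp 4 * step_exp 3 * step_exp 2)" using that inv1 by (intro power_increasing)
    finally show ?thesis using eY by linarith
  qed
  have st: "1 * step_exp 4 \<le> step_exp 4 * step_exp 3 * step_exp 2" "step_exp 4 * step_exp 3 \<le> step_exp 4 * step_exp 3 * step_exp 2"
    using mult_le_mono[of 1 "step_exp 3" 1 "step_exp 2"] s1[of 3] s1[of 2] by auto
  have M5: "\<eta> ^ 1 \<le> energy L J1 [diff_dir ?G1, diff_dir ?G2, diff_dir ?G3, diff_dir ?A, diff_dir ?A'] ?D"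
    using big by (simp add: dirs_eq J1_def)
  have "(\<eta> ^ 1) ^ step_exp 4 \<le> energy L (J1 \<times> J1) (map diff_dir [diff_dir ?G2, diff_dir ?G3, diff_dir ?A, diff_dir ?A']) ?D"
  proof (rule lowering_step[OF L g _ _ J(1,2) _ _ _ _ M5])
    show "card {m\<in>ZL L. \<eta> ^ 1 / 2 \<le> bias L J1 (diff_dir ?G1) m} \<le> (1 / \<eta> ^ 1) ^ 40"
      using nd e abs1[OF hk(3)] by (intro K[where w = h1]) (auto simp: nondeg_def J1_def bias_diff_dir)
  qed (use e t Yb[OF st(1)] in auto)
  then have M4: "\<eta> ^ step_exp 4 \<le> energy L J2 [diff_dir (diff_dir ?G2), diff_dir (diff_dir ?G3), diff_dir (diff_dir ?A), diff_dir (diff_dir ?A')] ?D"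
    by (simp add: J2_def)
  have "(\<eta> ^ step_exp 4) ^ step_exp 3 \<le> energy L (J2 \<times> J2) (map diff_dir [diff_dir (diff_dir ?G3), diff_dir (diff_dir ?A), diff_dir (diff_dir ?A')]) ?D"
  proof (rule lowering_step[OF L g _ _ J(3,4) _ _ _ _ M4])
    show "card {m\<in>ZL L. \<eta> ^ step_exp 4 / 2 \<le> bias L J2 (diff_dir (diff_dir ?G2)) m} \<le> (1 / \<eta> ^ step_exp 4) ^ 40"
      using nd pow[OF s1] abs1[OF hk(4)] 
      by (intro K[where w = k1]) (auto simp: nondeg_def J2_def J1_def intro: order_trans[OF bias_diff_dir bias_diff_dir])
  qed (use pow[OF s1] Yb[OF st(2)] in auto)
  then have M3: "\<eta> ^ (step_exp 4 * step_exp 3) \<le> energy L J3 [diff_dir (diff_dir (diff_dir ?G3)), diff_dir (diff_dir (diff_dir ?A)), diff_dir (diff_dir (diff_dir ?A'))] ?D"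
    by (simp add: J3_def power_mult)
  have s43: "1 \<le> step_exp 4 * step_exp 3" using s1[of 4] s1[of 3] by (metis mult_le_mono mult_1)
  have "(\<eta> ^ (step_exp 4 * step_exp 3)) ^ step_exp 2 \<le> energy L (J3 \<times> J3) (map diff_dir [diff_dir (diff_dir (diff_dir ?A)), diff_dir (diff_dir (diff_dir ?A'))]) ?D"
  proof (rule lowering_step[OF L g _ _ J(5,6) _ _ _ _ M3])
    show "card {m\<in>ZL L. \<eta> ^ (step_exp 4 * step_exp 3) / 2 \<le> bias L J3 (diff_dir (diff_dir (diff_dir ?G3))) m} \<le> (1 / \<eta> ^ (step_exp 4 * step_exp 3)) ^ 40"
      using nd pow[OF s43] absY[OF hk(3,4)] 
      by (intro K[where w = "h1 + k1"]) (auto simp: nondeg_def J3_def J2_def J1_def intro: order_trans[OF bias_diff_dir order_trans[OF bias_diff_dir bias_diff_dir]])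
  qed (use pow[OF s43] Yb[OF order_refl] in auto)
  then show ?thesis by (simp add: J4_def power_mult)
qed

text \<open>To profit from the average over \<open>h\<close>, the variable \<open>h\<close> is made
  part of the index, and \<open>lowering_step\<close> removes the resulting direction
  \<open>a\<close>. In the single direction left, \<open>k\<close> is likewise made part of the
  index, and \<open>removal\<close> bounds the average by the largest Fourier coefficient.\<close>

lemma final_descent:
  fixes P :: "int \<Rightarrow> 'j \<Rightarrow> int" and t \<zeta> :: real
  assumes L: "0 < L" "real L \<le> 12 * (real Y)\<^sup>2" and Y: "0 < Y" and g: "per L g1" "per L g2" "bd g1" "bd g2"
    and B: "t * Y \<le> B" "0 < B" and J: "finite J" "J \<noteq> {}"
    and P: "\<And>h m. bias L J (P h) m \<le> bias L (BB B) (dir1 (2 * h)) m"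
    and e: "0 < \<zeta>" "\<zeta> \<le> 1 / 2" "\<zeta> \<le> t" "(1 / \<zeta>) ^ (20 * (step_exp 1 + 1)) \<le> Y"
    and big: "2 * \<zeta> \<le> avg (sym_int Y) (\<lambda>h. avg (sym_int Y) (\<lambda>k. energy L J [P h, P k] (dual Y g1 g2)))"
  shows "\<exists>m. \<zeta> ^ (42 * (step_exp 1 + 1)) \<le> cmod (ft L (dual Y g1 g2) m)"
proof -
  let ?D = "dual Y g1 g2" and ?H = "sym_int Y"
  have D: "per L ?D" "bd ?D" using per_dual bd_dual g by auto
  note sym_int = sym_int_simps(1,2)[of Y]
  define I where "I = ?H \<times> J"
  have I: "finite I" "I \<noteq> {}" using J sym_int by (auto simp: I_def)
  define a where "a p = P (fst p) (snd p)" for p :: "int \<times> 'j"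
  \<comment> \<open>The first coordinate is ignored, so that \<open>b k\<close> lives on the same
    index set as \<open>a\<close> without changing its averages.\<close>
  define b where "b k p = P k (snd p)" for k and p :: "int \<times> 'j"
  define M where "M k = energy L I [a, b k] ?D" for k
  have M_eq: "M k = avg ?H (\<lambda>h. energy L J [P h, P k] ?D)" for k
  proof -
    define F where "F h j j' = (cmod (avg (ZL L) (mult_diff [P h, P k] [j, j'] ?D)))\<^sup>2" for h j j'
    have dlF: "(cmod (avg (ZL L) (mult_diff [a, b k] [p, q] ?D)))\<^sup>2 = F (fst p) (snd p) (snd q)" for p q
    proof -
      have "mult_diff [a, b k] [p, q] ?D = mult_diff [P (fst p), P k] [snd p, snd q] ?D"
        by (rule ext) (simp add: a_def b_def)
      then show ?thesis by (simp only: F_def)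
    qed
    have "M k = avg I (\<lambda>p. avg I (\<lambda>q. F (fst p) (snd p) (snd q)))"
      unfolding M_def energy_def by (simp only: list.size add_0_right add_Suc_right avg_tup_Suc avg_tup_0 dlF)
    also have "\<dots> = avg I (\<lambda>p. avg J (\<lambda>j'. F (fst p) (snd p) j'))"
      unfolding I_def using avg_Times[of ?H J "\<lambda>h j'. F h' j j'" for h' j] by (simp add: avg_const[OF sym_int])
    also have "\<dots> = avg ?H (\<lambda>h. avg J (\<lambda>j. avg J (\<lambda>j'. F h j j')))"
      unfolding I_def by (rule avg_Times)
    finally show ?thesis
      unfolding energy_def F_def by (simp only: list.size add_0_right add_Suc_right avg_tup_Suc avg_tup_0)
  qed
  have M1: "M k \<le> 1" for k
    unfolding M_def energy_def
    by (intro avg_le_const power_le_one norm_avg_le_const) (use bd_mult_diff[OF D(2)] in \<open>auto simp: bd_def\<close>)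
  have "2 * \<zeta> \<le> avg ?H M" using big unfolding M_eq by (subst avg_swap)
  then have dens: "2 * \<zeta> / 2 * card ?H \<le> card {k\<in>?H. 2 * \<zeta> / 2 \<le> M k}"
    using sym_int M1 e by (intro dense_of_avg) auto
  have inv1: "1 \<le> 1 / \<zeta>" using e by simp
  have s1: "1 \<le> step_exp 1" by (simp add: step_exp_def low_exp_def Suc_le_eq)
  have Yb: "(1 / \<zeta>) ^ c \<le> Y" if "c \<le> 20 * (step_exp 1 + 1)" for c
    using power_increasing[OF that inv1] e(4) by linarith
  have lwa: "bias L I a m \<le> avg ?H (\<lambda>h. bias L (BB B) (dir1 (2 * h)) m)" for m
  proof -
    have "avg I (\<lambda>p. ch L m (a p)) = avg ?H (\<lambda>h. avg J (\<lambda>j. ch L m (P h j)))"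
      unfolding I_def a_def by (rule avg_Times)
    then have "bias L I a m \<le> avg ?H (\<lambda>h. bias L J (P h) m)" by (simp add: bias_def norm_avg_le)
    also have "\<dots> \<le> avg ?H (\<lambda>h. bias L (BB B) (dir1 (2 * h)) m)" by (intro avg_mono P)
    finally show ?thesis .
  qed
  define N where "N k = energy L (I \<times> I) [diff_dir (b k)] ?D" for k
  have N0: "0 \<le> N k" for k unfolding N_def energy_def by (rule avg_nonneg) simp
  have N: "\<zeta> ^ step_exp 1 \<le> N k" if "\<zeta> \<le> M k" for k
  proof -
    have "\<zeta> ^ step_exp 1 \<le> energy L (I \<times> I) (map diff_dir [b k]) ?D"
    proof (rule lowering_step[OF L g _ _ I e(1,2)])
      show "card {m\<in>ZL L. \<zeta> / 2 \<le> bias L I a m} \<le> (1 / \<zeta>) ^ 40"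
        by (rule card_dir1_average[OF L B e(3,1,2) _ lwa]) (rule Yb, simp)
      show "(1 / \<zeta>) ^ step_exp 1 \<le> Y" by (rule Yb) simp
    qed (use that in \<open>auto simp: M_def\<close>)
    then show ?thesis by (simp add: N_def)
  qed
  define \<xi> where "\<xi> = \<zeta> ^ (step_exp 1 + 1)"
  have "\<xi> = \<zeta> * \<zeta> ^ step_exp 1" by (simp add: \<xi>_def)
  also have "\<dots> \<le> avg ?H N"
    by (rule avg_ge_of_dense[OF sym_int, where B = "{k\<in>?H. \<zeta> \<le> M k}"]) (use dens N N0 e in auto)
  finally have \<xi>: "\<xi> \<le> avg ?H N" .
  have \<xi>e: "0 < \<xi>" "\<xi> \<le> \<zeta>"
    using e power_decreasing[of 1 "step_exp 1 + 1" \<zeta>] by (auto simp: \<xi>_def)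
  define C where "C p = diff_dir (b (fst p)) (snd p)" for p :: "int \<times> ((int \<times> 'j) \<times> (int \<times> 'j))"
  have "avg ?H N = avg ?H (\<lambda>k. avg (I \<times> I) (\<lambda>q. (cmod (avg (ZL L) (\<lambda>x. ?D x * cnj (?D (x + diff_dir (b k) q)))))\<^sup>2))"
  proof -
    have "mult_diff [diff_dir (b k)] [q] ?D = (\<lambda>x. ?D x * cnj (?D (x + diff_dir (b k) q)))" for k q by (rule ext) simp
    then show ?thesis unfolding N_def energy_def by (simp add: avg_tup_Suc avg_tup_0)
  qed
  also have "\<dots> = avg (?H \<times> (I \<times> I)) (\<lambda>p. (cmod (avg (ZL L) (\<lambda>x. ?D x * cnj (?D (x + C p)))))\<^sup>2)"
    unfolding C_def by (rule avg_Times[symmetric])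
  finally have NC: "avg ?H N = avg (?H \<times> (I \<times> I)) (\<lambda>p. (cmod (avg (ZL L) (\<lambda>x. ?D x * cnj (?D (x + C p)))))\<^sup>2)" .
  have lwC: "bias L (?H \<times> (I \<times> I)) C m \<le> avg ?H (\<lambda>h. bias L (BB B) (dir1 (2 * h)) m)" for m
  proof -
    have "avg (?H \<times> (I \<times> I)) (\<lambda>p. ch L m (C p)) = avg ?H (\<lambda>k. avg (I \<times> I) (\<lambda>q. ch L m (diff_dir (b k) q)))"
      unfolding C_def by (rule avg_Times)
    then have "bias L (?H \<times> (I \<times> I)) C m \<le> avg ?H (\<lambda>k. bias L (I \<times> I) (diff_dir (b k)) m)" by (simp add: bias_def norm_avg_le)
    also have "\<dots> \<le> avg ?H (\<lambda>k. bias L (BB B) (dir1 (2 * k)) m)"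
    proof (rule avg_mono)
      fix k
      have "avg I (\<lambda>p. ch L m (b k p)) = avg J (\<lambda>j. ch L m (P k j))"
        unfolding I_def b_def using avg_Times[of ?H J "\<lambda>h j. ch L m (P k j)"] by (simp add: avg_const[OF sym_int])
      then have "bias L I (b k) m = bias L J (P k) m" by (simp add: bias_def)
      then show "bias L (I \<times> I) (diff_dir (b k)) m \<le> bias L (BB B) (dir1 (2 * k)) m" using bias_diff_dir[of L I "b k" m] P[of k m] by linarith
    qed
    finally show ?thesis .
  qed
  have K: "card {m\<in>ZL L. \<xi> / 2 \<le> bias L (?H \<times> (I \<times> I)) C m} \<le> (1 / \<xi>) ^ 40"
  proof (rule card_dir1_average[OF L B _ \<xi>e(1) _ _ lwC])
    have "(1 / \<xi>) ^ 20 = (1 / \<zeta>) ^ (20 * (step_exp 1 + 1))" by (simp only: \<xi>_def power_one_over power_mult[symmetric] mult.commute)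
    then show "(1 / \<xi>) ^ 20 \<le> Y" using e(4) by simp
  qed (use \<xi>e e in auto)
  show ?thesis
  \<comment> \<open>If all coefficients were below \<open>\<xi> ^ 42\<close>, then
    \<open>removal\<close> would bound the average of \<open>N\<close> by
    \<open>\<xi> / 2 + \<xi> ^ 84 * (1 / \<xi>) ^ 40\<close>, which is less than \<xi>.\<close>
  proof (rule ccontr)
    assume neg: "\<not> ?thesis"
    have "avg ?H N \<le> \<xi> / 2 + (\<zeta> ^ (42 * (step_exp 1 + 1)))\<^sup>2 * (1 / \<xi>) ^ 40"
      unfolding NC
    proof (rule removal[OF L(1) D _ K[unfolded bias_def]])
      show "(cmod (ft L ?D k))\<^sup>2 \<le> (\<zeta> ^ (42 * (step_exp 1 + 1)))\<^sup>2" for k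
        using neg by (intro power_mono) (auto simp: not_le less_imp_le)
    qed (use \<xi>e in auto)
    also have "(\<zeta> ^ (42 * (step_exp 1 + 1)))\<^sup>2 = \<xi> ^ 42 * \<xi> ^ 42"
      by (simp only: \<xi>_def power_mult[symmetric] power2_eq_square mult.commute)
    also have "\<xi> ^ 42 * \<xi> ^ 42 * (1 / \<xi>) ^ 40 = \<xi> ^ 44"
      using \<xi>e by (simp add: power_one_over power_add[symmetric] field_simps)
    finally have "avg ?H N \<le> \<xi> / 2 + \<xi> ^ 44" .
    moreover have "\<xi> ^ 44 \<le> \<xi> ^ 3" using \<xi>e e by (intro power_decreasing) auto
    moreover have "\<xi> ^ 3 \<le> \<xi> * (1 / 2 * (1 / 2))"
      unfolding power3_eq_cube mult.assoc using \<xi>e e by (intro mult_left_mono mult_mono) auto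
    ultimately show False using \<xi> \<xi>e(1) by linarith
  qed
qed

definition box_exp :: nat where "box_exp = 610 + 1218 * (step_exp 4 * step_exp 3 * step_exp 2)"
definition dual_exp :: nat where "dual_exp = 42 * (step_exp 1 + 1) * (box_exp + 1)"

lemma length_dirs: "length (dirs h k h1 k1) = 5" by (simp add: dirs_def)

lemma energy_ge_Box:
  "(Box L B f h k h1 k1)\<^sup>2 \<le> energy L (BB B \<times> BB B) (map diff_dir (dirs h k h1 k1)) f"
proof -
  let ?T = "tup 5 (BB B \<times> BB B)" and ?z = "\<lambda>p. avg (ZL L) (mult_diff (map diff_dir (dirs h k h1 k1)) p f)"
  have "\<bar>Box L B f h k h1 k1\<bar> \<le> cmod (avg ?T ?z)" unfolding Box_def by (rule abs_Re_le_cmod)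
  also have "\<dots> \<le> avg ?T (\<lambda>p. cmod (?z p))" by (rule norm_avg_le)
  finally have "\<bar>Box L B f h k h1 k1\<bar>\<^sup>2 \<le> (avg ?T (\<lambda>p. cmod (?z p)))\<^sup>2" by (intro power_mono) auto
  also have "\<dots> \<le> avg ?T (\<lambda>p. (cmod (?z p))\<^sup>2)" by (rule avg_square_le)
  finally show ?thesis
    unfolding energy_def by (simp add: length_dirs)
qed

lemma Box_le_one: "bd f \<Longrightarrow> Box L B f h k h1 k1 \<le> 1"
proof -
  assume f: "bd f"
  have "Box L B f h k h1 k1 \<le> cmod (avg (tup 5 (BB B \<times> BB B)) (\<lambda>p. avg (ZL L) (mult_diff (map diff_dir (dirs h k h1 k1)) p f)))"
    unfolding Box_def by (rule complex_Re_le_cmod)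
  also have "\<dots> \<le> 1" by (intro norm_avg_le_const) (use bd_mult_diff[OF f] in \<open>auto simp: bd_def\<close>)
  finally show ?thesis .
qed

text \<open>The first three directions are dropped for individual quadruples, the last two on
  average. The lower bounds on the dense set \<open>X'\<close> are therefore averaged again after
  \<open>lowering_chain\<close>; elsewhere \<open>energy\<close> is nonnegative.\<close>

lemma dual_large_coefficient:
  fixes \<delta> :: real
  assumes L: "0 < L" "real L \<le> 12 * (real Y)\<^sup>2" and f: "per L f1" "per L f2" "bd f1" "bd f2"
    and g: "per L g1" "per L g2" "bd g1" "bd g2"
    and d: "0 < \<delta>" "\<delta> \<le> 1 / 2" "(1 / \<delta>) ^ dual_exp \<le> Y"
    and big: "\<delta> \<le> cmod (Lam L Y f1 f2 (dual Y g1 g2))"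
  shows "\<exists>m. \<delta> ^ dual_exp \<le> cmod (ft L (dual Y g1 g2) m)"
proof -
  let ?D = "dual Y g1 g2"
  have D: "per L ?D" "bd ?D" using per_dual bd_dual g by auto
  have s1: "1 \<le> step_exp d" for d by (simp add: step_exp_def low_exp_def Suc_le_eq)
  define N where "N = step_exp 4 * step_exp 3 * step_exp 2"
  have N1: "1 \<le> N" unfolding N_def using s1 by (metis mult_le_mono mult_1)
  have ke: "1218 * N \<le> dual_exp" "20 * (step_exp 1 + 1) * (box_exp + 1) \<le> dual_exp" "616 \<le> dual_exp" "24 \<le> dual_exp"
  proof -
    have "box_exp + 1 \<le> dual_exp" unfolding dual_exp_def using mult_le_mono1[of 1 "42 * (step_exp 1 + 1)" "box_exp + 1"] by simp
    then show "1218 * N \<le> dual_exp" "616 \<le> dual_exp" "24 \<le> dual_exp" using N1 by (auto simp: box_exp_def N_def[symmetric])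
    show "20 * (step_exp 1 + 1) * (box_exp + 1) \<le> dual_exp" unfolding dual_exp_def by (intro mult_le_mono1) simp
  qed
  define E where "E = 1 / \<delta>"
  have E2: "2 \<le> E" and Ed: "\<delta> = 1 / E" using d by (auto simp: E_def field_simps)
  have E1: "1 \<le> E" and E0: "0 < E" using E2 by auto
  have EY: "E ^ a \<le> Y" if "a \<le> dual_exp" for a using power_increasing[OF that E1] d(3) by (simp add: E_def)
  have Y0: "0 < real Y" using EY[of 0] by simp
  then have Y: "0 < Y" by simp
  have dp: "\<delta> ^ b \<le> \<delta> ^ a" if "a \<le> b" for a b using that d by (intro power_decreasing) auto
  have d2: "2 ^ k * \<delta> ^ (k + a) \<le> \<delta> ^ a" for k a
  proof -
    have "2 ^ k * \<delta> ^ (k + a) = (2 * \<delta>) ^ k * \<delta> ^ a" by (simp add: power_add power_mult_distrib)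
    also have "\<dots> \<le> 1 * \<delta> ^ a" using d by (intro mult_right_mono power_le_one) auto
    finally show ?thesis by simp
  qed
  have dY: "1 \<le> \<delta> ^ a * Y" if "a \<le> dual_exp" for a
    using EY[OF that] E0 by (simp add: Ed power_one_over field_simps)
  \<comment> \<open>29160 is 20 times 1458, which makes the error \<open>20 * B / Y\<close> in
    \<open>linearization\<close> admissible.\<close>
  define B where "B = nat \<lfloor>\<delta> ^ 8 / 29160 * Y\<rfloor>"
  have Bu: "real B \<le> \<delta> ^ 8 / 29160 * Y" unfolding B_def by (rule of_nat_floor) (use d in simp)
  have Bl: "\<delta> ^ 24 * Y \<le> B"
  proof -
    have "32768 * \<delta> ^ 23 \<le> \<delta> ^ 8" using d2[of 15 8] by simp
    moreover have "0 \<le> \<delta> ^ 23" using d by simp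
    ultimately have "\<delta> ^ 23 \<le> \<delta> ^ 8 / 29160" by linarith
    then have "\<delta> ^ 23 * Y \<le> \<delta> ^ 8 / 29160 * Y" by (intro mult_right_mono) auto
    moreover have "2 * (\<delta> ^ 24 * Y) \<le> \<delta> ^ 23 * Y" using d2[of 1 23] Y0 by (simp add: mult.assoc[symmetric])
    moreover have "\<delta> ^ 8 / 29160 * Y - 1 < B" using real_nat_ceiling_ge[of "\<delta> ^ 8 / 29160 * Y - 1"] unfolding B_def by linarith
    ultimately show ?thesis using dY[OF ke(4)] by linarith
  qed
  then have B0: "0 < B" using dY[OF ke(4)] by (cases B) auto
  have "20 * B / Y \<le> 20 * (\<delta> ^ 8 / 29160 * Y) / Y" unfolding of_nat_mult of_nat_numeral by (rule divide_right_mono[OF mult_left_mono[OF Bu]]) auto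
  also have "\<dots> = \<delta> ^ 8 / 1458" using Y0 by simp
  finally have BY: "20 * B / Y \<le> \<delta> ^ 8 / 1458" .
  let ?Bx = "\<lambda>w. Box L B ?D (fst (fst w)) (snd (fst w)) (fst (snd w)) (snd (snd w))"
  \<comment> \<open>1458 is below \<open>2 ^ 11\<close>, so 8 grows to 19, and 608 is 32 times
    19.\<close>
  have "\<delta> ^ 608 = (\<delta> ^ 19) ^ 32" by (simp add: power_mult[symmetric])
  also have "\<dots> \<le> (\<delta> ^ 8 / 1458) ^ 32"
  proof (intro power_mono)
    have "2048 * \<delta> ^ 19 \<le> \<delta> ^ 8" using d2[of 11 8] by simp
    moreover have "0 \<le> \<delta> ^ 19" using d by simp
    ultimately show "\<delta> ^ 19 \<le> \<delta> ^ 8 / 1458" by linarith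
  qed (use d in auto)
  also have "\<dots> \<le> avg (H4 Y) ?Bx"
    by (rule linearization[OF L(1) f(2) D(1) f(3,4) D(2) Y B0 d(1) big BY])
  finally have avB: "\<delta> ^ 608 \<le> avg (H4 Y) ?Bx" .
  have fO: "finite (H4 Y)" "H4 Y \<noteq> {}" using sym_int_simps by auto
  define n where "n = real (card (H4 Y))"
  have n0: "0 < n" using fO by (simp add: n_def card_gt_0_iff)
  define X where "X = {w\<in>H4 Y. \<delta> ^ 608 / 2 \<le> ?Bx w}"
  have Xd: "\<delta> ^ 608 / 2 * n \<le> card X"
    unfolding X_def n_def by (rule dense_of_avg[OF fO _ avB]) (use Box_le_one[OF D(2)] d in auto)
  \<comment> \<open>The density \<open>32 * t\<close> of degenerate quadruples is then at most
    \<open>\<delta> ^ 611\<close>, well below the density \<open>\<delta> ^ 608 / 2\<close> of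
    \<open>X\<close>.\<close>
  define t where "t = \<delta> ^ 616"
  have t: "0 < t" "t \<le> 1 / 2" using d dp[of 1 616] by (auto simp: t_def)
  have tY: "1 \<le> 2 * t * Y" using dY[OF ke(3)] by (simp add: t_def)
  let ?nd = "\<lambda>w. nondeg Y t (fst (fst w)) (snd (fst w)) (fst (snd w)) (snd (snd w))"
  define Z where "Z = {w\<in>H4 Y. \<not> ?nd w}"
  have "real (card Z) / n = avg (H4 Y) (\<lambda>w. if \<not> ?nd w then 1 else 0)"
    unfolding Z_def n_def by (rule avg_bool_card[OF fO(1), symmetric])
  also have "\<dots> = avg (H4 Y) (\<lambda>w. if ?nd w then 0 else 1)" by (rule avg_cong) auto
  also have "\<dots> \<le> 32 * t" by (rule avg_degenerate_le[OF t tY])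
  also have "\<dots> \<le> \<delta> ^ 611" using d2[of 5 611] by (simp add: t_def)
  finally have Zd: "card Z \<le> \<delta> ^ 611 * n" using n0 by (simp add: field_simps)
  define X' where "X' = X - Z"
  have fX: "finite X" "finite Z" using fO by (auto simp: X_def Z_def)
  have X'd: "\<delta> ^ 610 * n \<le> card X'"
  proof -
    have "card X \<le> card (X' \<union> Z)" using fX by (intro card_mono) (auto simp: X'_def)
    also have "\<dots> \<le> card X' + card Z" by (rule card_Un_le)
    finally have "real (card X) \<le> card X' + real (card Z)" by linarith
    moreover have "4 * \<delta> ^ 610 * n \<le> \<delta> ^ 608 * n" using d2[of 2 608] n0 by (intro mult_right_mono) auto
    moreover have "2 * \<delta> ^ 611 * n \<le> \<delta> ^ 610 * n" using d2[of 1 610] n0 by (intro mult_right_mono) auto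
    ultimately show ?thesis using Xd Zd n0 by linarith
  qed
  define J1 where "J1 = BB B \<times> BB B"
  define J2 where "J2 = J1 \<times> J1"
  define J3 where "J3 = J2 \<times> J2"
  define J4 where "J4 = J3 \<times> J3"
  define P where "P h = diff_dir (diff_dir (diff_dir (diff_dir (dir1 (2 * h)))))" for h
  have J4: "finite J4" "J4 \<noteq> {}" using B0 by (auto simp: J1_def J2_def J3_def J4_def)
  have lwP: "bias L J4 (P h) m \<le> bias L (BB B) (dir1 (2 * h)) m" for h m
    unfolding P_def J4_def J3_def J2_def J1_def
    by (rule order_trans[OF bias_diff_dir order_trans[OF bias_diff_dir order_trans[OF bias_diff_dir bias_diff_dir]]])
  let ?M = "\<lambda>h k. energy L J4 [P h, P k] ?D"
  \<comment> \<open>On \<open>X'\<close> the value of \<open>Box\<close> is at least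
    \<open>\<delta> ^ 609\<close>, and \<open>energy\<close> is at least its square.\<close>
  define \<eta> where "\<eta> = \<delta> ^ 1218"
  have \<eta>: "0 < \<eta>" "\<eta> \<le> t" using d dp[of 616 1218] by (auto simp: \<eta>_def t_def)
  have tB: "t * Y \<le> B" unfolding t_def
    by (rule order_trans[OF mult_right_mono[OF dp[of 24 616]] Bl]) auto
  have low_exp: "\<eta> ^ N \<le> ?M (fst (fst w)) (snd (fst w))" if w: "w \<in> X'" for w
  proof -
    have wH: "w \<in> H4 Y" and nd: "?nd w" and box_diff: "\<delta> ^ 608 / 2 \<le> ?Bx w" using w by (auto simp: X'_def X_def Z_def)
    have "\<eta> = (\<delta> ^ 609)\<^sup>2" by (simp add: \<eta>_def power_mult[symmetric])
    also have "\<dots> \<le> (?Bx w)\<^sup>2" using box_diff d2[of 1 608] d by (intro power_mono) auto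
    also have "\<dots> \<le> energy L (BB B \<times> BB B) (map diff_dir (dirs (fst (fst w)) (snd (fst w)) (fst (snd w)) (snd (snd w)))) ?D"
      by (rule energy_ge_Box)
    finally have M5: "\<eta> \<le> energy L (BB B \<times> BB B) (map diff_dir (dirs (fst (fst w)) (snd (fst w)) (fst (snd w)) (snd (snd w)))) ?D" .
    have "(1 / \<eta>) ^ N = E ^ (1218 * N)" by (simp only: \<eta>_def E_def power_mult power_one_over)
    then have eY: "(1 / \<eta>) ^ N \<le> Y" using EY[OF ke(1)] by simp
    have hk: "fst (fst w) \<in> sym_int Y" "snd (fst w) \<in> sym_int Y" "fst (snd w) \<in> sym_int Y" "snd (snd w) \<in> sym_int Y"
      using wH by auto
    show ?thesis
      using lowering_chain[OF L Y g tB B0 t \<eta> eY[unfolded N_def] nd hk M5]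
      unfolding N_def P_def J4_def J3_def J2_def J1_def .
  qed
  have "\<delta> ^ box_exp = \<delta> ^ 610 * \<eta> ^ N" by (simp only: box_exp_def \<eta>_def N_def power_add power_mult)
  also have "\<dots> \<le> avg (H4 Y) (\<lambda>w. ?M (fst (fst w)) (snd (fst w)))"
  proof (rule avg_ge_of_dense[OF fO, where B = X'])
    show "\<delta> ^ 610 * card (H4 Y) \<le> card X'" using X'd by (simp add: n_def)
    show "0 \<le> ?M (fst (fst w)) (snd (fst w))" for w :: "(int \<times> int) \<times> (int \<times> int)"
      unfolding energy_def by (rule avg_nonneg) simp
  qed (use low_exp \<eta> in \<open>auto simp: X'_def X_def\<close>)
  also have "\<dots> = avg (sym_int Y) (\<lambda>h. avg (sym_int Y) (\<lambda>k. ?M h k))"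
    unfolding avg_H4[of Y "\<lambda>h k h1 k1. ?M h k"] by (simp add: avg_const[OF sym_int_simps(1,2)])
  finally have avM: "\<delta> ^ box_exp \<le> avg (sym_int Y) (\<lambda>h. avg (sym_int Y) (\<lambda>k. ?M h k))" .
  define \<zeta> where "\<zeta> = \<delta> ^ (box_exp + 1)"
  have "\<exists>m. \<zeta> ^ (42 * (step_exp 1 + 1)) \<le> cmod (ft L ?D m)"
  proof (rule final_descent[OF L Y g tB B0 J4 lwP])
    show "0 < \<zeta>" using d by (simp add: \<zeta>_def)
    have "\<zeta> \<le> \<delta>" unfolding \<zeta>_def using dp[of 1 "box_exp + 1"] by (simp only: power_one_right le_add2)
    then show "\<zeta> \<le> 1 / 2" using d by linarith
    show "\<zeta> \<le> t" unfolding \<zeta>_def t_def using N1 by (intro dp) (simp add: box_exp_def N_def[symmetric])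
    have "(1 / \<zeta>) ^ (20 * (step_exp 1 + 1)) = E ^ ((box_exp + 1) * (20 * (step_exp 1 + 1)))"
      by (simp only: \<zeta>_def E_def power_mult power_one_over)
    then show "(1 / \<zeta>) ^ (20 * (step_exp 1 + 1)) \<le> Y" using EY[OF ke(2)] by (simp only: mult.commute)
    show "2 * \<zeta> \<le> avg (sym_int Y) (\<lambda>h. avg (sym_int Y) (\<lambda>k. ?M h k))"
      using avM d2[of 1 box_exp] by (simp add: \<zeta>_def)
  qed
  moreover have "\<zeta> ^ (42 * (step_exp 1 + 1)) = \<delta> ^ dual_exp"
    unfolding \<zeta>_def dual_exp_def power_mult[symmetric] by (simp only: mult.commute)
  ultimately show ?thesis by simp
qed

section \<open>Correlation with major arcs\<close>

definition prog_avg :: "nat \<Rightarrow> (int \<Rightarrow> complex) \<Rightarrow> nat \<Rightarrow> nat \<Rightarrow> real" where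
  "prog_avg L f q T = avg (ZL L) (\<lambda>x. cmod (avg {0..<int T} (\<lambda>t. f (x + int q * t))))"

lemma avg_shift_close:
  fixes G :: "int \<Rightarrow> complex"
  assumes G: "\<And>y. cmod (G y) \<le> 1" and Y: "0 < Y" and p: "0 \<le> p"
  shows "cmod (avg {a..<a + int Y} G - avg {a..<a + int Y} (\<lambda>y. G (y + p))) \<le> 2 * of_int p / Y"
proof -
  have "avg {a..<a + int Y} G - avg {a..<a + int Y} (\<lambda>y. G (y + p))
     = ((\<Sum>y\<in>{a..<a + int Y}. G y) - (\<Sum>y\<in>{a..<a + int Y}. G (y + p))) / of_nat Y"
    by (simp add: avg_def diff_divide_distrib)
  also have "cmod \<dots> = cmod ((\<Sum>y\<in>{a..<a + int Y}. G y) - (\<Sum>y\<in>{a..<a + int Y}. G (y + p))) / Y"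
    by (simp add: norm_divide)
  also have "\<dots> \<le> 2 * of_int p / Y"
    by (intro divide_right_mono interval_shift_sum G p) simp
  finally show ?thesis .
qed

lemma avg_progression_close:
  fixes G :: "int \<Rightarrow> complex"
  assumes G: "\<And>y. cmod (G y) \<le> 1" and Y: "0 < Y" and T: "0 < T"
  shows "cmod (avg {a..<a + int Y} G - avg {0..<int T} (\<lambda>t. avg {a..<a + int Y} (\<lambda>y. G (y + int q * t)))) \<le> 2 * (real q * T) / Y"
proof -
  let ?V = "{a..<a + int Y}" and ?I = "{0..<int T}"
  have "avg ?V G = avg ?I (\<lambda>t. avg ?V G)" using T by (simp add: avg_const)
  then have "avg ?V G - avg ?I (\<lambda>t. avg ?V (\<lambda>y. G (y + int q * t))) = avg ?I (\<lambda>t. avg ?V G - avg ?V (\<lambda>y. G (y + int q * t)))"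
    by (simp add: avg_diff)
  also have "cmod \<dots> \<le> 2 * (real q * T) / Y"
  proof (rule norm_avg_le_const)
    fix t assume t: "t \<in> ?I"
    have "cmod (avg ?V G - avg ?V (\<lambda>y. G (y + int q * t))) \<le> 2 * of_int (int q * t) / Y"
      by (rule avg_shift_close[OF G Y]) (use t in auto)
    also have "\<dots> \<le> 2 * (real q * T) / Y"
      using t by (intro divide_right_mono mult_left_mono) (auto intro!: mult_left_mono)
    finally show "cmod (avg ?V G - avg ?V (\<lambda>y. G (y + int q * t))) \<le> 2 * (real q * T) / Y" .
  qed simp
  finally show ?thesis .
qed

lemma ch_near_one:
  assumes "0 < L"
  shows "cmod (ch L m (int q * j) - 1) \<le> 7 * (\<bar>of_int j\<bar> * nd (real q * (of_int m / L)))"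
proof -
  obtain r k where rk: "real q * (of_int m / L) = of_int r + k" "\<bar>k\<bar> = nd (real q * (of_int m / L))" by (rule nd_obtain)
  have "of_int (m * (int q * j)) / real L = of_int j * (real q * (of_int m / L))" by simp
  also have "\<dots> = of_int (j * r) + of_int j * k" unfolding rk(1) by (simp add: distrib_left)
  finally have "ch L m (int q * j) = ee (of_int j * k)" unfolding ch_def by (simp only: ee_of_int_add)
  then show ?thesis using ee_minus_one_le[of "of_int j * k"] rk(2) by (simp add: abs_mult)
qed

text \<open>On short progressions of step \<open>q\<close> the phase \<open>m y\<^sup>2 / L\<close> is nearly constant if \<open>q m / L\<close> is nearly
  an integer. The two choices of \<open>s\<close> and \<open>c\<close> serve the second and the first function.\<close>

lemma progression_average_large:
  fixes s c :: int and \<rho> :: real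
  assumes L: "0 < L" and Y: "0 < Y" and ab: "per L b" "bd a" "bd b" and sc: "\<bar>s\<bar> \<le> 1" "\<bar>c\<bar> \<le> 1"
    and big: "\<rho> \<le> cmod (avg {1..int Y} (\<lambda>y. avg (ZL L) (\<lambda>x. a x * b (x + s * y) * ch L m (x + (y\<^sup>2 - c * y)))))"
    and T: "0 < T" "q * T \<le> Y" "2 * (real q * T) / Y \<le> \<rho> / 4" "28 * (real T * Y) * nd (real q * (of_int m / L)) \<le> \<rho> / 4"
  shows "\<rho> / 2 \<le> avg (ZL L) (\<lambda>x. cmod (avg {0..<int T} (\<lambda>t. b (x + s * (int q * t)))))"
proof -
  let ?I = "{0..<int T}"
  have V: "{1..int Y} = {1..<1 + int Y}" by auto
  define G where "G y = avg (ZL L) (\<lambda>x. a x * b (x + s * y) * ch L m (x + (y\<^sup>2 - c * y)))" for y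
  define G' where "G' y t = avg (ZL L) (\<lambda>x. a x * b (x + s * (y + int q * t)) * ch L m (x + (y\<^sup>2 - c * y)))" for y t
  have n1: "cmod (a x * b z * ch L m w) \<le> 1" for x z w
    using ab by (auto simp: bd_def norm_mult intro!: mult_le_one)
  have G1: "cmod (G y) \<le> 1" for y unfolding G_def by (rule norm_avg_le_const) (use n1 in auto)
  have 1: "cmod (avg {1..int Y} G - avg ?I (\<lambda>t. avg {1..int Y} (\<lambda>y. G (y + int q * t)))) \<le> 2 * (real q * T) / Y"
    unfolding V by (rule avg_progression_close[OF G1 Y T(1)])
  have 2: "cmod (G (y + int q * t) - G' y t) \<le> 28 * (real T * Y) * nd (real q * (of_int m / L))"
    if t: "t \<in> ?I" and y: "y \<in> {1..int Y}" for y t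
  proof -
    \<comment> \<open>Moving \<open>y\<close> by \<open>q t\<close> changes the argument of the
      character by \<open>q\<close> times \<open>j\<close>. Since \<open>q * T\<close> is at most
      \<open>Y\<close>, the modulus of \<open>j\<close> is at most \<open>4 * T * Y\<close>; with
      the 7 of \<open>ch_near_one\<close> this gives 28.\<close>
    define j where "j = 2 * y * t + int q * t\<^sup>2 - c * t"
    have "(y + int q * t)\<^sup>2 - c * (y + int q * t) = (y\<^sup>2 - c * y) + int q * j"
      by (simp add: j_def power2_eq_square algebra_simps)
    then have "ch L m (x + ((y + int q * t)\<^sup>2 - c * (y + int q * t))) = ch L m (x + (y\<^sup>2 - c * y)) * ch L m (int q * j)" for x
      by (simp only: add.assoc[symmetric] ch_add)
    then have "G (y + int q * t) - G' y t
       = avg (ZL L) (\<lambda>x. (a x * b (x + s * (y + int q * t)) * ch L m (x + (y\<^sup>2 - c * y))) * (ch L m (int q * j) - 1))"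
      unfolding G_def G'_def avg_diff[symmetric] by (simp only: right_diff_distrib mult.assoc mult_1_right)
    also have "cmod \<dots> \<le> cmod (ch L m (int q * j) - 1)"
      by (intro norm_avg_le_const) (use n1 in \<open>auto simp: norm_mult[of _ "ch L m (int q * j) - 1"] intro!: mult_left_le_one_le\<close>)
    also have "\<dots> \<le> 7 * (\<bar>of_int j\<bar> * nd (real q * (of_int m / L)))" by (rule ch_near_one[OF L])
    also have "\<dots> \<le> 7 * ((4 * (real T * Y)) * nd (real q * (of_int m / L)))"
    proof (intro mult_left_mono mult_right_mono)
      have yt: "0 \<le> y" "y \<le> int Y" "0 \<le> t" "t \<le> int T" using t y by auto
      have a1: "\<bar>2 * y * t\<bar> \<le> 2 * (int Y * int T)" unfolding abs_mult using yt by (simp add: mult_mono)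
      have "int q * t\<^sup>2 = (int q * t) * t" by (simp add: power2_eq_square)
      also have "\<dots> \<le> (int q * int T) * int T" using yt by (intro mult_mono) auto
      also have "\<dots> \<le> int Y * int T" using T(2) by (intro mult_right_mono) (auto simp flip: of_nat_mult)
      finally have a2: "\<bar>int q * t\<^sup>2\<bar> \<le> int Y * int T" by simp
      have "\<bar>c * t\<bar> \<le> 1 * int T" unfolding abs_mult using sc yt by (intro mult_mono) auto
      also have "\<dots> \<le> int Y * int T" using Y by (intro mult_right_mono) auto
      finally have "\<bar>j\<bar> \<le> 4 * (int T * int Y)" using a1 a2 unfolding j_def by (simp only: mult.commute[of "int Y"])
      then have "real_of_int \<bar>j\<bar> \<le> of_int (4 * (int T * int Y))" by (simp only: of_int_le_iff)
      then show "\<bar>real_of_int j\<bar> \<le> 4 * (real T * Y)" by simp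
    qed auto
    finally show ?thesis by simp
  qed
  have 3: "cmod (avg ?I (\<lambda>t. avg {1..int Y} (\<lambda>y. G (y + int q * t))) - avg ?I (\<lambda>t. avg {1..int Y} (\<lambda>y. G' y t)))
     \<le> 28 * (real T * Y) * nd (real q * (of_int m / L))"
    unfolding avg_diff[symmetric]
    by (rule norm_avg_le_const, rule norm_avg_le_const, rule 2) auto
  have 4: "cmod (avg ?I (\<lambda>t. avg {1..int Y} (\<lambda>y. G' y t))) \<le> avg (ZL L) (\<lambda>x. cmod (avg ?I (\<lambda>t. b (x + s * (int q * t)))))"
  proof -
    have eq: "avg ?I (\<lambda>t. avg {1..int Y} (\<lambda>y. G' y t)) = avg {1..int Y} (\<lambda>y. avg (ZL L) (\<lambda>x. (a x * ch L m (x + (y\<^sup>2 - c * y))) * avg ?I (\<lambda>t. b (x + s * (y + int q * t)))))"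
    proof -
      have "avg ?I (\<lambda>t. G' y t) = avg (ZL L) (\<lambda>x. (a x * ch L m (x + (y\<^sup>2 - c * y))) * avg ?I (\<lambda>t. b (x + s * (y + int q * t))))" for y
        unfolding G'_def by (subst avg_swap) (simp add: avg_mult_left[symmetric] mult_ac)
      then show ?thesis by (subst avg_swap) simp
    qed
    show ?thesis unfolding eq
    proof (rule norm_avg_le_const)
      fix y
      have "cmod (avg (ZL L) (\<lambda>x. (a x * ch L m (x + (y\<^sup>2 - c * y))) * avg ?I (\<lambda>t. b (x + s * (y + int q * t)))))
         \<le> avg (ZL L) (\<lambda>x. cmod (avg ?I (\<lambda>t. b (x + s * (y + int q * t)))))"
        using ab by (intro order_trans[OF norm_avg_le] avg_mono) (auto simp: norm_mult bd_def intro!: mult_left_le_one_le)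
      also have "\<dots> = avg (ZL L) (\<lambda>x. cmod (avg ?I (\<lambda>t. b ((x + s * y) + s * (int q * t)))))"
        by (simp add: algebra_simps)
      also have "\<dots> = avg (ZL L) (\<lambda>x. cmod (avg ?I (\<lambda>t. b (x + s * (int q * t)))))"
        by (rule avg_per_shift[OF L, of "\<lambda>x. cmod (avg ?I (\<lambda>t. b (x + s * (int q * t))))"])
          (intro per_map[where h = cmod] per_avg per_shift ab)
      finally show "cmod (avg (ZL L) (\<lambda>x. (a x * ch L m (x + (y\<^sup>2 - c * y))) * avg ?I (\<lambda>t. b (x + s * (y + int q * t)))))
         \<le> avg (ZL L) (\<lambda>x. cmod (avg ?I (\<lambda>t. b (x + s * (int q * t)))))" .
    qed (rule avg_nonneg, simp)
  qed
  have "\<rho> \<le> cmod (avg {1..int Y} G)" using big unfolding G_def[abs_def] .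
  then show ?thesis using 1 3 4 T(3,4) norm_triangle_ineq2[of "avg {1..int Y} G" "avg ?I (\<lambda>t. avg {1..int Y} (\<lambda>y. G (y + int q * t)))"]
      norm_triangle_ineq2[of "avg ?I (\<lambda>t. avg {1..int Y} (\<lambda>y. G (y + int q * t)))" "avg ?I (\<lambda>t. avg {1..int Y} (\<lambda>y. G' y t))"]
    by linarith
qed

lemma prog_avg_of_corr:
  fixes \<rho> :: real
  assumes L: "0 < L" and g: "per L g1" "per L g2" "bd g1" "bd g2" and r: "0 < \<rho>" "\<rho> \<le> 1 / 2" "(1 / \<rho>) ^ 40 \<le> Y"
    and big: "\<rho> \<le> cmod (corr L Y g1 g2 m)"
  shows "\<exists>q T. 1 \<le> q \<and> real q \<le> (1 / \<rho>) ^ 9 \<and> q * T \<le> Y \<and> \<rho> ^ 40 * Y \<le> T \<and> \<rho> / 2 \<le> prog_avg L g1 q T \<and> \<rho> / 2 \<le> prog_avg L g2 q T"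
proof -
  define E where "E = 1 / \<rho>"
  have E2: "2 \<le> E" and Er: "\<rho> = 1 / E" using r by (auto simp: E_def field_simps)
  have E0: "0 < E" and E1: "1 \<le> E" using E2 by auto
  have EY: "E ^ a \<le> Y" if "a \<le> 40" for a using power_increasing[OF that E1] r(3) by (simp add: E_def)
  have Y0: "0 < real Y" using EY[of 0] by simp
  then have Y: "0 < Y" by simp
  obtain q :: nat where q: "1 \<le> q" "real q \<le> E ^ 9" "nd (real q * (of_int m / L)) \<le> E ^ 23 / (real Y)\<^sup>2"
    using major_of_correlation[OF L g r(1,2) _ big[unfolded corr_def]] EY[of 18] by (auto simp: E_def)
  \<comment> \<open>As \<open>q\<close> is at most \<open>\<rho> ^ (- 9)\<close> and
    \<open>nd\<close> at most \<open>\<rho> ^ (- 23) / Y\<^sup>2\<close>, the length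
    \<open>\<rho> ^ 34 * Y\<close> leaves errors of order \<open>\<rho> ^ 25\<close> from the shift
    of \<open>y\<close> and \<open>\<rho> ^ 11\<close> from the phase.\<close>
  define T where "T = nat \<lfloor>\<rho> ^ 34 * Y\<rfloor>"
  have Tu: "real T \<le> \<rho> ^ 34 * Y" unfolding T_def by (rule of_nat_floor) (use r in simp)
  have r34: "1 \<le> \<rho> ^ 34 * Y" using EY[of 34] E0 by (simp add: Er power_one_over field_simps)
  have Tl: "\<rho> ^ 35 * Y \<le> T"
  proof -
    have "\<rho> ^ 34 * Y < real T + 1" unfolding T_def by linarith
    moreover have "1 \<le> T" unfolding T_def by (rule le_nat_floor) (use r34 in simp)
    then have "1 \<le> real T" by simp
    ultimately have "\<rho> ^ 34 * Y \<le> 2 * T" by linarith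
    moreover have "2 * (\<rho> ^ 35 * Y) \<le> \<rho> ^ 34 * Y"
    proof -
      have "\<rho> ^ 35 = \<rho> ^ 34 * \<rho>" by (simp add: power_Suc2[symmetric])
      also have "\<dots> \<le> \<rho> ^ 34 * (1 / 2)" using r by (intro mult_left_mono) auto
      finally show ?thesis using Y0 by simp
    qed
    ultimately show ?thesis by linarith
  qed
  have T0: "0 < T" using Tl r Y0 by (cases T) (auto simp: mult_le_0_iff)
  have rp: "\<rho> ^ b \<le> \<rho> ^ a" if "a \<le> b" for a b using that r by (intro power_decreasing) auto
  have r2: "2 ^ k * \<rho> ^ (k + a) \<le> \<rho> ^ a" for k a
  proof -
    have "2 ^ k * \<rho> ^ (k + a) = (2 * \<rho>) ^ k * \<rho> ^ a" by (simp add: power_add power_mult_distrib)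
    also have "\<dots> \<le> 1 * \<rho> ^ a" using r by (intro mult_right_mono power_le_one) auto
    finally show ?thesis by simp
  qed
  have qT: "real q * T \<le> \<rho> ^ 25 * Y"
  proof -
    have "real q * T \<le> E ^ 9 * (\<rho> ^ 34 * Y)" using q(2) Tu E0 by (intro mult_mono) auto
    also have "\<dots> = (E ^ 9 * \<rho> ^ 9) * \<rho> ^ 25 * Y" by (simp add: power_add[symmetric])
    also have "E ^ 9 * \<rho> ^ 9 = 1" using r by (simp add: E_def power_mult_distrib[symmetric])
    finally show ?thesis by simp
  qed
  have qTY: "q * T \<le> Y"
  proof -
    have "\<rho> ^ 25 * real Y \<le> 1 * real Y" using r by (intro mult_right_mono power_le_one) auto
    then have "real (q * T) \<le> real Y" using qT by simp
    then show ?thesis by (simp only: of_nat_le_iff)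
  qed
  have c1: "2 * (real q * T) / Y \<le> \<rho> / 4"
  proof -
    have "2 * (real q * T) / Y \<le> 2 * \<rho> ^ 25" using qT Y0 by (simp add: field_simps)
    moreover have "8 * \<rho> ^ 25 \<le> \<rho>" using r2[of 3 1] rp[of 4 25] by simp
    ultimately show ?thesis by linarith
  qed
  have c2: "28 * (real T * Y) * nd (real q * (of_int m / L)) \<le> \<rho> / 4"
  proof -
    have "28 * (real T * Y) * nd (real q * (of_int m / L)) \<le> 28 * ((\<rho> ^ 34 * Y) * Y) * (E ^ 23 / (real Y)\<^sup>2)"
      using Tu q(3) r by (intro mult_mono mult_left_mono mult_right_mono) auto
    also have "\<dots> = 28 * (\<rho> ^ 34 * E ^ 23)" using Y0 by (simp add: power2_eq_square)
    also have "\<rho> ^ 34 * E ^ 23 = \<rho> ^ 11 * (\<rho> * E) ^ 23" by (simp add: power_mult_distrib power_add[symmetric])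
    also have "\<rho> * E = 1" using r by (simp add: E_def)
    finally have "28 * (real T * Y) * nd (real q * (of_int m / L)) \<le> 28 * \<rho> ^ 11" by simp
    moreover have "128 * \<rho> ^ 11 \<le> \<rho>" using r2[of 7 1] rp[of 8 11] by simp
    ultimately show ?thesis using r by linarith
  qed
  have "corr L Y g1 g2 m = avg {1..int Y} (\<lambda>y. avg (ZL L) (\<lambda>x. g1 x * g2 (x + 1 * y) * ch L m (x + (y\<^sup>2 - 0 * y))))"
    unfolding corr_def by (subst avg_swap) simp
  then have b1: "\<rho> \<le> cmod (avg {1..int Y} (\<lambda>y. avg (ZL L) (\<lambda>x. g1 x * g2 (x + 1 * y) * ch L m (x + (y\<^sup>2 - 0 * y)))))"
    using big by simp
  have "\<rho> / 2 \<le> avg (ZL L) (\<lambda>x. cmod (avg {0..<int T} (\<lambda>t. g2 (x + 1 * (int q * t)))))"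
    by (rule progression_average_large[OF L Y g(2,3,4) _ _ b1 T0 qTY c1 c2]) auto
  then have w2: "\<rho> / 2 \<le> prog_avg L g2 q T" by (simp add: prog_avg_def)
  \<comment> \<open>Translating \<open>x\<close> by \<open>y\<close> exchanges the roles of the two
    functions: the shift becomes \<open>- y\<close> and the character gets
    \<open>y\<^sup>2 - y\<close>, which is the case \<open>s = -1\<close>,
    \<open>c = 1\<close>.\<close>
  have "corr L Y g1 g2 m = avg {1..int Y} (\<lambda>y. avg (ZL L) (\<lambda>x. g2 x * g1 (x + (- 1) * y) * ch L m (x + (y\<^sup>2 - 1 * y))))"
    unfolding corr_def
  proof (subst avg_swap, rule avg_cong[OF refl])
    fix y
    have "per L (\<lambda>x. g1 x * g2 (x + y) * ch L m (x + y\<^sup>2))"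
      by (intro per_map2[where h = "(*)"] g per_shift ch_per L)
    from avg_per_shift_diff[OF L this, of y, symmetric]
    show "avg (ZL L) (\<lambda>x. g1 x * g2 (x + y) * ch L m (x + y\<^sup>2)) = avg (ZL L) (\<lambda>x. g2 x * g1 (x + (- 1) * y) * ch L m (x + (y\<^sup>2 - 1 * y)))"
      by (simp add: algebra_simps)
  qed
  then have b2: "\<rho> \<le> cmod (avg {1..int Y} (\<lambda>y. avg (ZL L) (\<lambda>x. g2 x * g1 (x + (- 1) * y) * ch L m (x + (y\<^sup>2 - 1 * y)))))"
    using big by simp
  have "\<rho> / 2 \<le> avg (ZL L) (\<lambda>x. cmod (avg {0..<int T} (\<lambda>t. g1 (x + (- 1) * (int q * t)))))"
    by (rule progression_average_large[OF L Y g(1,4,3) _ _ b2 T0 qTY c1 c2]) auto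
  also have "\<dots> = prog_avg L g1 q T"
  proof -
    \<comment> \<open>Progressions of step \<open>- q\<close> are those of step \<open>q\<close>
      read backwards, up to a translation of the starting point.\<close>
    have bij: "bij_betw (\<lambda>t. int T - 1 - t) {0..<int T} {0..<int T}"
      by (rule bij_betw_byWitness[where f' = "\<lambda>t. int T - 1 - t"]) auto
    have "avg {0..<int T} (\<lambda>t. g1 (x + (- 1) * (int q * t))) = avg {0..<int T} (\<lambda>t. g1 ((x - int q * (int T - 1)) + int q * t))" for x
      by (subst avg_reindex[OF bij]) (simp add: algebra_simps)
    then have "avg (ZL L) (\<lambda>x. cmod (avg {0..<int T} (\<lambda>t. g1 (x + (- 1) * (int q * t)))))
       = avg (ZL L) (\<lambda>x. cmod (avg {0..<int T} (\<lambda>t. g1 ((x - int q * (int T - 1)) + int q * t))))" by simp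
    also have "\<dots> = prog_avg L g1 q T"
      unfolding prog_avg_def
      by (rule avg_per_shift_diff[OF L, of "\<lambda>x. cmod (avg {0..<int T} (\<lambda>t. g1 (x + int q * t)))"])
        (intro per_map[where h = cmod] per_avg per_shift g)
    finally show ?thesis .
  qed
  finally have w1: "\<rho> / 2 \<le> prog_avg L g1 q T" .
  have "\<rho> ^ 40 * Y \<le> \<rho> ^ 35 * Y" using rp[of 35 40] by (intro mult_right_mono) auto
  then have "\<rho> ^ 40 * Y \<le> T" using Tl by linarith
  then show ?thesis using q qTY w1 w2 by (auto simp: E_def)
qed

section \<open>Large averages on short progressions\<close>

text \<open>A single \<rho> controls step, length and size of the averages, so that different losses
  can be compared by \<open>large_prog_avg_mono\<close>.\<close>

definition large_prog_avg :: "nat \<Rightarrow> nat \<Rightarrow> real \<Rightarrow> (int \<Rightarrow> complex) \<Rightarrow> bool" where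
  "large_prog_avg L Y \<rho> f \<longleftrightarrow> (\<exists>q T. 1 \<le> q \<and> real q \<le> 1 / \<rho> \<and> q * T \<le> Y \<and> \<rho> * Y \<le> T \<and> \<rho> \<le> prog_avg L f q T)"

lemma large_prog_avg_mono:
  assumes "large_prog_avg L Y \<rho> f" "0 < \<rho>'" "\<rho>' \<le> \<rho>"
  shows "large_prog_avg L Y \<rho>' f"
proof -
  obtain q T where qT: "1 \<le> q" "real q \<le> 1 / \<rho>" "q * T \<le> Y" "\<rho> * Y \<le> T" "\<rho> \<le> prog_avg L f q T"
    using assms(1) by (auto simp: large_prog_avg_def)
  have "1 / \<rho> \<le> 1 / \<rho>'" using assms(2,3) by (intro divide_left_mono) auto
  moreover have "\<rho>' * Y \<le> \<rho> * Y" using assms(3) by (intro mult_right_mono) auto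
  ultimately have "real q \<le> 1 / \<rho>'" "\<rho>' * Y \<le> T" "\<rho>' \<le> prog_avg L f q T" using qT assms(3) by linarith+
  then show ?thesis using qT unfolding large_prog_avg_def by blast
qed

lemma power_absorb:
  fixes \<rho> :: real
  assumes "0 \<le> \<rho>" "\<rho> \<le> 1 / 2" "k + a \<le> b"
  shows "2 ^ k * \<rho> ^ b \<le> \<rho> ^ a"
proof -
  have "2 ^ k * \<rho> ^ b \<le> 2 ^ k * \<rho> ^ (k + a)" using assms by (intro mult_left_mono power_decreasing) auto
  also have "\<dots> = (2 * \<rho>) ^ k * \<rho> ^ a" by (simp add: power_add power_mult_distrib)
  also have "\<dots> \<le> 1 * \<rho> ^ a" using assms by (intro mult_right_mono power_le_one) auto
  finally show ?thesis by simp
qed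

lemma nat_floor_half_le:
  fixes x :: real
  assumes "1 \<le> x"
  shows "x / 2 \<le> nat \<lfloor>x\<rfloor>"
proof -
  have "1 \<le> nat \<lfloor>x\<rfloor>" by (rule le_nat_floor) (use assms in simp)
  then have "1 \<le> real (nat \<lfloor>x\<rfloor>)" by simp
  moreover have "x < real (nat \<lfloor>x\<rfloor>) + 1" by linarith
  ultimately show ?thesis by linarith
qed

lemma Lam_eq_dual:
  assumes L: "0 < L" and f: "per L f1" "per L f2" "per L f3"
  shows "Lam L Y f1 f2 f3 = avg (ZL L) (\<lambda>z. f3 z * dual Y f1 f2 z)"
proof -
  have sh: "avg (ZL L) (\<lambda>x. f1 x * f2 (x + y) * f3 (x + y\<^sup>2)) = avg (ZL L) (\<lambda>z. f3 z * (f1 (z + - y\<^sup>2) * f2 (z + (y - y\<^sup>2))))" for y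
  proof -
    have "per L (\<lambda>x. f1 x * f2 (x + y) * f3 (x + y\<^sup>2))" by (intro per_map2[where h = "(*)"] f per_shift)
    from avg_per_shift_diff[OF L this, of "y\<^sup>2", symmetric] show ?thesis
      by (simp add: mult_ac add_diff_eq diff_add_eq)
  qed
  have "Lam L Y f1 f2 f3 = avg {1..int Y} (\<lambda>y. avg (ZL L) (\<lambda>x. f1 x * f2 (x + y) * f3 (x + y\<^sup>2)))"
    unfolding Lam_def by (rule avg_swap)
  also have "\<dots> = avg (ZL L) (\<lambda>z. f3 z * dual Y f1 f2 z)"
    unfolding sh dual_def avg_mult_left[symmetric] by (rule avg_swap)
  finally show ?thesis .
qed

lemma cnj_dual: "cnj (dual Y f1 f2 z) = dual Y (\<lambda>x. cnj (f1 x)) (\<lambda>x. cnj (f2 x)) z"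
  by (simp add: dual_def avg_cnj)

text \<open>Cauchy-Schwarz in \<open>z\<close> leaves the mean square of
  \<open>dual Y f1 f2\<close>, which is the counting form with the conjugate of this function in the
  third place.\<close>

lemma Lam_square_le_dual:
  assumes L: "0 < L" and f: "per L f1" "per L f2" "per L f3" "bd f3"
  shows "(cmod (Lam L Y f1 f2 f3))\<^sup>2 \<le> cmod (Lam L Y f1 f2 (dual Y (\<lambda>x. cnj (f1 x)) (\<lambda>x. cnj (f2 x))))"
proof -
  let ?A = "avg (ZL L) (\<lambda>z. (cmod (dual Y f1 f2 z))\<^sup>2)"
  have pd: "per L (dual Y (\<lambda>x. cnj (f1 x)) (\<lambda>x. cnj (f2 x)))"
    using per_dual[OF f(1,2)] unfolding cnj_dual[symmetric] by (rule per_map)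
  have eq: "Lam L Y f1 f2 (dual Y (\<lambda>x. cnj (f1 x)) (\<lambda>x. cnj (f2 x))) = complex_of_real ?A"
    unfolding Lam_eq_dual[OF L f(1,2) pd] cnj_dual[symmetric] avg_of_real[symmetric] norm_square_complex
    by (simp only: mult.commute)
  have "(cmod (Lam L Y f1 f2 f3))\<^sup>2 \<le> ?A"
    unfolding Lam_eq_dual[OF L f(1-3)] by (rule norm_avg_mult_square) (use f(4) in \<open>simp add: bd_def\<close>)
  also have "\<dots> \<le> cmod (complex_of_real ?A)" by (simp only: norm_of_real abs_ge_self)
  finally show ?thesis unfolding eq .
qed

lemma prog_avg_cnj: "prog_avg L (\<lambda>x. cnj (f x)) q T = prog_avg L f q T"
  unfolding prog_avg_def avg_cnj[symmetric] by (simp only: complex_mod_cnj)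

lemma dual_exp_pos: "0 < dual_exp" by (simp add: dual_exp_def)

lemma prog_avg_of_Lam:
  fixes \<delta> \<rho> :: real
  assumes L: "0 < L" "real L \<le> 12 * (real Y)\<^sup>2"
    and f: "per L f1" "per L f2" "per L f3" "bd f1" "bd f2" "bd f3"
    and d: "0 < \<delta>" "\<delta> \<le> 1 / 2" and r: "\<rho> = \<delta> ^ (2 * dual_exp)" "(1 / \<rho>) ^ 40 \<le> Y"
    and big: "\<delta> \<le> cmod (Lam L Y f1 f2 f3)"
  shows "\<exists>q T. 1 \<le> q \<and> real q \<le> (1 / \<rho>) ^ 9 \<and> q * T \<le> Y \<and> \<rho> ^ 40 * Y \<le> T \<and> \<rho> / 2 \<le> prog_avg L f1 q T \<and> \<rho> / 2 \<le> prog_avg L f2 q T"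
proof -
  let ?g1 = "\<lambda>x. cnj (f1 x)" and ?g2 = "\<lambda>x. cnj (f2 x)"
  have g: "per L ?g1" "per L ?g2" "bd ?g1" "bd ?g2" using f by (auto intro: per_map bd_cnj)
  have r0: "0 < \<rho>" using d r by simp
  have "\<rho> \<le> \<delta> ^ 1" unfolding r(1) using d dual_exp_pos by (intro power_decreasing) auto
  then have r1: "\<rho> \<le> 1 / 2" using d by simp
  have rk: "(\<delta>\<^sup>2) ^ dual_exp = \<rho>" by (simp add: r(1) power_mult)
  have "\<exists>m. (\<delta>\<^sup>2) ^ dual_exp \<le> cmod (ft L (dual Y ?g1 ?g2) m)"
  proof (rule dual_large_coefficient[OF L f(1,2,4,5) g])
    show "0 < \<delta>\<^sup>2" using d by simp
    have "\<delta>\<^sup>2 \<le> \<delta> ^ 1" using d by (intro power_decreasing) auto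
    then show "\<delta>\<^sup>2 \<le> 1 / 2" using d by simp
    have "(1 / \<delta>\<^sup>2) ^ dual_exp = (1 / \<rho>) ^ 1" by (simp only: rk power_one_over power_one_right)
    also have "\<dots> \<le> (1 / \<rho>) ^ 40" using r0 r1 by (intro power_increasing) auto
    finally show "(1 / \<delta>\<^sup>2) ^ dual_exp \<le> Y" using r(2) by simp
    have "\<delta>\<^sup>2 \<le> (cmod (Lam L Y f1 f2 f3))\<^sup>2" using big d by (intro power_mono) auto
    also have "\<dots> \<le> cmod (Lam L Y f1 f2 (dual Y ?g1 ?g2))" by (rule Lam_square_le_dual[OF L(1) f(1-3,6)])
    finally show "\<delta>\<^sup>2 \<le> cmod (Lam L Y f1 f2 (dual Y ?g1 ?g2))" .
  qed
  then obtain m where m: "\<rho> \<le> cmod (ft L (dual Y ?g1 ?g2) m)" by (auto simp: rk)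
  have "corr L Y ?g1 ?g2 (- m) = Lam L Y ?g1 ?g2 (ch L (- m))" by (simp add: corr_def Lam_def)
  also have "\<dots> = ft L (dual Y ?g1 ?g2) m"
    unfolding Lam_eq_dual[OF L(1) g(1,2) ch_per[OF L(1)]] ft_def by (simp only: mult.commute)
  finally have "\<rho> \<le> cmod (corr L Y ?g1 ?g2 (- m))" using m by simp
  from prog_avg_of_corr[OF L(1) g r0 r1 r(2) this] show ?thesis by (simp only: prog_avg_cnj)
qed

section \<open>The third function: from quadratic to linear progressions\<close>

lemma prog_avg_of_ft:
  fixes \<rho> :: real
  assumes L: "0 < L" and f: "per L f" "bd f" and T: "0 < T"
    and big: "\<rho> \<le> cmod (ft L f k)" and nd: "7 * (T * nd (real q * (of_int k / L))) \<le> \<rho> / 2"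
  shows "\<rho> / 2 \<le> prog_avg L f q T"
proof -
  let ?I = "{0..<int T}"
  define G where "G t = avg (ZL L) (\<lambda>x. f (x + int q * t) * ch L (- k) (x + int q * t))" for t
  define H where "H t = avg (ZL L) (\<lambda>x. f (x + int q * t) * ch L (- k) x)" for t
  have Gt: "G t = ft L f k" for t
  proof -
    have "per L (\<lambda>x. f x * ch L (- k) x)" by (intro per_map2[where h = "(*)"] f ch_per L)
    from avg_per_shift[OF L this] show ?thesis by (simp add: G_def ft_def)
  qed
  have "avg ?I G = avg ?I (\<lambda>t. ft L f k)" by (intro avg_cong refl Gt)
  then have "avg ?I G = ft L f k" using T by (simp add: avg_const)
  then have 1: "\<rho> \<le> cmod (avg ?I G)" using big by simp
  have 2: "cmod (avg ?I G - avg ?I H) \<le> \<rho> / 2"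
    unfolding avg_diff[symmetric]
  proof (rule norm_avg_le_const)
    fix t assume t: "t \<in> ?I"
    have eq: "G t - H t = avg (ZL L) (\<lambda>x. f (x + int q * t) * ch L (- k) x * (ch L (- k) (int q * t) - 1))"
      unfolding G_def H_def avg_diff[symmetric] by (simp only: ch_add right_diff_distrib mult.assoc mult_1_right)
    have "cmod (G t - H t) \<le> cmod (ch L (- k) (int q * t) - 1)"
      unfolding eq using f(2)
      by (intro norm_avg_le_const) (auto simp: norm_mult bd_def intro!: mult_left_le_one_le)
    also have "\<dots> \<le> 7 * (\<bar>of_int t\<bar> * nd (real q * (of_int (- k) / L)))" by (rule ch_near_one[OF L])
    also have "nd (real q * (of_int (- k) / L)) = nd (real q * (of_int k / L))"
      using nd_minus[of "real q * (of_int k / L)"] by simp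
    also have "7 * (\<bar>of_int t\<bar> * nd (real q * (of_int k / L))) \<le> 7 * (T * nd (real q * (of_int k / L)))"
      using t by (intro mult_left_mono mult_right_mono) auto
    finally show "cmod (G t - H t) \<le> \<rho> / 2" using nd by linarith
  next
    have "0 \<le> 7 * (T * nd (real q * (of_int k / L)))" by simp
    then show "0 \<le> \<rho> / 2" using nd by linarith
  qed
  have "avg ?I H = avg (ZL L) (\<lambda>x. avg ?I (\<lambda>t. f (x + int q * t)) * ch L (- k) x)"
    unfolding H_def avg_mult_right[symmetric] by (rule avg_swap)
  then have "cmod (avg ?I H) \<le> avg (ZL L) (\<lambda>x. cmod (avg ?I (\<lambda>t. f (x + int q * t)) * ch L (- k) x))"
    by (simp only: norm_avg_le)
  also have "\<dots> = prog_avg L f q T" unfolding prog_avg_def by (simp add: norm_mult)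
  finally show ?thesis using 1 2 norm_triangle_ineq2[of "avg ?I G" "avg ?I H"] by linarith
qed

text \<open>Averaging over \<open>y \<mapsto> y + q z\<close> moves the third function along a quadratic progression, while the
  first function, once smoothed along multiples of \<open>q\<close>, hardly changes and the second is frozen by the
  shift of \<open>x\<close>.\<close>

lemma quadratic_progression_large:
  fixes \<eta> :: real
  assumes L: "0 < L" and Y: "0 < Y" and f: "per L f2" "per L f3" "bd f2" "bd f3"
    and T: "0 < T" "0 < n" "2 * (real q * n) / Y \<le> \<eta> / 4" "2 * real n / T \<le> \<eta> / 4"
    and big: "\<eta> \<le> prog_avg L (\<lambda>x. avg {1..int Y} (\<lambda>y. f2 (x + y) * f3 (x + y\<^sup>2))) q T"
  shows "\<exists>y. \<eta> / 2 \<le> avg (ZL L) (\<lambda>x. cmod (avg {0..<int n} (\<lambda>z. f3 (x + ((y + int q * z)\<^sup>2 - (y + int q * z))))))"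
proof -
  let ?I = "{0..<int T}" and ?N = "{0..<int n}" and ?V = "{1..int Y}"
  have V: "?V = {1..<1 + int Y}" by auto
  define F where "F x = avg ?V (\<lambda>y. f2 (x + y) * f3 (x + y\<^sup>2))" for x
  have F: "per L F" unfolding F_def by (intro per_avg per_map2[where h = "(*)"] per_shift f)
  \<comment> \<open>Phases that replace the absolute values in \<open>prog_avg\<close>, making it an
    average of \<open>c x\<close> against values of \<open>F\<close>.\<close>
  define c where "c x = cnj (sgn (avg ?I (\<lambda>t. F (x + int q * t))))" for x
  have c: "per L c" unfolding c_def by (intro per_map[where h = "\<lambda>z. cnj (sgn z)"] per_avg per_shift F)
  have c1: "cmod (c x) \<le> 1" for x by (simp add: c_def norm_sgn)
  \<comment> \<open>Smoothing over \<open>t\<close> makes \<open>c'\<close> vary by at most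
    \<open>2 * z / T\<close> under a shift by \<open>q z\<close>; \<open>c\<close> itself has no
    regularity.\<close>
  define c' where "c' x = avg ?I (\<lambda>t. c (x - int q * t))" for x
  have c': "per L c'" unfolding c'_def by (intro per_avg per_shift_diff c)
  have c'1: "cmod (c' x) \<le> 1" for x unfolding c'_def by (rule norm_avg_le_const) (use c1 in auto)
  define G where "G y = avg (ZL L) (\<lambda>x. c' x * (f2 (x + y) * f3 (x + y\<^sup>2)))" for y
  \<comment> \<open>This is \<open>G\<close> at \<open>y + q z\<close> after translation by
    \<open>y + q z\<close>, but with \<open>c'\<close> evaluated as if the shift were only
    \<open>y\<close>, so that \<open>f3\<close> is the only factor depending on
    \<open>z\<close>.\<close>
  define H where "H y z = avg (ZL L) (\<lambda>x. c' (x - y) * f2 x * f3 (x + ((y + int q * z)\<^sup>2 - (y + int q * z))))" for y z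
  have G1: "cmod (G y) \<le> 1" for y
    unfolding G_def by (rule norm_avg_le_const) (use c'1 f in \<open>auto simp: norm_mult bd_def intro!: mult_le_one\<close>)
  have "complex_of_real (prog_avg L F q T) = avg (ZL L) (\<lambda>x. c x * avg ?I (\<lambda>t. F (x + int q * t)))"
    unfolding prog_avg_def avg_of_real[symmetric] c_def cnj_sgn_mult ..
  also have "\<dots> = avg ?I (\<lambda>t. avg (ZL L) (\<lambda>x. c x * F (x + int q * t)))"
    unfolding avg_mult_left[symmetric] by (rule avg_swap)
  also have "\<dots> = avg ?I (\<lambda>t. avg (ZL L) (\<lambda>x. c (x - int q * t) * F x))"
  proof (rule avg_cong[OF refl])
    fix t
    have "per L (\<lambda>x. c x * F (x + int q * t))" by (intro per_map2[where h = "(*)"] per_shift c F)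
    from avg_per_shift_diff[OF L this, of "int q * t", symmetric]
    show "avg (ZL L) (\<lambda>x. c x * F (x + int q * t)) = avg (ZL L) (\<lambda>x. c (x - int q * t) * F x)" by simp
  qed
  also have "\<dots> = avg (ZL L) (\<lambda>x. c' x * F x)"
    unfolding c'_def avg_mult_right[symmetric] by (rule avg_swap)
  also have "\<dots> = avg ?V G"
    unfolding F_def G_def avg_mult_left[symmetric] by (rule avg_swap)
  finally have "complex_of_real (prog_avg L F q T) = avg ?V G" .
  then have "cmod (avg ?V G) = \<bar>prog_avg L F q T\<bar>" by (metis norm_of_real)
  then have 0: "\<eta> \<le> cmod (avg ?V G)" using big unfolding F_def[symmetric] by linarith
  have 1: "cmod (avg ?V G - avg ?N (\<lambda>z. avg ?V (\<lambda>y. G (y + int q * z)))) \<le> \<eta> / 4"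
    using avg_progression_close[where G = G and a = 1 and q = q, OF G1 Y T(2)] T(3) unfolding V by linarith
  have 2: "cmod (G (y + int q * z) - H y z) \<le> \<eta> / 4" if z: "z \<in> ?N" for y z
  proof -
    let ?w = "y + int q * z"
    have "per L (\<lambda>x. c' x * (f2 (x + ?w) * f3 (x + ?w\<^sup>2)))" by (intro per_map2[where h = "(*)"] per_shift c' f)
    from avg_per_shift_diff[OF L this, of ?w, symmetric]
    have Gw: "G ?w = avg (ZL L) (\<lambda>x. c' (x - ?w) * f2 x * f3 (x + (?w\<^sup>2 - ?w)))"
      unfolding G_def by (simp add: mult.assoc add_diff_eq diff_add_eq)
    have eq: "G ?w - H y z = avg (ZL L) (\<lambda>x. (f2 x * f3 (x + (?w\<^sup>2 - ?w))) * (c' (x - ?w) - c' (x - y)))"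
      unfolding Gw H_def avg_diff[symmetric] by (simp only: left_diff_distrib right_diff_distrib mult_ac)
    have "cmod (G ?w - H y z) \<le> 2 * of_int z / T"
      unfolding eq
    proof (rule norm_avg_le_const)
      fix x
      have "c' (x - ?w) = avg ?I (\<lambda>t. c ((x - y) - int q * (t + z)))" unfolding c'_def by (simp add: algebra_simps)
      then have "cmod (c' (x - y) - c' (x - ?w)) \<le> 2 * of_int z / T"
        using avg_shift_close[of "\<lambda>t. c ((x - y) - int q * t)" T z 0] c1 T(1) z by (simp add: c'_def)
      then have "cmod (c' (x - ?w) - c' (x - y)) \<le> 2 * of_int z / T" by (simp only: norm_minus_commute)
      moreover have "cmod (f2 x * f3 (x + (?w\<^sup>2 - ?w)) * (c' (x - ?w) - c' (x - y))) \<le> cmod (c' (x - ?w) - c' (x - y))"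
        unfolding norm_mult[of _ "c' (x - ?w) - c' (x - y)"]
        using f by (intro mult_left_le_one_le) (auto simp: norm_mult bd_def intro!: mult_le_one)
      ultimately show "cmod (f2 x * f3 (x + (?w\<^sup>2 - ?w)) * (c' (x - ?w) - c' (x - y))) \<le> 2 * of_int z / T" by linarith
    qed (use z in simp)
    also have "\<dots> \<le> 2 * real n / T" using z by (intro divide_right_mono) auto
    finally show ?thesis using T(4) by linarith
  qed
  have 3: "cmod (avg ?N (\<lambda>z. avg ?V (\<lambda>y. G (y + int q * z))) - avg ?N (\<lambda>z. avg ?V (\<lambda>y. H y z))) \<le> \<eta> / 4"
  proof -
    have "0 \<le> 2 * real n / T" by simp
    then have "0 \<le> \<eta> / 4" using T(4) by linarith
    then show ?thesis unfolding avg_diff[symmetric]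
      by (intro norm_avg_le_const 2) auto
  qed
  define R where "R y = avg (ZL L) (\<lambda>x. cmod (avg ?N (\<lambda>z. f3 (x + ((y + int q * z)\<^sup>2 - (y + int q * z))))))" for y
  have 4: "cmod (avg ?N (H y)) \<le> R y" for y
  proof -
    have eq: "avg ?N (H y) = avg (ZL L) (\<lambda>x. (c' (x - y) * f2 x) * avg ?N (\<lambda>z. f3 (x + ((y + int q * z)\<^sup>2 - (y + int q * z)))))"
      unfolding H_def avg_mult_left[symmetric] by (rule avg_swap)
    show ?thesis unfolding eq R_def
    proof (intro order_trans[OF norm_avg_le] avg_mono)
      fix x
      have "cmod (c' (x - y) * f2 x) \<le> 1" using c'1 f by (auto simp: norm_mult bd_def intro!: mult_le_one)
      then show "cmod ((c' (x - y) * f2 x) * avg ?N (\<lambda>z. f3 (x + ((y + int q * z)\<^sup>2 - (y + int q * z)))))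
        \<le> cmod (avg ?N (\<lambda>z. f3 (x + ((y + int q * z)\<^sup>2 - (y + int q * z)))))"
        unfolding norm_mult[of "c' (x - y) * f2 x"] by (intro mult_left_le_one_le) auto
    qed
  qed
  have "avg ?N (\<lambda>z. avg ?V (\<lambda>y. H y z)) = avg ?V (\<lambda>y. avg ?N (H y))" by (rule avg_swap)
  then have "cmod (avg ?N (\<lambda>z. avg ?V (\<lambda>y. H y z))) \<le> avg ?V (\<lambda>y. cmod (avg ?N (H y)))" by (simp only: norm_avg_le)
  also have "\<dots> \<le> avg ?V R" by (intro avg_mono 4)
  finally have 5: "cmod (avg ?N (\<lambda>z. avg ?V (\<lambda>y. H y z))) \<le> avg ?V R" .
  obtain y where "avg ?V R \<le> R y" using ex_ge_avg[of ?V R] Y by auto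
  moreover have "\<eta> / 2 \<le> avg ?V R"
    using 0 1 3 5 norm_triangle_ineq2[of "avg ?V G" "avg ?N (\<lambda>z. avg ?V (\<lambda>y. G (y + int q * z)))"]
      norm_triangle_ineq2[of "avg ?N (\<lambda>z. avg ?V (\<lambda>y. G (y + int q * z)))" "avg ?N (\<lambda>z. avg ?V (\<lambda>y. H y z))"]
    by linarith
  ultimately show ?thesis unfolding R_def by (intro exI[of _ y]) linarith
qed

text \<open>Averaging translates of \<open>f\<close> multiplies its Fourier coefficients by the
  exponential sums \<open>S k\<close>. By Parseval the frequencies with \<open>S k\<close> below
  \<sigma> account for at most \<open>\<sigma>\<^sup>2\<close>; the others lie in major arcs by
  Weyl's inequality, so there are at most \<open>K\<close> of them and one carries its
  share.\<close>

lemma quadratic_spectrum: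
  fixes \<sigma> K :: real
  assumes L: "0 < L" and f: "per L f" "bd f" and s: "0 < \<sigma>" "\<sigma> \<le> 1 / 2" "(1 / \<sigma>) ^ 18 \<le> n" and q: "1 \<le> q"
    and big: "2 * \<sigma> \<le> avg (ZL L) (\<lambda>x. cmod (avg {0..<int n} (\<lambda>z. f (x + ((y + int q * z)\<^sup>2 - (y + int q * z))))))"
    and K: "0 < K" "card {k\<in>ZL L. \<exists>r::nat. 1 \<le> r \<and> r \<le> nat \<lfloor>(1 / \<sigma>) ^ 9 * (real q)\<^sup>2\<rfloor> \<and> nd (real r * (of_int k / L)) \<le> (1 / \<sigma>) ^ 23 / (real n)\<^sup>2} \<le> K"
  shows "\<exists>k r. (1::nat) \<le> r \<and> real r \<le> (1 / \<sigma>) ^ 9 * (real q)\<^sup>2 \<and> nd (real r * (of_int k / L)) \<le> (1 / \<sigma>) ^ 23 / (real n)\<^sup>2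
    \<and> 2 * \<sigma>\<^sup>2 / K \<le> (cmod (ft L f k))\<^sup>2"
proof -
  let ?N = "{0..<int n}"
  define p where "p z = (y + int q * z)\<^sup>2 - (y + int q * z)" for z
  define h where "h x = avg ?N (\<lambda>z. f (x + p z))" for x
  define S where "S k = avg ?N (\<lambda>z. ch L k (p z))" for k
  have h: "per L h" unfolding h_def by (intro per_avg per_shift f)
  have fth: "ft L h k = S k * ft L f k" for k
  proof -
    have "ft L h k = avg ?N (\<lambda>z. ft L (\<lambda>x. f (x + p z)) k)"
      unfolding ft_def h_def avg_mult_right[symmetric] by (rule avg_swap)
    also have "\<dots> = S k * ft L f k"
      unfolding S_def by (simp only: ft_shift[OF L f(1)] avg_mult_right)
    finally show ?thesis .
  qed
  have "(2 * \<sigma>)\<^sup>2 \<le> (avg (ZL L) (\<lambda>x. cmod (h x)))\<^sup>2"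
    using big s unfolding h_def p_def by (intro power_mono) auto
  also have "\<dots> \<le> avg (ZL L) (\<lambda>x. (cmod (h x))\<^sup>2)" by (rule avg_square_le)
  also have "\<dots> = (\<Sum>k\<in>ZL L. (cmod (S k))\<^sup>2 * (cmod (ft L f k))\<^sup>2)"
    unfolding parseval[OF L h, symmetric] fth by (simp add: norm_mult power_mult_distrib)
  finally have tot: "4 * \<sigma>\<^sup>2 \<le> (\<Sum>k\<in>ZL L. (cmod (S k))\<^sup>2 * (cmod (ft L f k))\<^sup>2)" by (simp add: power_mult_distrib)
  define M where "M = {k\<in>ZL L. \<sigma> \<le> cmod (S k)}"
  have fM: "finite M" "M \<subseteq> ZL L" unfolding M_def using finite_ZL_Collect by auto
  have maj: "\<exists>r. (1::nat) \<le> r \<and> real r \<le> (1 / \<sigma>) ^ 9 * (real q)\<^sup>2 \<and> nd (real r * (of_int k / L)) \<le> (1 / \<sigma>) ^ 23 / (real n)\<^sup>2"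
    if k: "k \<in> M" for k
  proof -
    define \<alpha> where "\<alpha> = (real q)\<^sup>2 * (of_int k / L)"
    have e: "ch L k (p z) = ee (\<alpha> * (of_int z)\<^sup>2 + (of_int (k * (2 * y * int q - int q)) / L) * of_int z + of_int (k * (y\<^sup>2 - y)) / L)" for z
      unfolding ch_def p_def \<alpha>_def by (rule arg_cong[of _ _ ee]) (simp add: power2_eq_square algebra_simps add_divide_distrib diff_divide_distrib)
    have "\<sigma> \<le> cmod (S k)" using k by (simp add: M_def)
    then have "\<sigma> \<le> cmod (avg {0..<0 + int n} (\<lambda>z. ee (\<alpha> * (of_int z)\<^sup>2 + (of_int (k * (2 * y * int q - int q)) / L) * of_int z + of_int (k * (y\<^sup>2 - y)) / L)))"
      unfolding S_def e by (simp only: add_0)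
    from weyl_quadratic[OF s this] obtain r :: nat where r: "1 \<le> r" "real r \<le> (1 / \<sigma>) ^ 9" "nd (r * \<alpha>) \<le> (1 / \<sigma>) ^ 23 / (real n)\<^sup>2"
      by blast
    \<comment> \<open>The leading coefficient in \<open>z\<close> is
      \<open>q\<^sup>2 * k / L\<close>, so a denominator \<open>r\<close> for it yields
      \<open>r * q\<^sup>2\<close> for \<open>k / L\<close>.\<close>
    have "1 \<le> r * q\<^sup>2" using r(1) q by (simp add: Suc_le_eq)
    moreover have "real (r * q\<^sup>2) \<le> (1 / \<sigma>) ^ 9 * (real q)\<^sup>2" using r(2) by (simp add: mult_right_mono)
    moreover have "real (r * q\<^sup>2) * (of_int k / L) = r * \<alpha>" by (simp add: \<alpha>_def)
    ultimately show ?thesis using r(3) by (intro exI[of _ "r * q\<^sup>2"]) simp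
  qed
  have "card M \<le> card {k\<in>ZL L. \<exists>r::nat. 1 \<le> r \<and> r \<le> nat \<lfloor>(1 / \<sigma>) ^ 9 * (real q)\<^sup>2\<rfloor> \<and> nd (real r * (of_int k / L)) \<le> (1 / \<sigma>) ^ 23 / (real n)\<^sup>2}"
  proof (intro card_mono finite_ZL_Collect subsetI CollectI conjI)
    fix k assume k: "k \<in> M"
    then show "k \<in> ZL L" using fM by blast
    show "\<exists>r::nat. 1 \<le> r \<and> r \<le> nat \<lfloor>(1 / \<sigma>) ^ 9 * (real q)\<^sup>2\<rfloor> \<and> nd (real r * (of_int k / L)) \<le> (1 / \<sigma>) ^ 23 / (real n)\<^sup>2"
      using maj[OF k] le_nat_floor by blast
  qed
  then have cM: "real (card M) \<le> K" using K(2) by linarith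
  have S1: "cmod (S k) \<le> 1" for k unfolding S_def by (rule norm_avg_le_const) auto
  have "(\<Sum>k\<in>ZL L - M. (cmod (S k))\<^sup>2 * (cmod (ft L f k))\<^sup>2) \<le> (\<Sum>k\<in>ZL L - M. \<sigma>\<^sup>2 * (cmod (ft L f k))\<^sup>2)"
    by (intro sum_mono mult_right_mono power_mono) (auto simp: M_def)
  also have "\<dots> \<le> (\<Sum>k\<in>ZL L. \<sigma>\<^sup>2 * (cmod (ft L f k))\<^sup>2)" by (intro sum_mono2) auto
  also have "\<dots> = \<sigma>\<^sup>2 * (\<Sum>k\<in>ZL L. (cmod (ft L f k))\<^sup>2)" by (simp only: sum_distrib_left)
  also have "\<dots> \<le> \<sigma>\<^sup>2 * 1" by (intro mult_left_mono bessel[OF L f]) simp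
  finally have bad: "(\<Sum>k\<in>ZL L - M. (cmod (S k))\<^sup>2 * (cmod (ft L f k))\<^sup>2) \<le> \<sigma>\<^sup>2" by simp
  have "(\<Sum>k\<in>ZL L. (cmod (S k))\<^sup>2 * (cmod (ft L f k))\<^sup>2)
      = (\<Sum>k\<in>ZL L - M. (cmod (S k))\<^sup>2 * (cmod (ft L f k))\<^sup>2) + (\<Sum>k\<in>M. (cmod (S k))\<^sup>2 * (cmod (ft L f k))\<^sup>2)"
    by (rule sum.subset_diff[OF fM(2)]) simp
  then have good: "3 * \<sigma>\<^sup>2 \<le> (\<Sum>k\<in>M. (cmod (S k))\<^sup>2 * (cmod (ft L f k))\<^sup>2)" using tot bad by linarith
  have "\<exists>k\<in>M. 2 * \<sigma>\<^sup>2 / K \<le> (cmod (ft L f k))\<^sup>2"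
  proof (rule ccontr)
    assume n: "\<not> ?thesis"
    have "(\<Sum>k\<in>M. (cmod (S k))\<^sup>2 * (cmod (ft L f k))\<^sup>2) \<le> (\<Sum>k\<in>M. 2 * \<sigma>\<^sup>2 / K)"
    proof (rule sum_mono)
      fix k assume k: "k \<in> M"
      have "(cmod (S k))\<^sup>2 * (cmod (ft L f k))\<^sup>2 \<le> 1 * (cmod (ft L f k))\<^sup>2"
        using S1 by (intro mult_right_mono power_le_one) auto
      moreover have "(cmod (ft L f k))\<^sup>2 \<le> 2 * \<sigma>\<^sup>2 / K" using n k by force
      ultimately show "(cmod (S k))\<^sup>2 * (cmod (ft L f k))\<^sup>2 \<le> 2 * \<sigma>\<^sup>2 / K" by linarith
    qed
    also have "\<dots> = card M * (2 * \<sigma>\<^sup>2 / K)" by simp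
    also have "\<dots> \<le> K * (2 * \<sigma>\<^sup>2 / K)" using cM K by (intro mult_right_mono) auto
    also have "\<dots> = 2 * \<sigma>\<^sup>2" using K by simp
    finally have "\<sigma>\<^sup>2 \<le> 0" using good by linarith
    then show False using s by simp
  qed
  then show ?thesis using maj by blast
qed

text \<open>The final step is the denominator of a major arc frequency of \<open>f3\<close> and may
  differ from \<open>q\<close>. It works because the character at such a frequency is nearly
  constant along progressions with this step.\<close>

lemma large_prog_avg_third:
  fixes \<rho> :: real
  assumes L: "0 < L" "real L \<le> 12 * (real Y)\<^sup>2" and f: "per L f2" "per L f3" "bd f2" "bd f3"
    and r: "0 < \<rho>" "\<rho> \<le> 1 / 2" "(1 / \<rho>) ^ 500 \<le> Y"
    and q: "1 \<le> q" "real q \<le> (1 / \<rho>) ^ 9" and T: "\<rho> ^ 40 * Y \<le> T"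
    and big: "\<rho> / 2 \<le> prog_avg L (\<lambda>x. avg {1..int Y} (\<lambda>y. f2 (x + y) * f3 (x + y\<^sup>2))) q T"
  shows "large_prog_avg L Y (\<rho> ^ 306) f3"
proof -
  define E where "E = 1 / \<rho>"
  have E2: "2 \<le> E" and rE: "\<rho> * E = 1" using r by (auto simp: E_def field_simps)
  have E0: "0 < E" and E1: "1 \<le> E" using E2 by auto
  have EY: "E ^ a \<le> Y" if "a \<le> 500" for a using power_increasing[OF that E1] r(3) by (simp add: E_def)
  have Y0: "0 < real Y" using EY[of 0] by simp
  then have Y: "0 < Y" by simp
  have can: "\<rho> ^ a * E ^ b = E ^ (b - a)" if "a \<le> b" for a b
  proof -
    have "E ^ b = E ^ a * E ^ (b - a)" using that by (simp flip: power_add)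
    then have "\<rho> ^ a * E ^ b = (\<rho> * E) ^ a * E ^ (b - a)" by (simp only: power_mult_distrib mult.assoc)
    then show ?thesis by (simp add: rE)
  qed
  have can': "\<rho> ^ b * E ^ a = \<rho> ^ (b - a)" if "a \<le> b" for a b
  proof -
    have "\<rho> ^ b = \<rho> ^ (b - a) * \<rho> ^ a" using that by (simp flip: power_add)
    then have "\<rho> ^ b * E ^ a = \<rho> ^ (b - a) * (\<rho> * E) ^ a" by (simp only: power_mult_distrib mult.assoc)
    then show ?thesis by (simp add: rE)
  qed
  have lower: "E ^ (b - a) \<le> \<rho> ^ a * Y" if "a \<le> b" "b \<le> 500" for a b
    using mult_left_mono[OF EY[OF that(2)], of "\<rho> ^ a"] can[OF that(1)] r by simp
  note ab = power_absorb[OF less_imp_le[OF r(1)] r(2)]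
  \<comment> \<open>With this length \<open>q * n\<close> is at most \<open>\<rho> ^ 36 * Y\<close>,
    and \<open>n\<close> is at most \<open>\<rho> ^ 5 * T\<close>, as both errors of
    \<open>quadratic_progression_large\<close> require.\<close>
  define n where "n = nat \<lfloor>\<rho> ^ 45 * Y\<rfloor>"
  have nu: "real n \<le> \<rho> ^ 45 * Y" unfolding n_def by (rule of_nat_floor) (use r in simp)
  have nl: "\<rho> ^ 46 * Y \<le> n"
  proof -
    have "\<rho> ^ 45 * Y / 2 \<le> n" unfolding n_def by (rule nat_floor_half_le) (use lower[of 45 45] in simp)
    moreover have "2 * \<rho> ^ 46 * Y \<le> \<rho> ^ 45 * Y" using ab[of 1 45 46] by (intro mult_right_mono) auto
    ultimately show ?thesis by linarith
  qed
  have n72: "E ^ 72 \<le> n" using lower[of 46 118] nl by simp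
  then have n0: "0 < n" using E0 by (cases n) (auto simp: not_le[symmetric])
  have T0: "0 < T" using T r Y0 by (cases T) (auto simp: mult_le_0_iff)
  have rpos: "0 < \<rho> ^ a" for a using r by simp
  have qn: "real q * n \<le> \<rho> ^ 36 * Y"
  proof -
    have "real q * n \<le> E ^ 9 * (\<rho> ^ 45 * Y)" using q(2) nu E0 by (intro mult_mono) (auto simp: E_def)
    also have "\<dots> = (\<rho> ^ 45 * E ^ 9) * Y" by (simp only: mult_ac)
    finally show ?thesis by (simp add: can')
  qed
  have c1: "2 * (real q * n) / Y \<le> \<rho> / 2 / 4"
  proof -
    have "2 * (real q * n) / Y \<le> 2 * (\<rho> ^ 36 * Y) / Y" using qn by (intro divide_right_mono mult_left_mono) auto
    also have "\<dots> = 2 * \<rho> ^ 36" using Y0 by simp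
    finally show ?thesis using ab[of 4 1 36] by simp
  qed
  have c2: "2 * real n / T \<le> \<rho> / 2 / 4"
  proof -
    have "16 * \<rho> ^ 45 * Y \<le> \<rho> ^ 41 * Y" using ab[of 4 41 45] by (intro mult_right_mono) auto
    also have "\<dots> = \<rho> * (\<rho> ^ 40 * Y)" by (simp flip: power_Suc)
    also have "\<dots> \<le> \<rho> * T" using T r by (intro mult_left_mono) auto
    finally have "16 * real n \<le> \<rho> * T" using nu by linarith
    then show ?thesis using T0 by (simp add: field_simps)
  qed
  obtain y where y: "\<rho> / 2 / 2 \<le> avg (ZL L) (\<lambda>x. cmod (avg {0..<int n} (\<lambda>z. f3 (x + ((y + int q * z)\<^sup>2 - (y + int q * z))))))"
    using quadratic_progression_large[OF L(1) Y f T0 n0 c1 c2 big] by blast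
  define \<sigma> where "\<sigma> = \<rho> ^ 4"
  have s0: "0 < \<sigma>" using r by (simp add: \<sigma>_def)
  have s1: "\<sigma> \<le> 1 / 2" using ab[of 1 0 4] by (simp add: \<sigma>_def)
  have sE: "(1 / \<sigma>) ^ a = E ^ (4 * a)" for a by (simp only: \<sigma>_def E_def power_mult power_one_over)
  have s2: "2 * \<sigma> \<le> \<rho> / 2 / 2" using ab[of 3 1 4] by (simp add: \<sigma>_def)
  define \<tau> where "\<tau> = (1 / \<sigma>) ^ 23 / (real n)\<^sup>2"
  have tau: "\<tau> * (real Y)\<^sup>2 \<le> E ^ 184"
  proof -
    have "(\<rho> ^ 46 * Y)\<^sup>2 \<le> (real n)\<^sup>2" using nl r by (intro power_mono) auto
    then have "E ^ 184 * (\<rho> ^ 92 * (real Y)\<^sup>2) \<le> E ^ 184 * (real n)\<^sup>2" using E0 by (intro mult_left_mono) (auto simp: power_mult_distrib simp flip: power_mult)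
    moreover have "E ^ 184 * (\<rho> ^ 92 * (real Y)\<^sup>2) = E ^ 92 * (real Y)\<^sup>2" using can[of 92 184] by (simp add: mult_ac)
    ultimately have "E ^ 92 * (real Y)\<^sup>2 \<le> E ^ 184 * (real n)\<^sup>2" by simp
    moreover have te: "\<tau> = E ^ 92 / (real n)\<^sup>2" unfolding \<tau>_def sE by simp
    ultimately show ?thesis unfolding te using n0 by (simp add: field_simps)
  qed
  have tau0: "0 \<le> \<tau>" using s0 by (simp add: \<tau>_def)
  define Q where "Q = nat \<lfloor>(1 / \<sigma>) ^ 9 * (real q)\<^sup>2\<rfloor>"
  have q2: "(1 / \<sigma>) ^ 9 * (real q)\<^sup>2 \<le> E ^ 54"
  proof -
    have "(real q)\<^sup>2 \<le> (E ^ 9)\<^sup>2" using q(2) by (intro power_mono) (auto simp: E_def)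
    then have "E ^ 36 * (real q)\<^sup>2 \<le> E ^ 36 * (E ^ 9)\<^sup>2" using E0 by (intro mult_left_mono) auto
    then show ?thesis unfolding sE by (simp flip: power_mult power_add)
  qed
  have "real Q \<le> (1 / \<sigma>) ^ 9 * (real q)\<^sup>2" unfolding Q_def by (rule of_nat_floor) (use s0 in simp)
  then have Q: "real Q \<le> E ^ 54" using q2 by linarith
  have card: "card {k\<in>ZL L. \<exists>r::nat. 1 \<le> r \<and> r \<le> nat \<lfloor>(1 / \<sigma>) ^ 9 * (real q)\<^sup>2\<rfloor> \<and> nd (real r * (of_int k / L)) \<le> (1 / \<sigma>) ^ 23 / (real n)\<^sup>2} \<le> E ^ 298"
  proof -
    have "card {k\<in>ZL L. \<exists>r::nat. 1 \<le> r \<and> r \<le> Q \<and> nd (real r * (of_int k / L)) \<le> \<tau>} \<le> real Q * (real Q + 1) * (2 * \<tau> * L + 1)"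
      by (rule card_major_arcs[OF L(1) tau0])
    also have "\<dots> \<le> E ^ 54 * (2 * E ^ 54) * (25 * E ^ 184)"
    proof (intro mult_mono)
      have "1 \<le> E ^ 54" "1 \<le> E ^ 184" using one_le_power[OF E1] by auto
      then show "real Q + 1 \<le> 2 * E ^ 54" using Q by linarith
      have "\<tau> * L \<le> \<tau> * (12 * (real Y)\<^sup>2)" by (intro mult_left_mono L(2) tau0)
      then show "2 * \<tau> * L + 1 \<le> 25 * E ^ 184" using tau \<open>1 \<le> E ^ 184\<close> by linarith
    qed (use Q E0 tau0 in auto)
    also have "\<dots> = 50 * E ^ 292" by (simp flip: power_add)
    also have "\<dots> \<le> E ^ 6 * E ^ 292"
    proof (intro mult_right_mono)
      have "2 ^ 6 \<le> E ^ 6" using E2 by (intro power_mono) auto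
      then show "50 \<le> E ^ 6" by simp
    qed (use E0 in simp)
    also have "\<dots> = E ^ 298" by (simp flip: power_add)
    finally show ?thesis unfolding Q_def \<tau>_def .
  qed
  have s18: "(1 / \<sigma>) ^ 18 \<le> n" unfolding sE using n72 by simp
  obtain k r where kr: "(1::nat) \<le> r" "real r \<le> (1 / \<sigma>) ^ 9 * (real q)\<^sup>2" "nd (real r * (of_int k / L)) \<le> \<tau>"
    "2 * \<sigma>\<^sup>2 / E ^ 298 \<le> (cmod (ft L f3 k))\<^sup>2"
    using quadratic_spectrum[OF L(1) f(2,4) s0 s1 s18 q(1) order_trans[OF s2 y] _ card] E0 unfolding \<tau>_def by auto
  have r54: "real r \<le> E ^ 54" using kr(2) q2 by linarith
  have "2 * \<rho> ^ 306 = 2 * \<sigma>\<^sup>2 / E ^ 298"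
    using r by (simp add: \<sigma>_def E_def power_one_over flip: power_mult power_add)
  also have "\<dots> \<le> cmod (ft L f3 k) * 1"
    using kr(4) mult_left_mono[OF ft_le_one[OF f(4), of L k], of "cmod (ft L f3 k)"] by (simp add: power2_eq_square)
  finally have ftk: "2 * \<rho> ^ 306 \<le> cmod (ft L f3 k)" by simp
  \<comment> \<open>The step \<open>r\<close> is at most \<open>\<rho> ^ (- 54)\<close>, so
    \<open>r * U\<close> stays below \<open>Y\<close>.\<close>
  define U where "U = nat \<lfloor>\<rho> ^ 54 * Y\<rfloor>"
  have Uu: "real U \<le> \<rho> ^ 54 * Y" unfolding U_def by (rule of_nat_floor) (use r in simp)
  have Ul: "\<rho> ^ 306 * Y \<le> U"
  proof -
    have "\<rho> ^ 54 * Y / 2 \<le> U" unfolding U_def by (rule nat_floor_half_le) (use lower[of 54 54] in simp)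
    moreover have "2 * \<rho> ^ 306 * Y \<le> \<rho> ^ 54 * Y" using ab[of 1 54 306] by (intro mult_right_mono) auto
    ultimately show ?thesis by linarith
  qed
  then have U0: "0 < U" using r Y0 by (cases U) (auto simp: mult_le_0_iff)
  have rU: "r * U \<le> Y"
  proof -
    have "real r * U \<le> E ^ 54 * (\<rho> ^ 54 * Y)" using r54 Uu E0 by (intro mult_mono) auto
    also have "\<dots> = (\<rho> ^ 54 * E ^ 54) * Y" by (simp only: mult_ac)
    also have "\<dots> = real Y" by (simp add: can)
    finally have "real (r * U) \<le> real Y" by simp
    then show ?thesis by (simp only: of_nat_le_iff)
  qed
  have nd: "7 * (U * nd (real r * (of_int k / L))) \<le> 2 * \<rho> ^ 306 / 2"
  proof -
    have YU: "real U \<le> Y"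
    proof -
      have "\<rho> ^ 54 * real Y \<le> 1 * real Y" using r by (intro mult_right_mono power_le_one) auto
      then show ?thesis using Uu by linarith
    qed
    \<comment> \<open>This is where \<open>Y\<close> must be as large as
      \<open>\<rho> ^ (- 500)\<close>: \<tau> is at most
      \<open>\<rho> ^ (- 184) / Y\<^sup>2\<close>, and the drift over length \<open>Y\<close> has to
      lie well below \<open>\<rho> ^ 306\<close>.\<close>
    have "\<tau> * Y \<le> \<rho> ^ 316"
    proof -
      have "(\<tau> * Y) * E ^ 500 \<le> (\<tau> * Y) * Y" using EY[of 500] tau0 by (intro mult_left_mono) auto
      also have "\<dots> \<le> E ^ 184" using tau by (simp only: power2_eq_square mult.assoc)
      also have "\<dots> = \<rho> ^ 316 * E ^ 500" by (simp add: can)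
      finally show ?thesis using E0 by simp
    qed
    moreover have "U * nd (real r * (of_int k / L)) \<le> Y * \<tau>" using YU kr(3) by (intro mult_mono) auto
    ultimately have "U * nd (real r * (of_int k / L)) \<le> \<rho> ^ 316" by (simp add: mult.commute)
    moreover have "8 * \<rho> ^ 316 \<le> \<rho> ^ 306" using ab[of 3 306 316] by simp
    ultimately show ?thesis using rpos[of 316] by linarith
  qed
  have "2 * \<rho> ^ 306 / 2 \<le> prog_avg L f3 r U" by (rule prog_avg_of_ft[OF L(1) f(2,4) U0 ftk nd])
  moreover have "real r \<le> 1 / \<rho> ^ 306"
  proof -
    have "E ^ 54 \<le> E ^ 306" using E1 by (intro power_increasing) auto
    then show ?thesis using r54 by (simp add: E_def power_one_over)
  qed
  ultimately show ?thesis unfolding large_prog_avg_def using kr(1) rU Ul by auto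
qed

lemma large_prog_avg_of_Lam:
  fixes \<delta> :: real
  assumes L: "0 < L" "real L \<le> 12 * (real Y)\<^sup>2"
    and f: "per L f1" "per L f2" "per L f3" "bd f1" "bd f2" "bd f3"
    and d: "0 < \<delta>" "\<delta> \<le> 1 / 2" "(1 / \<delta>) ^ (2000 * dual_exp) \<le> Y"
    and big: "\<delta> \<le> cmod (Lam L Y f1 f2 f3)"
  shows "large_prog_avg L Y (\<delta> ^ (2000 * dual_exp)) f1" "large_prog_avg L Y (\<delta> ^ (2000 * dual_exp)) f2" "large_prog_avg L Y (\<delta> ^ (2000 * dual_exp)) f3"
proof -
  have dY: "(1 / \<delta>) ^ a \<le> Y" if "a \<le> 2000 * dual_exp" for a
  proof -
    have "1 \<le> 1 / \<delta>" using d by simp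
    from power_increasing[OF that this] show ?thesis using d(3) by linarith
  qed
  have dm: "\<delta> ^ (2000 * dual_exp) \<le> \<delta> ^ a" if "a \<le> 2000 * dual_exp" for a using that d by (intro power_decreasing) auto
  have dh: "\<delta> ^ a \<le> 1 / 2" if "1 \<le> a" for a
    using power_absorb[of \<delta> 1 0 a] d that by simp
  have dp: "0 < \<delta> ^ a" for a using d by simp
  have ik: "1 / (1 / \<delta>) = \<delta>" by simp
  define \<rho> where "\<rho> = \<delta> ^ (2 * dual_exp)"
  have r0: "0 < \<rho>" "\<rho> \<le> 1 / 2" unfolding \<rho>_def using dp dh[of "2 * dual_exp"] dual_exp_pos by auto
  have rk: "(1 / \<rho>) ^ a = (1 / \<delta>) ^ (2 * dual_exp * a)" "\<rho> ^ a = \<delta> ^ (2 * dual_exp * a)" for a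
    by (simp_all only: \<rho>_def power_mult power_one_over)
  have "\<exists>q T. 1 \<le> q \<and> real q \<le> (1 / \<rho>) ^ 9 \<and> q * T \<le> Y \<and> \<rho> ^ 40 * Y \<le> T \<and> \<rho> / 2 \<le> prog_avg L f1 q T \<and> \<rho> / 2 \<le> prog_avg L f2 q T"
    by (rule prog_avg_of_Lam[OF L f d(1,2) \<rho>_def _ big]) (unfold rk, rule dY, simp)
  then obtain q T where qT: "1 \<le> q" "real q \<le> (1 / \<rho>) ^ 9" "q * T \<le> Y" "\<rho> ^ 40 * Y \<le> T" "\<rho> / 2 \<le> prog_avg L f1 q T" "\<rho> / 2 \<le> prog_avg L f2 q T"
    by blast
  have "(1 / \<rho>) ^ 9 \<le> (1 / \<rho>) ^ 40" using r0 by (intro power_increasing) auto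
  then have q40: "real q \<le> 1 / \<rho> ^ 40" using qT(2) by (simp add: power_one_over)
  have r40: "\<rho> ^ 40 \<le> \<rho> / 2" using power_absorb[of \<rho> 1 1 40] r0 by simp
  have w: "large_prog_avg L Y (\<rho> ^ 40) f1" "large_prog_avg L Y (\<rho> ^ 40) f2"
    unfolding large_prog_avg_def using qT q40 order_trans[OF r40] by blast+
  show "large_prog_avg L Y (\<delta> ^ (2000 * dual_exp)) f1" "large_prog_avg L Y (\<delta> ^ (2000 * dual_exp)) f2"
    using w[THEN large_prog_avg_mono, OF dp, of "2000 * dual_exp"] dm[of "2 * dual_exp * 40"] by (simp_all add: rk)
  \<comment> \<open>With the conjugate of \<open>D\<close> in the first place the counting form is
    the mean square of \<open>D\<close>, at least \<open>\<delta>\<^sup>2\<close>; the conclusion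
    for a first function then applies to \<open>D\<close>.\<close>
  define D where "D x = avg {1..int Y} (\<lambda>y. f2 (x + y) * f3 (x + y\<^sup>2))" for x
  have D: "per L D" unfolding D_def by (intro per_avg per_map2[where h = "(*)"] per_shift f)
  have D1: "bd D" unfolding D_def by (intro bd_avg bd_mult bd_add f)
  let ?F = "\<lambda>x. cnj (D x)"
  have F: "per L ?F" "bd ?F" using D D1 by (auto intro: per_map bd_cnj)
  have LamD: "Lam L Y g f2 f3 = avg (ZL L) (\<lambda>x. g x * D x)" for g
    unfolding Lam_def D_def avg_mult_left[symmetric] by (simp only: mult.assoc)
  have "\<delta>\<^sup>2 \<le> (cmod (Lam L Y f1 f2 f3))\<^sup>2" using big d by (intro power_mono) auto
  also have "\<dots> \<le> avg (ZL L) (\<lambda>x. (cmod (D x))\<^sup>2)"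
    unfolding LamD by (rule norm_avg_mult_square) (use f(4) in \<open>simp add: bd_def\<close>)
  also have "\<dots> \<le> cmod (complex_of_real (avg (ZL L) (\<lambda>x. (cmod (D x))\<^sup>2)))" by (simp only: norm_of_real abs_ge_self)
  also have "complex_of_real (avg (ZL L) (\<lambda>x. (cmod (D x))\<^sup>2)) = Lam L Y ?F f2 f3"
    unfolding LamD avg_of_real[symmetric] norm_square_complex by (simp only: mult.commute)
  finally have big2: "\<delta>\<^sup>2 \<le> cmod (Lam L Y ?F f2 f3)" .
  define \<rho>' where "\<rho>' = (\<delta>\<^sup>2) ^ (2 * dual_exp)"
  have rk': "\<rho>' = \<delta> ^ (4 * dual_exp)" by (simp add: \<rho>'_def flip: power_mult)
  have r0': "0 < \<rho>'" "\<rho>' \<le> 1 / 2" unfolding rk' using dp dh[of "4 * dual_exp"] dual_exp_pos by auto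
  have rka: "(1 / \<rho>') ^ a = (1 / \<delta>) ^ (4 * dual_exp * a)" "\<rho>' ^ a = \<delta> ^ (4 * dual_exp * a)" for a
    by (simp_all only: rk' power_mult power_one_over)
  have "\<exists>q T. 1 \<le> q \<and> real q \<le> (1 / \<rho>') ^ 9 \<and> q * T \<le> Y \<and> \<rho>' ^ 40 * Y \<le> T \<and> \<rho>' / 2 \<le> prog_avg L ?F q T \<and> \<rho>' / 2 \<le> prog_avg L f2 q T"
  proof (rule prog_avg_of_Lam[OF L F(1) f(2,3) F(2) f(5,6) _ _ \<rho>'_def _ big2])
    show "0 < \<delta>\<^sup>2" "\<delta>\<^sup>2 \<le> 1 / 2" using dp[of 2] dh[of 2] by auto
    show "(1 / \<rho>') ^ 40 \<le> Y" unfolding rka by (rule dY) simp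
  qed
  then obtain q T where qT': "1 \<le> q" "real q \<le> (1 / \<rho>') ^ 9" "\<rho>' ^ 40 * Y \<le> T" "\<rho>' / 2 \<le> prog_avg L D q T"
    unfolding prog_avg_cnj by blast
  \<comment> \<open>Since \<open>\<rho>'\<close> is \<open>\<delta> ^ (4 * dual_exp)\<close>, the
    power 500 is the origin of the exponent \<open>2000 * dual_exp\<close>.\<close>
  have Y500: "(1 / \<rho>') ^ 500 \<le> Y" unfolding rka by (rule dY) simp
  have "large_prog_avg L Y (\<rho>' ^ 306) f3"
    by (rule large_prog_avg_third[OF L f(2,3,5,6) r0' Y500 qT'(1-3) qT'(4)[unfolded D_def]])
  then show "large_prog_avg L Y (\<delta> ^ (2000 * dual_exp)) f3"
    using large_prog_avg_mono[OF _ dp dm[of "4 * dual_exp * 306"]] by (simp add: rka)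
qed

section \<open>Local functions\<close>

text \<open>For \<open>M = q T\<close> the number \<open>z - q * (((z - r) mod M) div q)\<close> is the point congruent to \<open>z\<close> modulo \<open>q\<close>
  among the first \<open>q\<close> points of the block of \<open>z\<close>, where the blocks have length \<open>M\<close> and start at \<open>r + M j\<close>.\<close>

definition block_fun :: "(int \<Rightarrow> complex) \<Rightarrow> nat \<Rightarrow> nat \<Rightarrow> int \<Rightarrow> int \<Rightarrow> complex" where
  "block_fun c M q r z = c (z - int q * (((z - r) mod int M) div int q))"

lemma block_fun_eq:
  assumes z: "z \<in> {r + int M * j..<r + int M * j + int M}"
  shows "block_fun c M q r z = c (r + int M * j + (z - (r + int M * j)) mod int q)"
proof -
  define u where "u = z - (r + int M * j)"
  have u: "0 \<le> u" "u < int M" using z by (auto simp: u_def)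
  have "z - r = u + int M * j" by (simp add: u_def)
  then have m: "(z - r) mod int M = u" using u by simp
  have "z - int q * (u div int q) = r + int M * j + (u - int q * (u div int q))" by (simp add: u_def)
  also have "u - int q * (u div int q) = u mod int q" by (rule minus_mult_div_eq_mod)
  finally show ?thesis unfolding block_fun_def m by (simp add: u_def)
qed

lemma local_function_block_fun:
  assumes M: "0 < M" and q: "0 < q"
  shows "local_function M q (block_fun c M q r)"
proof -
  define I where "I j = {r + int M * j..<r + int M * j + int M}" for j
  have memI: "z \<in> I j \<longleftrightarrow> (z - r) div int M = j" for z j
  proof
    assume z: "z \<in> I j"
    have "(a + int M * j) div int M = j + a div int M" for a using M by simp
    from this[of "z - r - int M * j"] have "(z - r) div int M = j + (z - r - int M * j) div int M" by (simp only: diff_add_cancel)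
    moreover have "(z - r - int M * j) div int M = 0" using z by (intro div_pos_pos_trivial) (auto simp: I_def)
    ultimately show "(z - r) div int M = j" by simp
  next
    assume "(z - r) div int M = j"
    then have "z - r = int M * j + (z - r) mod int M" by (metis mult_div_mod_eq)
    moreover have "0 \<le> (z - r) mod int M" "(z - r) mod int M < int M" using M by auto
    ultimately show "z \<in> I j" unfolding I_def atLeastLessThan_iff by linarith
  qed
  have "partition_on UNIV (range I)"
  proof (rule partition_onI)
    show "\<Union> (range I) = UNIV" using memI by blast
    show "{} \<notin> range I" using M by (auto simp: I_def)
    show "disjnt p p'" if "p \<in> range I" "p' \<in> range I" "p \<noteq> p'" for p p'
    proof -
      from that(1,2) obtain j j' where "p = I j" "p' = I j'" by auto
      then show ?thesis using that(3) by (auto simp: disjnt_iff memI)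
    qed
  qed
  moreover have "\<forall>p\<in>range I. \<exists>a. p = {a..<a + int M}" by (auto simp: I_def)
  moreover have "block_fun c M q r constant_on (p \<inter> {x. [x = s] (mod int q)})" if "p \<in> range I" for p s
  proof -
    from that obtain j where j: "p = I j" by auto
    show ?thesis unfolding constant_on_def
    proof (intro exI ballI)
      fix z assume "z \<in> p \<inter> {x. [x = s] (mod int q)}"
      then have z: "z \<in> I j" "[z = s] (mod int q)" by (auto simp: j)
      have "[z - (r + int M * j) = s - (r + int M * j)] (mod int q)" by (intro cong_diff z(2) cong_refl)
      then show "block_fun c M q r z = c (r + int M * j + (s - (r + int M * j)) mod int q)"
        unfolding block_fun_eq[OF z(1)[unfolded I_def]] cong_def by simp
    qed
  qed
  ultimately show ?thesis unfolding local_function_def using M q by blast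
qed

text \<open>Each quotient is attained exactly \<open>q\<close> times.\<close>

lemma avg_div:
  assumes q: "0 < q"
  shows "avg (ZL (q * T)) (\<lambda>k. G (k div int q)) = avg (ZL T) G"
proof -
  have fib: "{k\<in>ZL (q * T). k div int q = t} = {int q * t..<int q * t + int q}" if t: "t \<in> ZL T" for t
  proof -
    have up: "int q * t + int q \<le> int q * int T"
      using mult_left_mono[of "t + 1" "int T" "int q"] t by (simp add: distrib_left)
    have lo: "0 \<le> int q * t" using t by simp
    have iff: "k div int q = t \<longleftrightarrow> int q * t \<le> k \<and> k < int q * t + int q" for k
    proof
      assume "k div int q = t"
      then have "k = int q * t + k mod int q" by (metis mult_div_mod_eq)
      moreover have "0 \<le> k mod int q" "k mod int q < int q" using q by auto
      ultimately show "int q * t \<le> k \<and> k < int q * t + int q" by linarith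
    next
      assume "int q * t \<le> k \<and> k < int q * t + int q"
      then show "k div int q = t" by (intro int_div_pos_eq[where r = "k - int q * t"]) auto
    qed
    show ?thesis
    proof (intro set_eqI iffI)
      fix k assume "k \<in> {k\<in>ZL (q * T). k div int q = t}"
      then show "k \<in> {int q * t..<int q * t + int q}" unfolding atLeastLessThan_iff iff[symmetric] by simp
    next
      fix k assume "k \<in> {int q * t..<int q * t + int q}"
      then have k: "int q * t \<le> k \<and> k < int q * t + int q" by simp
      then have "k div int q = t" by (simp only: iff)
      moreover have "0 \<le> k" "k < int q * int T" using k lo up by linarith+
      ultimately show "k \<in> {k\<in>ZL (q * T). k div int q = t}" by simp
    qed
  qed
  have sub: "(\<lambda>k. k div int q) ` ZL (q * T) \<subseteq> ZL T"
  proof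
    fix t assume "t \<in> (\<lambda>k. k div int q) ` ZL (q * T)"
    then obtain k where k: "t = k div int q" "0 \<le> k" "k < int T * int q" by (auto simp: mult.commute)
    have "k div int q < int T"
    proof (rule ccontr)
      assume "\<not> k div int q < int T"
      then have "int T * int q \<le> k div int q * int q" by (intro mult_right_mono) auto
      also have "\<dots> \<le> k div int q * int q + k mod int q" using q by (simp only: le_add_same_cancel1 pos_mod_sign of_nat_0_less_iff)
      also have "\<dots> = k" by (rule div_mult_mod_eq)
      finally show False using k(3) by simp
    qed
    then show "t \<in> ZL T" using k q by (simp add: pos_imp_zdiv_nonneg_iff)
  qed
  have "(\<Sum>k\<in>ZL (q * T). G (k div int q)) = (\<Sum>t\<in>ZL T. \<Sum>k\<in>{k\<in>ZL (q * T). k div int q = t}. G (k div int q))"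
    by (rule sum.group[OF _ _ sub, symmetric]) auto
  also have "\<dots> = (\<Sum>t\<in>ZL T. \<Sum>k\<in>{k\<in>ZL (q * T). k div int q = t}. G t)" by (intro sum.cong refl) auto
  also have "\<dots> = (\<Sum>t\<in>ZL T. of_nat q * G t)"
    by (rule sum.cong[OF refl]) (simp only: sum_constant fib card_atLeastLessThan_int, simp)
  also have "\<dots> = of_nat q * (\<Sum>t\<in>ZL T. G t)" by (rule sum_distrib_left[symmetric])
  finally show ?thesis using q by (simp add: avg_def)
qed

text \<open>As the offset \<open>r\<close> runs over a period, \<open>(z - r) mod M\<close> runs
  over all residues and its quotient by \<open>q\<close> takes each value \<open>t\<close> equally
  often. A random offset of the blocks thus reproduces the average over a progression.\<close>

lemma avg_block_fun:
  assumes q: "0 < q" and T: "0 < T"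
  shows "avg (ZL (q * T)) (\<lambda>r. block_fun c (q * T) q r z) = avg (ZL T) (\<lambda>t. c (z - int q * t))"
proof -
  let ?M = "q * T" and ?G = "\<lambda>t. c (z - int q * t)"
  define F where "F k = ?G ((k mod int ?M) div int q)" for k
  have M: "0 < ?M" using q T by simp
  have F: "per ?M F" by (simp add: per_def F_def)
  have "avg (ZL ?M) (\<lambda>r. block_fun c ?M q r z) = avg (ZL ?M) (\<lambda>r. F (z - r))" by (simp only: block_fun_def F_def)
  also have "\<dots> = avg (ZL ?M) F" unfolding avg_def sum_per_minus[OF M F] ..
  also have "\<dots> = avg (ZL ?M) (\<lambda>k. ?G (k div int q))"
    by (rule avg_cong[OF refl]) (simp add: F_def)
  also have "\<dots> = avg (ZL T) ?G" by (rule avg_div[OF q])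
  finally show ?thesis .
qed

text \<open>By duality \<open>f\<close> correlates with an average over \<open>t\<close> of
  translates of the phases \<open>c\<close>. By \<open>avg_block_fun\<close> this is an average of
  local functions over block offsets, and some offset does at least as well as the average.\<close>

lemma local_correlation:
  fixes f :: "int \<Rightarrow> complex" and \<rho> :: real
  assumes f: "\<And>x. x \<notin> {1..int N} \<Longrightarrow> f x = 0" and N: "0 < N" and Y: "0 < Y" "Y \<le> N"
    and r: "0 < \<rho>" and w: "large_prog_avg (3 * N) Y \<rho> (\<lambda>x. f (x mod int (3 * N)))"
  shows "\<exists>\<phi> M q. local_function M q \<phi> \<and> (\<forall>x. cmod (\<phi> x) \<le> 1) \<and> \<rho> * Y \<le> real M \<and> real q \<le> 1 / \<rho> \<and>
    \<rho> * N \<le> cmod (\<Sum>x\<in>{1..int N}. f x * \<phi> x)"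
proof -
  let ?L = "3 * N" and ?h = "\<lambda>x. f (x mod int (3 * N))"
  obtain q T where qT: "1 \<le> q" "real q \<le> 1 / \<rho>" "q * T \<le> Y" "\<rho> * Y \<le> T" "\<rho> \<le> prog_avg ?L ?h q T"
    using w by (auto simp: large_prog_avg_def)
  have "0 < \<rho> * Y" using r Y by simp
  then have "0 < real T" using qT(4) by linarith
  then have T: "0 < T" by simp
  have q: "0 < q" using qT by simp
  have M: "0 < q * T" using q T by simp
  \<comment> \<open>A full period of length \<open>3 * N\<close>, placed so that it contains every
    \<open>x\<close> for which \<open>x + int q * t\<close> can meet the support of
    \<open>f\<close>.\<close>
  let ?X = "{- int N..<2 * int N}" and ?I = "ZL T"
  have qt: "0 \<le> int q * t" "int q * t \<le> int N" if t: "t \<in> ?I" for t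
  proof -
    have "int q * t \<le> int q * int T" using t by (intro mult_left_mono) auto
    also have "\<dots> = int (q * T)" by simp
    also have "\<dots> \<le> int N" using qT(3) Y(2) by linarith
    finally show "int q * t \<le> int N" .
  qed (use t in auto)
  define u where "u x = avg ?I (\<lambda>t. f (x + int q * t))" for x
  define c where "c x = (if x \<in> ?X then cnj (sgn (u x)) else 0)" for x
  have hf: "?h x = f x" if x: "- int N \<le> x" "x < 3 * int N" for x
  proof (cases "0 \<le> x")
    case True
    then show ?thesis using x by simp
  next
    case False
    have "x mod int ?L = (x + int ?L) mod int ?L" by simp
    also have "\<dots> = x + int ?L" using False x by (intro mod_pos_pos_trivial) auto
    finally have "x mod int ?L \<notin> {1..int N}" using x unfolding atLeastAtMost_iff by linarith
    then show ?thesis using f False by simp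
  qed
  have ph: "per ?L ?h" by (simp add: per_def)
  have pw: "per ?L (\<lambda>x. cmod (avg ?I (\<lambda>t. ?h (x + int q * t))))"
    by (intro per_map[where h = cmod] per_avg per_shift[OF ph])
  have L0: "0 < ?L" using N by simp
  have "prog_avg ?L ?h q T = avg (ZL ?L) (\<lambda>x. cmod (avg ?I (\<lambda>t. ?h ((x - int N) + int q * t))))"
    unfolding prog_avg_def
    by (rule avg_per_shift_diff[OF L0 pw, symmetric])
  also have "\<dots> = avg (ZL ?L) (\<lambda>x. cmod (u (x - int N)))"
  proof (rule avg_cong[OF refl])
    fix x assume x: "x \<in> ZL ?L"
    have "avg ?I (\<lambda>t. ?h ((x - int N) + int q * t)) = u (x - int N)"
      unfolding u_def
    proof (rule avg_cong[OF refl])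
      fix t assume "t \<in> ?I"
      then show "?h ((x - int N) + int q * t) = f ((x - int N) + int q * t)"
        using x qt[of t] by (intro hf) auto
    qed
    then show "cmod (avg ?I (\<lambda>t. ?h ((x - int N) + int q * t))) = cmod (u (x - int N))" by simp
  qed
  also have "\<dots> = (\<Sum>x\<in>ZL ?L. cmod (u (x - int N))) / (3 * N)" by (simp add: avg_def)
  also have "(\<Sum>x\<in>ZL ?L. cmod (u (x - int N))) = (\<Sum>x\<in>?X. cmod (u x))"
    by (rule sum.reindex_bij_witness[of _ "\<lambda>x. x + int N" "\<lambda>x. x - int N"]) auto
  finally have prog_avg: "prog_avg ?L ?h q T = (\<Sum>x\<in>?X. cmod (u x)) / (3 * N)" .
  have big: "\<rho> * (3 * N) \<le> (\<Sum>x\<in>?X. cmod (u x))" using qT(5) N unfolding prog_avg by (simp add: field_simps)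
  have "complex_of_real (\<Sum>x\<in>?X. cmod (u x)) = (\<Sum>x\<in>?X. c x * u x)"
    unfolding of_real_sum by (intro sum.cong refl) (simp add: c_def cnj_sgn_mult)
  also have "\<dots> = avg ?I (\<lambda>t. \<Sum>x\<in>?X. c x * f (x + int q * t))"
    unfolding u_def avg_sum avg_mult_left ..
  also have "\<dots> = avg ?I (\<lambda>t. \<Sum>z\<in>{1..int N}. f z * c (z - int q * t))"
  proof (rule avg_cong[OF refl])
    fix t assume t: "t \<in> ?I"
    have "(\<Sum>x\<in>?X. c x * f (x + int q * t)) = (\<Sum>z\<in>{- int N + int q * t..<2 * int N + int q * t}. f z * c (z - int q * t))"
      by (rule sum.reindex_bij_witness[of _ "\<lambda>z. z - int q * t" "\<lambda>x. x + int q * t"]) auto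
    also have "\<dots> = (\<Sum>z\<in>{1..int N}. f z * c (z - int q * t))"
      using qt[OF t] N f by (intro sum.mono_neutral_right) auto
    finally show "(\<Sum>x\<in>?X. c x * f (x + int q * t)) = (\<Sum>z\<in>{1..int N}. f z * c (z - int q * t))" .
  qed
  also have "\<dots> = (\<Sum>z\<in>{1..int N}. f z * avg ?I (\<lambda>t. c (z - int q * t)))"
    unfolding avg_sum avg_mult_left ..
  also have "\<dots> = avg (ZL (q * T)) (\<lambda>r. \<Sum>z\<in>{1..int N}. f z * block_fun c (q * T) q r z)"
    unfolding avg_block_fun[OF q T, symmetric] avg_sum avg_mult_left ..
  finally have eq: "complex_of_real (\<Sum>x\<in>?X. cmod (u x)) = avg (ZL (q * T)) (\<lambda>r. \<Sum>z\<in>{1..int N}. f z * block_fun c (q * T) q r z)" .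
  have "(\<Sum>x\<in>?X. cmod (u x)) \<le> cmod (complex_of_real (\<Sum>x\<in>?X. cmod (u x)))" by (simp only: norm_of_real abs_ge_self)
  also have "\<dots> \<le> avg (ZL (q * T)) (\<lambda>r. cmod (\<Sum>z\<in>{1..int N}. f z * block_fun c (q * T) q r z))"
    unfolding eq by (rule norm_avg_le)
  finally have av: "\<rho> * (3 * N) \<le> avg (ZL (q * T)) (\<lambda>r. cmod (\<Sum>z\<in>{1..int N}. f z * block_fun c (q * T) q r z))"
    using big by linarith
  have ne: "ZL (q * T) \<noteq> {}" using M by simp
  obtain r where "avg (ZL (q * T)) (\<lambda>r. cmod (\<Sum>z\<in>{1..int N}. f z * block_fun c (q * T) q r z)) \<le> cmod (\<Sum>z\<in>{1..int N}. f z * block_fun c (q * T) q r z)"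
    using ex_ge_avg[OF finite_atLeastLessThan_int ne, of "\<lambda>r. cmod (\<Sum>z\<in>{1..int N}. f z * block_fun c (q * T) q r z)"] by blast
  moreover have "\<rho> * N \<le> \<rho> * (3 * N)" using r by (intro mult_left_mono) auto
  ultimately have cor: "\<rho> * N \<le> cmod (\<Sum>z\<in>{1..int N}. f z * block_fun c (q * T) q r z)" using av by linarith
  have "cmod (block_fun c (q * T) q r x) \<le> 1" for x by (simp add: block_fun_def c_def norm_sgn)
  moreover have "\<rho> * Y \<le> real (q * T)"
  proof -
    have "1 * real T \<le> real q * real T" using qT(1) by (intro mult_right_mono) auto
    then show ?thesis using qT(4) by simp
  qed
  ultimately show ?thesis using local_function_block_fun[OF M q] qT(2) cor by blast
qed

section \<open>From the cyclic group back to the integers\<close>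

lemma triple_sum_finite:
  fixes f1 f2 f3 :: "int \<Rightarrow> complex"
  assumes s: "\<And>x. x \<notin> {1..int N} \<Longrightarrow> f1 x = 0" "\<And>x. x \<notin> {1..int N} \<Longrightarrow> f3 x = 0" and Y: "int N < (int Y + 1)\<^sup>2"
  shows "(\<Sum>\<^sub>\<infinity>x\<in>UNIV. \<Sum>\<^sub>\<infinity>y\<in>{1::nat..}. f1 x * f2 (x + int y) * f3 (x + (int y)\<^sup>2))
    = (\<Sum>x\<in>{1..int N}. \<Sum>y\<in>{1..int Y}. f1 x * f2 (x + y) * f3 (x + y\<^sup>2))"
proof -
  let ?g = "\<lambda>x y. f1 x * f2 (x + y) * f3 (x + y\<^sup>2)"
  have inner: "(\<Sum>\<^sub>\<infinity>y\<in>{1::nat..}. ?g x (int y)) = (\<Sum>y\<in>{1..int Y}. ?g x y)" if x: "x \<in> {1..int N}" for x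
  proof -
    have "(\<Sum>\<^sub>\<infinity>y\<in>{1::nat..}. ?g x (int y)) = (\<Sum>\<^sub>\<infinity>y\<in>{1..Y}. ?g x (int y))"
    proof (rule infsum_cong_neutral)
      fix y assume y: "y \<in> {1::nat..} - {1..Y}"
      then have "int Y + 1 \<le> int y" by auto
      then have "(int Y + 1)\<^sup>2 \<le> (int y)\<^sup>2" by (intro power_mono) auto
      then have "int N < (int y)\<^sup>2" using Y by linarith
      then have "x + (int y)\<^sup>2 \<notin> {1..int N}" using x unfolding atLeastAtMost_iff by linarith
      then show "?g x (int y) = 0" using s(2) by simp
    qed auto
    also have "\<dots> = (\<Sum>y\<in>{1..Y}. ?g x (int y))" by simp
    also have "\<dots> = (\<Sum>y\<in>int ` {1..Y}. ?g x y)" by (simp add: sum.reindex)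
    finally show ?thesis by (simp add: image_int_atLeastAtMost)
  qed
  have "(\<Sum>\<^sub>\<infinity>x\<in>UNIV. \<Sum>\<^sub>\<infinity>y\<in>{1::nat..}. ?g x (int y)) = (\<Sum>\<^sub>\<infinity>x\<in>{1..int N}. \<Sum>y\<in>{1..int Y}. ?g x y)"
  proof (rule infsum_cong_neutral)
    fix x assume "x \<in> UNIV - {1..int N}"
    then show "(\<Sum>\<^sub>\<infinity>y\<in>{1::nat..}. ?g x (int y)) = 0" using s(1) by simp
  qed (simp_all only: inner Int_iff Diff_iff UNIV_I simp_thms)
  then show ?thesis by simp
qed

text \<open>The support has length at most a third of the period and the shifts are at most \<open>N\<close>, so nothing wraps
  around.\<close>

lemma Lam_periodic_extension:
  fixes f1 f2 f3 :: "int \<Rightarrow> complex"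
  assumes s: "\<And>x. x \<notin> {1..int N} \<Longrightarrow> f1 x = 0" and N: "0 < N" and Y: "Y\<^sup>2 \<le> N"
  shows "Lam (3 * N) Y (\<lambda>x. f1 (x mod int (3 * N))) (\<lambda>x. f2 (x mod int (3 * N))) (\<lambda>x. f3 (x mod int (3 * N)))
    = (\<Sum>x\<in>{1..int N}. \<Sum>y\<in>{1..int Y}. f1 x * f2 (x + y) * f3 (x + y\<^sup>2)) / (3 * of_nat N * of_nat Y)"
proof -
  let ?L = "int (3 * N)" and ?g = "\<lambda>x y. f1 x * f2 (x + y) * f3 (x + y\<^sup>2)"
  have "(\<Sum>x\<in>ZL (3 * N). avg {1..int Y} (\<lambda>y. f1 (x mod ?L) * f2 ((x + y) mod ?L) * f3 ((x + y\<^sup>2) mod ?L)))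
      = (\<Sum>x\<in>{1..int N}. avg {1..int Y} (?g x))"
  proof (rule sum.mono_neutral_cong_right)
    show "finite (ZL (3 * N))" "{1..int N} \<subseteq> ZL (3 * N)" by auto
    show "\<forall>x\<in>ZL (3 * N) - {1..int N}. avg {1..int Y} (\<lambda>y. f1 (x mod ?L) * f2 ((x + y) mod ?L) * f3 ((x + y\<^sup>2) mod ?L)) = 0"
      using s by (simp add: avg_def)
    fix x assume x: "x \<in> {1..int N}"
    show "avg {1..int Y} (\<lambda>y. f1 (x mod ?L) * f2 ((x + y) mod ?L) * f3 ((x + y\<^sup>2) mod ?L)) = avg {1..int Y} (?g x)"
    proof (rule avg_cong[OF refl])
      fix y assume y: "y \<in> {1..int Y}"
      have "y\<^sup>2 \<le> (int Y)\<^sup>2" using y by (intro power_mono) auto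
      also have "\<dots> \<le> int N" using Y by (simp flip: of_nat_power)
      finally have y2: "y\<^sup>2 \<le> int N" .
      have "y * 1 \<le> y * y" using y by (intro mult_left_mono) auto
      then have y1: "y \<le> int N" using y2 by (simp add: power2_eq_square)
      have "x mod ?L = x" "(x + y) mod ?L = x + y" "(x + y\<^sup>2) mod ?L = x + y\<^sup>2"
        using x y y1 y2 by (auto intro!: mod_pos_pos_trivial)
      then show "f1 (x mod ?L) * f2 ((x + y) mod ?L) * f3 ((x + y\<^sup>2) mod ?L) = ?g x y" by simp
    qed
  qed
  then show ?thesis unfolding Lam_def
    by (simp add: avg_def[of "ZL (3 * N)"]) (simp add: avg_def sum_divide_distrib[symmetric] divide_divide_eq_left mult_ac)
qed

lemma inverse_counting:
  fixes \<delta> \<rho> :: real and f :: "nat \<Rightarrow> int \<Rightarrow> complex"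
  assumes d: "0 < \<delta>" and N: "0 < N"
    and f: "\<And>i x. i \<in> {1, 2, 3} \<Longrightarrow> cmod (f i x) \<le> 1" "\<And>i x. i \<in> {1, 2, 3} \<Longrightarrow> x \<notin> {1..int N} \<Longrightarrow> f i x = 0"
    and big: "\<delta> * real N powr (3 / 2) \<le> cmod (\<Sum>\<^sub>\<infinity>x\<in>UNIV. \<Sum>\<^sub>\<infinity>y\<in>{1::nat..}. f 1 x * f 2 (x + int y) * f 3 (x + (int y)\<^sup>2))"
    and r: "\<rho> = (\<delta> / 6) ^ (2000 * dual_exp)"
  shows "\<delta> \<le> 1"
    and "i \<in> {1, 2, 3} \<Longrightarrow> real N \<le> 4 * (1 / \<rho>)\<^sup>2 \<or>
      (\<exists>\<phi> M q. local_function M q \<phi> \<and> (\<forall>x. cmod (\<phi> x) \<le> 1) \<and> \<rho> * sqrt N / 2 \<le> real M \<and> real q \<le> 1 / \<rho> \<and>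
        \<rho> * N \<le> cmod (\<Sum>\<^sub>\<infinity>x\<in>UNIV. f i x * \<phi> x))"
proof -
  define Y where "Y = nat \<lfloor>sqrt N\<rfloor>"
  have sN: "1 \<le> sqrt N" using N by simp
  have Yu: "real Y \<le> sqrt N" unfolding Y_def by (rule of_nat_floor) simp
  have Yl: "sqrt N < real Y + 1" unfolding Y_def by linarith
  have Y2: "sqrt N / 2 \<le> Y" unfolding Y_def by (rule nat_floor_half_le[OF sN])
  have Y0: "0 < real Y" using Y2 sN by linarith
  have "(real Y)\<^sup>2 \<le> (sqrt N)\<^sup>2" using Yu by (intro power_mono) auto
  then have "real (Y\<^sup>2) \<le> real N" by simp
  then have YN2: "Y\<^sup>2 \<le> N" by (simp only: of_nat_le_iff)
  have YN: "Y \<le> N" by (rule order_trans[OF _ YN2]) (simp add: power2_eq_square)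
  have "(sqrt N)\<^sup>2 < (real Y + 1)\<^sup>2" using Yl by (intro power_strict_mono) auto
  then have "real_of_int (int N) < real_of_int ((int Y + 1)\<^sup>2)" by simp
  then have NY: "int N < (int Y + 1)\<^sup>2" by (simp only: of_int_less_iff)
  have "(sqrt N)\<^sup>2 \<le> (2 * real Y)\<^sup>2" using Y2 by (intro power_mono) auto
  then have N4: "real N \<le> 4 * (real Y)\<^sup>2" by (simp add: power_mult_distrib)
  let ?S = "\<Sum>x\<in>{1..int N}. \<Sum>y\<in>{1..int Y}. f 1 x * f 2 (x + y) * f 3 (x + y\<^sup>2)"
  have S: "(\<Sum>\<^sub>\<infinity>x\<in>UNIV. \<Sum>\<^sub>\<infinity>y\<in>{1::nat..}. f 1 x * f 2 (x + int y) * f 3 (x + (int y)\<^sup>2)) = ?S"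
    by (rule triple_sum_finite[OF _ _ NY]) (use f(2) in auto)
  have "real N powr (3 / 2) = real N powr (1 + 1 / 2)" by simp
  also have "\<dots> = real N * sqrt N" using N by (simp only: powr_add) (simp add: powr_half_sqrt)
  finally have big': "\<delta> * (real N * sqrt N) \<le> cmod ?S" using big unfolding S by simp
  have "cmod ?S \<le> (\<Sum>x\<in>{1..int N}. \<Sum>y\<in>{1..int Y}. 1)"
  proof (intro order_trans[OF norm_sum] sum_mono)
    fix x y
    show "cmod (f 1 x * f 2 (x + y) * f 3 (x + y\<^sup>2)) \<le> 1"
      using f(1)[of 1 x] f(1)[of 2 "x + y"] f(1)[of 3 "x + y\<^sup>2"] by (auto simp: norm_mult intro!: mult_le_one)
  qed
  then have "cmod ?S \<le> real N * Y" by simp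
  also have "\<dots> \<le> real N * sqrt N" using Yu by (intro mult_left_mono) auto
  finally have "\<delta> * (real N * sqrt N) \<le> 1 * (real N * sqrt N)" using big' by simp
  then show d1: "\<delta> \<le> 1" using N by (simp only: mult_le_cancel_right) simp
  have r0: "0 < \<rho>" using d by (simp add: r)
  let ?h = "\<lambda>i x. f i (x mod int (3 * N))"
  have h: "per (3 * N) (?h i)" for i by (simp add: per_def)
  have h1: "bd (?h i)" if "i \<in> {1, 2, 3}" for i using f(1)[OF that] by (simp add: bd_def)
  have "Lam (3 * N) Y (?h 1) (?h 2) (?h 3) = ?S / (3 * of_nat N * of_nat Y)"
    by (rule Lam_periodic_extension[OF _ N YN2]) (use f(2) in auto)
  then have LS: "cmod (Lam (3 * N) Y (?h 1) (?h 2) (?h 3)) = cmod ?S / (3 * real N * real Y)"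
    by (simp only: norm_divide norm_mult norm_of_nat norm_numeral)
  \<comment> \<open>The 3 in 6 is the ratio of \<open>L\<close> to \<open>N\<close>; the other
    factor is room to spare.\<close>
  have "\<delta> / 6 * (3 * real N * real Y) = \<delta> * (real N * real Y) / 2" by simp
  also have "\<dots> \<le> \<delta> * (real N * real Y)" using d by simp
  also have "\<dots> \<le> \<delta> * (real N * sqrt N)" using Yu d by (intro mult_left_mono) auto
  also have "\<dots> \<le> cmod ?S" by (rule big')
  finally have big6: "\<delta> / 6 \<le> cmod (Lam (3 * N) Y (?h 1) (?h 2) (?h 3))"
    unfolding LS using N Y0 by (subst pos_le_divide_eq) auto
  assume i: "i \<in> {1, 2, 3}"
  show "real N \<le> 4 * (1 / \<rho>)\<^sup>2 \<or>
      (\<exists>\<phi> M q. local_function M q \<phi> \<and> (\<forall>x. cmod (\<phi> x) \<le> 1) \<and> \<rho> * sqrt N / 2 \<le> real M \<and> real q \<le> 1 / \<rho> \<and>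
        \<rho> * N \<le> cmod (\<Sum>\<^sub>\<infinity>x\<in>UNIV. f i x * \<phi> x))"
  proof (cases "1 / \<rho> \<le> Y")
    case False
    \<comment> \<open>When \<open>Y\<close> is too small for the main argument, \<open>N\<close> is
      at most \<open>4 * Y\<^sup>2\<close> and the first alternative holds.\<close>
    then have "(real Y)\<^sup>2 \<le> (1 / \<rho>)\<^sup>2" by (intro power_mono) auto
    then show ?thesis using N4 by linarith
  next
    case True
    have L: "0 < 3 * N" "real (3 * N) \<le> 12 * (real Y)\<^sup>2" using N N4 by auto
    have dY: "(1 / (\<delta> / 6)) ^ (2000 * dual_exp) \<le> Y" using True by (simp only: r power_one_over)
    have d6: "0 < \<delta> / 6" "\<delta> / 6 \<le> 1 / 2" using d d1 by auto
    note w = large_prog_avg_of_Lam[OF L h h h h1 h1 h1 d6 dY big6, folded r]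
    have "large_prog_avg (3 * N) Y \<rho> (?h i)" using i w by auto
    from local_correlation[OF f(2)[OF i] N _ YN r0 this] obtain \<phi> M q where l: "local_function M q \<phi>" "\<forall>x. cmod (\<phi> x) \<le> 1"
      "\<rho> * Y \<le> real M" "real q \<le> 1 / \<rho>" "\<rho> * N \<le> cmod (\<Sum>x\<in>{1..int N}. f i x * \<phi> x)"
      using Y0 by auto
    have "(\<Sum>\<^sub>\<infinity>x\<in>UNIV. f i x * \<phi> x) = (\<Sum>\<^sub>\<infinity>x\<in>{1..int N}. f i x * \<phi> x)"
      by (rule infsum_cong_neutral) (use f(2)[OF i] in auto)
    then have "(\<Sum>\<^sub>\<infinity>x\<in>UNIV. f i x * \<phi> x) = (\<Sum>x\<in>{1..int N}. f i x * \<phi> x)" by simp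
    moreover have "\<rho> * (sqrt N / 2) \<le> \<rho> * Y" using Y2 r0 by (intro mult_left_mono) auto
    ultimately show ?thesis using l by (intro disjI2 exI[of _ \<phi>] exI[of _ M] exI[of _ q]) auto
  qed
qed

theorem theorem1p5:
  "\<exists>C::real. C \<ge> 1 \<and>
     (\<forall>(\<delta>::real) (N::nat) (f :: nat \<Rightarrow> int \<Rightarrow> complex).
        \<delta> > 0 \<longrightarrow> N > 0 \<longrightarrow>
        (\<forall>i\<in>{1,2,3}. (\<forall>x. cmod (f i x) \<le> 1) \<and> {x. f i x \<noteq> 0} \<subseteq> {1..int N}) \<longrightarrow>
        cmod (\<Sum>\<^sub>\<infinity>x\<in>UNIV. \<Sum>\<^sub>\<infinity>y\<in>{1::nat..}.
                f 1 x * f 2 (x + int y) * f 3 (x + (int y)\<^sup>2)) \<ge> \<delta> * real N powr (3/2) \<longrightarrow>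
        real N \<le> C * \<delta> powr (-C) \<or>
        (\<forall>i\<in>{1,2,3}. \<exists>(\<phi> :: int \<Rightarrow> complex) (M::nat) (q::nat).
           local_function M q \<phi> \<and> (\<forall>x. cmod (\<phi> x) \<le> 1) \<and>
           real M \<ge> inverse C * \<delta> powr C * real N powr (1/2) \<and>
           real q \<le> C * \<delta> powr (-C) \<and>
           cmod (\<Sum>\<^sub>\<infinity>x\<in>UNIV. f i x * \<phi> x) \<ge> inverse C * \<delta> powr C * real N))"
proof -
  define \<kappa> where "\<kappa> = 2000 * dual_exp"
  define A :: real where "A = 6 ^ (2 * \<kappa>)"
  \<comment> \<open>\<open>4 * A\<close> pays for the powers of 6 in
    \<open>4 * (1 / \<rho>)\<^sup>2\<close>; the summand \<open>2 * real \<kappa>\<close> makes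
    \<open>\<delta> powr C\<close> at most \<open>\<delta> ^ (2 * \<kappa>)\<close>, because
    \<delta> is at most 1 by the trivial bound on the sum.\<close>
  define C where "C = 4 * A + 2 * real \<kappa>"
  have A: "1 \<le> A" "6 ^ \<kappa> \<le> A" by (auto simp: A_def intro!: one_le_power power_increasing)
  have C4: "4 * A \<le> C" and Ck: "real (2 * \<kappa>) \<le> C" using A by (auto simp: C_def)
  have C1: "1 \<le> C" using C4 A by linarith
  show ?thesis
  proof (intro exI[of _ C] conjI allI impI C1)
    fix \<delta> :: real and N :: nat and f :: "nat \<Rightarrow> int \<Rightarrow> complex"
    assume d: "\<delta> > 0" and N: "N > 0"
      and f: "\<forall>i\<in>{1,2,3}. (\<forall>x. cmod (f i x) \<le> 1) \<and> {x. f i x \<noteq> 0} \<subseteq> {1..int N}"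
      and big: "cmod (\<Sum>\<^sub>\<infinity>x\<in>UNIV. \<Sum>\<^sub>\<infinity>y\<in>{1::nat..}.
                f 1 x * f 2 (x + int y) * f 3 (x + (int y)\<^sup>2)) \<ge> \<delta> * real N powr (3/2)"
    define \<rho> where "\<rho> = (\<delta> / 6) ^ (2000 * dual_exp)"
    have f': "cmod (f i x) \<le> 1" "x \<notin> {1..int N} \<Longrightarrow> f i x = 0" if "i \<in> {1, 2, 3}" for i x
      using f[rule_format, OF that] by auto
    have d1: "\<delta> \<le> 1" by (rule inverse_counting(1)[OF d N _ _ big \<rho>_def]) (use f' in auto)
    define p where "p = \<delta> powr C"
    have p0: "0 < p" and pm: "\<delta> powr (- C) = 1 / p" using d by (simp_all add: p_def powr_minus_divide)
    have "p \<le> \<delta> powr real (2 * \<kappa>)" unfolding p_def using Ck d d1 by (intro powr_mono') auto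
    then have pd2: "p \<le> \<delta> ^ (2 * \<kappa>)" using d by (simp only: powr_realpow)
    also have "\<dots> \<le> \<delta> ^ \<kappa>" using d d1 by (intro power_decreasing) auto
    finally have pd: "p \<le> \<delta> ^ \<kappa>" .
    have rd: "\<rho> = \<delta> ^ \<kappa> / 6 ^ \<kappa>" by (simp only: \<rho>_def \<kappa>_def power_divide)
    have r0: "0 < \<rho>" using d by (simp add: \<rho>_def)
    have c6: "2 * 6 ^ \<kappa> \<le> C" using A C4 by linarith
    have p\<rho>: "p / C \<le> \<rho> / 2"
    proof -
      have "p / C \<le> \<delta> ^ \<kappa> / (2 * 6 ^ \<kappa>)" using pd c6 d by (intro frac_le) auto
      then show ?thesis by (simp add: rd)
    qed
    have C\<rho>: "1 / \<rho> \<le> C / p"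
    proof -
      have "1 / \<rho> = 6 ^ \<kappa> / \<delta> ^ \<kappa>" by (simp add: rd)
      also have "\<dots> \<le> C / p" using pd c6 p0 C1 by (intro frac_le) auto
      finally show ?thesis .
    qed
    have C\<rho>2: "4 * (1 / \<rho>)\<^sup>2 \<le> C / p"
    proof -
      have "4 * (1 / \<rho>)\<^sup>2 = 4 * A / \<delta> ^ (2 * \<kappa>)"
        by (simp add: rd A_def power_divide power_mult[of _ \<kappa> 2] mult.commute[of 2 \<kappa>])
      also have "\<dots> \<le> C / p" using pd2 C4 p0 C1 by (intro frac_le) auto
      finally show ?thesis .
    qed
    have iC: "inverse C * p = p / C" by (simp only: divide_inverse mult.commute)
    have "p / C * sqrt N \<le> \<rho> / 2 * sqrt N" by (rule mult_right_mono[OF p\<rho>]) simp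
    moreover have "real N powr (1 / 2) = sqrt N" by (simp add: powr_half_sqrt)
    ultimately have M: "inverse C * p * real N powr (1 / 2) \<le> \<rho> * sqrt N / 2" unfolding iC by simp
    have N': "inverse C * p * real N \<le> \<rho> * N"
      unfolding iC by (rule mult_right_mono) (use p\<rho> r0 in linarith, simp)
    show "real N \<le> C * \<delta> powr (-C) \<or>
        (\<forall>i\<in>{1,2,3}. \<exists>(\<phi> :: int \<Rightarrow> complex) (M::nat) (q::nat).
           local_function M q \<phi> \<and> (\<forall>x. cmod (\<phi> x) \<le> 1) \<and>
           real M \<ge> inverse C * \<delta> powr C * real N powr (1/2) \<and>
           real q \<le> C * \<delta> powr (-C) \<and>
           cmod (\<Sum>\<^sub>\<infinity>x\<in>UNIV. f i x * \<phi> x) \<ge> inverse C * \<delta> powr C * real N)"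
    proof (cases "real N \<le> 4 * (1 / \<rho>)\<^sup>2")
      case True
      then show ?thesis using C\<rho>2 by (simp add: pm)
    next
      case False
      show ?thesis
      proof (intro disjI2 ballI)
        fix i :: nat assume i: "i \<in> {1, 2, 3}"
        have "real N \<le> 4 * (1 / \<rho>)\<^sup>2 \<or>
          (\<exists>\<phi> M q. local_function M q \<phi> \<and> (\<forall>x. cmod (\<phi> x) \<le> 1) \<and> \<rho> * sqrt N / 2 \<le> real M \<and> real q \<le> 1 / \<rho> \<and>
            \<rho> * N \<le> cmod (\<Sum>\<^sub>\<infinity>x\<in>UNIV. f i x * \<phi> x))"
          by (rule inverse_counting(2)[OF d N _ _ big \<rho>_def i]) (use f' in auto)
        then obtain \<phi> M q where l: "local_function M q \<phi>" "\<forall>x. cmod (\<phi> x) \<le> 1" "\<rho> * sqrt N / 2 \<le> real M" "real q \<le> 1 / \<rho>"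
          "\<rho> * N \<le> cmod (\<Sum>\<^sub>\<infinity>x\<in>UNIV. f i x * \<phi> x)"
          using False by blast
        have "inverse C * \<delta> powr C * real N powr (1/2) \<le> real M" "real q \<le> C * \<delta> powr (-C)"
          "inverse C * \<delta> powr C * real N \<le> cmod (\<Sum>\<^sub>\<infinity>x\<in>UNIV. f i x * \<phi> x)"
          using l(3-5) M N' C\<rho> unfolding p_def[symmetric] pm by auto
        then show "\<exists>(\<phi> :: int \<Rightarrow> complex) (M::nat) (q::nat).
           local_function M q \<phi> \<and> (\<forall>x. cmod (\<phi> x) \<le> 1) \<and>
           real M \<ge> inverse C * \<delta> powr C * real N powr (1/2) \<and>
           real q \<le> C * \<delta> powr (-C) \<and>
           cmod (\<Sum>\<^sub>\<infinity>x\<in>UNIV. f i x * \<phi> x) \<ge> inverse C * \<delta> powr C * real N" using l(1,2) by blast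
      qed
    qed
  qed
qed

end
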